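(* Let $\Omega\subset\mathbb{R}^n$ ($n\le 3$) be a bounded Lipschitz domain and let $d_1,d_2,d_3,a_1,a_3,b_1,b_2,c_2,c_3,F,G_1,G_2$ be arbitrary positive constants. Let $\{S(t)\}_{t\ge0}$ be the Oregonator semiflow on $H_+$ generated by $$\frac{\partial u}{\partial t}=d_1\Delta u+a_1u+b_1v-Fu^2-G_1uv,\qquad \frac{\partial v}{\partial t}=d_2\Delta v-b_2v+c_2w-G_2uv,\qquad \frac{\partial w}{\partial t}=d_3\Delta w+a_3u-c_3w$$ on $\Omega$ with $u=v=w=0$ on $\partial\Omega$. Then there exists an exponential attractor $\mathscr{E}$ in $H_+$ for $\{S(t)\}_{t\ge0}$.
   Context: Spaces: $H=[L^2(\Omega)]^3$ with norm $\|\cdot\|$, $E=[H_0^1(\Omega)]^3$ with norm $\|\varphi\|_E=\|\nabla\varphi\|$, $E^*=[H^{-1}(\Omega)]^3$, with $(\cdot,\cdot)$ the $(E^*,E)$ dual product. $H_+=\{\varphi\in H:\varphi_i\ge0 \text{ a.e. in }\Omega,\ i=1,2,3\}$. Operators: $A=\mathrm{diag}(d_1\Delta,d_2\Delta,d_3\Delta)$ with Dirichlet conditions, regarded also as a bounded operator $E\to E^*$, and $f:E\to H$, $f(u,v,w)=(a_1u+b_1v-Fu^2-G_1uv,\,-b_2v+c_2w-G_2uv,\,a_3u-c_3w)$. The system is written as $\frac{dg}{dt}=Ag+f(g)$, $g(0)=g_0$, with $g=(u,v,w)$. Weak solution on $[0,\tau]$: a function $g\in L^2(0,\tau;E)\cap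 C_w([0,\tau];H)$ ($C_w$: weakly continuous) with $g(0)=g_0$ such that for every $\phi\in E$, $\frac{d}{dt}(g,\phi)=(Ag,\phi)+(f(g),\phi)$ for a.e. $t\in[0,\tau]$ (time derivative in the distributional sense). A global weak solution is a function on $[0,\infty)$ that is a weak solution on every $[0,\tau]$. Oregonator semiflow: for every $g_0\in H_+$ there is a unique global weak solution $g(t;g_0)$, and it stays in $H_+$; $S(t)g_0=g(t;g_0)$, $t\ge0$. Exponential attractor in $H_+$ for $\{S(t)\}_{t\ge0}$: a set $\mathscr{E}\subset H_+$ such that (i) $\mathscr{E}$ is nonempty, compact in the $H$-norm, and positively invariant, i.e. $S(t)\mathscr{E}\subset\mathscr{E}$ for all $t\ge0$; (ii) $\mathscr{E}$ has finite fractal (upper box-counting) dimension in $H$; (iii) $\mathscr{E}$ attracts every bounded set $B\subset H_+$ exponentially: there exist a constant $\mu>0$ and, for each such $B$, a constant $C(B)>0$ with $\sup_{x\in B}\inf_{y\in\mathscr{E}}\|S(t)x-y\|\le C(B)e^{-\mu t}$ for all $t\ge0$. *)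

theory Defs
  imports "HOL-Analysis.Analysis"
begin

section \<open>The Hilbert space \<open>L\<^sup>2(\<real>\<^sup>n)\<close>\<close>

definition square_integrable :: "('a::euclidean_space \<Rightarrow> real) \<Rightarrow> bool" where
  "square_integrable f \<longleftrightarrow>
     f \<in> borel_measurable lebesgue \<and> integrable lebesgue (\<lambda>x. (f x)\<^sup>2)"

definition L2_rel :: "('a::euclidean_space \<Rightarrow> real) \<Rightarrow> ('a \<Rightarrow> real) \<Rightarrow> bool" where
  "L2_rel f g \<longleftrightarrow> square_integrable f \<and> square_integrable g \<and> (AE x in lebesgue. f x = g x)"

lemma square_integrable_mult:
  assumes "square_integrable f" "square_integrable g"
  shows "integrable lebesgue (\<lambda>x. f x * g x)"
proof (rule Bochner_Integration.integrable_bound)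
  show "integrable lebesgue (\<lambda>x. (f x)\<^sup>2 + (g x)\<^sup>2)"
    using assms by (auto simp: square_integrable_def)
  show "(\<lambda>x. f x * g x) \<in> borel_measurable lebesgue"
    using assms by (auto simp: square_integrable_def)
  show "AE x in lebesgue. norm (f x * g x) \<le> norm ((f x)\<^sup>2 + (g x)\<^sup>2)"
  proof (rule AE_I2)
    fix x
    have "2 * (\<bar>f x\<bar> * \<bar>g x\<bar>) \<le> (f x)\<^sup>2 + (g x)\<^sup>2"
      using sum_squares_bound[of "\<bar>f x\<bar>" "\<bar>g x\<bar>"] by (simp add: mult.assoc)
    moreover have "norm (f x * g x) = \<bar>f x\<bar> * \<bar>g x\<bar>" "0 \<le> \<bar>f x\<bar> * \<bar>g x\<bar>"
      by (simp_all add: abs_mult)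
    moreover have "norm ((f x)\<^sup>2 + (g x)\<^sup>2) = (f x)\<^sup>2 + (g x)\<^sup>2" by simp
    ultimately show "norm (f x * g x) \<le> norm ((f x)\<^sup>2 + (g x)\<^sup>2)"
      by linarith
  qed
qed

lemma square_integrable_zero: "square_integrable (\<lambda>x. 0)"
  by (simp add: square_integrable_def)

lemma square_integrable_add:
  assumes "square_integrable f" "square_integrable g"
  shows "square_integrable (\<lambda>x. f x + g x)"
proof -
  have "integrable lebesgue (\<lambda>x. (f x)\<^sup>2 + (g x)\<^sup>2 + 2 * (f x * g x))"
    using assms square_integrable_mult[OF assms] by (auto simp: square_integrable_def)
  then show ?thesis
    using assms by (auto simp: square_integrable_def power2_sum algebra_simps)
qed

lemma square_integrable_scale:
  assumes "square_integrable f" shows "square_integrable (\<lambda>x. c * f x)"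
  using assms by (auto simp: square_integrable_def power_mult_distrib)

quotient_type (overloaded) 'a L2 = "'a::euclidean_space \<Rightarrow> real" / partial: L2_rel
proof (rule part_equivpI)
  show "\<exists>f. L2_rel f f" using square_integrable_zero by (auto simp: L2_rel_def)
  show "symp L2_rel"
    unfolding symp_def L2_rel_def by (auto simp: eq_commute)
  show "transp L2_rel"
  proof (rule transpI)
    fix f g h
    assume fg: "L2_rel f g" and gh: "L2_rel g h"
    have "AE x in lebesgue. f x = g x" "AE x in lebesgue. g x = h x"
      using fg gh by (simp_all add: L2_rel_def)
    then have "AE x in lebesgue. f x = h x" by eventually_elim simp
    then show "L2_rel f h" using fg gh by (simp add: L2_rel_def)
  qed
qed

instantiation L2 :: (euclidean_space) real_vector
begin

lift_definition zero_L2 :: "'a L2" is "\<lambda>x. 0"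
  by (simp add: L2_rel_def square_integrable_zero)

lift_definition plus_L2 :: "'a L2 \<Rightarrow> 'a L2 \<Rightarrow> 'a L2" is "\<lambda>f g x. f x + g x"
  by (auto simp: L2_rel_def square_integrable_add)

lift_definition uminus_L2 :: "'a L2 \<Rightarrow> 'a L2" is "\<lambda>f x. - f x"
  by (auto simp: L2_rel_def square_integrable_def)

lift_definition scaleR_L2 :: "real \<Rightarrow> 'a L2 \<Rightarrow> 'a L2" is "\<lambda>c f x. c * f x"
  by (auto simp: L2_rel_def square_integrable_scale)

definition minus_L2 :: "'a L2 \<Rightarrow> 'a L2 \<Rightarrow> 'a L2" where "minus_L2 u v = u + - v"

instance
proof
  fix u v w :: "'a L2" and a b :: real
  show "u + v + w = u + (v + w)"
    by transfer (auto simp: L2_rel_def square_integrable_add add.assoc)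
  show "u + v = v + u"
    by transfer (auto simp: L2_rel_def square_integrable_add add.commute)
  show "0 + u = u" by transfer (auto simp: L2_rel_def)
  show "- u + u = 0"
    by transfer (auto simp: L2_rel_def square_integrable_zero)
  show "u - v = u + - v" by (simp add: minus_L2_def)
  show "a *\<^sub>R (u + v) = a *\<^sub>R u + a *\<^sub>R v"
    by transfer (auto simp: L2_rel_def square_integrable_add square_integrable_scale distrib_left)
  show "(a + b) *\<^sub>R u = a *\<^sub>R u + b *\<^sub>R u"
    by transfer (auto simp: L2_rel_def square_integrable_add square_integrable_scale distrib_right)
  show "a *\<^sub>R b *\<^sub>R u = (a * b) *\<^sub>R u"
    by transfer (auto simp: L2_rel_def square_integrable_scale mult.assoc)
  show "1 *\<^sub>R u = u" by transfer (auto simp: L2_rel_def)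
qed

end

instantiation L2 :: (euclidean_space) real_inner
begin

lift_definition inner_L2 :: "'a L2 \<Rightarrow> 'a L2 \<Rightarrow> real" is
  "\<lambda>f g. integral\<^sup>L lebesgue (\<lambda>x. f x * g x)"
  by (rule integral_cong_AE) (auto simp: L2_rel_def square_integrable_def)

definition norm_L2 :: "'a L2 \<Rightarrow> real" where "norm_L2 u = sqrt (u \<bullet> u)"
definition sgn_L2 :: "'a L2 \<Rightarrow> 'a L2" where "sgn_L2 u = u /\<^sub>R norm u"
definition dist_L2 :: "'a L2 \<Rightarrow> 'a L2 \<Rightarrow> real" where "dist_L2 u v = norm (u - v)"
definition uniformity_L2 :: "('a L2 \<times> 'a L2) filter" where
  "uniformity_L2 = (INF e\<in>{0 <..}. principal {(x, y). dist x y < e})"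
definition open_L2 :: "'a L2 set \<Rightarrow> bool" where
  "open_L2 U \<longleftrightarrow> (\<forall>x\<in>U. eventually (\<lambda>(x', y). x' = x \<longrightarrow> y \<in> U) uniformity)"

instance
proof
  fix u v w :: "'a L2" and a :: real
  show "sgn u = u /\<^sub>R norm u" by (simp add: sgn_L2_def)
  show "dist u v = norm (u - v)" by (simp add: dist_L2_def)
  show "uniformity = (INF e\<in>{0 <..}. principal {(x, y :: 'a L2). dist x y < e})"
    by (simp add: uniformity_L2_def)
  show "open U = (\<forall>x\<in>U. \<forall>\<^sub>F (x', y) in uniformity. x' = x \<longrightarrow> y \<in> U)" for U :: "'a L2 set"
    by (simp add: open_L2_def)
  show "norm u = sqrt (u \<bullet> u)" by (simp add: norm_L2_def)
  show "u \<bullet> v = v \<bullet> u" by transfer (simp add: mult.commute)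
  show "(u + v) \<bullet> w = u \<bullet> w + v \<bullet> w"
    by transfer (auto simp: L2_rel_def distrib_right square_integrable_mult)
  show "(a *\<^sub>R u) \<bullet> v = a * (u \<bullet> v)"
    by transfer (simp add: mult.assoc)
  show "0 \<le> u \<bullet> u" by transfer simp
  show "(u \<bullet> u = 0) = (u = 0)"
  proof transfer
    fix f :: "'a \<Rightarrow> real" assume "L2_rel f f"
    then have f: "square_integrable f" by (simp add: L2_rel_def)
    have "(integral\<^sup>L lebesgue (\<lambda>x. f x * f x) = 0) = (AE x in lebesgue. f x * f x = 0)"
      by (rule integral_nonneg_eq_0_iff_AE) (use square_integrable_mult[OF f f] in auto)
    then show "(integral\<^sup>L lebesgue (\<lambda>x. f x * f x) = 0) = L2_rel f (\<lambda>x. 0)"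
      using f by (simp add: L2_rel_def square_integrable_zero)
  qed
qed

end

text \<open>A representative of \<open>u\<close> is \<open>rep_L2 u\<close>. The class of a function that is not square integrable
  is taken to be \<open>0\<close>.\<close>

definition L2_of :: "('a::euclidean_space \<Rightarrow> real) \<Rightarrow> 'a L2" where
  "L2_of f = (if square_integrable f then abs_L2 f else 0)"

text \<open>The space \<open>L\<^sup>2(\<Omega>)\<close>, embedded isometrically in \<open>L\<^sup>2(\<real>\<^sup>n)\<close> through extension by zero.\<close>

definition L2_on :: "'a::euclidean_space set \<Rightarrow> 'a L2 set" where
  "L2_on \<Omega> = {u. AE x in lebesgue. x \<notin> \<Omega> \<longrightarrow> rep_L2 u x = 0}"

text \<open>The pointwise product. For factors in \<open>H\<^sub>0\<^sup>1(\<Omega>)\<close> and dimension at most 3 it is square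
  integrable, by the Sobolev embedding into \<open>L\<^sup>4\<close>; hence the default value in \<open>L2_of\<close> plays no
  role there.\<close>

definition L2_mult :: "'a::euclidean_space L2 \<Rightarrow> 'a L2 \<Rightarrow> 'a L2" (infixl "\<odot>" 75) where
  "u \<odot> v = L2_of (\<lambda>x. rep_L2 u x * rep_L2 v x)"


section \<open>Weak derivatives and \<open>H\<^sub>0\<^sup>1(\<Omega>)\<close>\<close>

definition partial_deriv :: "'a::euclidean_space \<Rightarrow> ('a \<Rightarrow> real) \<Rightarrow> 'a \<Rightarrow> real" where
  "partial_deriv b f x = frechet_derivative f (at x) b"

text \<open>All iterated partial derivatives exist and are differentiable (hence continuous).\<close>

definition smooth :: "('a::euclidean_space \<Rightarrow> real) \<Rightarrow> bool" where
  "smooth f \<longleftrightarrow>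
     (\<forall>bs. set bs \<subseteq> Basis \<longrightarrow> (\<forall>x. foldr partial_deriv bs f differentiable (at x)))"

definition test_functions :: "'a::euclidean_space set \<Rightarrow> ('a \<Rightarrow> real) set" where
  "test_functions U = {\<phi>. smooth \<phi> \<and> compact (closure {x. \<phi> x \<noteq> 0}) \<and> closure {x. \<phi> x \<noteq> 0} \<subseteq> U}"

definition locally_integrable :: "'a::euclidean_space set \<Rightarrow> ('a \<Rightarrow> real) \<Rightarrow> bool" where
  "locally_integrable U f \<longleftrightarrow> (\<forall>K. compact K \<and> K \<subseteq> U \<longrightarrow> set_integrable lebesgue K f)"

definition has_weak_partial ::
    "'a::euclidean_space set \<Rightarrow> 'a \<Rightarrow> ('a \<Rightarrow> real) \<Rightarrow> ('a \<Rightarrow> real) \<Rightarrow> bool" where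
  "has_weak_partial U b f h \<longleftrightarrow>
     locally_integrable U f \<and> locally_integrable U h \<and>
     (\<forall>\<phi>\<in>test_functions U.
        (LINT x:U|lebesgue. f x * partial_deriv b \<phi> x) = - (LINT x:U|lebesgue. h x * \<phi> x))"

definition H1 :: "'a::euclidean_space set \<Rightarrow> 'a L2 set" where
  "H1 \<Omega> = {u \<in> L2_on \<Omega>. \<forall>b\<in>Basis. \<exists>v\<in>L2_on \<Omega>. has_weak_partial \<Omega> b (rep_L2 u) (rep_L2 v)}"

definition weak_partial :: "'a::euclidean_space set \<Rightarrow> 'a \<Rightarrow> 'a L2 \<Rightarrow> 'a L2" where
  "weak_partial \<Omega> b u = (THE v. v \<in> L2_on \<Omega> \<and> has_weak_partial \<Omega> b (rep_L2 u) (rep_L2 v))"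

text \<open>The closure of the test functions in \<open>H\<^sup>1(\<Omega>)\<close>.\<close>

definition H10 :: "'a::euclidean_space set \<Rightarrow> 'a L2 set" where
  "H10 \<Omega> = {u \<in> H1 \<Omega>. \<exists>\<phi>. (\<forall>k::nat. \<phi> k \<in> test_functions \<Omega>) \<and>
     (\<lambda>k. L2_of (\<phi> k)) \<longlonglongrightarrow> u \<and>
     (\<forall>b\<in>Basis. (\<lambda>k. L2_of (partial_deriv b (\<phi> k))) \<longlonglongrightarrow> weak_partial \<Omega> b u)}"

definition grad_inner :: "'a::euclidean_space set \<Rightarrow> 'a L2 \<Rightarrow> 'a L2 \<Rightarrow> real" where
  "grad_inner \<Omega> u v = (\<Sum>b\<in>Basis. weak_partial \<Omega> b u \<bullet> weak_partial \<Omega> b v)"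


section \<open>Bounded Lipschitz domains\<close>

text \<open>Near each boundary point, \<open>\<Omega>\<close> is the strict epigraph of a Lipschitz function of the
  coordinates orthogonal to some unit vector \<open>e\<close>.\<close>

definition bounded_lipschitz_domain :: "'a::euclidean_space set \<Rightarrow> bool" where
  "bounded_lipschitz_domain \<Omega> \<longleftrightarrow>
     open \<Omega> \<and> connected \<Omega> \<and> \<Omega> \<noteq> {} \<and> bounded \<Omega> \<and>
     (\<forall>z\<in>frontier \<Omega>. \<exists>e r \<gamma> L. norm e = 1 \<and> r > 0 \<and> L-lipschitz_on {y. y \<bullet> e = 0} \<gamma> \<and>
        \<Omega> \<inter> ball z r = {x \<in> ball z r. x \<bullet> e > (\<gamma> (x - (x \<bullet> e) *\<^sub>R e) :: real)})"


section \<open>Phase spaces and operators\<close>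

text \<open>The library norm and inner product on products of inner product spaces make \<open>H_space \<Omega>\<close>
  the Hilbert space \<open>[L\<^sup>2(\<Omega>)]\<^sup>3\<close>.\<close>

type_synonym 'a L2_triple = "'a L2 \<times> 'a L2 \<times> 'a L2"

definition H_space :: "'a::euclidean_space set \<Rightarrow> 'a L2_triple set" where
  "H_space \<Omega> = L2_on \<Omega> \<times> L2_on \<Omega> \<times> L2_on \<Omega>"

definition L2_nonneg :: "'a::euclidean_space set \<Rightarrow> 'a L2 set" where
  "L2_nonneg \<Omega> = {u \<in> L2_on \<Omega>. AE x in lebesgue. x \<in> \<Omega> \<longrightarrow> rep_L2 u x \<ge> 0}"

definition H_plus :: "'a::euclidean_space set \<Rightarrow> 'a L2_triple set" where
  "H_plus \<Omega> = L2_nonneg \<Omega> \<times> L2_nonneg \<Omega> \<times> L2_nonneg \<Omega>"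

definition E_space :: "'a::euclidean_space set \<Rightarrow> 'a L2_triple set" where
  "E_space \<Omega> = H10 \<Omega> \<times> H10 \<Omega> \<times> H10 \<Omega>"

fun E_norm :: "'a::euclidean_space set \<Rightarrow> 'a L2_triple \<Rightarrow> real" where
  "E_norm \<Omega> (u, v, w) = sqrt (grad_inner \<Omega> u u + grad_inner \<Omega> v v + grad_inner \<Omega> w w)"

text \<open>The operator \<open>diag(d\<^sub>1\<Delta>, d\<^sub>2\<Delta>, d\<^sub>3\<Delta>) : E \<rightarrow> E\<^sup>*\<close>; elements of \<open>E\<^sup>*\<close> are represented as
  functionals, so that \<open>dirichlet_diffusion \<Omega> d1 d2 d3 g \<phi>\<close> is the dual product \<open>(Ag, \<phi>)\<close>.\<close>

fun dirichlet_diffusion ::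
    "'a::euclidean_space set \<Rightarrow> real \<Rightarrow> real \<Rightarrow> real \<Rightarrow> 'a L2_triple \<Rightarrow> 'a L2_triple \<Rightarrow> real" where
  "dirichlet_diffusion \<Omega> d1 d2 d3 (u, v, w) (p, q, r) =
     - (d1 * grad_inner \<Omega> u p + d2 * grad_inner \<Omega> v q + d3 * grad_inner \<Omega> w r)"

fun oregonator_reaction ::
    "real \<Rightarrow> real \<Rightarrow> real \<Rightarrow> real \<Rightarrow> real \<Rightarrow> real \<Rightarrow> real \<Rightarrow> real \<Rightarrow> real \<Rightarrow>
     'a::euclidean_space L2_triple \<Rightarrow> 'a L2_triple" where
  "oregonator_reaction a1 a3 b1 b2 c2 c3 F G1 G2 (u, v, w) =
     (a1 *\<^sub>R u + b1 *\<^sub>R v - F *\<^sub>R (u \<odot> u) - G1 *\<^sub>R (u \<odot> v),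
      - (b2 *\<^sub>R v) + c2 *\<^sub>R w - G2 *\<^sub>R (u \<odot> v),
      a3 *\<^sub>R u - c3 *\<^sub>R w)"


section \<open>Weak solutions and the semiflow\<close>

text \<open>The Bochner space \<open>L\<^sup>2(0,\<tau>;E)\<close>: strong measurability means being an almost everywhere limit,
  in the norm of \<open>E\<close>, of \<open>E\<close>-valued simple functions.\<close>

definition bochner_L2_E ::
    "'a::euclidean_space set \<Rightarrow> real \<Rightarrow> (real \<Rightarrow> 'a L2_triple) \<Rightarrow> bool" where
  "bochner_L2_E \<Omega> \<tau> g \<longleftrightarrow>
     (AE t in lebesgue_on {0..\<tau>}. g t \<in> E_space \<Omega>) \<and>
     (\<exists>s. (\<forall>k::nat. simple_function (lebesgue_on {0..\<tau>}) (s k) \<and> range (s k) \<subseteq> E_space \<Omega>) \<and>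
          (AE t in lebesgue_on {0..\<tau>}. (\<lambda>k. E_norm \<Omega> (s k t - g t)) \<longlonglongrightarrow> 0)) \<and>
     integrable (lebesgue_on {0..\<tau>}) (\<lambda>t. (E_norm \<Omega> (g t))\<^sup>2)"

definition weakly_continuous_H ::
    "'a::euclidean_space set \<Rightarrow> real \<Rightarrow> (real \<Rightarrow> 'a L2_triple) \<Rightarrow> bool" where
  "weakly_continuous_H \<Omega> \<tau> g \<longleftrightarrow>
     (\<forall>t\<in>{0..\<tau>}. g t \<in> H_space \<Omega>) \<and>
     (\<forall>h\<in>H_space \<Omega>. continuous_on {0..\<tau>} (\<lambda>t. g t \<bullet> h))"

text \<open>Weak solutions of \<open>dg/dt = Ag + f(g)\<close>, \<open>g(0) = g\<^sub>0\<close>, on \<open>[0,\<tau>]\<close>; the time derivative is the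
  distributional one on \<open>(0,\<tau>)\<close>, the basis of the type \<open>real\<close> being \<open>{1}\<close>.\<close>

definition weak_solution ::
    "'a::euclidean_space set \<Rightarrow> ('a L2_triple \<Rightarrow> 'a L2_triple \<Rightarrow> real) \<Rightarrow>
     ('a L2_triple \<Rightarrow> 'a L2_triple) \<Rightarrow> 'a L2_triple \<Rightarrow> real \<Rightarrow> (real \<Rightarrow> 'a L2_triple) \<Rightarrow> bool" where
  "weak_solution \<Omega> A f g0 \<tau> g \<longleftrightarrow>
     bochner_L2_E \<Omega> \<tau> g \<and> weakly_continuous_H \<Omega> \<tau> g \<and> g 0 = g0 \<and>
     (\<forall>\<phi>\<in>E_space \<Omega>. has_weak_partial {0<..<\<tau>} 1 (\<lambda>t. g t \<bullet> \<phi>) (\<lambda>t. A (g t) \<phi> + f (g t) \<bullet> \<phi>))"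

definition global_weak_solution ::
    "'a::euclidean_space set \<Rightarrow> ('a L2_triple \<Rightarrow> 'a L2_triple \<Rightarrow> real) \<Rightarrow>
     ('a L2_triple \<Rightarrow> 'a L2_triple) \<Rightarrow> 'a L2_triple \<Rightarrow> (real \<Rightarrow> 'a L2_triple) \<Rightarrow> bool" where
  "global_weak_solution \<Omega> A f g0 g \<longleftrightarrow> (\<forall>\<tau>>0. weak_solution \<Omega> A f g0 \<tau> g)"

text \<open>\<open>S t g0\<close>, for \<open>t \<ge> 0\<close> and \<open>g0 \<in> H\<^sub>+\<close>, is the value at time \<open>t\<close> of the unique global weak solution
  starting at \<open>g0\<close>, which stays in \<open>H\<^sub>+\<close>. Values for other arguments are irrelevant.\<close>

definition weak_solution_semiflow ::
    "'a::euclidean_space set \<Rightarrow> ('a L2_triple \<Rightarrow> 'a L2_triple \<Rightarrow> real) \<Rightarrow>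
     ('a L2_triple \<Rightarrow> 'a L2_triple) \<Rightarrow> (real \<Rightarrow> 'a L2_triple \<Rightarrow> 'a L2_triple) \<Rightarrow> bool" where
  "weak_solution_semiflow \<Omega> A f S \<longleftrightarrow>
     (\<forall>g0\<in>H_plus \<Omega>.
        global_weak_solution \<Omega> A f g0 (\<lambda>t. S t g0) \<and>
        (\<forall>g. global_weak_solution \<Omega> A f g0 g \<longrightarrow> (\<forall>t\<ge>0. g t = S t g0)) \<and>
        (\<forall>t\<ge>0. S t g0 \<in> H_plus \<Omega>))"


section \<open>Exponential attractors\<close>

text \<open>Only meaningful for totally bounded sets, for which the minimum exists.\<close>

definition covering_number :: "'a::metric_space set \<Rightarrow> real \<Rightarrow> nat" where
  "covering_number X \<epsilon> = (LEAST k. \<exists>C. finite C \<and> card C = k \<and> X \<subseteq> (\<Union>c\<in>C. cball c \<epsilon>))"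

definition upper_box_dimension :: "'a::metric_space set \<Rightarrow> ereal" where
  "upper_box_dimension X =
     Limsup (at_right 0) (\<lambda>\<epsilon>. ereal (ln (real (covering_number X \<epsilon>)) / ln (1 / \<epsilon>)))"

definition exponential_attractor ::
    "'a::real_normed_vector set \<Rightarrow> (real \<Rightarrow> 'a \<Rightarrow> 'a) \<Rightarrow> 'a set \<Rightarrow> bool" where
  "exponential_attractor X S M \<longleftrightarrow>
     M \<subseteq> X \<and> M \<noteq> {} \<and> compact M \<and> (\<forall>t\<ge>0. S t ` M \<subseteq> M) \<and>
     upper_box_dimension M < \<infinity> \<and>
     (\<exists>\<mu>>0. \<forall>B. bounded B \<and> B \<subseteq> X \<longrightarrow>
        (\<exists>C>0. \<forall>t\<ge>0. \<forall>x\<in>B. infdist (S t x) M \<le> C * exp (- \<mu> * t)))"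

end

theory Submission
 imports Defs "HOL-Computational_Algebra.Polynomial"
begin

text \<open>Weighting the third component suitably makes the reaction dissipative, which yields a bounded
 absorbing set \<open>B\<close>. On \<open>B\<close> the quadratic terms of the equation for the difference of two
 trajectories either have a sign or are absorbed by diffusion, by the Sobolev embedding into \<open>L\<^sup>4\<close>.
 Hence \<open>S t\<close> is Lipschitz on \<open>B\<close>, and the time average over \<open>[0,1]\<close> of the squared \<open>E\<close>-norm of
 a difference is controlled by its initial \<open>H\<close>-norm. As the unit ball of \<open>E\<close> is totally bounded in
 \<open>H\<close>, \<open>S 1\<close> maps every subset of \<open>B\<close> of radius \<open>r\<close> into \<open>N\<close> balls of radius \<open>r/2\<close>, where \<open>N\<close> does
 not depend on \<open>r\<close>. Iteration gives nets of \<open>S n ` B\<close> with at most \<open>N ^ n\<close> points at scale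
 \<open>2 ^ (- n)\<close>, and the attractor is the closure of all orbits of all these nets. Its dimension
 stays finite because trajectories are Hoelder continuous in time with exponent \<open>1/4\<close>: an orbit
 piece of length \<open>n\<close> is covered at scale \<open>2 ^ (- n)\<close> by a constant times \<open>n * 16 ^ n\<close> balls.\<close>


subsection \<open>The Hilbert space \<open>L^2\<close>\<close>

text \<open>A weak solution is only weakly continuous in \<open>H\<close>, and its
  \<open>E\<close>-norm is only square integrable in time, so neither an energy identity nor a bound
  in \<open>E\<close> at a given time is at hand. The energy inequality is therefore derived from
  difference quotients in time (Steklov averages). Wherever an \<open>E\<close>-bound at a single
  instant is wanted, averaging over [0,1] supplies a good time, and Lipschitz dependence carries the
  result on to time 1. In the squeezing step one good time has to serve a whole finite set of
  points, which is why that step bounds the cardinality of separated sets. The Gronwall arguments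
  run on integral inequalities for functions not known to be continuous. The signs of the quadratic
  terms come from nonnegativity of the components; for differences the products are split so that
  the remaining indefinite terms carry coefficients of one solution only. Orbits of the nets make
  the set positively invariant in continuous time, and the closure costs nothing in dimension
  because all covers are finite unions of closed balls.\<close>

lemma square_integrable_rep: "square_integrable (rep_L2 u)"
proof -
 have "L2_rel (rep_L2 u) (rep_L2 u)"
  by (rule Quotient_rep_reflp[OF Quotient_L2])
 then show ?thesis by (simp add: L2_rel_def)
qed

lemma measurable_rep_L2 [measurable]: "rep_L2 u \<in> borel_measurable lebesgue"
 using square_integrable_rep by (auto simp: square_integrable_def)

lemma L2_rel_self: "square_integrable f \<Longrightarrow> L2_rel f f"
 by (simp add: L2_rel_def)

lemma rep_abs_L2:
 assumes "square_integrable f" shows "AE x in lebesgue. rep_L2 (abs_L2 f) x = f x"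
 using rep_abs_rsp[OF Quotient3_L2, OF L2_rel_self[OF assms]]
 by (auto simp: L2_rel_def elim: eventually_mono)

lemma rep_L2_of: "square_integrable f \<Longrightarrow> AE x in lebesgue. rep_L2 (L2_of f) x = f x"
 by (simp add: L2_of_def rep_abs_L2)

lemma L2_eqI:
 assumes "AE x in lebesgue. rep_L2 u x = rep_L2 v x" shows "u = v"
proof -
 have "L2_rel (rep_L2 u) (rep_L2 v)"
  using assms square_integrable_rep by (auto simp: L2_rel_def)
 then show ?thesis by (simp add: Quotient3_rel_rep[OF Quotient3_L2])
qed

lemma rep_L2_zero: "AE x in lebesgue. rep_L2 0 x = 0"
 unfolding zero_L2_def by (rule rep_abs_L2[OF square_integrable_zero])

lemma abs_rep_L2: "abs_L2 (rep_L2 u) = u"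
 by (rule Quotient_abs_rep[OF Quotient_L2])

lemma rep_L2_add: "AE x in lebesgue. rep_L2 (u + v) x = rep_L2 u x + rep_L2 v x"
proof -
 have "abs_L2 (rep_L2 u) + abs_L2 (rep_L2 v) = abs_L2 (\<lambda>x. rep_L2 u x + rep_L2 v x)"
  by (rule plus_L2.abs_eq) (simp_all add: L2_rel_self square_integrable_rep)
 then have "u + v = abs_L2 (\<lambda>x. rep_L2 u x + rep_L2 v x)" by (simp add: abs_rep_L2)
 then show ?thesis by (simp add: rep_abs_L2 square_integrable_add square_integrable_rep)
qed

lemma rep_L2_scaleR: "AE x in lebesgue. rep_L2 (c *\<^sub>R u) x = c * rep_L2 u x"
proof -
 have "c *\<^sub>R abs_L2 (rep_L2 u) = abs_L2 (\<lambda>x. c * rep_L2 u x)"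
  by (rule scaleR_L2.abs_eq) (simp add: L2_rel_self square_integrable_rep)
 then have "c *\<^sub>R u = abs_L2 (\<lambda>x. c * rep_L2 u x)" by (simp add: abs_rep_L2)
 then show ?thesis by (simp add: rep_abs_L2 square_integrable_scale square_integrable_rep)
qed

lemma rep_L2_minus: "AE x in lebesgue. rep_L2 (- u) x = - rep_L2 u x"
 using rep_L2_scaleR[of "-1" u] by simp

lemma rep_L2_diff: "AE x in lebesgue. rep_L2 (u - v) x = rep_L2 u x - rep_L2 v x"
proof -
 have "AE x in lebesgue. rep_L2 (u + - v) x = rep_L2 u x + rep_L2 (- v) x" by (rule rep_L2_add)
 with rep_L2_minus[of v] have "AE x in lebesgue. rep_L2 (u + - v) x = rep_L2 u x - rep_L2 v x"
  by eventually_elim simp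
 then show ?thesis by simp
qed

lemma inner_L2_eq: "u \<bullet> v = (LINT x|lebesgue. rep_L2 u x * rep_L2 v x)"
proof -
 have "abs_L2 (rep_L2 u) \<bullet> abs_L2 (rep_L2 v) = (LINT x|lebesgue. rep_L2 u x * rep_L2 v x)"
  by (rule inner_L2.abs_eq) (auto simp: L2_rel_self square_integrable_rep)
 then show ?thesis by (simp add: abs_rep_L2)
qed

lemma integrable_rep_mult: "integrable lebesgue (\<lambda>x. rep_L2 u x * rep_L2 v x)"
 by (rule square_integrable_mult) (rule square_integrable_rep)+

lemma integrable_rep_power2: "integrable lebesgue (\<lambda>x. (rep_L2 u x)^2)"
 using integrable_rep_mult[of u u] by (simp add: power2_eq_square)

lemma norm_L2_power2: "(norm u)^2 = (LINT x|lebesgue. (rep_L2 u x)^2)"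
 by (simp add: power2_norm_eq_inner inner_L2_eq flip: power2_eq_square)

lemma nn_integral_rep_power2: "(\<integral>\<^sup>+x. ennreal ((rep_L2 u x)^2) \<partial>lebesgue) = ennreal ((norm u)^2)"
 unfolding norm_L2_power2 by (rule nn_integral_eq_integral) (auto simp: integrable_rep_power2)

lemma inner_L2_of:
 assumes "square_integrable f"
 shows "L2_of f \<bullet> v = (LINT x|lebesgue. f x * rep_L2 v x)"
 unfolding inner_L2_eq
proof (rule integral_cong_AE)
 show "AE x in lebesgue. rep_L2 (L2_of f) x * rep_L2 v x = f x * rep_L2 v x"
  using rep_L2_of[OF assms] by eventually_elim simp
qed (use assms in \<open>auto simp: square_integrable_def\<close>)

lemma norm_L2_of:
 assumes "square_integrable f"
 shows "(norm (L2_of f))^2 = (LINT x|lebesgue. (f x)^2)"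
 unfolding norm_L2_power2
proof (rule integral_cong_AE)
 show "AE x in lebesgue. (rep_L2 (L2_of f) x)^2 = (f x)^2"
  using rep_L2_of[OF assms] by eventually_elim simp
qed (use assms in \<open>auto simp: square_integrable_def\<close>)

lemma L2_of_eqI:
 assumes "square_integrable f" "AE x in lebesgue. rep_L2 u x = f x"
 shows "L2_of f = u"
proof (rule L2_eqI)
 show "AE x in lebesgue. rep_L2 (L2_of f) x = rep_L2 u x"
  using rep_L2_of[OF assms(1)] assms(2) by eventually_elim simp
qed

lemma L2_of_add:
 assumes "square_integrable f" "square_integrable g"
 shows "L2_of (\<lambda>x. f x + g x) = L2_of f + L2_of g"
proof (rule L2_of_eqI)
 show "AE x in lebesgue. rep_L2 (L2_of f + L2_of g) x = f x + g x"
  using rep_L2_of[OF assms(1)] rep_L2_of[OF assms(2)] rep_L2_add[of "L2_of f" "L2_of g"]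
  by eventually_elim simp
qed (simp add: assms square_integrable_add)

lemma L2_of_scale:
 assumes "square_integrable f"
 shows "L2_of (\<lambda>x. c * f x) = c *\<^sub>R L2_of f"
proof (rule L2_of_eqI)
 show "AE x in lebesgue. rep_L2 (c *\<^sub>R L2_of f) x = c * f x"
  using rep_L2_of[OF assms(1)] rep_L2_scaleR[of c "L2_of f"]
  by eventually_elim simp
qed (simp add: assms square_integrable_scale)

text \<open>The series of 2^k (d_k)^2 has integral at most the sum of 2^k 4^(-k), which is 2, so it
  is finite almost everywhere. A finite value C gives |d_k(x)| \<le> sqrt(C) 2^(-k/2), and this is
  summable. The weights keep the whole argument at the level of nonnegative integrals of
  squares.\<close>

lemma AE_summable_of_summable_norms:
 fixes d :: "nat \<Rightarrow> 'a::euclidean_space L2"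
 assumes "\<And>k. norm (d k) \<le> (1/2) ^ k"
 shows "AE x in lebesgue. summable (\<lambda>k. rep_L2 (d k) x)"
proof -
 have "(\<integral>\<^sup>+x. (\<Sum>k. ennreal (2 ^ k * (rep_L2 (d k) x)^2)) \<partial>lebesgue)
   = (\<Sum>k. \<integral>\<^sup>+x. ennreal (2 ^ k * (rep_L2 (d k) x)^2) \<partial>lebesgue)"
  by (rule nn_integral_suminf) measurable
 also have "... \<le> (\<Sum>k. ennreal ((1/2) ^ k))"
 proof (rule suminf_le)
  fix k
  have "(norm (d k))^2 \<le> ((1/2) ^ k)^2" using assms by (intro power_mono) auto
  then have *: "2 ^ k * (norm (d k))^2 \<le> (1/2) ^ k"
   by (simp add: power2_eq_square field_simps)
  have "(\<integral>\<^sup>+x. ennreal (2 ^ k * (rep_L2 (d k) x)^2) \<partial>lebesgue)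
    = ennreal (2 ^ k) * (\<integral>\<^sup>+x. ennreal ((rep_L2 (d k) x)^2) \<partial>lebesgue)"
   by (subst nn_integral_cmult[symmetric]) (auto simp: ennreal_mult)
  also have "... = ennreal (2 ^ k * (norm (d k))^2)"
   by (simp add: nn_integral_rep_power2 ennreal_mult)
  also have "... \<le> ennreal ((1/2) ^ k)" using * by (rule ennreal_leI)
  finally show "(\<integral>\<^sup>+x. ennreal (2 ^ k * (rep_L2 (d k) x)^2) \<partial>lebesgue) \<le> ennreal ((1/2) ^ k)" .
 qed auto
 also have "... = ennreal (\<Sum>k. (1/2) ^ k)"
  by (intro suminf_ennreal2) (auto simp: summable_geometric)
 finally have fin: "(\<integral>\<^sup>+x. (\<Sum>k. ennreal (2 ^ k * (rep_L2 (d k) x)^2)) \<partial>lebesgue) \<noteq> \<infinity>"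
  unfolding infinity_ennreal_def by (rule neq_top_trans[OF ennreal_neq_top])
 have "AE x in lebesgue. (\<Sum>k. ennreal (2 ^ k * (rep_L2 (d k) x)^2)) \<noteq> \<infinity>"
  by (rule nn_integral_PInf_AE[OF _ fin]) measurable
 then show ?thesis
 proof eventually_elim
  case (elim x)
  then have sm: "summable (\<lambda>k. 2 ^ k * (rep_L2 (d k) x)^2)"
   by (intro summable_suminf_not_top) (simp_all only: infinity_ennreal_def zero_le_power zero_le_power2
     mult_nonneg_nonneg zero_le_numeral not_False_eq_True)
  define C where "C = (\<Sum>k. 2 ^ k * (rep_L2 (d k) x)^2)"
  have bound: "norm (rep_L2 (d k) x) \<le> sqrt C * (sqrt (1/2)) ^ k" for k
  proof -
   have "(\<Sum>i\<in>{k}. 2 ^ i * (rep_L2 (d i) x)^2) \<le> C"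
    unfolding C_def by (rule sum_le_suminf[OF sm]) auto
   then have "2 ^ k * (rep_L2 (d k) x)^2 \<le> C" by simp
   then have "(rep_L2 (d k) x)^2 \<le> C * (1/2) ^ k" by (simp add: field_simps)
   then have "sqrt ((rep_L2 (d k) x)^2) \<le> sqrt (C * (1/2) ^ k)" by (rule real_sqrt_le_mono)
   then have "\<bar>rep_L2 (d k) x\<bar> \<le> sqrt (C * (1/2) ^ k)" by simp
   then show ?thesis by (simp add: real_sqrt_mult real_sqrt_power)
  qed
  have "sqrt (1/2) < 1" by simp
  then have "summable (\<lambda>k. sqrt C * (sqrt (1/2)) ^ k)"
   by (intro summable_mult summable_geometric) auto
  then show ?case using bound by (rule summable_comparison_test'[where N=0])
 qed
qed

text \<open>Riesz-Fischer: a subsequence with increments below 2^(-k) telescopes to an almost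
  everywhere limit \<open>f\<close>, and Fatou's lemma transfers the Cauchy estimate to
  \<open>f - X n\<close>.\<close>

instance L2 :: (euclidean_space) complete_space
proof
 fix X :: "nat \<Rightarrow> 'a L2"
 assume "Cauchy X"
 have "\<exists>r. \<forall>k. (\<forall>m\<ge>r k. \<forall>n\<ge>r k. norm (X m - X n) < (1/2) ^ k) \<and> r k < (r (Suc k) :: nat)"
 proof (rule dependent_nat_choice)
  show "\<exists>x. \<forall>m\<ge>x. \<forall>n\<ge>x. norm (X m - X n) < (1/2) ^ 0"
   using CauchyD[OF \<open>Cauchy X\<close>, of 1] by auto
 next
  fix x :: nat and k
  obtain M where "\<forall>m\<ge>M. \<forall>n\<ge>M. norm (X m - X n) < (1/2) ^ Suc k"
   using CauchyD[OF \<open>Cauchy X\<close>, of "(1/2) ^ Suc k"] by auto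
  then show "\<exists>y. (\<forall>m\<ge>y. \<forall>n\<ge>y. norm (X m - X n) < (1/2) ^ Suc k) \<and> x < y"
   by (intro exI[of _ "max M (Suc x)"]) auto
 qed
 then obtain r where r: "\<And>k m n. m \<ge> r k \<Longrightarrow> n \<ge> r k \<Longrightarrow> norm (X m - X n) < (1/2) ^ k"
  and mono: "strict_mono r" by (auto simp: strict_mono_Suc_iff)
 define d where "d k = X (r (Suc k)) - X (r k)" for k
 have "norm (d k) \<le> (1/2) ^ k" for k
  using r[of k "r (Suc k)" "r k"] strict_monoD[OF mono, of k "Suc k"] by (simp add: d_def)
 then have "AE x in lebesgue. summable (\<lambda>k. rep_L2 (d k) x)"
  by (rule AE_summable_of_summable_norms)
 moreover have "AE x in lebesgue. \<forall>k. rep_L2 (d k) x = rep_L2 (X (r (Suc k))) x - rep_L2 (X (r k)) x"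
  unfolding d_def by (simp add: AE_all_countable rep_L2_diff)
 ultimately have conv: "AE x in lebesgue. convergent (\<lambda>k. rep_L2 (X (r k)) x)"
 proof eventually_elim
  case (elim x)
  then have "summable (\<lambda>k. rep_L2 (X (r (Suc k))) x - rep_L2 (X (r k)) x)" by simp
  then have "convergent (\<lambda>n. \<Sum>k<n. rep_L2 (X (r (Suc k))) x - rep_L2 (X (r k)) x)"
   by (simp add: summable_iff_convergent)
  then have "convergent (\<lambda>n. rep_L2 (X (r n)) x - rep_L2 (X (r 0)) x)"
   by (simp add: sum_lessThan_telescope[of "\<lambda>k. rep_L2 (X (r k)) x"])
  then have "convergent (\<lambda>n. (rep_L2 (X (r n)) x - rep_L2 (X (r 0)) x) + rep_L2 (X (r 0)) x)"
   by (intro convergent_add) (auto simp: convergent_const)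
  then show ?case by simp
 qed
 define f where "f x = lim (\<lambda>k. rep_L2 (X (r k)) x)" for x
 have f_meas[measurable]: "f \<in> borel_measurable lebesgue"
  unfolding f_def by (rule borel_measurable_lim_metric) measurable
 have fX: "AE x in lebesgue. (\<lambda>k. rep_L2 (X (r k)) x) \<longlonglongrightarrow> f x"
  using conv unfolding f_def by eventually_elim (simp add: convergent_LIMSEQ_iff)
 \<comment> \<open>Fatou along the subsequence: for m \<ge> k both r m and n lie beyond r k, so the
   integrals under the limit inferior are at most 4^(-k).\<close>
 have dist: "(\<integral>\<^sup>+x. ennreal ((f x - rep_L2 (X n) x)^2) \<partial>lebesgue) \<le> ennreal (((1/2) ^ k)^2)"
  if "n \<ge> r k" for n k
 proof -
  have "(\<integral>\<^sup>+x. ennreal ((f x - rep_L2 (X n) x)^2) \<partial>lebesgue)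
    = (\<integral>\<^sup>+x. liminf (\<lambda>m. ennreal ((rep_L2 (X (r m)) x - rep_L2 (X n) x)^2)) \<partial>lebesgue)"
  proof (rule nn_integral_cong_AE)
   show "AE x in lebesgue. ennreal ((f x - rep_L2 (X n) x)^2) =
     liminf (\<lambda>m. ennreal ((rep_L2 (X (r m)) x - rep_L2 (X n) x)^2))"
    using fX
   proof eventually_elim
    case (elim x)
    have "(\<lambda>m. ennreal ((rep_L2 (X (r m)) x - rep_L2 (X n) x)^2)) \<longlonglongrightarrow> ennreal ((f x - rep_L2 (X n) x)^2)"
     by (intro tendsto_ennrealI tendsto_intros elim)
    then show ?case by (metis lim_imp_Liminf trivial_limit_sequentially)
   qed
  qed
  also have "... \<le> liminf (\<lambda>m. \<integral>\<^sup>+x. ennreal ((rep_L2 (X (r m)) x - rep_L2 (X n) x)^2) \<partial>lebesgue)"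
   by (rule nn_integral_liminf) measurable
  also have "... \<le> ennreal (((1/2) ^ k)^2)"
  proof (rule Liminf_le)
   show "\<forall>\<^sub>F m in sequentially. (\<integral>\<^sup>+x. ennreal ((rep_L2 (X (r m)) x - rep_L2 (X n) x)^2) \<partial>lebesgue) \<le> ennreal (((1/2) ^ k)^2)"
    using eventually_ge_at_top[of k]
   proof eventually_elim
    case (elim m)
    have "(\<integral>\<^sup>+x. ennreal ((rep_L2 (X (r m)) x - rep_L2 (X n) x)^2) \<partial>lebesgue)
      = (\<integral>\<^sup>+x. ennreal ((rep_L2 (X (r m) - X n) x)^2) \<partial>lebesgue)"
     by (rule nn_integral_cong_AE) (use rep_L2_diff[of "X (r m)" "X n"] in \<open>eventually_elim, simp\<close>)
    also have "... = ennreal ((norm (X (r m) - X n))^2)" by (rule nn_integral_rep_power2)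
    also have "... \<le> ennreal (((1/2) ^ k)^2)"
    proof -
     have "r k \<le> r m" using mono elim by (simp add: strict_mono_less_eq)
     then have "norm (X (r m) - X n) \<le> (1/2) ^ k" using r[of k "r m" n] that by simp
     then show ?thesis by (intro ennreal_leI power_mono) auto
    qed
    finally show ?case .
   qed
  qed simp
  finally show ?thesis .
 qed
 \<comment> \<open>So far only differences from members of the sequence are controlled; adding one
   member back shows that the limit itself is square integrable.\<close>
 have sq0: "square_integrable (\<lambda>x. f x - rep_L2 (X (r 0)) x)"
  unfolding square_integrable_def
 proof
  show "integrable lebesgue (\<lambda>x. (f x - rep_L2 (X (r 0)) x)^2)"
  proof (rule integrableI_bounded)
   show "(\<integral>\<^sup>+x. ennreal (norm ((f x - rep_L2 (X (r 0)) x)^2)) \<partial>lebesgue) < \<infinity>"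
    using le_less_trans[OF dist[of 0 "r 0"] ennreal_less_top] by simp
  qed measurable
 qed measurable
 have sqf: "square_integrable f"
  using square_integrable_add[OF sq0 square_integrable_rep[of "X (r 0)"]] by simp
 have "norm (L2_of f - X n) \<le> (1/2) ^ k" if "n \<ge> r k" for n k
 proof -
  have "ennreal ((norm (L2_of f - X n))^2) = (\<integral>\<^sup>+x. ennreal ((rep_L2 (L2_of f - X n) x)^2) \<partial>lebesgue)"
   by (rule nn_integral_rep_power2[symmetric])
  also have "... = (\<integral>\<^sup>+x. ennreal ((f x - rep_L2 (X n) x)^2) \<partial>lebesgue)"
   by (rule nn_integral_cong_AE)
    (use rep_L2_diff[of "L2_of f" "X n"] rep_L2_of[OF sqf] in \<open>eventually_elim, simp\<close>)
  also have "... \<le> ennreal (((1/2) ^ k)^2)" using dist[OF that] .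
  finally have "(norm (L2_of f - X n))^2 \<le> ((1/2) ^ k)^2" by (simp add: ennreal_le_iff)
  then show ?thesis by (rule power2_le_imp_le) simp
 qed
 note bound = this
 have "X \<longlonglongrightarrow> L2_of f"
 proof (rule LIMSEQ_I)
  fix e :: real assume "e > 0"
  then obtain k where "(1/2::real) ^ k < e" using real_arch_pow_inv[of e "1/2"] by auto
  then show "\<exists>no. \<forall>n\<ge>no. norm (X n - L2_of f) < e"
   using bound by (intro exI[of _ "r k"]) (metis le_less_trans norm_minus_commute)
 qed
 then show "convergent X" by (auto simp: convergent_def)
qed

text \<open>The squares of the differences converge to 0 in L^1, and convergence in L^1 yields an
  almost everywhere convergent subsequence.\<close>

lemma L2_tendsto_AE_subseq:
 assumes "X \<longlonglongrightarrow> (u :: 'a::euclidean_space L2)"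
 shows "\<exists>r::nat \<Rightarrow> nat. strict_mono r \<and> (AE x in lebesgue. (\<lambda>k. rep_L2 (X (r k)) x) \<longlonglongrightarrow> rep_L2 u x)"
proof -
 have "\<exists>r::nat\<Rightarrow>nat. strict_mono r \<and> (AE x in lebesgue. (\<lambda>n. (rep_L2 (X (r n) - u) x)^2) \<longlonglongrightarrow> 0)"
 proof (rule tendsto_L1_AE_subseq)
  have "(\<lambda>n. (norm (X n - u))^2) \<longlonglongrightarrow> 0^2"
   using assms by (intro tendsto_power) (simp add: LIM_zero_iff tendsto_norm_zero_iff)
  then show "(\<lambda>n. LINT x|lebesgue. norm ((rep_L2 (X n - u) x)^2)) \<longlonglongrightarrow> 0"
   by (simp add: norm_L2_power2)
 qed (rule integrable_rep_power2)
 then obtain r where r: "strict_mono r" "AE x in lebesgue. (\<lambda>n. (rep_L2 (X (r n) - u) x)^2) \<longlonglongrightarrow> 0"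
  by blast
 have "AE x in lebesgue. \<forall>n. rep_L2 (X (r n) - u) x = rep_L2 (X (r n)) x - rep_L2 u x"
  by (simp add: AE_all_countable rep_L2_diff)
 with r(2) have "AE x in lebesgue. (\<lambda>k. rep_L2 (X (r k)) x) \<longlonglongrightarrow> rep_L2 u x"
 proof eventually_elim
  case (elim x)
  then have "(\<lambda>n. (rep_L2 (X (r n)) x - rep_L2 u x)^2) \<longlonglongrightarrow> 0" by simp
  then have "(\<lambda>n. sqrt ((rep_L2 (X (r n)) x - rep_L2 u x)^2)) \<longlonglongrightarrow> sqrt 0" by (rule tendsto_real_sqrt)
  then show ?case by (simp add: tendsto_rabs_zero_iff LIM_zero_iff)
 qed
 with r(1) show ?thesis by blast
qed

lemma L2_on_subspace: "subspace (L2_on \<Omega>)"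
proof (rule subspaceI)
 show "0 \<in> L2_on \<Omega>" unfolding L2_on_def using rep_L2_zero by (simp, eventually_elim, simp)
 show "x + y \<in> L2_on \<Omega>" if "x \<in> L2_on \<Omega>" "y \<in> L2_on \<Omega>" for x y
 proof -
  from that have "AE t in lebesgue. t \<notin> \<Omega> \<longrightarrow> rep_L2 x t = 0" "AE t in lebesgue. t \<notin> \<Omega> \<longrightarrow> rep_L2 y t = 0"
   by (simp_all add: L2_on_def)
  with rep_L2_add[of x y] have "AE t in lebesgue. t \<notin> \<Omega> \<longrightarrow> rep_L2 (x + y) t = 0"
   by eventually_elim simp
  then show ?thesis by (simp add: L2_on_def)
 qed
 show "c *\<^sub>R x \<in> L2_on \<Omega>" if "x \<in> L2_on \<Omega>" for c x
 proof -
  from that have "AE t in lebesgue. t \<notin> \<Omega> \<longrightarrow> rep_L2 x t = 0"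
   by (simp_all add: L2_on_def)
  with rep_L2_scaleR[of c x] have "AE t in lebesgue. t \<notin> \<Omega> \<longrightarrow> rep_L2 (c *\<^sub>R x) t = 0"
   by eventually_elim simp
  then show ?thesis by (simp add: L2_on_def)
 qed
qed

text \<open>A sign condition passes to the limit along an almost everywhere convergent subsequence.
  This makes the positive cone complete and the absorbing set closed, so that the closure taken at
  the end stays inside.\<close>

lemma closed_L2_nonneg: "closed (L2_nonneg \<Omega>)"
 unfolding closed_sequential_limits
proof (intro allI impI)
 fix X u assume "(\<forall>n. X n \<in> L2_nonneg \<Omega>) \<and> X \<longlonglongrightarrow> u"
 then have X: "\<And>n. X n \<in> L2_nonneg \<Omega>" and lim: "X \<longlonglongrightarrow> u" by auto
 obtain r :: "nat \<Rightarrow> nat" where r: "AE x in lebesgue. (\<lambda>k. rep_L2 (X (r k)) x) \<longlonglongrightarrow> rep_L2 u x"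
  using L2_tendsto_AE_subseq[OF lim] by blast
 have 1: "AE x in lebesgue. \<forall>k. x \<notin> \<Omega> \<longrightarrow> rep_L2 (X (r k)) x = 0"
  using X by (subst AE_all_countable) (auto simp: L2_nonneg_def L2_on_def)
 have 2: "AE x in lebesgue. \<forall>k. x \<in> \<Omega> \<longrightarrow> rep_L2 (X (r k)) x \<ge> 0"
  using X by (subst AE_all_countable) (auto simp: L2_nonneg_def L2_on_def)
 have "AE x in lebesgue. x \<notin> \<Omega> \<longrightarrow> rep_L2 u x = 0" using 1 r
  by eventually_elim (auto simp: LIMSEQ_const_iff)
 moreover have "AE x in lebesgue. x \<in> \<Omega> \<longrightarrow> rep_L2 u x \<ge> 0" using 2 r
  by eventually_elim (metis LIMSEQ_le_const)
 ultimately show "u \<in> L2_nonneg \<Omega>" by (simp add: L2_nonneg_def L2_on_def)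
qed

lemma closed_H_plus: "closed (H_plus \<Omega>)"
 unfolding H_plus_def by (intro closed_Times closed_L2_nonneg)

subsection \<open>Smooth bump functions\<close>

text \<open>A polynomial in 1/t in front of exp(-1/t) makes the family closed under differentiation;
  the basic bump is the case p = 1, and its smoothness follows without computing higher
  derivatives.\<close>

definition expinv :: "real poly \<Rightarrow> real \<Rightarrow> real" where
 "expinv p t = (if t > 0 then poly p (1 / t) * exp (- (1 / t)) else 0)"

lemma poly_times_exp_minus_tendsto_0: "((\<lambda>y. poly p y * exp (- y)) \<longlongrightarrow> (0::real)) at_top"
proof -
 have "((\<lambda>y. \<Sum>i\<le>degree p. coeff p i * (y ^ i / exp y)) \<longlongrightarrow> (\<Sum>i\<le>degree p. coeff p i * 0)) at_top"
  by (intro tendsto_sum tendsto_mult tendsto_const tendsto_power_div_exp_0)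
 moreover have "(\<Sum>i\<le>degree p. coeff p i * (y ^ i / exp y)) = poly p y * exp (- y)" for y
  by (simp add: poly_altdef sum_distrib_right exp_minus divide_inverse mult.assoc)
 ultimately show ?thesis by simp
qed

text \<open>For t > 0 the chain rule gives (1/t)^2 (p - p')(1/t) exp(-1/t). At 0 the right
  difference quotient is the member of the family with polynomial X p, which tends to 0 because the
  exponential beats every polynomial.\<close>

lemma expinv_has_derivative:
 "(expinv p has_real_derivative expinv (monom 1 2 * (p - pderiv p)) t) (at t)"
proof -
 consider "t > 0" | "t < 0" | "t = 0" by linarith
 then show ?thesis
 proof cases
  case 1
  have "((\<lambda>t. poly p (1 / t) * exp (- (1 / t))) has_real_derivative
    expinv (monom 1 2 * (p - pderiv p)) t) (at t)"
   using 1 unfolding expinv_def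
   by (auto intro!: derivative_eq_intros DERIV_chain2[OF poly_DERIV]
     simp: poly_monom field_simps power2_eq_square)
  then show ?thesis
  proof (rule has_field_derivative_transform_within_open[where S="{0<..}"])
   show "poly p (1 / x) * exp (- (1 / x)) = expinv p x" if "x \<in> {0<..}" for x
    using that by (simp add: expinv_def)
  qed (use 1 in auto)
 next
  case 2
  have "((\<lambda>t. 0) has_real_derivative 0) (at t)" by simp
  then have "(expinv p has_real_derivative 0) (at t)"
   by (rule has_field_derivative_transform_within_open[where S="{..<0}"])
    (use 2 in \<open>auto simp: expinv_def\<close>)
  with 2 show ?thesis by (simp add: expinv_def)
 next
  case 3
  have "((\<lambda>h. (expinv p h - expinv p 0) / (h - 0)) \<longlongrightarrow> 0) (at 0)"
  proof (rule filterlim_split_at)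
   show "((\<lambda>h. (expinv p h - expinv p 0) / (h - 0)) \<longlongrightarrow> 0) (at_left 0)"
    by (rule tendsto_eventually) (auto simp: expinv_def eventually_at_left_field intro!: exI[of _ "-1"])
   have "((\<lambda>h. poly (monom 1 1 * p) (inverse h) * exp (- (inverse h))) \<longlongrightarrow> 0) (at_right (0::real))"
    by (rule filterlim_compose[OF poly_times_exp_minus_tendsto_0 filterlim_inverse_at_top_right])
   moreover have "\<forall>\<^sub>F h in at_right (0::real). poly (monom 1 1 * p) (inverse h) * exp (- (inverse h))
     = (expinv p h - expinv p 0) / (h - 0)"
    unfolding eventually_at_right_field
    by (auto simp: expinv_def poly_monom field_simps intro!: exI[of _ 1])
   ultimately show "((\<lambda>h. (expinv p h - expinv p 0) / (h - 0)) \<longlongrightarrow> 0) (at_right 0)"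
    by (rule Lim_transform_eventually)
  qed
  then show ?thesis using 3 by (simp add: has_field_derivative_iff expinv_def)
 qed
qed

text \<open>An algebra of functions closed under differentiation, hence consisting of smooth functions.\<close>

inductive_set bump_algebra :: "('a::euclidean_space \<Rightarrow> real) set" where
 base: "(\<lambda>x. expinv p (x \<bullet> a + c)) \<in> bump_algebra"
| const: "(\<lambda>x. c) \<in> bump_algebra"
| add: "f \<in> bump_algebra \<Longrightarrow> g \<in> bump_algebra \<Longrightarrow> (\<lambda>x. f x + g x) \<in> bump_algebra"
| mult: "f \<in> bump_algebra \<Longrightarrow> g \<in> bump_algebra \<Longrightarrow> (\<lambda>x. f x * g x) \<in> bump_algebra"

text \<open>\<open>D\<close> takes the direction first, so that for a fixed direction the derivative
  is a function of the point and can itself be a member of the algebra.\<close>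

lemma bump_algebra_derivative:
 assumes "f \<in> bump_algebra"
 shows "\<exists>D. (\<forall>x. (f has_derivative (\<lambda>v. D v x)) (at x)) \<and> (\<forall>v. D v \<in> bump_algebra)"
 using assms
proof induction
 case (base p a c)
 let ?D = "\<lambda>v x. (v \<bullet> a) * expinv (monom 1 2 * (p - pderiv p)) (x \<bullet> a + c)"
 have "((\<lambda>x. expinv p (x \<bullet> a + c)) has_derivative (\<lambda>v. ?D v x)) (at x)" for x
 proof -
  have "((\<lambda>x. x \<bullet> a + c) has_derivative (\<lambda>v. v \<bullet> a)) (at x)"
   by (auto intro!: derivative_eq_intros)
  from has_derivative_compose[OF this expinv_has_derivative[unfolded has_field_derivative_def]]
  show ?thesis by (simp add: mult.commute)
 qed
 then show ?case
  by (intro exI[of _ ?D]) (auto intro!: bump_algebra.intros)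
next
 case (const c)
 then show ?case by (intro exI[of _ "\<lambda>v x. 0"]) (auto intro!: bump_algebra.intros)
next
 case (add f g)
 then obtain D D' where "\<And>x. (f has_derivative (\<lambda>v. D v x)) (at x)" "\<And>v. D v \<in> bump_algebra"
  "\<And>x. (g has_derivative (\<lambda>v. D' v x)) (at x)" "\<And>v. D' v \<in> bump_algebra" by auto
 then show ?case
  by (intro exI[of _ "\<lambda>v x. D v x + D' v x"])
   (auto intro!: bump_algebra.intros derivative_intros)
next
 case (mult f g)
 then obtain D D' where "\<And>x. (f has_derivative (\<lambda>v. D v x)) (at x)" "\<And>v. D v \<in> bump_algebra"
  "\<And>x. (g has_derivative (\<lambda>v. D' v x)) (at x)" "\<And>v. D' v \<in> bump_algebra" by auto
 with mult.hyps show ?case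
  by (intro exI[of _ "\<lambda>v x. f x * D' v x + D v x * g x"])
   (auto intro!: bump_algebra.intros has_derivative_mult)
qed

lemma partial_deriv_eq: "(f has_derivative D) (at x) \<Longrightarrow> partial_deriv b f x = D b"
 by (simp add: partial_deriv_def frechet_derivative_at[symmetric])

lemma smooth_bump_algebra:
 assumes "f \<in> bump_algebra" shows "smooth f"
proof -
 have "foldr partial_deriv bs f \<in> bump_algebra" for bs
 proof (induction bs)
  case (Cons b bs)
  obtain D where D: "\<And>x. (foldr partial_deriv bs f has_derivative (\<lambda>v. D v x)) (at x)" "\<And>v. D v \<in> bump_algebra"
   using bump_algebra_derivative[OF Cons] by auto
  have "partial_deriv b (foldr partial_deriv bs f) = D b"
   using partial_deriv_eq[OF D(1)] by auto
  then show ?case using D(2) by simp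
 qed (use assms in simp)
 then show ?thesis unfolding smooth_def differentiable_def using bump_algebra_derivative by blast
qed

text \<open>One factor for each of the two faces in every coordinate. The index \<open>k\<close>
  only steepens the flanks: the set where the bump is positive remains the open box, while the
  values inside tend to 1.\<close>

definition box_bump :: "'a \<Rightarrow> 'a \<Rightarrow> nat \<Rightarrow> 'a::euclidean_space \<Rightarrow> real" where
 "box_bump a b k x =
   (\<Prod>i\<in>Basis. expinv 1 (real (Suc k) * (x \<bullet> i - a \<bullet> i)) * expinv 1 (real (Suc k) * (b \<bullet> i - x \<bullet> i)))"

lemma bump_algebra_prod:
 assumes "finite I" "\<And>i. i \<in> I \<Longrightarrow> f i \<in> bump_algebra"
 shows "(\<lambda>x. \<Prod>i\<in>I. f i x) \<in> bump_algebra"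
 using assms by (induction I) (auto intro: bump_algebra.intros)

lemma smooth_box_bump: "smooth (box_bump a b k)"
proof (rule smooth_bump_algebra)
 have "(\<lambda>x. expinv 1 (real (Suc k) * (x \<bullet> i - a \<bullet> i)) * expinv 1 (real (Suc k) * (b \<bullet> i - x \<bullet> i))) \<in> bump_algebra" for i
 proof (rule bump_algebra.mult)
  have "(\<lambda>x. expinv 1 (x \<bullet> (real (Suc k) *\<^sub>R i) + - (real (Suc k) * (a \<bullet> i)))) \<in> bump_algebra"
   by (rule bump_algebra.base)
  then show "(\<lambda>x. expinv 1 (real (Suc k) * (x \<bullet> i - a \<bullet> i))) \<in> bump_algebra"
   by (simp add: right_diff_distrib)
  have "(\<lambda>x. expinv 1 (x \<bullet> (- real (Suc k) *\<^sub>R i) + (real (Suc k) * (b \<bullet> i)))) \<in> bump_algebra"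
   by (rule bump_algebra.base)
  then show "(\<lambda>x. expinv 1 (real (Suc k) * (b \<bullet> i - x \<bullet> i))) \<in> bump_algebra"
   by (simp add: right_diff_distrib algebra_simps)
 qed
 then have "(\<lambda>x. \<Prod>i\<in>Basis. expinv 1 (real (Suc k) * (x \<bullet> i - a \<bullet> i)) * expinv 1 (real (Suc k) * (b \<bullet> i - x \<bullet> i))) \<in> bump_algebra"
  by (intro bump_algebra_prod) auto
 then show "box_bump a b k \<in> bump_algebra" by (simp add: box_bump_def[abs_def])
qed

lemma expinv_1_bounds: "0 \<le> expinv 1 t" "expinv 1 t \<le> 1"
 by (auto simp: expinv_def)

lemma expinv_1_eq_0_iff: "expinv 1 t = 0 \<longleftrightarrow> t \<le> 0"
 by (auto simp: expinv_def)

lemma box_bump_bounds: "0 \<le> box_bump a b k x" "box_bump a b k x \<le> 1"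
 unfolding box_bump_def
 by (auto intro!: prod_nonneg prod_le_1 mult_nonneg_nonneg mult_le_one expinv_1_bounds)

lemma box_bump_eq_0_iff: "box_bump a b k x = 0 \<longleftrightarrow> x \<notin> box a b"
 unfolding box_bump_def by (auto simp: expinv_1_eq_0_iff mem_box mult_le_0_iff not_less)

lemma box_bump_tendsto: "(\<lambda>k. box_bump a b k x) \<longlonglongrightarrow> indicator (box a b) x"
proof (cases "x \<in> box a b")
 case True
 have *: "(\<lambda>k. expinv 1 (real (Suc k) * t)) \<longlonglongrightarrow> 1" if "t > 0" for t
 proof -
  have "(\<lambda>k. exp (- (inverse (real (Suc k)) * (1 / t)))) \<longlonglongrightarrow> exp (- (0 * (1 / t)))"
   by (intro tendsto_intros LIMSEQ_inverse_real_of_nat)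
  moreover have "exp (- (inverse (real (Suc k)) * (1 / t))) = expinv 1 (real (Suc k) * t)" for k
  proof -
   have "real (Suc k) * t > 0" using that by simp
   then show ?thesis unfolding expinv_def by (simp add: divide_simps del: of_nat_Suc)
  qed
  ultimately show ?thesis by simp
 qed
 have "(\<lambda>k. box_bump a b k x) \<longlonglongrightarrow> (\<Prod>i\<in>(Basis::'a set). 1 * 1)"
  unfolding box_bump_def using True by (intro tendsto_prod tendsto_mult *) (auto simp: mem_box)
 with True show ?thesis by simp
next
 case False
 then show ?thesis by (simp add: box_bump_eq_0_iff[THEN iffD2])
qed

lemma box_bump_test_function:
 assumes "cbox a b \<subseteq> U" shows "box_bump a b k \<in> test_functions U"
proof -
 have "{x. box_bump a b k x \<noteq> 0} \<subseteq> cbox a b"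
  using box_subset_cbox by (auto simp: box_bump_eq_0_iff)
 then have "closure {x. box_bump a b k x \<noteq> 0} \<subseteq> cbox a b"
  by (rule closure_minimal[OF _ closed_cbox])
 moreover from this have "compact (closure {x. box_bump a b k x \<noteq> 0})"
  by (meson bounded_cbox bounded_subset closed_closure compact_eq_bounded_closed)
 ultimately show ?thesis using assms smooth_box_bump by (auto simp: test_functions_def)
qed

subsection \<open>Test functions\<close>

lemma smooth_partial_deriv:
 assumes "smooth f" "b \<in> Basis" shows "smooth (partial_deriv b f)"
 unfolding smooth_def
proof (intro allI impI)
 fix bs :: "'a list" and x assume "set bs \<subseteq> Basis"
 then have "set (bs @ [b]) \<subseteq> Basis" using assms(2) by simp
 then have "foldr partial_deriv (bs @ [b]) f differentiable (at x)"
  using assms(1) unfolding smooth_def by blast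
 then show "foldr partial_deriv bs (partial_deriv b f) differentiable at x" by simp
qed

lemma smooth_differentiable: "smooth f \<Longrightarrow> f differentiable (at x)"
 unfolding smooth_def by (drule spec[where x="[]"]) simp

lemma smooth_frechet_derivative: "smooth f \<Longrightarrow> (f has_derivative frechet_derivative f (at x)) (at x)"
 using smooth_differentiable frechet_derivative_works by blast

lemma smooth_has_derivative:
 assumes "smooth f" shows "(f has_derivative (\<lambda>v. \<Sum>b\<in>Basis. (v \<bullet> b) * partial_deriv b f x)) (at x)"
proof -
 have D: "(f has_derivative frechet_derivative f (at x)) (at x)"
  using smooth_differentiable[OF assms] frechet_derivative_works by blast
 interpret linear "frechet_derivative f (at x)" using D has_derivative_linear by blast
 have "frechet_derivative f (at x) v = (\<Sum>b\<in>Basis. (v \<bullet> b) * partial_deriv b f x)" for v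
 proof -
  have "frechet_derivative f (at x) v = frechet_derivative f (at x) (\<Sum>b\<in>Basis. (v \<bullet> b) *\<^sub>R b)"
   by (simp add: euclidean_representation)
  also have "... = (\<Sum>b\<in>Basis. (v \<bullet> b) * partial_deriv b f x)"
   by (simp add: sum scale partial_deriv_def)
  finally show ?thesis .
 qed
 then show ?thesis using D by (metis (no_types, lifting) ext)
qed

lemma smooth_continuous: "smooth f \<Longrightarrow> continuous_on S f"
 by (intro continuous_at_imp_continuous_on ballI differentiable_imp_continuous_within smooth_differentiable)

lemma smooth_add:
 assumes "smooth f" "smooth g" shows "smooth (\<lambda>x. f x + g x)"
proof -
 have "foldr partial_deriv bs (\<lambda>x. f x + g x) = (\<lambda>x. foldr partial_deriv bs f x + foldr partial_deriv bs g x)"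
  if "set bs \<subseteq> Basis" for bs using that
 proof (induction bs)
  case (Cons b bs)
  have "foldr partial_deriv bs f differentiable (at x)" "foldr partial_deriv bs g differentiable (at x)" for x
   using Cons assms by (auto simp: smooth_def)
  then have *: "(foldr partial_deriv bs f has_derivative frechet_derivative (foldr partial_deriv bs f) (at x)) (at x)"
   "(foldr partial_deriv bs g has_derivative frechet_derivative (foldr partial_deriv bs g) (at x)) (at x)" for x
   using frechet_derivative_works by blast+
  have "partial_deriv b (\<lambda>x. foldr partial_deriv bs f x + foldr partial_deriv bs g x) x
   = partial_deriv b (foldr partial_deriv bs f) x + partial_deriv b (foldr partial_deriv bs g) x" for x
   using partial_deriv_eq[OF has_derivative_add[OF *]] by (simp add: partial_deriv_def)
  with Cons show ?case by auto
 qed simp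
 with assms show ?thesis by (auto simp: smooth_def)
qed

lemma smooth_scale:
 assumes "smooth f" shows "smooth (\<lambda>x. c * f x)"
proof -
 have "foldr partial_deriv bs (\<lambda>x. c * f x) = (\<lambda>x. c * foldr partial_deriv bs f x)"
  if "set bs \<subseteq> Basis" for bs using that
 proof (induction bs)
  case (Cons b bs)
  have "foldr partial_deriv bs f differentiable (at x)" for x
   using Cons assms by (auto simp: smooth_def)
  then have *: "(foldr partial_deriv bs f has_derivative frechet_derivative (foldr partial_deriv bs f) (at x)) (at x)" for x
   using frechet_derivative_works by blast
  have "partial_deriv b (\<lambda>x. c * foldr partial_deriv bs f x) x = c * partial_deriv b (foldr partial_deriv bs f) x" for x
   using partial_deriv_eq[OF has_derivative_mult_right[OF *]] by (simp add: partial_deriv_def)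
  with Cons show ?case by auto
 qed simp
 with assms show ?thesis by (auto simp: smooth_def)
qed

text \<open>Needed to move test functions in time when a solution is restarted at a later
  instant.\<close>

lemma smooth_translate:
 assumes "smooth f" shows "smooth (\<lambda>x. f (x + c))"
  and "partial_deriv b (\<lambda>x. f (x + c)) x = partial_deriv b f (x + c)"
proof -
 have *: "partial_deriv b (\<lambda>x. g (x + c)) x = partial_deriv b g (x + c)"
  and **: "(\<lambda>x. g (x + c)) differentiable (at x)"
  if "\<And>y. g differentiable (at y)" for g :: "'a \<Rightarrow> real" and b x
 proof -
  have "(g has_derivative frechet_derivative g (at (x + c))) (at (x + c))"
   using that frechet_derivative_works by blast
  moreover have "((\<lambda>x. x + c) has_derivative (\<lambda>v. v)) (at x)"
   by (auto intro!: derivative_eq_intros)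
  ultimately have D: "((\<lambda>x. g (x + c)) has_derivative frechet_derivative g (at (x + c))) (at x)"
   using has_derivative_compose[of "\<lambda>x. x + c" "\<lambda>v. v" x UNIV g] by fast
  show "partial_deriv b (\<lambda>x. g (x + c)) x = partial_deriv b g (x + c)"
   using partial_deriv_eq[OF D] by (simp add: partial_deriv_def)
  show "(\<lambda>x. g (x + c)) differentiable (at x)" using D by (auto simp: differentiable_def)
 qed
 have "foldr partial_deriv bs (\<lambda>x. f (x + c)) = (\<lambda>x. foldr partial_deriv bs f (x + c))"
  if "set bs \<subseteq> Basis" for bs using that
 proof (induction bs)
  case (Cons b bs)
  then have "foldr partial_deriv bs f differentiable (at x)" for x
   using assms by (auto simp: smooth_def)
  then show ?case using Cons * by fastforce
 qed simp
 with assms ** show "smooth (\<lambda>x. f (x + c))" by (simp add: smooth_def)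
 show "partial_deriv b (\<lambda>x. f (x + c)) x = partial_deriv b f (x + c)"
  by (rule *) (rule smooth_differentiable[OF assms])
qed

lemma test_function_smooth: "\<phi> \<in> test_functions U \<Longrightarrow> smooth \<phi>"
 by (simp add: test_functions_def)

text \<open>The complement of the closed support is open, so the derivatives vanish there together
  with the function.\<close>

lemma test_function_compact_support:
 assumes "\<phi> \<in> test_functions U"
 obtains K where "compact K" "K \<subseteq> U" "\<And>x. x \<notin> K \<Longrightarrow> \<phi> x = 0" "\<And>x b. x \<notin> K \<Longrightarrow> partial_deriv b \<phi> x = 0"
proof
 let ?K = "closure {x. \<phi> x \<noteq> 0}"
 show "compact ?K" "?K \<subseteq> U" using assms by (auto simp: test_functions_def)
 show *: "\<phi> x = 0" if "x \<notin> ?K" for x using that closure_subset[of "{x. \<phi> x \<noteq> 0}"] by auto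
 show "partial_deriv b \<phi> x = 0" if "x \<notin> ?K" for x b
 proof -
  have "((\<lambda>_. 0) has_derivative (\<lambda>_. 0)) (at x)" by simp
  then have "(\<phi> has_derivative (\<lambda>_. 0)) (at x)"
  proof (rule has_derivative_transform_within_open)
   show "open (- ?K)" by (rule open_Compl) (rule closed_closure)
   show "x \<in> - ?K" using that by simp
   show "0 = \<phi> y" if "y \<in> - ?K" for y using *[of y] that by simp
  qed
  then show ?thesis by (rule partial_deriv_eq)
 qed
qed

lemma test_functions_add:
 assumes "\<phi> \<in> test_functions U" "\<psi> \<in> test_functions U"
 shows "(\<lambda>x. \<phi> x + \<psi> x) \<in> test_functions U"
proof -
 have "closure {x. \<phi> x + \<psi> x \<noteq> 0} \<subseteq> closure ({x. \<phi> x \<noteq> 0} \<union> {x. \<psi> x \<noteq> 0})"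
  by (rule closure_mono) auto
 then have *: "closure {x. \<phi> x + \<psi> x \<noteq> 0} \<subseteq> closure {x. \<phi> x \<noteq> 0} \<union> closure {x. \<psi> x \<noteq> 0}" by simp
 moreover have "compact (closure {x. \<phi> x \<noteq> 0} \<union> closure {x. \<psi> x \<noteq> 0})"
  using assms by (auto simp: test_functions_def)
 ultimately have "compact (closure {x. \<phi> x + \<psi> x \<noteq> 0})"
  using bounded_subset[OF _ *] by (simp add: compact_eq_bounded_closed)
 with * assms show ?thesis by (auto simp: test_functions_def smooth_add)
qed

lemma test_functions_scale:
 assumes "\<phi> \<in> test_functions U" shows "(\<lambda>x. c * \<phi> x) \<in> test_functions U"
proof -
 have *: "closure {x. c * \<phi> x \<noteq> 0} \<subseteq> closure {x. \<phi> x \<noteq> 0}"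
  by (rule closure_mono) auto
 moreover have "compact (closure {x. c * \<phi> x \<noteq> 0})"
  using assms bounded_subset[OF _ *] by (simp add: compact_eq_bounded_closed test_functions_def)
 ultimately show ?thesis using assms by (auto simp: test_functions_def smooth_scale)
qed

lemma partial_deriv_add:
 assumes "smooth f" "smooth g"
 shows "partial_deriv b (\<lambda>x. f x + g x) x = partial_deriv b f x + partial_deriv b g x"
 using partial_deriv_eq[OF has_derivative_add[OF smooth_frechet_derivative[OF assms(1)]
    smooth_frechet_derivative[OF assms(2)]]]
 by (simp add: partial_deriv_def)

lemma partial_deriv_scale:
 assumes "smooth f"
 shows "partial_deriv b (\<lambda>x. c * f x) x = c * partial_deriv b f x"
 using partial_deriv_eq[OF has_derivative_mult_right[OF smooth_frechet_derivative[OF assms]]]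
 by (simp add: partial_deriv_def)

lemma zero_test_function: "(\<lambda>x. 0) \<in> test_functions U"
 using smooth_bump_algebra[OF bump_algebra.const, of 0] by (simp add: test_functions_def)

lemma integrable_continuous_compact_support:
 fixes f :: "'a::euclidean_space \<Rightarrow> real"
 assumes "continuous_on UNIV f" "compact K" "\<And>x. x \<notin> K \<Longrightarrow> f x = 0"
 shows "integrable lborel f"
proof -
 have "integrable lborel (\<lambda>x. indicator K x *\<^sub>R f x)"
  using assms by (intro borel_integrable_compact) (auto intro: continuous_on_subset)
 moreover have "(\<lambda>x. indicator K x *\<^sub>R f x) = f"
 proof
  fix x show "indicator K x *\<^sub>R f x = f x" using assms(3)[of x] by (cases "x \<in> K") auto
 qed
 ultimately show ?thesis by simp
qed

lemma square_integrable_continuous_compact_support: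
 fixes f :: "'a::euclidean_space \<Rightarrow> real"
 assumes "continuous_on UNIV f" "compact K" "\<And>x. x \<notin> K \<Longrightarrow> f x = 0"
 shows "square_integrable f"
proof -
 have "integrable lborel (\<lambda>x. (f x)^2)"
  by (rule integrable_continuous_compact_support[OF _ assms(2)])
   (use assms in \<open>auto intro!: continuous_intros\<close>)
 moreover have "f \<in> borel_measurable borel" using assms(1) by (rule borel_measurable_continuous_onI)
 ultimately show ?thesis unfolding square_integrable_def
  by (auto intro: integrable_completion[THEN iffD2] measurable_completion)
qed

lemma test_function_square_integrable:
 assumes "\<phi> \<in> test_functions U" shows "square_integrable \<phi>"
proof -
 obtain K where "compact K" "\<And>x. x \<notin> K \<Longrightarrow> \<phi> x = 0"
  by (rule test_function_compact_support[OF assms]) blast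
 then show ?thesis
  by (rule square_integrable_continuous_compact_support[OF smooth_continuous[OF test_function_smooth[OF assms]]])
qed

lemma test_function_partial_square_integrable:
 assumes "\<phi> \<in> test_functions U" "b \<in> Basis" shows "square_integrable (partial_deriv b \<phi>)"
proof -
 obtain K where "compact K" "\<And>x. x \<notin> K \<Longrightarrow> partial_deriv b \<phi> x = 0"
  by (rule test_function_compact_support[OF assms(1)]) blast
 then show ?thesis
  by (rule square_integrable_continuous_compact_support[OF smooth_continuous[OF
    smooth_partial_deriv[OF test_function_smooth[OF assms(1)] assms(2)]]])
qed

subsection \<open>The fundamental lemma of the calculus of variations\<close>

text \<open>The positive and the negative part of a Borel version of \<open>h\<close> are densities
  of two measures that agree on all open boxes, an intersection-stable generator of the Borel sets.
  The measures coincide, hence so do the densities.\<close>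

lemma AE_zero_if_integral_box_zero:
 fixes h :: "'a::euclidean_space \<Rightarrow> real"
 assumes h: "integrable lebesgue h"
  and zero: "\<And>a b. (LINT x|lebesgue. indicator (box a b) x * h x) = 0"
 shows "AE x in lebesgue. h x = 0"
proof -
 have hm: "h \<in> borel_measurable (completion lborel)" using h by auto
 \<comment> \<open>Lebesgue measurability refers to the completion, while the uniqueness argument
   lives on Borel sets; \<open>h\<close> is replaced by a Borel function equal to it almost
   everywhere.\<close>
 obtain g where g[measurable]: "g \<in> borel_measurable lborel" and hg: "AE x in lborel. h x = g x"
  using completion_ex_borel_measurable_real[OF hm] by auto
 have hg': "AE x in lebesgue. h x = g x" using AE_completion[OF hg] .
 have gi: "integrable lborel g"
 proof -
  have "integrable lebesgue g"
   using h hg' by (subst integrable_cong_AE[where g=h]) (auto intro: measurable_completion)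
  then show ?thesis by (simp add: integrable_completion)
 qed
 have gz: "(LINT x|lborel. indicator (box a b) x * g x) = 0" for a b
 proof -
  have "(LINT x|lborel. indicator (box a b) x * g x) = (LINT x|lebesgue. indicator (box a b) x * g x)"
   by (rule integral_completion[symmetric]) measurable
  also have "... = (LINT x|lebesgue. indicator (box a b) x * h x)"
   using hg' hm by (intro integral_cong_AE borel_measurable_times borel_measurable_indicator)
    (auto intro: measurable_completion elim: eventually_mono)
  finally show ?thesis using zero by simp
 qed
 define M where "M = density lborel (\<lambda>x. ennreal (g x))"
 define N where "N = density lborel (\<lambda>x. ennreal (- g x))"
 have ind: "integrable lborel (\<lambda>x. indicator (box a b) x * g x)" for a b
  using integrable_real_mult_indicator[OF _ gi, of "box a b"] by (simp add: mult.commute)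
 have pos: "integrable lborel (\<lambda>x. indicator (box a b) x * max 0 (k x))"
   "emeasure (density lborel (\<lambda>x. ennreal (k x))) (box a b) = ennreal (LINT x|lborel. indicator (box a b) x * max 0 (k x))"
  if [measurable]: "k \<in> borel_measurable lborel" and k: "\<And>x. \<bar>k x\<bar> = \<bar>g x\<bar>" for k a b
 proof -
  show i: "integrable lborel (\<lambda>x. indicator (box a b) x * max 0 (k x))"
  proof (rule Bochner_Integration.integrable_bound[OF ind[of a b]])
   show "AE x in lborel. norm (indicator (box a b) x * max 0 (k x)) \<le> norm (indicator (box a b) x * g x)"
    by (rule AE_I2) (simp add: k[symmetric] indicator_def abs_ge_self)
  qed measurable
  have "emeasure (density lborel (\<lambda>x. ennreal (k x))) (box a b) = (\<integral>\<^sup>+x. ennreal (k x) * indicator (box a b) x \<partial>lborel)"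
   by (rule emeasure_density) auto
  also have "... = (\<integral>\<^sup>+x. ennreal (indicator (box a b) x * max 0 (k x)) \<partial>lborel)"
   by (intro nn_integral_cong) (auto simp: indicator_def max_def ennreal_neg)
  also have "... = ennreal (LINT x|lborel. indicator (box a b) x * max 0 (k x))"
   by (rule nn_integral_eq_integral[OF i]) auto
  finally show "emeasure (density lborel (\<lambda>x. ennreal (k x))) (box a b) = ..." .
 qed
 have gm: "g \<in> borel_measurable lborel" "(\<lambda>x. - g x) \<in> borel_measurable lborel" by measurable
 note M = pos(2)[OF gm(1) refl, folded M_def] and N = pos(2)[OF gm(2) abs_minus_cancel, folded N_def]
 have MN: "emeasure M (box a b) = emeasure N (box a b)" for a b
 proof -
  have "(LINT x|lborel. indicator (box a b) x * max 0 (g x)) - (LINT x|lborel. indicator (box a b) x * max 0 (- g x))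
    = (LINT x|lborel. indicator (box a b) x * max 0 (g x) - indicator (box a b) x * max 0 (- g x))"
   by (rule Bochner_Integration.integral_diff[OF pos(1)[OF gm(1) refl] pos(1)[OF gm(2) abs_minus_cancel], symmetric])
  also have "... = (LINT x|lborel. indicator (box a b) x * g x)"
   by (intro Bochner_Integration.integral_cong) (auto simp: indicator_def)
  finally show ?thesis unfolding M N using gz[of a b] by simp
 qed
 have "M = N"
 proof (rule measure_eqI_generator_eq[where E="range (\<lambda>(a, b). box a b :: 'a set)" and \<Omega>=UNIV
     and A="\<lambda>n. box (- (real n *\<^sub>R One)) (real n *\<^sub>R One)"])
  show "Int_stable (range (\<lambda>(a, b). box a b :: 'a set))"
   by (auto simp: Int_stable_def box_Int_box)
  show "sets M = sigma_sets UNIV (range (\<lambda>(a, b). box a b))"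
   "sets N = sigma_sets UNIV (range (\<lambda>(a, b). box a b))"
   by (simp_all add: M_def N_def borel_eq_box)
  show "(\<Union>n. box (- (real n *\<^sub>R One)) (real n *\<^sub>R One)) = (UNIV :: 'a set)"
   by (rule UN_box_eq_UNIV)
  show "emeasure M (box (- (real n *\<^sub>R One)) (real n *\<^sub>R One)) \<noteq> \<infinity>" for n
   unfolding M by simp
 qed (auto simp: MN)
 then have "AE x in lborel. ennreal (g x) = ennreal (- g x)"
  unfolding M_def N_def
  by (intro sigma_finite_measure.density_unique[OF lborel.sigma_finite_measure_axioms]) auto
 \<comment> \<open>\<open>ennreal\<close> truncates negative values to 0, so equality of
   \<open>ennreal (g x)\<close> and \<open>ennreal (- g x)\<close> leaves only
   \<open>g x = 0\<close>.\<close>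
 then have "AE x in lborel. g x = 0"
 proof eventually_elim
  case (elim x)
  then show ?case by (cases "g x \<ge> 0") (auto simp: ennreal_neg ennreal_eq_0_iff)
 qed
 with hg have "AE x in lborel. h x = 0" by eventually_elim simp
 then show ?thesis by (rule AE_completion)
qed

text \<open>Smooth bumps converge boundedly to indicators of boxes, so the integrals of
  \<open>h\<close> over boxes inside \<open>U\<close> vanish by dominated convergence. A countable
  cover of \<open>U\<close> by closed boxes collects the exceptional null sets.\<close>

lemma fundamental_lemma:
 fixes h :: "'a::euclidean_space \<Rightarrow> real"
 assumes "open U" and loc: "locally_integrable U h"
  and zero: "\<And>\<phi>. \<phi> \<in> test_functions U \<Longrightarrow> (LINT x:U|lebesgue. h x * \<phi> x) = 0"
 shows "AE x in lebesgue. x \<in> U \<longrightarrow> h x = 0"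
proof -
 have box: "AE x in lebesgue. x \<in> cbox a b \<longrightarrow> h x = 0" if "cbox a b \<subseteq> U" for a b
 proof -
  have "set_integrable lebesgue (cbox a b) h" using that loc by (auto simp: locally_integrable_def)
  then have hi: "integrable lebesgue (\<lambda>x. indicator (cbox a b) x * h x)"
   by (simp add: set_integrable_def)
  have him: "(\<lambda>x. indicator A x * (indicator (cbox a b) x * h x)) \<in> borel_measurable lebesgue"
   if "A \<in> sets lebesgue" for A
   using that by (rule borel_measurable_times[OF borel_measurable_indicator borel_measurable_integrable[OF hi]])
  \<comment> \<open>Cutting \<open>h\<close> off by a closed box inside \<open>U\<close> makes it
    globally integrable. An arbitrary box then matters only through its intersection with the
    interior of that box, the boundary being negligible.\<close>
  have "AE x in lebesgue. indicator (cbox a b) x * h x = 0"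
  proof (rule AE_zero_if_integral_box_zero[OF hi])
   fix c d :: 'a
   let ?h = "\<lambda>x. indicator (cbox a b) x * h x"
   show "(LINT x|lebesgue. indicator (box c d) x * ?h x) = 0"
   proof (cases "box a b \<inter> box c d = {}")
    case True
    have "AE x in lebesgue. x \<notin> cbox a b - box a b"
     using negligible_frontier_interval[of a b] by (intro AE_not_in) (simp add: negligible_iff_null_sets)
    then have "AE x in lebesgue. indicator (box c d) x * ?h x = 0"
     by eventually_elim (use True in \<open>auto simp: indicator_def\<close>)
    then show ?thesis by (rule integral_eq_zero_AE)
   next
    case False
    define a' :: 'a where "a' = (\<Sum>i\<in>Basis. max (a \<bullet> i) (c \<bullet> i) *\<^sub>R i)"
    define b' :: 'a where "b' = (\<Sum>i\<in>Basis. min (b \<bullet> i) (d \<bullet> i) *\<^sub>R i)"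
    have eq: "box a b \<inter> box c d = box a' b'" by (simp add: box_Int_box a'_def b'_def)
    \<comment> \<open>The open intersection is nonempty here, so the closed box is the closure of
      the open one and inherits the inclusion.\<close>
    then have "cbox a' b' \<subseteq> cbox a b"
     using False by (metis Int_lower1 closure_box closure_mono inf_bot_left)
    then have tf: "box_bump a' b' k \<in> test_functions U" for k
     using that by (intro box_bump_test_function) auto
    have "(\<lambda>k. LINT x|lebesgue. box_bump a' b' k x * ?h x) \<longlonglongrightarrow> (LINT x|lebesgue. indicator (box a' b') x * ?h x)"
    proof (rule integral_dominated_convergence[where w="\<lambda>x. norm (?h x)"])
     show "(\<lambda>x. box_bump a' b' k x * ?h x) \<in> borel_measurable lebesgue" for k
     proof (rule borel_measurable_times)
      show "box_bump a' b' k \<in> borel_measurable lebesgue"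
       using borel_measurable_continuous_onI[OF smooth_continuous[OF smooth_box_bump], of a' b' k]
       by (auto intro!: measurable_completion)
     qed (use hi in auto)
     show "(\<lambda>x. indicator (box a' b') x * ?h x) \<in> borel_measurable lebesgue"
      by (rule him) auto
     show "integrable lebesgue (\<lambda>x. norm (?h x))" using hi by (rule integrable_norm)
     show "AE x in lebesgue. norm (box_bump a' b' k x * ?h x) \<le> norm (?h x)" for k
      using box_bump_bounds[of a' b' k] by (auto simp: abs_mult mult_left_le_one_le)
    qed (auto intro!: tendsto_mult box_bump_tendsto)
    moreover have "(LINT x|lebesgue. box_bump a' b' k x * ?h x) = 0" for k
    proof -
     have "box_bump a' b' k x * ?h x = indicator U x *\<^sub>R (h x * box_bump a' b' k x)" for x
     proof (cases "x \<in> cbox a b")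
      case False
      then have "x \<notin> box a' b'" using \<open>cbox a' b' \<subseteq> cbox a b\<close> box_subset_cbox by blast
      then show ?thesis using False by (simp add: box_bump_eq_0_iff[THEN iffD2])
     qed (use that in auto)
     then show ?thesis using zero[OF tf[of k]] by (simp only: set_lebesgue_integral_def)
    qed
    ultimately have "(LINT x|lebesgue. indicator (box a' b') x * ?h x) = 0"
     by (simp add: LIMSEQ_const_iff)
    moreover have "(LINT x|lebesgue. indicator (box c d) x * ?h x) = (LINT x|lebesgue. indicator (box a' b') x * ?h x)"
    proof (rule integral_cong_AE)
     have "AE x in lebesgue. x \<notin> cbox a b - box a b"
      using negligible_frontier_interval[of a b] by (intro AE_not_in) (simp add: negligible_iff_null_sets)
     then show "AE x in lebesgue. indicator (box c d) x * ?h x = indicator (box a' b') x * ?h x"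
      by eventually_elim (auto simp: eq[symmetric] indicator_def)
    qed (auto intro!: him)
    ultimately show ?thesis by simp
   qed
  qed
  then show ?thesis by eventually_elim (auto simp: indicator_def split: if_splits)
 qed
 obtain \<D> where D: "countable \<D>" "\<D> \<subseteq> Pow U" "\<And>X. X \<in> \<D> \<Longrightarrow> \<exists>a b. X = cbox a b" "\<Union>\<D> = U"
  by (rule open_countable_Union_open_cbox[OF \<open>open U\<close>]) blast
 have "AE x in lebesgue. \<forall>X\<in>\<D>. x \<in> X \<longrightarrow> h x = 0"
 proof (subst AE_ball_countable[OF D(1)], intro ballI)
  fix X assume "X \<in> \<D>"
  with D(2,3) obtain a b where "X = cbox a b" "X \<subseteq> U" by blast
  then show "AE x in lebesgue. x \<in> X \<longrightarrow> h x = 0" using box by simp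
 qed
 then show ?thesis unfolding D(4)[symmetric] by eventually_elim blast
qed

subsection \<open>Weak derivatives and \<open>H\<^sub>0\<^sup>1\<close>\<close>

text \<open>On a compact set |u| is dominated by the integrable function 1 + u^2.\<close>

lemma locally_integrable_rep_L2: "locally_integrable U (rep_L2 u)"
 unfolding locally_integrable_def set_integrable_def
proof (intro allI impI)
 fix K :: "'a set" assume "compact K \<and> K \<subseteq> U"
 then have K: "K \<in> lmeasurable" by (simp add: lmeasurable_compact)
 then have [measurable]: "K \<in> sets lebesgue" by (rule fmeasurableD)
 have "integrable lebesgue (\<lambda>x. indicator K x + (rep_L2 u x)^2)"
  using K integrable_rep_power2 by (intro Bochner_Integration.integrable_add integrable_real_indicator)
   (auto simp: fmeasurable_def)
 then show "integrable lebesgue (\<lambda>x. indicat_real K x *\<^sub>R rep_L2 u x)"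
 proof (rule Bochner_Integration.integrable_bound)
  have "norm (indicat_real K x *\<^sub>R rep_L2 u x) \<le> norm (indicator K x + (rep_L2 u x)^2)" for x
  proof -
   have "0 \<le> (\<bar>rep_L2 u x\<bar> - 1)^2" by simp
   then have "\<bar>rep_L2 u x\<bar> * 2 \<le> 1 + (rep_L2 u x)^2" by (simp add: power2_diff)
   then have "\<bar>rep_L2 u x\<bar> \<le> 1 + (rep_L2 u x)^2" using zero_le_power2[of "rep_L2 u x"] by linarith
   then show ?thesis by (simp add: indicator_def)
  qed
  then show "AE x in lebesgue. norm (indicat_real K x *\<^sub>R rep_L2 u x) \<le> norm (indicator K x + (rep_L2 u x)^2)"
   by simp
 qed measurable
qed

lemma set_integral_eq_integral:
 assumes "\<And>x. x \<notin> U \<Longrightarrow> f x = (0::real)"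
 shows "(LINT x:U|lebesgue. f x) = (LINT x|lebesgue. f x)"
 unfolding set_lebesgue_integral_def
proof (rule Bochner_Integration.integral_cong[OF refl])
 show "indicator U x *\<^sub>R f x = f x" for x using assms[of x] by (cases "x \<in> U") auto
qed

lemma set_integral_test_function:
 assumes "\<phi> \<in> test_functions U"
 shows "(LINT x:U|lebesgue. f x * \<phi> x) = (LINT x|lebesgue. f x * \<phi> x)"
  and "(LINT x:U|lebesgue. f x * partial_deriv b \<phi> x) = (LINT x|lebesgue. f x * partial_deriv b \<phi> x)"
proof -
 obtain K where K: "K \<subseteq> U" "\<And>x. x \<notin> K \<Longrightarrow> \<phi> x = 0" "\<And>x b. x \<notin> K \<Longrightarrow> partial_deriv b \<phi> x = 0"
  by (rule test_function_compact_support[OF assms]) blast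
 show "(LINT x:U|lebesgue. f x * \<phi> x) = (LINT x|lebesgue. f x * \<phi> x)"
  by (rule set_integral_eq_integral) (use K in auto)
 show "(LINT x:U|lebesgue. f x * partial_deriv b \<phi> x) = (LINT x|lebesgue. f x * partial_deriv b \<phi> x)"
  by (rule set_integral_eq_integral) (use K in auto)
qed

text \<open>Weak differentiability becomes a family of identities between inner products with fixed
  vectors, so linearity needs no further measure theory. Test functions vanish outside
  \<open>U\<close>, which turns the integrals over \<open>U\<close> into global ones.\<close>

lemma has_weak_partial_L2_iff:
 assumes "b \<in> Basis"
 shows "has_weak_partial U b (rep_L2 u) (rep_L2 v) \<longleftrightarrow>
  (\<forall>\<phi>\<in>test_functions U. L2_of (partial_deriv b \<phi>) \<bullet> u = - (L2_of \<phi> \<bullet> v))"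
proof -
 have "(LINT x:U|lebesgue. rep_L2 u x * partial_deriv b \<phi> x) = L2_of (partial_deriv b \<phi>) \<bullet> u"
  "(LINT x:U|lebesgue. rep_L2 v x * \<phi> x) = L2_of \<phi> \<bullet> v" if "\<phi> \<in> test_functions U" for \<phi>
  unfolding set_integral_test_function[OF that] inner_L2_of[OF test_function_square_integrable[OF that]]
   inner_L2_of[OF test_function_partial_square_integrable[OF that assms]]
  by (simp_all add: mult.commute)
 then show ?thesis by (simp add: has_weak_partial_def locally_integrable_rep_L2)
qed

text \<open>The difference is orthogonal to all test functions, hence 0 on \<open>U\<close>, and it
  is 0 off \<open>U\<close> by membership in \<open>L2_on U\<close>. This gives the definite
  description in \<open>weak_partial\<close> its value.\<close>

lemma weak_partial_unique:
 assumes "open U" "b \<in> Basis" "v \<in> L2_on U" "v' \<in> L2_on U"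
  "has_weak_partial U b (rep_L2 u) (rep_L2 v)" "has_weak_partial U b (rep_L2 u) (rep_L2 v')"
 shows "v = v'"
proof -
 have "AE x in lebesgue. x \<in> U \<longrightarrow> rep_L2 (v - v') x = 0"
 proof (rule fundamental_lemma[OF \<open>open U\<close> locally_integrable_rep_L2])
  fix \<phi> assume \<phi>: "\<phi> \<in> test_functions U"
  then have "L2_of \<phi> \<bullet> v = L2_of \<phi> \<bullet> v'"
   using assms(5,6) \<phi> unfolding has_weak_partial_L2_iff[OF assms(2)] by (metis neg_equal_iff_equal)
  then have "L2_of \<phi> \<bullet> (v - v') = 0" by (simp add: inner_diff_right)
  then show "(LINT x:U|lebesgue. rep_L2 (v - v') x * \<phi> x) = 0"
   unfolding set_integral_test_function[OF \<phi>] inner_L2_of[OF test_function_square_integrable[OF \<phi>]]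
   by (simp add: mult.commute)
 qed
 moreover have "AE x in lebesgue. x \<notin> U \<longrightarrow> rep_L2 (v - v') x = 0"
  using subspace_diff[OF L2_on_subspace assms(3,4)] by (simp add: L2_on_def)
 ultimately have "AE x in lebesgue. rep_L2 (v - v') x = rep_L2 0 x"
  using rep_L2_zero by eventually_elim auto
 then have "v - v' = 0" by (rule L2_eqI)
 then show ?thesis by simp
qed

lemma weak_partial_eqI:
 assumes "open U" "b \<in> Basis" "v \<in> L2_on U" "has_weak_partial U b (rep_L2 u) (rep_L2 v)"
 shows "weak_partial U b u = v"
 unfolding weak_partial_def using assms weak_partial_unique[OF assms(1,2)] by (intro the_equality) blast+

lemma weak_partial_H1:
 assumes "open U" "b \<in> Basis" "u \<in> H1 U"
 shows "weak_partial U b u \<in> L2_on U" "has_weak_partial U b (rep_L2 u) (rep_L2 (weak_partial U b u))"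
proof -
 obtain v where "v \<in> L2_on U" "has_weak_partial U b (rep_L2 u) (rep_L2 v)"
  using assms by (auto simp: H1_def)
 with weak_partial_eqI[OF assms(1,2)] show "weak_partial U b u \<in> L2_on U"
  "has_weak_partial U b (rep_L2 u) (rep_L2 (weak_partial U b u))" by metis+
qed

text \<open>Sums and multiples are treated together, so that the linearity facts below are all
  instances.\<close>

lemma H1_linear_combination:
 assumes "open U" "u \<in> H1 U" "v \<in> H1 U"
 shows "c *\<^sub>R u + d *\<^sub>R v \<in> H1 U"
  and "b \<in> Basis \<Longrightarrow> weak_partial U b (c *\<^sub>R u + d *\<^sub>R v) = c *\<^sub>R weak_partial U b u + d *\<^sub>R weak_partial U b v"
proof -
 have *: "c *\<^sub>R weak_partial U b u + d *\<^sub>R weak_partial U b v \<in> L2_on U"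
  "has_weak_partial U b (rep_L2 (c *\<^sub>R u + d *\<^sub>R v)) (rep_L2 (c *\<^sub>R weak_partial U b u + d *\<^sub>R weak_partial U b v))"
  if "b \<in> Basis" for b
 proof -
  show "c *\<^sub>R weak_partial U b u + d *\<^sub>R weak_partial U b v \<in> L2_on U"
   using weak_partial_H1[OF assms(1) that] assms by (intro subspace_add subspace_scale L2_on_subspace) auto
  show "has_weak_partial U b (rep_L2 (c *\<^sub>R u + d *\<^sub>R v)) (rep_L2 (c *\<^sub>R weak_partial U b u + d *\<^sub>R weak_partial U b v))"
   using weak_partial_H1(2)[OF assms(1) that assms(2)] weak_partial_H1(2)[OF assms(1) that assms(3)]
   unfolding has_weak_partial_L2_iff[OF that] by (simp add: inner_add_right)
 qed
 have "c *\<^sub>R u + d *\<^sub>R v \<in> L2_on U"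
  using assms by (intro subspace_add subspace_scale L2_on_subspace) (auto simp: H1_def)
 with * show "c *\<^sub>R u + d *\<^sub>R v \<in> H1 U" unfolding H1_def by blast
 show "weak_partial U b (c *\<^sub>R u + d *\<^sub>R v) = c *\<^sub>R weak_partial U b u + d *\<^sub>R weak_partial U b v"
  if "b \<in> Basis" using weak_partial_eqI[OF assms(1) that *[OF that]] .
qed

lemma H10_H1: "u \<in> H10 U \<Longrightarrow> u \<in> H1 U"
 by (simp add: H10_def)

lemma H10_L2_on: "u \<in> H10 U \<Longrightarrow> u \<in> L2_on U"
 by (simp add: H10_def H1_def)

lemma H10_linear_combination:
 assumes "open U" "u \<in> H10 U" "v \<in> H10 U"
 shows "c *\<^sub>R u + d *\<^sub>R v \<in> H10 U"
proof -
 obtain \<phi> where \<phi>: "\<And>k::nat. \<phi> k \<in> test_functions U" "(\<lambda>k. L2_of (\<phi> k)) \<longlonglongrightarrow> u"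
  "\<And>b. b \<in> Basis \<Longrightarrow> (\<lambda>k. L2_of (partial_deriv b (\<phi> k))) \<longlonglongrightarrow> weak_partial U b u"
  using assms(2) by (auto simp: H10_def)
 obtain \<psi> where \<psi>: "\<And>k::nat. \<psi> k \<in> test_functions U" "(\<lambda>k. L2_of (\<psi> k)) \<longlonglongrightarrow> v"
  "\<And>b. b \<in> Basis \<Longrightarrow> (\<lambda>k. L2_of (partial_deriv b (\<psi> k))) \<longlonglongrightarrow> weak_partial U b v"
  using assms(3) by (auto simp: H10_def)
 let ?\<chi> = "\<lambda>k x. c * \<phi> k x + d * \<psi> k x"
 have sc: "(\<lambda>x. c * \<phi> k x) \<in> test_functions U" "(\<lambda>x. d * \<psi> k x) \<in> test_functions U" for k
  using \<phi>(1) \<psi>(1) by (auto intro: test_functions_scale)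
 have "?\<chi> k \<in> test_functions U" for k by (intro test_functions_add sc)
 moreover have "L2_of (?\<chi> k) = c *\<^sub>R L2_of (\<phi> k) + d *\<^sub>R L2_of (\<psi> k)" for k
  using test_function_square_integrable[OF \<phi>(1)] test_function_square_integrable[OF \<psi>(1)]
  by (simp add: L2_of_add L2_of_scale square_integrable_scale)
 moreover have "L2_of (partial_deriv b (?\<chi> k)) = c *\<^sub>R L2_of (partial_deriv b (\<phi> k)) + d *\<^sub>R L2_of (partial_deriv b (\<psi> k))"
  if "b \<in> Basis" for k b
 proof -
  have "partial_deriv b (?\<chi> k) = (\<lambda>x. c * partial_deriv b (\<phi> k) x + d * partial_deriv b (\<psi> k) x)"
   using partial_deriv_add[OF test_function_smooth[OF sc(1)] test_function_smooth[OF sc(2)]]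
    partial_deriv_scale[OF test_function_smooth[OF \<phi>(1)]] partial_deriv_scale[OF test_function_smooth[OF \<psi>(1)]]
   by (intro ext) simp
  then show ?thesis
   using test_function_partial_square_integrable[OF \<phi>(1) that]
    test_function_partial_square_integrable[OF \<psi>(1) that]
   by (simp add: L2_of_add L2_of_scale square_integrable_scale)
 qed
 moreover have "(\<lambda>k. c *\<^sub>R L2_of (\<phi> k) + d *\<^sub>R L2_of (\<psi> k)) \<longlonglongrightarrow> c *\<^sub>R u + d *\<^sub>R v"
  by (intro tendsto_intros \<phi> \<psi>)
 moreover have "(\<lambda>k. c *\<^sub>R L2_of (partial_deriv b (\<phi> k)) + d *\<^sub>R L2_of (partial_deriv b (\<psi> k)))
   \<longlonglongrightarrow> weak_partial U b (c *\<^sub>R u + d *\<^sub>R v)" if "b \<in> Basis" for b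
  using that unfolding H1_linear_combination(2)[OF assms(1) H10_H1[OF assms(2)] H10_H1[OF assms(3)] that]
  by (intro tendsto_intros \<phi> \<psi>)
 ultimately show ?thesis
  using H1_linear_combination(1)[OF assms(1) H10_H1[OF assms(2)] H10_H1[OF assms(3)], of c d]
  unfolding H10_def by (intro CollectI conjI exI[of _ ?\<chi>]) auto
qed

lemma zero_H10:
 assumes "open U" shows "0 \<in> H10 U"
proof -
 have z: "L2_of (\<lambda>x. 0 :: real) = (0 :: 'a L2)"
  by (rule L2_of_eqI) (auto simp: square_integrable_zero rep_L2_zero)
 have pd: "partial_deriv b (\<lambda>x. 0 :: real) = (\<lambda>x::'a. 0)" for b
  by (simp add: partial_deriv_def fun_eq_iff)
 have w: "has_weak_partial U b (rep_L2 0) (rep_L2 0)" if "b \<in> Basis" for b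
  by (simp add: has_weak_partial_L2_iff[OF that])
 have "weak_partial U b 0 = 0" if "b \<in> Basis" for b
  by (rule weak_partial_eqI[OF assms that subspace_0[OF L2_on_subspace] w[OF that]])
 moreover have "0 \<in> H1 U" unfolding H1_def using w subspace_0[OF L2_on_subspace] by blast
 ultimately show ?thesis unfolding H10_def
  by (intro CollectI conjI exI[of _ "\<lambda>k x. 0"]) (auto simp: zero_test_function z pd)
qed

lemma subspace_H10: "open U \<Longrightarrow> subspace (H10 U)"
proof (rule subspaceI)
 assume "open U"
 show "0 \<in> H10 U" by (rule zero_H10[OF \<open>open U\<close>])
 show "x + y \<in> H10 U" if "x \<in> H10 U" "y \<in> H10 U" for x y
  using H10_linear_combination[OF \<open>open U\<close> that, of 1 1] by simp
 show "c *\<^sub>R x \<in> H10 U" if "x \<in> H10 U" for c x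
  using H10_linear_combination[OF \<open>open U\<close> that that, of c 0] by simp
qed

text \<open>Written with \<open>L2_set\<close> so that the triangle inequality, homogeneity and the
  Cauchy-Schwarz inequality for \<open>grad_inner\<close> are inherited from that norm.\<close>

definition grad_norm :: "'a::euclidean_space set \<Rightarrow> 'a L2 \<Rightarrow> real" where
 "grad_norm \<Omega> u = L2_set (\<lambda>b. norm (weak_partial \<Omega> b u)) Basis"

lemma grad_norm_nonneg: "0 \<le> grad_norm \<Omega> u"
 by (simp add: grad_norm_def L2_set_nonneg)

lemma grad_norm_power2: "(grad_norm \<Omega> u)^2 = grad_inner \<Omega> u u"
 by (simp add: grad_norm_def L2_set_def grad_inner_def sum_nonneg power2_norm_eq_inner)

lemma grad_inner_le: "\<bar>grad_inner \<Omega> u v\<bar> \<le> grad_norm \<Omega> u * grad_norm \<Omega> v"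
proof -
 have "\<bar>grad_inner \<Omega> u v\<bar> \<le> (\<Sum>b\<in>Basis. \<bar>norm (weak_partial \<Omega> b u)\<bar> * \<bar>norm (weak_partial \<Omega> b v)\<bar>)"
  unfolding grad_inner_def by (rule order_trans[OF sum_abs]) (auto intro!: sum_mono Cauchy_Schwarz_ineq2)
 also have "... \<le> grad_norm \<Omega> u * grad_norm \<Omega> v"
  unfolding grad_norm_def by (rule L2_set_mult_ineq)
 finally show ?thesis .
qed

context
 fixes \<Omega> :: "'a::euclidean_space set"
 assumes "open \<Omega>"
begin

lemma weak_partial_add:
 "u \<in> H10 \<Omega> \<Longrightarrow> v \<in> H10 \<Omega> \<Longrightarrow> b \<in> Basis \<Longrightarrow> weak_partial \<Omega> b (u + v) = weak_partial \<Omega> b u + weak_partial \<Omega> b v"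
 using H1_linear_combination(2)[OF \<open>open \<Omega>\<close> H10_H1 H10_H1, of u v b 1 1] by simp

lemma weak_partial_scaleR:
 "u \<in> H10 \<Omega> \<Longrightarrow> b \<in> Basis \<Longrightarrow> weak_partial \<Omega> b (c *\<^sub>R u) = c *\<^sub>R weak_partial \<Omega> b u"
 using H1_linear_combination(2)[OF \<open>open \<Omega>\<close> H10_H1 H10_H1, of u u b c 0] by simp

lemma grad_inner_add:
 "u \<in> H10 \<Omega> \<Longrightarrow> v \<in> H10 \<Omega> \<Longrightarrow> grad_inner \<Omega> w (u + v) = grad_inner \<Omega> w u + grad_inner \<Omega> w v"
 "u \<in> H10 \<Omega> \<Longrightarrow> v \<in> H10 \<Omega> \<Longrightarrow> grad_inner \<Omega> (u + v) w = grad_inner \<Omega> u w + grad_inner \<Omega> v w"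
 unfolding grad_inner_def by (simp_all add: weak_partial_add inner_add sum.distrib)

lemma grad_inner_scaleR:
 "u \<in> H10 \<Omega> \<Longrightarrow> grad_inner \<Omega> w (c *\<^sub>R u) = c * grad_inner \<Omega> w u"
 "u \<in> H10 \<Omega> \<Longrightarrow> grad_inner \<Omega> (c *\<^sub>R u) w = c * grad_inner \<Omega> u w"
 unfolding grad_inner_def by (simp_all add: weak_partial_scaleR sum_distrib_left)

lemma grad_norm_triangle:
 assumes "u \<in> H10 \<Omega>" "v \<in> H10 \<Omega>" shows "grad_norm \<Omega> (u + v) \<le> grad_norm \<Omega> u + grad_norm \<Omega> v"
proof -
 have "grad_norm \<Omega> (u + v) \<le> L2_set (\<lambda>b. norm (weak_partial \<Omega> b u) + norm (weak_partial \<Omega> b v)) Basis"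
  unfolding grad_norm_def using assms
  by (intro L2_set_mono) (auto simp: weak_partial_add intro: norm_triangle_ineq)
 also have "... \<le> grad_norm \<Omega> u + grad_norm \<Omega> v"
  unfolding grad_norm_def by (rule L2_set_triangle_ineq)
 finally show ?thesis .
qed

lemma grad_norm_scaleR:
 assumes "u \<in> H10 \<Omega>" shows "grad_norm \<Omega> (c *\<^sub>R u) = \<bar>c\<bar> * grad_norm \<Omega> u"
 unfolding grad_norm_def using assms
 by (simp add: weak_partial_scaleR L2_set_right_distrib cong: L2_set_cong)

end

subsection \<open>Cube averages of test functions\<close>

definition grad2 :: "('a::euclidean_space \<Rightarrow> real) \<Rightarrow> 'a \<Rightarrow> real" where
 "grad2 \<phi> x = (\<Sum>b\<in>Basis. (partial_deriv b \<phi> x)^2)"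

text \<open>The mean of \<phi> over the cube with lower corner x and side s, pulled back to the unit
  cube. In this form it makes sense at s = 0, where it is \<phi> itself, and the side appears inside
  \<phi>, where differences in s are integrals of the gradient.\<close>

definition cube_avg :: "('a::euclidean_space \<Rightarrow> real) \<Rightarrow> real \<Rightarrow> 'a \<Rightarrow> real" where
 "cube_avg \<phi> s x = (LINT y:cbox 0 One|lborel. \<phi> (x + s *\<^sub>R y))"

text \<open>Change of variables with the Jacobian as a factor on the left, so that no division of
  extended reals occurs.\<close>

lemma nn_integral_lborel_affine:
 fixes f :: "'a::euclidean_space \<Rightarrow> ennreal"
 assumes [measurable]: "f \<in> borel_measurable borel" and "c \<noteq> 0"
 shows "ennreal (\<bar>c\<bar> ^ DIM('a)) * (\<integral>\<^sup>+x. f (t + c *\<^sub>R x) \<partial>lborel) = (\<integral>\<^sup>+x. f x \<partial>lborel)"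
proof -
 have "(\<integral>\<^sup>+x. f x \<partial>lborel) = (\<integral>\<^sup>+x. f x \<partial>density (distr lborel borel (\<lambda>x. t + c *\<^sub>R x)) (\<lambda>_. \<bar>c\<bar>^DIM('a)))"
  using lborel_affine[OF \<open>c \<noteq> 0\<close>, of t] by simp
 also have "... = (\<integral>\<^sup>+x. ennreal (\<bar>c\<bar> ^ DIM('a)) * f (t + c *\<^sub>R x) \<partial>lborel)"
  by (simp add: nn_integral_density nn_integral_distr)
 also have "... = ennreal (\<bar>c\<bar> ^ DIM('a)) * (\<integral>\<^sup>+x. f (t + c *\<^sub>R x) \<partial>lborel)"
  by (rule nn_integral_cmult) measurable
 finally show ?thesis by simp
qed

lemma nn_integral_lborel_translate:
 fixes f :: "'a::euclidean_space \<Rightarrow> ennreal"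
 assumes "f \<in> borel_measurable borel"
 shows "(\<integral>\<^sup>+x. f (x + t) \<partial>lborel) = (\<integral>\<^sup>+x. f x \<partial>lborel)"
 using nn_integral_lborel_affine[OF assms, of 1 t] by (simp add: add.commute)

lemma ennreal_power2_abs: "ennreal (x^2) = (ennreal \<bar>x\<bar>)^2"
 by (simp add: ennreal_power)

lemma smooth_measurable:
 assumes "smooth \<phi>"
 shows "\<phi> \<in> borel_measurable borel" "b \<in> Basis \<Longrightarrow> partial_deriv b \<phi> \<in> borel_measurable borel"
  "grad2 \<phi> \<in> borel_measurable borel"
proof -
 show "\<phi> \<in> borel_measurable borel"
  by (intro borel_measurable_continuous_onI smooth_continuous assms)
 show *: "partial_deriv b \<phi> \<in> borel_measurable borel" if "b \<in> Basis" for b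
  by (intro borel_measurable_continuous_onI smooth_continuous smooth_partial_deriv assms that)
 show "grad2 \<phi> \<in> borel_measurable borel"
  unfolding grad2_def[abs_def] using * by (intro borel_measurable_sum borel_measurable_power) auto
qed

lemma grad2_nonneg: "0 \<le> grad2 \<phi> x"
 by (simp add: grad2_def sum_nonneg)

lemma directional_derivative_le:
 fixes v :: "'a::euclidean_space"
 shows "\<bar>\<Sum>b\<in>Basis. (v \<bullet> b) * partial_deriv b \<phi> x\<bar> \<le> norm v * sqrt (grad2 \<phi> x)"
proof -
 have "\<bar>\<Sum>b\<in>Basis. (v \<bullet> b) * partial_deriv b \<phi> x\<bar> \<le> (\<Sum>b\<in>Basis. \<bar>v \<bullet> b\<bar> * \<bar>partial_deriv b \<phi> x\<bar>)"
  by (rule order_trans[OF sum_abs]) (simp add: abs_mult)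
 also have "... \<le> L2_set (\<lambda>b. v \<bullet> b) Basis * L2_set (\<lambda>b. partial_deriv b \<phi> x) Basis"
  by (rule L2_set_mult_ineq)
 also have "L2_set (\<lambda>b. v \<bullet> b) Basis = norm v"
  by (subst norm_conv_dist, subst euclidean_dist_l2) (simp add: dist_real_def L2_set_def)
 also have "L2_set (\<lambda>b. partial_deriv b \<phi> x) Basis = sqrt (grad2 \<phi> x)"
  by (simp add: L2_set_def grad2_def)
 finally show ?thesis .
qed

text \<open>The fundamental theorem of calculus along the segment, followed by Cauchy-Schwarz in the
  parameter. The right-hand side is an extended real, so the Fubini arguments that follow need no
  integrability of the gradient.\<close>

lemma segment_difference_le:
 fixes \<phi> :: "'a::euclidean_space \<Rightarrow> real"
 assumes "smooth \<phi>" "a \<le> b"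
 shows "ennreal ((\<phi> (x + b *\<^sub>R v) - \<phi> (x + a *\<^sub>R v))^2)
  \<le> ennreal ((b - a) * (norm v)^2) * (\<integral>\<^sup>+s. indicator {a..b} s * ennreal (grad2 \<phi> (x + s *\<^sub>R v)) \<partial>lborel)"
proof -
 note [measurable] = smooth_measurable[OF assms(1)]
 let ?h = "\<lambda>s. \<Sum>i\<in>Basis. (v \<bullet> i) * partial_deriv i \<phi> (x + s *\<^sub>R v)"
 have cont: "continuous_on {a..b} ?h"
 proof (intro continuous_on_sum continuous_on_mult continuous_on_const)
  fix i :: 'a assume "i \<in> Basis"
  then have "continuous_on UNIV (partial_deriv i \<phi>)"
   by (intro smooth_continuous smooth_partial_deriv assms(1))
  then show "continuous_on {a..b} (\<lambda>s. partial_deriv i \<phi> (x + s *\<^sub>R v))"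
   by (rule continuous_on_compose2) (auto intro!: continuous_intros)
 qed
 have deriv: "((\<lambda>s. \<phi> (x + s *\<^sub>R v)) has_vector_derivative ?h s) (at s within {a..b})" for s
 proof -
  have "((\<lambda>s. x + s *\<^sub>R v) has_derivative (\<lambda>s. s *\<^sub>R v)) (at s within {a..b})"
   by (auto intro!: derivative_eq_intros)
  from has_derivative_compose[OF this smooth_has_derivative[OF assms(1)]]
  show ?thesis unfolding has_vector_derivative_def
   by (simp add: sum_distrib_left mult.assoc)
 qed
 have *: "integral\<^sup>L lborel (\<lambda>s. indicator {a..b} s *\<^sub>R ?h s) = \<phi> (x + b *\<^sub>R v) - \<phi> (x + a *\<^sub>R v)"
  by (rule integral_FTC_Icc[OF assms(2) deriv cont])
 have int: "integrable lborel (\<lambda>s. indicator {a..b} s *\<^sub>R ?h s)"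
  by (rule borel_integrable_compact) (use cont in auto)
 have "ennreal \<bar>\<phi> (x + b *\<^sub>R v) - \<phi> (x + a *\<^sub>R v)\<bar> \<le> (\<integral>\<^sup>+s. ennreal (norm (indicator {a..b} s *\<^sub>R ?h s)) \<partial>lborel)"
  using integral_norm_bound_ennreal[OF int] unfolding * by simp
 also have "... \<le> (\<integral>\<^sup>+s. (ennreal (norm v) * indicator {a..b} s) * (indicator {a..b} s * ennreal (sqrt (grad2 \<phi> (x + s *\<^sub>R v)))) \<partial>lborel)"
  using directional_derivative_le[of v \<phi>]
  by (intro nn_integral_mono) (auto simp: indicator_def ennreal_mult[symmetric] grad2_nonneg intro!: ennreal_leI)
 finally have "(ennreal \<bar>\<phi> (x + b *\<^sub>R v) - \<phi> (x + a *\<^sub>R v)\<bar>)^2 \<le> (\<integral>\<^sup>+s. (ennreal (norm v) * indicator {a..b} s) * (indicator {a..b} s * ennreal (sqrt (grad2 \<phi> (x + s *\<^sub>R v)))) \<partial>lborel)^2"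
  by (rule power_mono) simp
 also have "... \<le> (\<integral>\<^sup>+s. (ennreal (norm v) * indicator {a..b} s)^2 \<partial>lborel) * (\<integral>\<^sup>+s. (indicator {a..b} s * ennreal (sqrt (grad2 \<phi> (x + s *\<^sub>R v))))^2 \<partial>lborel)"
  by (rule Cauchy_Schwarz_nn_integral) measurable
 also have "(\<integral>\<^sup>+s. (ennreal (norm v) * indicator {a..b} s)^2 \<partial>lborel) = (\<integral>\<^sup>+s. (ennreal (norm v))^2 * indicator {a..b} s \<partial>lborel)"
  by (intro nn_integral_cong) (auto simp: indicator_def)
 also have "... = ennreal ((b - a) * (norm v)^2)"
  using assms(2) by (subst nn_integral_cmult_indicator) (auto simp: ennreal_power ennreal_mult mult.commute)
 also have "(\<integral>\<^sup>+s. (indicator {a..b} s * ennreal (sqrt (grad2 \<phi> (x + s *\<^sub>R v))))^2 \<partial>lborel)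
  = (\<integral>\<^sup>+s. indicator {a..b} s * ennreal (grad2 \<phi> (x + s *\<^sub>R v)) \<partial>lborel)"
  by (intro nn_integral_cong) (auto simp: indicator_def ennreal_power grad2_nonneg)
 finally show ?thesis by (simp add: ennreal_power2_abs)
qed

lemma norm_unit_cube_le:
 assumes "y \<in> cbox 0 (One :: 'a::euclidean_space)" shows "(norm y)^2 \<le> DIM('a)"
proof -
 have "(norm y)^2 = (\<Sum>i\<in>Basis. (y \<bullet> i)^2)"
  unfolding power2_norm_eq_inner by (subst euclidean_inner) (simp add: power2_eq_square)
 also have "... \<le> (\<Sum>i\<in>(Basis::'a set). 1)"
  using assms by (intro sum_mono power_le_one) (auto simp: mem_box)
 finally show ?thesis by simp
qed

lemma cube_set_integrable:
 fixes \<phi> :: "'a::euclidean_space \<Rightarrow> real"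
 assumes "continuous_on UNIV \<phi>"
 shows "set_integrable lborel (cbox 0 One) (\<lambda>y. \<phi> (x + s *\<^sub>R y))"
 unfolding set_integrable_def
 by (intro borel_integrable_compact compact_cbox continuous_on_compose2[OF assms] continuous_intros) auto

text \<open>Jensen's inequality for the square, obtained from Cauchy-Schwarz because the unit cube
  has measure 1.\<close>

lemma square_set_integral_cube_le:
 fixes f :: "'a::euclidean_space \<Rightarrow> real"
 assumes "set_integrable lborel (cbox 0 One) f" and [measurable]: "f \<in> borel_measurable borel"
 shows "ennreal ((LINT y:cbox 0 One|lborel. f y)^2) \<le> (\<integral>\<^sup>+y. indicator (cbox 0 One) y * ennreal ((f y)^2) \<partial>lborel)"
proof -
 let ?Q = "cbox 0 (One::'a)"
 have "ennreal \<bar>LINT y:?Q|lborel. f y\<bar> \<le> (\<integral>\<^sup>+y. ennreal (norm (indicator ?Q y *\<^sub>R f y)) \<partial>lborel)"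
  using integral_norm_bound_ennreal[OF assms(1)[unfolded set_integrable_def]]
  by (simp add: set_lebesgue_integral_def)
 also have "... = (\<integral>\<^sup>+y. indicator ?Q y * (indicator ?Q y * ennreal \<bar>f y\<bar>) \<partial>lborel)"
  by (intro nn_integral_cong) (auto simp: indicator_def)
 finally have "(ennreal \<bar>LINT y:?Q|lborel. f y\<bar>)^2 \<le> (\<integral>\<^sup>+y. indicator ?Q y * (indicator ?Q y * ennreal \<bar>f y\<bar>) \<partial>lborel)^2"
  by (rule power_mono) simp
 also have "... \<le> (\<integral>\<^sup>+y. (indicator ?Q y)^2 \<partial>lborel) * (\<integral>\<^sup>+y. (indicator ?Q y * ennreal \<bar>f y\<bar>)^2 \<partial>lborel)"
  by (rule Cauchy_Schwarz_nn_integral) measurable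
 also have "(\<integral>\<^sup>+y. (indicator ?Q y)^2 \<partial>lborel) = (\<integral>\<^sup>+y. indicator ?Q y \<partial>lborel)"
  by (intro nn_integral_cong) (auto simp: indicator_def)
 also have "... = 1" by (subst nn_integral_indicator) (auto simp: emeasure_lborel_cbox_eq)
 also have "(\<integral>\<^sup>+y. (indicator ?Q y * ennreal \<bar>f y\<bar>)^2 \<partial>lborel) = (\<integral>\<^sup>+y. indicator ?Q y * ennreal ((f y)^2) \<partial>lborel)"
  by (intro nn_integral_cong) (auto simp: indicator_def ennreal_power)
 finally show ?thesis by (simp add: ennreal_power2_abs)
qed

text \<open>As the side grows from a to b, the point x + s y travels along a segment with direction
  y in the unit cube, where |y|^2 is at most the dimension. The segment estimate is averaged over y
  and the order of integration exchanged.\<close>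

lemma cube_avg_difference_le:
 fixes \<phi> :: "'a::euclidean_space \<Rightarrow> real"
 assumes "smooth \<phi>" "a \<le> b"
 shows "ennreal ((cube_avg \<phi> b x - cube_avg \<phi> a x)^2) \<le> ennreal ((b - a) * DIM('a)) *
  (\<integral>\<^sup>+s. indicator {a..b} s * (\<integral>\<^sup>+y. indicator (cbox 0 One) y * ennreal (grad2 \<phi> (x + s *\<^sub>R y)) \<partial>lborel) \<partial>lborel)"
proof -
 note [measurable] = smooth_measurable[OF assms(1)]
 note cont = smooth_continuous[OF assms(1)]
 let ?Q = "cbox 0 (One::'a)"
 have "cube_avg \<phi> b x - cube_avg \<phi> a x = (LINT y:?Q|lborel. \<phi> (x + b *\<^sub>R y) - \<phi> (x + a *\<^sub>R y))"
  unfolding cube_avg_def by (rule set_integral_diff(2)[symmetric]) (rule cube_set_integrable[OF cont])+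
 then have "ennreal ((cube_avg \<phi> b x - cube_avg \<phi> a x)^2) \<le>
  (\<integral>\<^sup>+y. indicator ?Q y * ennreal ((\<phi> (x + b *\<^sub>R y) - \<phi> (x + a *\<^sub>R y))^2) \<partial>lborel)"
  by (simp only:) (rule square_set_integral_cube_le, intro set_integral_diff(1) cube_set_integrable[OF cont], measurable)
 also have "... \<le> (\<integral>\<^sup>+y. indicator ?Q y * (ennreal ((b - a) * DIM('a)) * (\<integral>\<^sup>+s. indicator {a..b} s * ennreal (grad2 \<phi> (x + s *\<^sub>R y)) \<partial>lborel)) \<partial>lborel)"
 proof (rule nn_integral_mono)
  fix y
  show "indicator ?Q y * ennreal ((\<phi> (x + b *\<^sub>R y) - \<phi> (x + a *\<^sub>R y))^2) \<le>
   indicator ?Q y * (ennreal ((b - a) * DIM('a)) * (\<integral>\<^sup>+s. indicator {a..b} s * ennreal (grad2 \<phi> (x + s *\<^sub>R y)) \<partial>lborel))"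
  proof (cases "y \<in> ?Q")
   case True
   have "ennreal ((\<phi> (x + b *\<^sub>R y) - \<phi> (x + a *\<^sub>R y))^2) \<le> ennreal ((b - a) * (norm y)^2) * (\<integral>\<^sup>+s. indicator {a..b} s * ennreal (grad2 \<phi> (x + s *\<^sub>R y)) \<partial>lborel)"
    by (rule segment_difference_le[OF assms])
   also have "... \<le> ennreal ((b - a) * DIM('a)) * (\<integral>\<^sup>+s. indicator {a..b} s * ennreal (grad2 \<phi> (x + s *\<^sub>R y)) \<partial>lborel)"
    using norm_unit_cube_le[OF True] assms(2) by (intro mult_right_mono ennreal_leI mult_left_mono) auto
   finally show ?thesis by (simp add: mult_left_mono)
  qed simp
 qed
 also have "... = ennreal ((b - a) * DIM('a)) * (\<integral>\<^sup>+y. (\<integral>\<^sup>+s. indicator ?Q y * (indicator {a..b} s * ennreal (grad2 \<phi> (x + s *\<^sub>R y))) \<partial>lborel) \<partial>lborel)"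
 proof -
  have "indicator ?Q y * (\<integral>\<^sup>+s. indicator {a..b} s * ennreal (grad2 \<phi> (x + s *\<^sub>R y)) \<partial>lborel)
   = (\<integral>\<^sup>+s. indicator ?Q y * (indicator {a..b} s * ennreal (grad2 \<phi> (x + s *\<^sub>R y))) \<partial>lborel)" for y
   by (rule nn_integral_cmult[symmetric]) measurable
  then show ?thesis
   by (simp only: mult.left_commute[of "indicator ?Q _" "ennreal _"]) (rule nn_integral_cmult, measurable)
 qed
 also have "(\<integral>\<^sup>+y. (\<integral>\<^sup>+s. indicator ?Q y * (indicator {a..b} s * ennreal (grad2 \<phi> (x + s *\<^sub>R y))) \<partial>lborel) \<partial>lborel)
  = (\<integral>\<^sup>+s. (\<integral>\<^sup>+y. indicator ?Q y * (indicator {a..b} s * ennreal (grad2 \<phi> (x + s *\<^sub>R y))) \<partial>lborel) \<partial>lborel)"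
  by (rule lborel_pair.Fubini') measurable
 also have "... = (\<integral>\<^sup>+s. indicator {a..b} s * (\<integral>\<^sup>+y. indicator ?Q y * ennreal (grad2 \<phi> (x + s *\<^sub>R y)) \<partial>lborel) \<partial>lborel)"
  by (intro nn_integral_cong) (auto simp: indicator_def)
 finally show ?thesis .
qed

text \<open>Integrating over x removes the dependence on s and y by translation invariance; the
  s-integral then contributes the second factor b - a.\<close>

lemma cube_avg_difference_L2:
 fixes \<phi> :: "'a::euclidean_space \<Rightarrow> real"
 assumes "smooth \<phi>" "a \<le> b"
 shows "(\<integral>\<^sup>+x. ennreal ((cube_avg \<phi> b x - cube_avg \<phi> a x)^2) \<partial>lborel) \<le> ennreal ((b - a)^2 * DIM('a)) * (\<integral>\<^sup>+x. ennreal (grad2 \<phi> x) \<partial>lborel)"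
proof -
 note [measurable] = smooth_measurable[OF assms(1)]
 let ?Q = "cbox 0 (One::'a)" and ?G = "\<integral>\<^sup>+x. ennreal (grad2 \<phi> x) \<partial>lborel"
 have "(\<integral>\<^sup>+x. ennreal ((cube_avg \<phi> b x - cube_avg \<phi> a x)^2) \<partial>lborel) \<le> (\<integral>\<^sup>+x. ennreal ((b - a) * DIM('a)) *
  (\<integral>\<^sup>+s. indicator {a..b} s * (\<integral>\<^sup>+y. indicator ?Q y * ennreal (grad2 \<phi> (x + s *\<^sub>R y)) \<partial>lborel) \<partial>lborel) \<partial>lborel)"
  by (intro nn_integral_mono cube_avg_difference_le assms)
 also have "... = ennreal ((b - a) * DIM('a)) *
  (\<integral>\<^sup>+x. (\<integral>\<^sup>+s. indicator {a..b} s * (\<integral>\<^sup>+y. indicator ?Q y * ennreal (grad2 \<phi> (x + s *\<^sub>R y)) \<partial>lborel) \<partial>lborel) \<partial>lborel)"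
  by (rule nn_integral_cmult) measurable
 also have "(\<integral>\<^sup>+x. (\<integral>\<^sup>+s. indicator {a..b} s * (\<integral>\<^sup>+y. indicator ?Q y * ennreal (grad2 \<phi> (x + s *\<^sub>R y)) \<partial>lborel) \<partial>lborel) \<partial>lborel)
  = (\<integral>\<^sup>+s. (\<integral>\<^sup>+x. indicator {a..b} s * (\<integral>\<^sup>+y. indicator ?Q y * ennreal (grad2 \<phi> (x + s *\<^sub>R y)) \<partial>lborel) \<partial>lborel) \<partial>lborel)"
  by (rule lborel_pair.Fubini') measurable
 also have "... = (\<integral>\<^sup>+s. indicator {a..b} s * ?G \<partial>lborel)"
 proof (rule nn_integral_cong)
  fix s
  have "(\<integral>\<^sup>+x. (\<integral>\<^sup>+y. indicator ?Q y * ennreal (grad2 \<phi> (x + s *\<^sub>R y)) \<partial>lborel) \<partial>lborel)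
   = (\<integral>\<^sup>+y. (\<integral>\<^sup>+x. indicator ?Q y * ennreal (grad2 \<phi> (x + s *\<^sub>R y)) \<partial>lborel) \<partial>lborel)"
   by (rule lborel_pair.Fubini') measurable
  also have "... = (\<integral>\<^sup>+y. indicator ?Q y * ?G \<partial>lborel)"
   by (intro nn_integral_cong) (simp add: nn_integral_cmult nn_integral_lborel_translate[of "\<lambda>x. ennreal (grad2 \<phi> x)"])
  also have "... = ?G"
   by (simp add: nn_integral_multc emeasure_lborel_cbox_eq)
  finally show "(\<integral>\<^sup>+x. indicator {a..b} s * (\<integral>\<^sup>+y. indicator ?Q y * ennreal (grad2 \<phi> (x + s *\<^sub>R y)) \<partial>lborel) \<partial>lborel)
   = indicator {a..b} s * ?G"
   by (simp add: nn_integral_cmult)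
 qed
 also have "... = ennreal (b - a) * ?G"
  using assms(2) by (simp add: nn_integral_multc)
 also have "ennreal ((b - a) * DIM('a)) * (ennreal (b - a) * ?G) = ennreal ((b - a)^2 * DIM('a)) * ?G"
  using assms(2) by (subst mult.assoc[symmetric], subst ennreal_mult[symmetric])
   (auto simp: power2_eq_square mult.commute mult.left_commute)
 finally show ?thesis .
qed

text \<open>After dropping the indicator, the substitution z = x + s y produces the factor s^(-n),
  which is largest at the smallest admissible side.\<close>

lemma nn_integral_scaled_cube_le:
 fixes f :: "'a::euclidean_space \<Rightarrow> ennreal"
 assumes [measurable]: "f \<in> borel_measurable borel" and "0 < a" "a \<le> s"
 shows "(\<integral>\<^sup>+y. indicator (cbox 0 One) y * f (x + s *\<^sub>R y) \<partial>lborel) \<le> ennreal (1 / a ^ DIM('a)) * (\<integral>\<^sup>+y. f y \<partial>lborel)"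
proof -
 have "(\<integral>\<^sup>+y. indicator (cbox 0 One) y * f (x + s *\<^sub>R y) \<partial>lborel) \<le> (\<integral>\<^sup>+y. f (x + s *\<^sub>R y) \<partial>lborel)"
  by (intro nn_integral_mono) (auto simp: indicator_def)
 also have "... = (ennreal (1 / s ^ DIM('a)) * ennreal (s ^ DIM('a))) * (\<integral>\<^sup>+y. f (x + s *\<^sub>R y) \<partial>lborel)"
  using assms by (simp add: ennreal_mult[symmetric])
 also have "... = ennreal (1 / s ^ DIM('a)) * (\<integral>\<^sup>+y. f y \<partial>lborel)"
  using assms nn_integral_lborel_affine[OF assms(1), of s x] by (simp add: mult.assoc)
 also have "... \<le> ennreal (1 / a ^ DIM('a)) * (\<integral>\<^sup>+y. f y \<partial>lborel)"
  using assms by (intro mult_right_mono ennreal_leI divide_left_mono power_mono) auto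
 finally show ?thesis .
qed

text \<open>The uniform counterpart of the L^2 estimate: instead of integrating over x, the cube
  integral is enlarged to the whole space at the price of a^(-n).\<close>

lemma cube_avg_difference_sup:
 fixes \<phi> :: "'a::euclidean_space \<Rightarrow> real"
 assumes "smooth \<phi>" "0 < a" "a \<le> b"
 shows "ennreal ((cube_avg \<phi> b x - cube_avg \<phi> a x)^2) \<le> ennreal ((b - a)^2 * DIM('a) / a ^ DIM('a)) * (\<integral>\<^sup>+x. ennreal (grad2 \<phi> x) \<partial>lborel)"
proof -
 note [measurable] = smooth_measurable[OF assms(1)]
 let ?Q = "cbox 0 (One::'a)" and ?G = "\<integral>\<^sup>+x. ennreal (grad2 \<phi> x) \<partial>lborel"
 have "ennreal ((cube_avg \<phi> b x - cube_avg \<phi> a x)^2) \<le> ennreal ((b - a) * DIM('a)) *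
  (\<integral>\<^sup>+s. indicator {a..b} s * (\<integral>\<^sup>+y. indicator ?Q y * ennreal (grad2 \<phi> (x + s *\<^sub>R y)) \<partial>lborel) \<partial>lborel)"
  using assms by (intro cube_avg_difference_le) auto
 also have "... \<le> ennreal ((b - a) * DIM('a)) * (\<integral>\<^sup>+s. indicator {a..b} s * (ennreal (1 / a ^ DIM('a)) * ?G) \<partial>lborel)"
 proof (rule mult_left_mono, rule nn_integral_mono)
  fix s
  show "indicator {a..b} s * (\<integral>\<^sup>+y. indicator ?Q y * ennreal (grad2 \<phi> (x + s *\<^sub>R y)) \<partial>lborel)
   \<le> indicator {a..b} s * (ennreal (1 / a ^ DIM('a)) * ?G)"
   using nn_integral_scaled_cube_le[of "\<lambda>x. ennreal (grad2 \<phi> x)" a s x] assms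
   by (cases "s \<in> {a..b}") auto
 qed simp
 also have "... = ennreal ((b - a) * DIM('a)) * (ennreal (b - a) * (ennreal (1 / a ^ DIM('a)) * ?G))"
  using assms by (simp add: nn_integral_multc)
 also have "... = ennreal ((b - a)^2 * DIM('a) / a ^ DIM('a)) * ?G"
 proof -
  have "ennreal ((b - a) * DIM('a)) * (ennreal (b - a) * ennreal (1 / a ^ DIM('a))) = ennreal ((b - a)^2 * DIM('a) / a ^ DIM('a))"
   using assms by (simp add: ennreal_mult[symmetric] power2_eq_square mult.commute mult.left_commute)
  then show ?thesis by (simp add: mult.assoc[symmetric])
 qed
 finally show ?thesis .
qed

lemma cube_avg_sup:
 fixes \<phi> :: "'a::euclidean_space \<Rightarrow> real"
 assumes "smooth \<phi>" "0 < r"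
 shows "ennreal ((cube_avg \<phi> r x)^2) \<le> ennreal (1 / r ^ DIM('a)) * (\<integral>\<^sup>+x. ennreal ((\<phi> x)^2) \<partial>lborel)"
proof -
 note [measurable] = smooth_measurable[OF assms(1)]
 have "ennreal ((cube_avg \<phi> r x)^2) \<le> (\<integral>\<^sup>+y. indicator (cbox 0 One) y * ennreal ((\<phi> (x + r *\<^sub>R y))^2) \<partial>lborel)"
  unfolding cube_avg_def by (rule square_set_integral_cube_le[OF cube_set_integrable[OF smooth_continuous[OF assms(1)]]]) measurable
 also have "... \<le> ennreal (1 / r ^ DIM('a)) * (\<integral>\<^sup>+x. ennreal ((\<phi> x)^2) \<partial>lborel)"
  using nn_integral_scaled_cube_le[of "\<lambda>x. ennreal ((\<phi> x)^2)" r r x] assms by simp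
 finally show ?thesis .
qed

lemma cube_avg_measurable:
 assumes "smooth \<phi>" shows "cube_avg \<phi> r \<in> borel_measurable borel"
proof -
 note [measurable] = smooth_measurable[OF assms(1)]
 show ?thesis unfolding cube_avg_def[abs_def] set_lebesgue_integral_def by measurable
qed

lemma cube_avg_L2:
 fixes \<phi> :: "'a::euclidean_space \<Rightarrow> real"
 assumes "smooth \<phi>"
 shows "(\<integral>\<^sup>+x. ennreal ((cube_avg \<phi> r x)^2) \<partial>lborel) \<le> (\<integral>\<^sup>+x. ennreal ((\<phi> x)^2) \<partial>lborel)"
proof -
 note [measurable] = smooth_measurable[OF assms(1)]
 let ?Q = "cbox 0 (One::'a)"
 have "(\<integral>\<^sup>+x. ennreal ((cube_avg \<phi> r x)^2) \<partial>lborel) \<le> (\<integral>\<^sup>+x. (\<integral>\<^sup>+y. indicator ?Q y * ennreal ((\<phi> (x + r *\<^sub>R y))^2) \<partial>lborel) \<partial>lborel)"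
  unfolding cube_avg_def
  by (intro nn_integral_mono square_set_integral_cube_le[OF cube_set_integrable[OF smooth_continuous[OF assms(1)]]]) measurable
 also have "... = (\<integral>\<^sup>+y. (\<integral>\<^sup>+x. indicator ?Q y * ennreal ((\<phi> (x + r *\<^sub>R y))^2) \<partial>lborel) \<partial>lborel)"
  by (rule lborel_pair.Fubini') measurable
 also have "... = (\<integral>\<^sup>+y. indicator ?Q y * (\<integral>\<^sup>+x. ennreal ((\<phi> x)^2) \<partial>lborel) \<partial>lborel)"
  by (intro nn_integral_cong) (simp add: nn_integral_cmult nn_integral_lborel_translate[of "\<lambda>x. ennreal ((\<phi> x)^2)"])
 also have "... = (\<integral>\<^sup>+x. ennreal ((\<phi> x)^2) \<partial>lborel)"
  by (simp add: nn_integral_multc emeasure_lborel_cbox_eq)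
 finally show ?thesis .
qed

lemma translate_difference_L2:
 assumes "smooth \<phi>"
 shows "(\<integral>\<^sup>+x. ennreal ((\<phi> (x + v) - \<phi> x)^2) \<partial>lborel) \<le> ennreal ((norm v)^2) * (\<integral>\<^sup>+x. ennreal (grad2 \<phi> x) \<partial>lborel)"
proof -
 note [measurable] = smooth_measurable[OF assms(1)]
 let ?G = "\<integral>\<^sup>+x. ennreal (grad2 \<phi> x) \<partial>lborel"
 have "(\<integral>\<^sup>+x. ennreal ((\<phi> (x + v) - \<phi> x)^2) \<partial>lborel)
  \<le> (\<integral>\<^sup>+x. ennreal ((norm v)^2) * (\<integral>\<^sup>+s. indicator {0..1::real} s * ennreal (grad2 \<phi> (x + s *\<^sub>R v)) \<partial>lborel) \<partial>lborel)"
  using segment_difference_le[OF assms, of 0 1 _ v] by (intro nn_integral_mono) simp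
 also have "... = ennreal ((norm v)^2) * (\<integral>\<^sup>+x. (\<integral>\<^sup>+s. indicator {0..1::real} s * ennreal (grad2 \<phi> (x + s *\<^sub>R v)) \<partial>lborel) \<partial>lborel)"
  by (rule nn_integral_cmult) measurable
 also have "(\<integral>\<^sup>+x. (\<integral>\<^sup>+s. indicator {0..1::real} s * ennreal (grad2 \<phi> (x + s *\<^sub>R v)) \<partial>lborel) \<partial>lborel)
  = (\<integral>\<^sup>+s. (\<integral>\<^sup>+x. indicator {0..1::real} s * ennreal (grad2 \<phi> (x + s *\<^sub>R v)) \<partial>lborel) \<partial>lborel)"
  by (rule lborel_pair.Fubini') measurable
 also have "... = (\<integral>\<^sup>+s. indicator {0..1::real} s * ?G \<partial>lborel)"
  by (intro nn_integral_cong) (simp add: nn_integral_cmult nn_integral_lborel_translate[of "\<lambda>x. ennreal (grad2 \<phi> x)"])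
 also have "... = ?G" by (simp add: nn_integral_multc)
 finally show ?thesis .
qed

text \<open>A difference of averages is the average of a difference of translates, whose L^2 norm
  the gradient controls. The constant blows up as r tends to 0, but at fixed r the averages of
  functions with bounded gradient are equicontinuous, and this is the source of compactness.\<close>

lemma cube_avg_lipschitz:
 fixes \<phi> :: "'a::euclidean_space \<Rightarrow> real"
 assumes "smooth \<phi>" "0 < r"
 shows "ennreal ((cube_avg \<phi> r x' - cube_avg \<phi> r x)^2) \<le> ennreal ((norm (x' - x))^2 / r ^ DIM('a)) * (\<integral>\<^sup>+x. ennreal (grad2 \<phi> x) \<partial>lborel)"
proof -
 note [measurable] = smooth_measurable[OF assms(1)]
 note cont = smooth_continuous[OF assms(1)]
 let ?Q = "cbox 0 (One::'a)"
 have "cube_avg \<phi> r x' - cube_avg \<phi> r x = (LINT y:?Q|lborel. \<phi> (x' + r *\<^sub>R y) - \<phi> (x + r *\<^sub>R y))"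
  unfolding cube_avg_def by (rule set_integral_diff(2)[symmetric]) (rule cube_set_integrable[OF cont])+
 then have "ennreal ((cube_avg \<phi> r x' - cube_avg \<phi> r x)^2) \<le>
  (\<integral>\<^sup>+y. indicator ?Q y * ennreal ((\<phi> (x' + r *\<^sub>R y) - \<phi> (x + r *\<^sub>R y))^2) \<partial>lborel)"
  by (simp only:) (rule square_set_integral_cube_le, intro set_integral_diff(1) cube_set_integrable[OF cont], measurable)
 also have "... = (\<integral>\<^sup>+y. indicator ?Q y * ennreal ((\<phi> ((x + r *\<^sub>R y) + (x' - x)) - \<phi> (x + r *\<^sub>R y))^2) \<partial>lborel)"
  by (simp add: add.commute add.left_commute)
 also have "... \<le> ennreal (1 / r ^ DIM('a)) * (\<integral>\<^sup>+y. ennreal ((\<phi> (y + (x' - x)) - \<phi> y)^2) \<partial>lborel)"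
  using nn_integral_scaled_cube_le[of "\<lambda>y. ennreal ((\<phi> (y + (x' - x)) - \<phi> y)^2)" r r x] assms by simp
 also have "... \<le> ennreal (1 / r ^ DIM('a)) * (ennreal ((norm (x' - x))^2) * (\<integral>\<^sup>+x. ennreal (grad2 \<phi> x) \<partial>lborel))"
  by (intro mult_left_mono translate_difference_L2 assms) simp
 finally show ?thesis
  using assms by (simp add: mult.assoc[symmetric] ennreal_mult[symmetric])
qed

subsection \<open>Sobolev and Poincare inequalities, compactness\<close>

definition grad_int :: "('a::euclidean_space \<Rightarrow> real) \<Rightarrow> real" where
 "grad_int \<phi> = (\<Sum>b\<in>Basis. (norm (L2_of (partial_deriv b \<phi>)))^2)"

lemma grad_int_nonneg: "0 \<le> grad_int \<phi>"
 by (simp add: grad_int_def sum_nonneg)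

text \<open>Translates between the nonnegative Borel integrals of the averaging estimates and norms
  in \<open>L2\<close>.\<close>

lemma nn_integral_test_function_power2:
 fixes \<phi> :: "'a::euclidean_space \<Rightarrow> real"
 assumes "\<phi> \<in> test_functions U"
 shows "(\<integral>\<^sup>+x. ennreal ((\<phi> x)^2) \<partial>lborel) = ennreal ((norm (L2_of \<phi>))^2)"
  and "(\<integral>\<^sup>+x. ennreal (grad2 \<phi> x) \<partial>lborel) = ennreal (grad_int \<phi>)"
proof -
 have *: "(\<integral>\<^sup>+x. ennreal ((f x)^2) \<partial>lborel) = ennreal ((norm (L2_of f))^2)"
  if "square_integrable f" for f :: "'a \<Rightarrow> real"
  using that unfolding norm_L2_of[OF that]
  by (subst nn_integral_completion[symmetric], intro nn_integral_eq_integral) (auto simp: square_integrable_def)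
 note [measurable] = smooth_measurable[OF test_function_smooth[OF assms]]
 show "(\<integral>\<^sup>+x. ennreal ((\<phi> x)^2) \<partial>lborel) = ennreal ((norm (L2_of \<phi>))^2)"
  by (rule *[OF test_function_square_integrable[OF assms]])
 have "(\<integral>\<^sup>+x. ennreal (grad2 \<phi> x) \<partial>lborel) = (\<integral>\<^sup>+x. (\<Sum>b\<in>Basis. ennreal ((partial_deriv b \<phi> x)^2)) \<partial>lborel)"
  by (simp add: grad2_def sum_ennreal)
 also have "... = (\<Sum>b\<in>Basis. \<integral>\<^sup>+x. ennreal ((partial_deriv b \<phi> x)^2) \<partial>lborel)"
  by (rule nn_integral_sum) measurable
 also have "... = ennreal (grad_int \<phi>)"
  by (simp add: grad_int_def sum_ennreal *[OF test_function_partial_square_integrable[OF assms]])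
 finally show "(\<integral>\<^sup>+x. ennreal (grad2 \<phi> x) \<partial>lborel) = ennreal (grad_int \<phi>)" .
qed

lemma test_function_bounded:
 assumes "\<phi> \<in> test_functions U"
 obtains B where "\<And>x. \<bar>\<phi> x\<bar> \<le> B"
proof -
 obtain K where K: "compact K" "\<And>x. x \<notin> K \<Longrightarrow> \<phi> x = 0"
  by (rule test_function_compact_support[OF assms]) blast
 have "bounded (\<phi> ` K)"
  using compact_imp_bounded compact_continuous_image smooth_continuous[OF test_function_smooth[OF assms]] K(1) by blast
 then obtain B where B: "\<And>x. x \<in> K \<Longrightarrow> \<bar>\<phi> x\<bar> \<le> B" by (auto simp: bounded_iff)
 have "\<bar>\<phi> x\<bar> \<le> max B 0" for x using B[of x] K(2)[of x] by (cases "x \<in> K") auto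
 then show ?thesis by (rule that)
qed

lemma cube_avg_0: "cube_avg \<phi> 0 x = \<phi> x"
 by (simp add: cube_avg_def set_lebesgue_integral_def)

lemma cube_avg_tendsto:
 assumes "\<phi> \<in> test_functions U" and X: "X \<longlonglongrightarrow> 0"
 shows "(\<lambda>k. cube_avg \<phi> (X k) x) \<longlonglongrightarrow> \<phi> x"
proof -
 obtain B where B: "\<And>x. \<bar>\<phi> x\<bar> \<le> B" using test_function_bounded[OF assms(1)] by blast
 note [measurable] = smooth_measurable[OF test_function_smooth[OF assms(1)]]
 have "isCont \<phi> z" for z
  using smooth_continuous[OF test_function_smooth[OF assms(1)], of UNIV] by (simp add: continuous_on_eq_continuous_at)
 then have "(\<lambda>k. \<phi> (x + X k *\<^sub>R y)) \<longlonglongrightarrow> \<phi> (x + 0 *\<^sub>R y)" for y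
  by (rule isCont_tendsto_compose) (intro tendsto_intros X)
 note lim = this
 have "(\<lambda>k. cube_avg \<phi> (X k) x) \<longlonglongrightarrow> cube_avg \<phi> 0 x"
  unfolding cube_avg_def set_lebesgue_integral_def
 proof (rule integral_dominated_convergence[where w="\<lambda>y. B * indicator (cbox 0 One) y"])
  show "integrable lborel (\<lambda>y. B * indicat_real (cbox 0 One) y :: real)"
   by (intro integrable_mult_right integrable_real_indicator) (auto simp: emeasure_lborel_cbox_eq)
  show "AE y in lborel. norm (indicator (cbox 0 One) y *\<^sub>R \<phi> (x + X k *\<^sub>R y)) \<le> B * indicator (cbox 0 One) y" for k
   using B by (auto simp: indicator_def)
  show "AE y in lborel. (\<lambda>k. indicator (cbox 0 One) y *\<^sub>R \<phi> (x + X k *\<^sub>R y)) \<longlonglongrightarrow> indicator (cbox 0 One) y *\<^sub>R \<phi> (x + 0 *\<^sub>R y)"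
   by (intro always_eventually allI tendsto_scaleR tendsto_const lim)
 qed measurable
 then show ?thesis by (simp add: cube_avg_0)
qed

text \<open>With c the fourth root of the weighted sum, each term is at most c (9/10)^k, and the
  geometric series sums to at most 10. The ratio 9/10 lies above the fourth root of 1/2, so the
  weights (9/10)^(-4k) do not destroy a decay of order 2^(-k) in the fourth powers.\<close>

lemma sum_power4_le:
 fixes w :: "nat \<Rightarrow> real"
 shows "(\<Sum>k<m. \<bar>w k\<bar>) ^ 4 \<le> 10000 * (\<Sum>k<m. w k ^ 4 / (9/10) ^ (4 * k))"
proof -
 let ?s = "\<Sum>k<m. w k ^ 4 / (9/10) ^ (4 * k)"
 define c where "c = root 4 ?s"
 have s0: "0 \<le> ?s" by (intro sum_nonneg divide_nonneg_nonneg) auto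
 have c0: "0 \<le> c" and c4: "c ^ 4 = ?s" using s0 by (auto simp: c_def)
 have wk: "\<bar>w k\<bar> \<le> c * (9/10) ^ k" if "k < m" for k
 proof -
  have "w k ^ 4 / (9/10) ^ (4 * k) \<le> ?s"
   using that by (intro member_le_sum divide_nonneg_nonneg) auto
  then have "\<bar>w k\<bar> ^ 4 \<le> (c * (9/10) ^ k) ^ 4"
   unfolding power_mult_distrib c4 by (simp add: field_simps power_mult[symmetric] mult.commute)
  then show ?thesis by (rule power_le_imp_le_base[where n=3, simplified]) (use c0 in auto)
 qed
 have "(\<Sum>k<m. \<bar>w k\<bar>) \<le> (\<Sum>k<m. c * (9/10) ^ k)" using wk by (intro sum_mono) auto
 also have "... = c * ((1 - (9/10) ^ m) * 10)"
  unfolding sum_distrib_left[symmetric] by (subst sum_gp_strict) simp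
 also have "... \<le> c * 10" using c0 by (intro mult_left_mono) auto
 finally have "(\<Sum>k<m. \<bar>w k\<bar>) ^ 4 \<le> (c * 10) ^ 4" by (intro power_mono sum_nonneg) auto
 then show ?thesis by (simp add: power_mult_distrib c4)
qed

lemma power4_add_le: "((x::real) + y) ^ 4 \<le> 8 * x ^ 4 + 8 * y ^ 4"
proof -
 have "(x + y)^2 \<le> 2 * x^2 + 2 * y^2" using zero_le_power2[of "x - y"] by (simp add: power2_eq_square algebra_simps)
 then have "((x + y)^2)^2 \<le> (2 * x^2 + 2 * y^2)^2" by (intro power_mono) auto
 also have "... \<le> 8 * (x^2)^2 + 8 * (y^2)^2"
  using zero_le_power2[of "x^2 - y^2"] by (simp add: power2_eq_square algebra_simps)
 finally show ?thesis by (simp add: power_mult[symmetric])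
qed

lemma ennreal_power4_split: "ennreal (x ^ 4) = ennreal (x^2) * ennreal (x^2)"
 by (simp add: ennreal_mult[symmetric] power2_eq_square power4_eq_xxxx mult.assoc)

text \<open>The dyadic telescoping series of cube averages converges in \<open>L\<^sup>4\<close>, since its \<open>k\<close>-th term is of size
 \<open>2\<^bsup>- k\<^esup>\<close> in \<open>L^2\<close> and of size \<open>2\<^bsup>k (n/2 - 1)\<^esup>\<close> in \<open>L\<^sup>\<infinity>\<close>, and \<open>n < 4\<close>.\<close>

lemma test_function_L4:
 fixes \<phi> :: "'a::euclidean_space \<Rightarrow> real"
 assumes \<phi>: "\<phi> \<in> test_functions U" and dim: "DIM('a) \<le> 3" and r: "0 < r" "r \<le> 1"
 shows "(\<integral>\<^sup>+x. ennreal ((\<phi> x) ^ 4) \<partial>lborel) \<le>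
  ennreal (8 / r ^ DIM('a) * (norm (L2_of \<phi>)) ^ 4 + 2000000 * r * (grad_int \<phi>)^2)"
proof -
 note sm = test_function_smooth[OF \<phi>]
 note [measurable] = smooth_measurable[OF sm] cube_avg_measurable[OF sm]
 let ?n = "DIM('a)" and ?G = "grad_int \<phi>" and ?A = "cube_avg \<phi>"
 define w where "w k x = ?A (r / 2 ^ k) x - ?A (r / 2 ^ Suc k) x" for k x
 have wm[measurable]: "w k \<in> borel_measurable borel" for k unfolding w_def[abs_def] by measurable
 have n1: "?n \<ge> 1" by (simp add: Suc_leI)
 have tele: "?A (r / 2 ^ m) x = ?A r x + - (\<Sum>k<m. w k x)" for m x
  by (induction m) (auto simp: w_def)
 have fin: "(?A (r / 2 ^ m) x) ^ 4 \<le> 8 * (?A r x) ^ 4 + (\<Sum>k<m. 80000 * (w k x ^ 4 / (9/10) ^ (4 * k)))" for m x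
 proof -
  have "(?A (r / 2 ^ m) x) ^ 4 \<le> 8 * (?A r x) ^ 4 + 8 * (- (\<Sum>k<m. w k x)) ^ 4"
   unfolding tele by (rule power4_add_le)
  also have "(- (\<Sum>k<m. w k x)) ^ 4 \<le> (\<Sum>k<m. \<bar>w k x\<bar>) ^ 4"
   using power_mono[OF sum_abs[of "\<lambda>k. w k x" "{..<m}"], of 4] by simp
  also note sum_power4_le
  finally show ?thesis by (simp add: sum_distrib_left)
 qed
 \<comment> \<open>The partial sums telescope to the average at side r / 2^m, which tends to \<phi>
   x; the weighted bound for fourth powers is uniform in m.\<close>
 have pointwise: "ennreal (\<phi> x ^ 4) \<le> 8 * ennreal ((?A r x) ^ 4) + (\<Sum>k. ennreal (80000 * (w k x ^ 4 / (9/10) ^ (4 * k))))" for x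
 proof (rule LIMSEQ_le_const2)
  have "(\<lambda>m. r * (1/2) ^ m) \<longlonglongrightarrow> r * 0" by (intro tendsto_intros LIMSEQ_power_zero) simp
  then have "(\<lambda>m. ?A (r / 2 ^ m) x) \<longlonglongrightarrow> \<phi> x"
   by (intro cube_avg_tendsto[OF \<phi>]) (simp add: power_one_over field_simps)
  then show "(\<lambda>m. ennreal ((?A (r / 2 ^ m) x) ^ 4)) \<longlonglongrightarrow> ennreal (\<phi> x ^ 4)"
   by (intro tendsto_ennrealI tendsto_power)
  have "ennreal ((?A (r / 2 ^ m) x) ^ 4) \<le> 8 * ennreal ((?A r x) ^ 4) + (\<Sum>k. ennreal (80000 * (w k x ^ 4 / (9/10) ^ (4 * k))))" for m
  proof -
   have "ennreal ((?A (r / 2 ^ m) x) ^ 4) \<le> ennreal (8 * (?A r x) ^ 4 + (\<Sum>k<m. 80000 * (w k x ^ 4 / (9/10) ^ (4 * k))))"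
    by (rule ennreal_leI[OF fin])
   also have "... = 8 * ennreal ((?A r x) ^ 4) + (\<Sum>k<m. ennreal (80000 * (w k x ^ 4 / (9/10) ^ (4 * k))))"
    by (subst ennreal_plus) (auto simp: ennreal_mult sum_ennreal intro!: sum_nonneg)
   also have "... \<le> 8 * ennreal ((?A r x) ^ 4) + (\<Sum>k. ennreal (80000 * (w k x ^ 4 / (9/10) ^ (4 * k))))"
    by (intro add_left_mono sum_le_suminf) auto
   finally show ?thesis .
  qed
  then show "\<exists>N. \<forall>m\<ge>N. ennreal ((?A (r / 2 ^ m) x) ^ 4) \<le> 8 * ennreal ((?A r x) ^ 4) + (\<Sum>k. ennreal (80000 * (w k x ^ 4 / (9/10) ^ (4 * k))))"
   by blast
 qed
 \<comment> \<open>The fourth power is estimated by the uniform bound of the square times the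
   integral of the square. With a = r / 2^(k+1) this gives n^2 a^(4-n) times the squared gradient
   integral.\<close>
 have w4: "(\<integral>\<^sup>+x. ennreal (w k x ^ 4) \<partial>lborel) \<le> ennreal (9 * r / 2 ^ Suc k * ?G^2)" for k
 proof -
  define a where "a = r / 2 ^ Suc k"
  have a: "0 < a" "a \<le> r / 2 ^ k" "r / 2 ^ k - a = a" "a \<le> 1"
  proof -
   have "r \<le> 2 ^ Suc k" using r(2) one_le_power[of "2::real" "Suc k"] by linarith
   then show "a \<le> 1" by (simp add: a_def)
  qed (use r in \<open>auto simp: a_def field_simps\<close>)
  have sup: "ennreal ((w k x)^2) \<le> ennreal (a^2 * ?n / a ^ ?n * ?G)" for x
   using cube_avg_difference_sup[OF sm a(1,2), of x]
   unfolding nn_integral_test_function_power2[OF \<phi>] w_def a_def[symmetric] a(3)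
   using a(1) by (simp add: ennreal_mult[symmetric] grad_int_nonneg)
  have L2: "(\<integral>\<^sup>+x. ennreal ((w k x)^2) \<partial>lborel) \<le> ennreal (a^2 * ?n * ?G)"
   using cube_avg_difference_L2[OF sm a(2)]
   unfolding nn_integral_test_function_power2[OF \<phi>] w_def a_def[symmetric] a(3)
   by (simp add: ennreal_mult[symmetric] grad_int_nonneg)
  have "(\<integral>\<^sup>+x. ennreal (w k x ^ 4) \<partial>lborel) \<le> (\<integral>\<^sup>+x. ennreal (a^2 * ?n / a ^ ?n * ?G) * ennreal ((w k x)^2) \<partial>lborel)"
   unfolding ennreal_power4_split by (intro nn_integral_mono mult_right_mono sup) simp
  also have "... = ennreal (a^2 * ?n / a ^ ?n * ?G) * (\<integral>\<^sup>+x. ennreal ((w k x)^2) \<partial>lborel)"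
   by (rule nn_integral_cmult) measurable
  also have "... \<le> ennreal (a^2 * ?n / a ^ ?n * ?G) * ennreal (a^2 * ?n * ?G)"
   by (intro mult_left_mono L2) simp
  also have "... = ennreal ((a^2 * ?n / a ^ ?n * ?G) * (a^2 * ?n * ?G))"
   using a(1) by (intro ennreal_mult[symmetric]) (auto simp: grad_int_nonneg)
  also have "... \<le> ennreal (9 * a * ?G^2)"
  proof (rule ennreal_leI)
   \<comment> \<open>Here the dimension enters: 4 - n is at least 1 and a is at most 1, so the power
     of a is at most a.\<close>
   have "a ^ 4 / a ^ ?n = a ^ (4 - ?n)" using a(1) dim by (subst power_diff) auto
   also have "... \<le> a ^ 1" using a dim by (intro power_decreasing) auto
   finally have 1: "a ^ 4 / a ^ ?n \<le> a" by simp
   have "real ?n * real ?n \<le> 3 * 3" using dim by (intro mult_mono) auto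
   then have "(real ?n * real ?n) * (a ^ 4 / a ^ ?n) \<le> 9 * a" using 1 a(1) by (intro mult_mono) auto
   then have "(real ?n * real ?n) * (a ^ 4 / a ^ ?n) * ?G^2 \<le> 9 * a * ?G^2" by (intro mult_right_mono) auto
   moreover have eq: "(x^2 * n / y * g) * (x^2 * n * g) = (n * n) * (x ^ 4 / y) * g^2" for x n y g :: real
    by (simp add: power2_eq_square power4_eq_xxxx)
   ultimately show "(a^2 * ?n / a ^ ?n * ?G) * (a^2 * ?n * ?G) \<le> 9 * a * ?G^2" by (simp only: eq)
  qed
  finally show ?thesis by (simp add: a_def)
 qed
 \<comment> \<open>The coarsest average is not small. It is bounded both uniformly and in L^2 by the
   norm of \<phi>, and it carries the factor r^(-n).\<close>
 have A4: "(\<integral>\<^sup>+x. ennreal ((?A r x) ^ 4) \<partial>lborel) \<le> ennreal (1 / r ^ ?n * (norm (L2_of \<phi>)) ^ 4)"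
 proof -
  have sup: "ennreal ((?A r x)^2) \<le> ennreal (1 / r ^ ?n * (norm (L2_of \<phi>))^2)" for x
   using cube_avg_sup[OF sm r(1), of x] unfolding nn_integral_test_function_power2[OF \<phi>]
   using r by (simp add: ennreal_mult[symmetric])
  have L2: "(\<integral>\<^sup>+x. ennreal ((?A r x)^2) \<partial>lborel) \<le> ennreal ((norm (L2_of \<phi>))^2)"
   using cube_avg_L2[OF sm, of r] unfolding nn_integral_test_function_power2[OF \<phi>] .
  have "(\<integral>\<^sup>+x. ennreal ((?A r x) ^ 4) \<partial>lborel) \<le> (\<integral>\<^sup>+x. ennreal (1 / r ^ ?n * (norm (L2_of \<phi>))^2) * ennreal ((?A r x)^2) \<partial>lborel)"
   unfolding ennreal_power4_split by (intro nn_integral_mono mult_right_mono sup) simp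
  also have "... = ennreal (1 / r ^ ?n * (norm (L2_of \<phi>))^2) * (\<integral>\<^sup>+x. ennreal ((?A r x)^2) \<partial>lborel)"
   by (rule nn_integral_cmult) measurable
  also have "... \<le> ennreal (1 / r ^ ?n * (norm (L2_of \<phi>))^2) * ennreal ((norm (L2_of \<phi>))^2)"
   by (intro mult_left_mono L2) simp
  also have "... = ennreal (1 / r ^ ?n * (norm (L2_of \<phi>)) ^ 4)"
   using r by (simp add: ennreal_mult[symmetric] power2_eq_square power4_eq_xxxx)
  finally show ?thesis .
 qed
 \<comment> \<open>The decay 1/2 of the terms against the weight (9/10)^4 = 0.6561 leaves a ratio of
   about 0.762. Then 360000 / (1 - ?q) is about 1.51 million, which is rounded up to 2000000; 360000
   is 80000 times 9/2.\<close>
 let ?q = "(1/2) / (9/10) ^ 4 :: real"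
 have q: "0 \<le> ?q" "?q < 1" by (simp_all add: power4_eq_xxxx)
 have "(\<integral>\<^sup>+x. ennreal ((\<phi> x) ^ 4) \<partial>lborel) \<le> (\<integral>\<^sup>+x. 8 * ennreal ((?A r x) ^ 4) + (\<Sum>k. ennreal (80000 * (w k x ^ 4 / (9/10) ^ (4 * k)))) \<partial>lborel)"
  by (intro nn_integral_mono pointwise)
 also have "... = (\<integral>\<^sup>+x. 8 * ennreal ((?A r x) ^ 4) \<partial>lborel) + (\<integral>\<^sup>+x. (\<Sum>k. ennreal (80000 * (w k x ^ 4 / (9/10) ^ (4 * k)))) \<partial>lborel)"
  by (rule nn_integral_add) measurable
 also have "(\<integral>\<^sup>+x. (\<Sum>k. ennreal (80000 * (w k x ^ 4 / (9/10) ^ (4 * k)))) \<partial>lborel)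
  = (\<Sum>k. \<integral>\<^sup>+x. ennreal (80000 * (w k x ^ 4 / (9/10) ^ (4 * k))) \<partial>lborel)"
  by (rule nn_integral_suminf) measurable
 also have "... \<le> (\<Sum>k. ennreal (360000 * r * ?G^2 * ?q ^ k))"
 proof (rule suminf_le)
  fix k
  have "(\<integral>\<^sup>+x. ennreal (80000 * (w k x ^ 4 / (9/10) ^ (4 * k))) \<partial>lborel)
   = (\<integral>\<^sup>+x. ennreal (80000 / (9/10) ^ (4 * k)) * ennreal (w k x ^ 4) \<partial>lborel)"
   by (intro nn_integral_cong) (simp add: ennreal_mult[symmetric])
  also have "... = ennreal (80000 / (9/10) ^ (4 * k)) * (\<integral>\<^sup>+x. ennreal (w k x ^ 4) \<partial>lborel)"
   by (rule nn_integral_cmult) measurable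
  also have "... \<le> ennreal (80000 / (9/10) ^ (4 * k)) * ennreal (9 * r / 2 ^ Suc k * ?G^2)"
   by (intro mult_left_mono w4) simp
  also have "... = ennreal (80000 / (9/10) ^ (4 * k) * (9 * r / 2 ^ Suc k * ?G^2))"
   using r by (intro ennreal_mult[symmetric]) auto
  also have "80000 / (9/10) ^ (4 * k) * (9 * r / 2 ^ Suc k * ?G^2) = 360000 * r * ?G^2 * ?q ^ k"
  proof -
   have "80000 / c ^ k * (9 * r / 2 ^ Suc k * g) = 360000 * r * g * ((1/2) / c) ^ k" if "c \<noteq> 0" for c g :: real
    using that by (simp add: power_divide power_mult_distrib field_simps)
   note eq = this
   have "(9/10 :: real) ^ 4 \<noteq> 0" by simp
   then show ?thesis unfolding power_mult by (rule eq)
  qed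
  finally show "(\<integral>\<^sup>+x. ennreal (80000 * (w k x ^ 4 / (9/10) ^ (4 * k))) \<partial>lborel) \<le> ennreal (360000 * r * ?G^2 * ?q ^ k)" .
 qed auto
 also have "... = ennreal (\<Sum>k. 360000 * r * ?G^2 * ?q ^ k)"
  using r q by (intro suminf_ennreal2 summable_mult summable_geometric) auto
 also have "(\<Sum>k. 360000 * r * ?G^2 * ?q ^ k) = 360000 * r * ?G^2 * (1 / (1 - ?q))"
  using q by (subst suminf_mult) (auto simp: suminf_geometric intro!: summable_geometric)
 also have "ennreal ... \<le> ennreal (2000000 * r * ?G^2)"
 proof (rule ennreal_leI)
  have "360000 * (1 / (1 - ?q)) \<le> 2000000" by (simp add: power4_eq_xxxx)
  then have "(360000 * (1 / (1 - ?q))) * (r * ?G^2) \<le> 2000000 * (r * ?G^2)"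
   using r by (intro mult_right_mono) auto
  moreover have "360000 * r * ?G^2 * c = (360000 * c) * (r * ?G^2)" for c :: real by simp
  ultimately show "360000 * r * ?G^2 * (1 / (1 - ?q)) \<le> 2000000 * r * ?G^2" by (simp only: mult.assoc)
 qed
 also have "(\<integral>\<^sup>+x. 8 * ennreal ((?A r x) ^ 4) \<partial>lborel) = 8 * (\<integral>\<^sup>+x. ennreal ((?A r x) ^ 4) \<partial>lborel)"
  by (rule nn_integral_cmult) measurable
 also have "... \<le> 8 * ennreal (1 / r ^ ?n * (norm (L2_of \<phi>)) ^ 4)" by (intro mult_left_mono A4) simp
 also have "8 * ennreal (1 / r ^ ?n * (norm (L2_of \<phi>)) ^ 4) + ennreal (2000000 * r * ?G^2)
  = ennreal (8 / r ^ ?n * (norm (L2_of \<phi>)) ^ 4 + 2000000 * r * ?G^2)"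
  using r by (subst ennreal_plus) (auto simp: ennreal_mult grad_int_nonneg times_divide_eq_right[symmetric]
    simp del: times_divide_eq_right)
 finally show ?thesis by (simp add: add_mono)
qed

text \<open>Puts the definition of \<open>H10\<close> into the form in which inequalities pass from
  test functions to their limits: norms and gradient integrals both converge.\<close>

lemma H10_approximation:
 assumes "u \<in> H10 \<Omega>"
 obtains \<phi> where "\<And>k::nat. \<phi> k \<in> test_functions \<Omega>" "(\<lambda>k. L2_of (\<phi> k)) \<longlonglongrightarrow> u"
  "(\<lambda>k. grad_int (\<phi> k)) \<longlonglongrightarrow> (grad_norm \<Omega> u)^2"
proof -
 obtain \<phi> where \<phi>: "\<And>k::nat. \<phi> k \<in> test_functions \<Omega>" "(\<lambda>k. L2_of (\<phi> k)) \<longlonglongrightarrow> u"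
  "\<And>b. b \<in> Basis \<Longrightarrow> (\<lambda>k. L2_of (partial_deriv b (\<phi> k))) \<longlonglongrightarrow> weak_partial \<Omega> b u"
  using assms by (auto simp: H10_def)
 have "(\<lambda>k. grad_int (\<phi> k)) \<longlonglongrightarrow> (\<Sum>b\<in>Basis. (norm (weak_partial \<Omega> b u))^2)"
  unfolding grad_int_def by (intro tendsto_intros \<phi>)
 also have "(\<Sum>b\<in>Basis. (norm (weak_partial \<Omega> b u))^2) = (grad_norm \<Omega> u)^2"
  by (simp add: grad_norm_def L2_set_def sum_nonneg)
 finally show ?thesis using that \<phi> by blast
qed

text \<open>A small largest scale r makes the gradient term small, at the price of the large factor
  8 r^(-n) in front of the L^2 norm. The bound passes from test functions to \<open>H10\<close> by
  Fatou along an almost everywhere convergent subsequence.\<close>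

lemma H10_L4:
 fixes \<Omega> :: "'a::euclidean_space set"
 assumes dim: "DIM('a) \<le> 3" and "\<epsilon> > 0"
 shows "\<exists>C\<ge>0. \<forall>u\<in>H10 \<Omega>. (\<integral>\<^sup>+x. ennreal ((rep_L2 u x) ^ 4) \<partial>lebesgue) \<le> ennreal (\<epsilon> * (grad_norm \<Omega> u) ^ 4 + C * (norm u) ^ 4)"
proof -
 define r where "r = min 1 (\<epsilon> / 2000000)"
 have r: "0 < r" "r \<le> 1" "2000000 * r \<le> \<epsilon>" using assms by (auto simp: r_def)
 let ?C = "8 / r ^ DIM('a)"
 have "(\<integral>\<^sup>+x. ennreal ((rep_L2 u x) ^ 4) \<partial>lebesgue) \<le> ennreal (\<epsilon> * (grad_norm \<Omega> u) ^ 4 + ?C * (norm u) ^ 4)"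
  if u: "u \<in> H10 \<Omega>" for u
 proof -
  obtain \<phi> where \<phi>: "\<And>k::nat. \<phi> k \<in> test_functions \<Omega>" "(\<lambda>k. L2_of (\<phi> k)) \<longlonglongrightarrow> u"
   "(\<lambda>k. grad_int (\<phi> k)) \<longlonglongrightarrow> (grad_norm \<Omega> u)^2" using H10_approximation[OF u] by blast
  obtain s :: "nat \<Rightarrow> nat" where s: "strict_mono s"
   "AE x in lebesgue. (\<lambda>k. rep_L2 (L2_of (\<phi> (s k))) x) \<longlonglongrightarrow> rep_L2 u x"
   using L2_tendsto_AE_subseq[OF \<phi>(2)] by blast
  have *: "AE x in lebesgue. \<forall>k. rep_L2 (L2_of (\<phi> (s k))) x = \<phi> (s k) x"
   by (subst AE_all_countable) (intro allI rep_L2_of test_function_square_integrable[OF \<phi>(1)])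
  note [measurable] = smooth_measurable(1)[OF test_function_smooth[OF \<phi>(1)]]
  have m: "\<phi> k \<in> borel_measurable lebesgue" for k by (rule measurable_completion) measurable
  note [measurable] = m
  have "(\<integral>\<^sup>+x. ennreal ((rep_L2 u x) ^ 4) \<partial>lebesgue) = (\<integral>\<^sup>+x. liminf (\<lambda>k. ennreal (\<phi> (s k) x ^ 4)) \<partial>lebesgue)"
  proof (rule nn_integral_cong_AE)
   show "AE x in lebesgue. ennreal ((rep_L2 u x) ^ 4) = liminf (\<lambda>k. ennreal (\<phi> (s k) x ^ 4))"
    using s(2) *
   proof eventually_elim
    case (elim x)
    then have "(\<lambda>k. \<phi> (s k) x) \<longlonglongrightarrow> rep_L2 u x" by simp
    then have "(\<lambda>k. ennreal (\<phi> (s k) x ^ 4)) \<longlonglongrightarrow> ennreal ((rep_L2 u x) ^ 4)"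
     by (intro tendsto_ennrealI tendsto_power)
    then show ?case by (metis lim_imp_Liminf trivial_limit_sequentially)
   qed
  qed
  also have "... \<le> liminf (\<lambda>k. \<integral>\<^sup>+x. ennreal (\<phi> (s k) x ^ 4) \<partial>lebesgue)"
   by (rule nn_integral_liminf) measurable
  also have "... \<le> liminf (\<lambda>k. ennreal (?C * (norm (L2_of (\<phi> (s k)))) ^ 4 + 2000000 * r * (grad_int (\<phi> (s k)))^2))"
   using test_function_L4[OF \<phi>(1) dim r(1,2)] by (intro Liminf_mono always_eventually) (simp add: nn_integral_completion)
  also have "... = ennreal (?C * (norm u) ^ 4 + 2000000 * r * ((grad_norm \<Omega> u)^2)^2)"
  proof (rule lim_imp_Liminf)
   have "(\<lambda>k. ?C * (norm (L2_of (\<phi> k))) ^ 4 + 2000000 * r * (grad_int (\<phi> k))^2) \<longlonglongrightarrow>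
    ?C * (norm u) ^ 4 + 2000000 * r * ((grad_norm \<Omega> u)^2)^2"
    by (intro tendsto_intros \<phi>)
   from LIMSEQ_subseq_LIMSEQ[OF this s(1)]
   show "(\<lambda>k. ennreal (?C * (norm (L2_of (\<phi> (s k)))) ^ 4 + 2000000 * r * (grad_int (\<phi> (s k)))^2)) \<longlonglongrightarrow>
    ennreal (?C * (norm u) ^ 4 + 2000000 * r * ((grad_norm \<Omega> u)^2)^2)"
    by (intro tendsto_ennrealI) (simp add: o_def)
  qed simp
  also have "... \<le> ennreal (\<epsilon> * (grad_norm \<Omega> u) ^ 4 + ?C * (norm u) ^ 4)"
   using r mult_right_mono[OF r(3), of "(grad_norm \<Omega> u) ^ 4"] by (intro ennreal_leI) (simp add: power_mult[symmetric])
  finally show ?thesis .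
 qed
 moreover have "0 \<le> ?C" using r by simp
 ultimately show ?thesis by blast
qed

text \<open>Translation by a vector v longer than the diameter separates the supports, so \<phi>(x +
  v) - \<phi>(x) has twice the squared norm of \<phi>, while the translate estimate bounds it by
  |v|^2 times the gradient integral.\<close>

lemma H10_poincare:
 fixes \<Omega> :: "'a::euclidean_space set"
 assumes "bounded \<Omega>"
 shows "\<exists>C>0. \<forall>u\<in>H10 \<Omega>. norm u \<le> C * grad_norm \<Omega> u"
proof -
 obtain D where D: "D > 0" "\<And>x. x \<in> \<Omega> \<Longrightarrow> norm x \<le> D" using assms by (auto simp: bounded_pos)
 obtain b :: 'a where b: "b \<in> Basis" using nonempty_Basis by blast
 define v where "v = (2 * D + 1) *\<^sub>R b"
 have v: "norm v = 2 * D + 1" using b D by (simp add: v_def)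
 have test: "2 * (norm (L2_of \<phi>))^2 \<le> (norm v)^2 * grad_int \<phi>" if \<phi>: "\<phi> \<in> test_functions \<Omega>" for \<phi>
 proof -
  note [measurable] = smooth_measurable[OF test_function_smooth[OF \<phi>]]
  obtain K where K: "K \<subseteq> \<Omega>" "\<And>x. x \<notin> K \<Longrightarrow> \<phi> x = 0"
   by (rule test_function_compact_support[OF \<phi>]) blast
  have disj: "\<phi> (x + v) = 0 \<or> \<phi> x = 0" for x
  proof (rule ccontr)
   assume "\<not> ?thesis"
   then have "x + v \<in> \<Omega>" "x \<in> \<Omega>" using K by blast+
   then have "norm (x + v) \<le> D" "norm x \<le> D" using D by auto
   moreover have "norm v \<le> norm (x + v) + norm x" by (metis add_diff_cancel_left' norm_triangle_ineq4)
   ultimately show False using v by linarith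
  qed
  have "ennreal (2 * (norm (L2_of \<phi>))^2) = (\<integral>\<^sup>+x. ennreal ((\<phi> (x + v))^2) \<partial>lborel) + (\<integral>\<^sup>+x. ennreal ((\<phi> x)^2) \<partial>lborel)"
   using nn_integral_lborel_translate[of "\<lambda>x. ennreal ((\<phi> x)^2)" v]
   by (simp add: nn_integral_test_function_power2[OF \<phi>] ennreal_plus[symmetric] del: ennreal_plus)
  also have "... = (\<integral>\<^sup>+x. ennreal ((\<phi> (x + v))^2) + ennreal ((\<phi> x)^2) \<partial>lborel)"
   by (rule nn_integral_add[symmetric]) measurable
  also have "... = (\<integral>\<^sup>+x. ennreal ((\<phi> (x + v) - \<phi> x)^2) \<partial>lborel)"
  proof (rule nn_integral_cong)
   fix x
   have "(\<phi> (x + v))^2 + (\<phi> x)^2 = (\<phi> (x + v) - \<phi> x)^2" using disj[of x] by auto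
   then show "ennreal ((\<phi> (x + v))^2) + ennreal ((\<phi> x)^2) = ennreal ((\<phi> (x + v) - \<phi> x)^2)"
    by (simp add: ennreal_plus[symmetric] del: ennreal_plus)
  qed
  also have "... \<le> ennreal ((norm v)^2) * ennreal (grad_int \<phi>)"
   using translate_difference_L2[OF test_function_smooth[OF \<phi>], of v] by (simp add: nn_integral_test_function_power2[OF \<phi>])
  also have "... = ennreal ((norm v)^2 * grad_int \<phi>)" by (simp add: ennreal_mult grad_int_nonneg)
  finally show ?thesis by (subst (asm) ennreal_le_iff) (auto simp: grad_int_nonneg)
 qed
 have "norm u \<le> norm v * grad_norm \<Omega> u" if u: "u \<in> H10 \<Omega>" for u
 proof -
  obtain \<phi> where \<phi>: "\<And>k::nat. \<phi> k \<in> test_functions \<Omega>" "(\<lambda>k. L2_of (\<phi> k)) \<longlonglongrightarrow> u"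
   "(\<lambda>k. grad_int (\<phi> k)) \<longlonglongrightarrow> (grad_norm \<Omega> u)^2" using H10_approximation[OF u] by blast
  have "2 * (norm u)^2 \<le> (norm v)^2 * (grad_norm \<Omega> u)^2"
   by (rule LIMSEQ_le[OF tendsto_mult[OF tendsto_const tendsto_power[OF tendsto_norm[OF \<phi>(2)]]]
      tendsto_mult[OF tendsto_const \<phi>(3)]]) (use test[OF \<phi>(1)] in blast)
  then have "(norm u)^2 \<le> (norm v * grad_norm \<Omega> u)^2"
   using zero_le_power2[of "norm u"] unfolding power_mult_distrib by linarith
  then show ?thesis by (rule power2_le_imp_le) (simp add: grad_norm_nonneg)
 qed
 moreover have "norm v > 0" using v D by simp
 ultimately show ?thesis by blast
qed

text \<open>Exhibits the average as a bounded functional on L^2, so that smallness of finitely many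
  averages becomes a condition on the limit of the test functions and not only on the test functions
  themselves.\<close>

lemma cube_avg_inner:
 fixes \<phi> :: "'a::euclidean_space \<Rightarrow> real"
 assumes \<phi>: "\<phi> \<in> test_functions U" and r: "0 < r"
 shows "cube_avg \<phi> r x = L2_of (\<lambda>z. 1 / r ^ DIM('a) * indicator (cbox x (x + r *\<^sub>R One)) z) \<bullet> L2_of \<phi>"
proof -
 note [measurable] = smooth_measurable[OF test_function_smooth[OF \<phi>]]
 let ?Q = "cbox x (x + r *\<^sub>R One)" and ?n = "DIM('a)"
 have m: "\<phi> \<in> borel_measurable lebesgue" by (rule measurable_completion) measurable
 have sq: "square_integrable (\<lambda>z. 1 / r ^ ?n * indicator ?Q z)"
 proof (rule square_integrable_scale)
  have "integrable lebesgue (indicat_real ?Q)"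
   by (rule integrable_real_indicator) (auto simp: emeasure_lborel_cbox_eq)
  moreover have "(\<lambda>z. (indicat_real ?Q z)^2) = indicator ?Q" by (auto simp: indicator_def)
  ultimately show "square_integrable (indicat_real ?Q)" unfolding square_integrable_def by simp
 qed
 have "L2_of (\<lambda>z. 1 / r ^ ?n * indicator ?Q z) \<bullet> L2_of \<phi> = (LINT z|lebesgue. 1 / r ^ ?n * indicator ?Q z * rep_L2 (L2_of \<phi>) z)"
  by (rule inner_L2_of[OF sq])
 also have "... = (LINT z|lebesgue. 1 / r ^ ?n * indicator ?Q z * \<phi> z)"
 proof (rule integral_cong_AE)
  have [measurable]: "?Q \<in> sets lebesgue" by simp
  note [measurable] = m
  show "(\<lambda>z. 1 / r ^ ?n * indicator ?Q z * rep_L2 (L2_of \<phi>) z) \<in> borel_measurable lebesgue"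
   "(\<lambda>z. 1 / r ^ ?n * indicator ?Q z * \<phi> z) \<in> borel_measurable lebesgue"
   by measurable
  show "AE z in lebesgue. 1 / r ^ ?n * indicator ?Q z * rep_L2 (L2_of \<phi>) z = 1 / r ^ ?n * indicator ?Q z * \<phi> z"
   using rep_L2_of[OF test_function_square_integrable[OF \<phi>]] by eventually_elim simp
 qed
 also have "... = (LINT z|lborel. 1 / r ^ ?n * indicator ?Q z * \<phi> z)"
  by (rule integral_completion) measurable
 also have "... = (LINT z|density (distr lborel borel (\<lambda>y. x + r *\<^sub>R y)) (\<lambda>_. ennreal (\<bar>r\<bar>^DIM('a))). 1 / r ^ ?n * indicator ?Q z * \<phi> z)"
  using lborel_affine[of r x] r by simp
 also have "... = (LINT y|lborel. \<bar>r\<bar> ^ ?n * (1 / r ^ ?n * indicator ?Q (x + r *\<^sub>R y) * \<phi> (x + r *\<^sub>R y)))"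
  by (subst integral_density) (auto simp: integral_distr)
 also have "... = (LINT y:cbox 0 One|lborel. \<phi> (x + r *\<^sub>R y))"
  unfolding set_lebesgue_integral_def using r
  by (intro Bochner_Integration.integral_cong) (auto simp: indicator_def mem_box algebra_simps zero_le_mult_iff)
 finally show ?thesis by (simp add: cube_avg_def)
qed

text \<open>A function is close in L^2 to its cube averages at a small side r, and these are
  Lipschitz, so on the bounded set they are controlled by their values on a finite net. Small values
  on the net therefore force a small norm. The bound 2 on the gradient norm is meant for differences
  of two elements of the unit ball.\<close>

lemma H10_finite_rank:
 fixes \<Omega> :: "'a::euclidean_space set"
 assumes "bounded \<Omega>" "open \<Omega>" "\<epsilon> > 0"
 shows "\<exists>Z \<eta>. finite Z \<and> \<eta> > 0 \<and> (\<forall>w\<in>H10 \<Omega>. grad_norm \<Omega> w \<le> 2 \<longrightarrow> (\<forall>z\<in>Z. \<bar>z \<bullet> w\<bar> \<le> \<eta>) \<longrightarrow> norm w \<le> \<epsilon>)"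
proof -
 let ?n = "DIM('a)" and ?\<mu> = "measure lborel \<Omega>"
 have n: "real ?n \<ge> 1" by (simp add: Suc_leI)
 have finO: "emeasure lborel \<Omega> < \<infinity>" using emeasure_bounded_finite[OF assms(1)] by simp
 have [measurable]: "\<Omega> \<in> sets borel" using assms(2) by simp
 \<comment> \<open>The three parameters keep three error terms at most \<epsilon>^2/3 each when the
   gradient norm is at most 2: r for the distance to the averages, \<delta> for their oscillation
   between net points, \<eta> for their values on the net.\<close>
 define r where "r = \<epsilon> / (5 * ?n)"
 have r: "r > 0" using assms n by (simp add: r_def)
 define \<delta> where "\<delta> = sqrt (\<epsilon>^2 * r ^ ?n / (48 * (?\<mu> + 1)))"
 define \<eta> where "\<eta> = sqrt (\<epsilon>^2 / (48 * (?\<mu> + 1)))"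
 have mu: "0 \<le> ?\<mu>" "0 < ?\<mu> + 1" by (auto simp: add_nonneg_pos)
 have \<delta>: "\<delta> > 0" "\<delta>^2 = \<epsilon>^2 * r ^ ?n / (48 * (?\<mu> + 1))" and \<eta>: "\<eta> > 0" "\<eta>^2 = \<epsilon>^2 / (48 * (?\<mu> + 1))"
  using r assms mu by (auto simp: \<delta>_def \<eta>_def)
 have "compact (closure \<Omega>)" using assms by (simp add: compact_closure)
 then obtain N where N: "finite N" "closure \<Omega> \<subseteq> (\<Union>x\<in>N. ball x \<delta>)"
  using compactE_image[of "closure \<Omega>" "closure \<Omega>" "\<lambda>x. ball x \<delta>"] \<delta>
  by (metis UN_I centre_in_ball open_ball subsetI)
 define \<zeta> where "\<zeta> x = L2_of (\<lambda>z. 1 / r ^ ?n * indicator (cbox x (x + r *\<^sub>R One)) z)" for x :: 'a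
 have test: "(norm (L2_of \<phi>))^2 \<le> 4 * ?\<mu> * M^2 + (4 * ?\<mu> * \<delta>^2 / r ^ ?n + 2 * ?n * r^2) * grad_int \<phi>"
  if \<phi>: "\<phi> \<in> test_functions \<Omega>" and M: "\<And>x. x \<in> N \<Longrightarrow> \<bar>\<zeta> x \<bullet> L2_of \<phi>\<bar> \<le> M" for \<phi> M
 proof -
  note sm = test_function_smooth[OF \<phi>]
  note [measurable] = smooth_measurable[OF sm] cube_avg_measurable[OF sm]
  let ?G = "grad_int \<phi>" and ?A = "cube_avg \<phi> r"
  obtain K where K: "K \<subseteq> \<Omega>" "\<And>x. x \<notin> K \<Longrightarrow> \<phi> x = 0"
   by (rule test_function_compact_support[OF \<phi>]) blast
  have A: "(?A x)^2 \<le> 2 * M^2 + 2 * (\<delta>^2 / r ^ ?n * ?G)" if "x \<in> \<Omega>" for x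
  proof -
   have "x \<in> closure \<Omega>" using that closure_subset by blast
   then obtain x' where "x' \<in> N" "x \<in> ball x' \<delta>" using N(2) by blast
   then have x': "x' \<in> N" "dist x' x < \<delta>" by auto
   have "ennreal ((?A x - ?A x')^2) \<le> ennreal ((norm (x - x'))^2 / r ^ ?n * ?G)"
    using cube_avg_lipschitz[OF sm r, of x x'] r unfolding nn_integral_test_function_power2[OF \<phi>]
    by (simp add: ennreal_mult[symmetric] grad_int_nonneg)
   then have "(?A x - ?A x')^2 \<le> (norm (x - x'))^2 / r ^ ?n * ?G"
    using r by (subst (asm) ennreal_le_iff) (auto simp: grad_int_nonneg)
   also have "... \<le> \<delta>^2 / r ^ ?n * ?G"
    using x'(2) r by (intro mult_right_mono divide_right_mono power_mono) (auto simp: grad_int_nonneg dist_norm norm_minus_commute)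
   finally have 1: "(?A x - ?A x')^2 \<le> \<delta>^2 / r ^ ?n * ?G" .
   have "\<bar>?A x'\<bar> \<le> M" using M[OF x'(1)] unfolding \<zeta>_def cube_avg_inner[OF \<phi> r, symmetric] .
   then have 2: "(?A x')^2 \<le> M^2" by (metis abs_ge_zero power2_abs power_mono)
   have "(?A x)^2 \<le> 2 * (?A x')^2 + 2 * (?A x - ?A x')^2"
    using zero_le_power2[of "?A x - 2 * ?A x'"] by (simp add: power2_eq_square algebra_simps)
   with 1 2 show ?thesis by linarith
  qed
  let ?B = "2 * M^2 + 2 * (\<delta>^2 / r ^ ?n * ?G)"
  have B0: "0 \<le> ?B" using r by (simp add: grad_int_nonneg)
  have "ennreal ((norm (L2_of \<phi>))^2) = (\<integral>\<^sup>+x. ennreal ((\<phi> x)^2) \<partial>lborel)"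
   by (rule nn_integral_test_function_power2[OF \<phi>, symmetric])
  also have "... \<le> (\<integral>\<^sup>+x. ennreal (2 * ?B) * indicator \<Omega> x + 2 * ennreal ((?A x - cube_avg \<phi> 0 x)^2) \<partial>lborel)"
  proof (rule nn_integral_mono)
   fix x
   show "ennreal ((\<phi> x)^2) \<le> ennreal (2 * ?B) * indicator \<Omega> x + 2 * ennreal ((?A x - cube_avg \<phi> 0 x)^2)"
   proof (cases "x \<in> \<Omega>")
    case True
    have "(\<phi> x)^2 \<le> 2 * (?A x)^2 + 2 * (?A x - \<phi> x)^2"
     using zero_le_power2[of "\<phi> x - 2 * ?A x"] by (simp add: power2_eq_square algebra_simps)
    also have "... \<le> 2 * ?B + 2 * (?A x - \<phi> x)^2"
     by (intro add_right_mono mult_left_mono A[OF True]) simp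
    finally have "(\<phi> x)^2 \<le> 2 * ?B + 2 * (?A x - \<phi> x)^2" .
    then have "ennreal ((\<phi> x)^2) \<le> ennreal (2 * ?B + 2 * (?A x - \<phi> x)^2)" by (rule ennreal_leI)
    also have "... = ennreal (2 * ?B) + 2 * ennreal ((?A x - \<phi> x)^2)"
     using B0 by (subst ennreal_plus) (auto simp: ennreal_mult)
    finally show ?thesis using True by (simp add: cube_avg_0)
   next
    case False
    then have "\<phi> x = 0" using K by blast
    then show ?thesis by simp
   qed
  qed
  also have "... = (\<integral>\<^sup>+x. ennreal (2 * ?B) * indicator \<Omega> x \<partial>lborel) + (\<integral>\<^sup>+x. 2 * ennreal ((?A x - cube_avg \<phi> 0 x)^2) \<partial>lborel)"
   by (rule nn_integral_add) measurable
  also have "(\<integral>\<^sup>+x. ennreal (2 * ?B) * indicator \<Omega> x \<partial>lborel) = ennreal (2 * ?B) * emeasure lborel \<Omega>"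
   by (rule nn_integral_cmult_indicator) simp
  also have "... = ennreal (2 * ?B * ?\<mu>)"
   using finO B0 by (subst emeasure_eq_ennreal_measure) (auto simp: ennreal_mult)
  also have "(\<integral>\<^sup>+x. 2 * ennreal ((?A x - cube_avg \<phi> 0 x)^2) \<partial>lborel) = 2 * (\<integral>\<^sup>+x. ennreal ((?A x - cube_avg \<phi> 0 x)^2) \<partial>lborel)"
   by (rule nn_integral_cmult) measurable
  also have "... \<le> 2 * (ennreal ((r - 0)^2 * ?n) * ennreal ?G)"
   using cube_avg_difference_L2[OF sm, of 0 r] r unfolding nn_integral_test_function_power2[OF \<phi>]
   by (intro mult_left_mono) auto
  also have "ennreal (2 * ?B * ?\<mu>) + ... = ennreal (2 * ?B * ?\<mu> + 2 * (r^2 * ?n * ?G))"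
   using B0 by (subst ennreal_plus) (auto simp: ennreal_mult grad_int_nonneg)
  finally have "ennreal ((norm (L2_of \<phi>))^2) \<le> ennreal (2 * ?B * ?\<mu> + 2 * (r^2 * ?n * ?G))" by (simp add: add_left_mono)
  then have "(norm (L2_of \<phi>))^2 \<le> 2 * ?B * ?\<mu> + 2 * (r^2 * ?n * ?G)"
   using B0 by (subst (asm) ennreal_le_iff) (auto simp: grad_int_nonneg)
  then show ?thesis by (simp add: algebra_simps)
 qed
 have "norm w \<le> \<epsilon>" if w: "w \<in> H10 \<Omega>" "grad_norm \<Omega> w \<le> 2" and small: "\<forall>z\<in>\<zeta> ` N. \<bar>z \<bullet> w\<bar> \<le> \<eta>" for w
 proof -
  obtain \<phi> where \<phi>: "\<And>k::nat. \<phi> k \<in> test_functions \<Omega>" "(\<lambda>k. L2_of (\<phi> k)) \<longlonglongrightarrow> w"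
   "(\<lambda>k. grad_int (\<phi> k)) \<longlonglongrightarrow> (grad_norm \<Omega> w)^2" using H10_approximation[OF w(1)] by blast
  have "\<forall>\<^sub>F k in sequentially. \<forall>x\<in>N. \<bar>\<zeta> x \<bullet> L2_of (\<phi> k)\<bar> < 2 * \<eta>"
  proof (intro eventually_ball_finite N(1) ballI)
   \<comment> \<open>The bound \<eta> holds for the limit \<open>w\<close>; the approximants satisfy
     it only eventually and with the relaxed constant 2 \<eta>.\<close>
   fix x assume "x \<in> N"
   then have "\<bar>\<zeta> x \<bullet> w\<bar> < 2 * \<eta>" using small \<eta>(1) by fastforce
   moreover have "(\<lambda>k. \<bar>\<zeta> x \<bullet> L2_of (\<phi> k)\<bar>) \<longlonglongrightarrow> \<bar>\<zeta> x \<bullet> w\<bar>" by (intro tendsto_intros \<phi>)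
   ultimately show "\<forall>\<^sub>F k in sequentially. \<bar>\<zeta> x \<bullet> L2_of (\<phi> k)\<bar> < 2 * \<eta>" by (rule order_tendstoD(2)[rotated])
  qed
  then have ev: "\<forall>\<^sub>F k in sequentially. (norm (L2_of (\<phi> k)))^2 \<le> 4 * ?\<mu> * (2 * \<eta>)^2 + (4 * ?\<mu> * \<delta>^2 / r ^ ?n + 2 * ?n * r^2) * grad_int (\<phi> k)"
   by eventually_elim (rule test[OF \<phi>(1)], simp add: less_imp_le)
  have "(norm w)^2 \<le> 4 * ?\<mu> * (2 * \<eta>)^2 + (4 * ?\<mu> * \<delta>^2 / r ^ ?n + 2 * ?n * r^2) * (grad_norm \<Omega> w)^2"
   by (rule tendsto_le[OF _ tendsto_add[OF tendsto_const tendsto_mult[OF tendsto_const \<phi>(3)]] tendsto_power[OF tendsto_norm[OF \<phi>(2)]] ev]) simp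
  also have "... \<le> 4 * ?\<mu> * (2 * \<eta>)^2 + (4 * ?\<mu> * \<delta>^2 / r ^ ?n + 2 * ?n * r^2) * 2^2"
   using w(2) r mu by (intro add_left_mono mult_left_mono power_mono) (auto simp: grad_norm_nonneg)
  also have "... \<le> \<epsilon>^2"
  proof -
   have "?\<mu> / (?\<mu> + 1) \<le> 1" using mu by simp
   then have *: "\<epsilon>^2 * (?\<mu> / (?\<mu> + 1)) \<le> \<epsilon>^2 * 1" by (rule mult_left_mono) simp
   have 1: "4 * ?\<mu> * (2 * \<eta>)^2 \<le> \<epsilon>^2 / 3" using * mu unfolding power_mult_distrib \<eta>(2) by (simp add: field_simps)
   have "4 * ?\<mu> * \<delta>^2 / r ^ ?n * 2^2 = \<epsilon>^2 * (?\<mu> / (?\<mu> + 1)) / 3"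
    using r mu unfolding \<delta>(2) by (simp add: divide_simps)
   then have 2: "4 * ?\<mu> * \<delta>^2 / r ^ ?n * 2^2 \<le> \<epsilon>^2 / 3"
    by (rule ord_eq_le_trans) (use divide_right_mono[OF *, of 3] in simp)
   have "2 * ?n * r^2 * 2^2 = \<epsilon>^2 * (8 / (25 * ?n))" using n by (simp add: r_def power2_eq_square field_simps)
   also have "... \<le> \<epsilon>^2 * (1 / 3)"
   proof -
    have "8 / (25 * x) \<le> 1 / 3" if "x \<ge> 1" for x :: real using that by (simp add: field_simps)
    from mult_left_mono[OF this[OF n], of "\<epsilon>^2"] show ?thesis by simp
   qed
   finally have 3: "2 * ?n * r^2 * 2^2 \<le> \<epsilon>^2 / 3" by simp
   show ?thesis unfolding distrib_right using 1 2 3 by linarith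
  qed
  finally show ?thesis using assms(3) by (intro power2_le_imp_le[of "norm w" \<epsilon>]) auto
 qed
 then show ?thesis using N(1) \<eta>(1) by (intro exI[of _ "\<zeta> ` N"] exI[of _ \<eta>]) auto
qed

text \<open>Rounding the finitely many numbers z \<bullet> u / \<eta> down to integers gives a label
  with finitely many values on the unit ball; equal labels mean pairings within \<eta>, hence a
  small difference. A labelling, unlike a net, lets separated sets be counted by
  injectivity.\<close>

lemma H10_totally_bounded:
 fixes \<Omega> :: "'a::euclidean_space set"
 assumes "bounded \<Omega>" "open \<Omega>" "\<epsilon> > 0"
 shows "\<exists>\<kappa> :: 'a L2 \<Rightarrow> 'a L2 \<Rightarrow> int. finite (\<kappa> ` {u \<in> H10 \<Omega>. grad_norm \<Omega> u \<le> 1}) \<and>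
  (\<forall>u\<in>H10 \<Omega>. \<forall>v\<in>H10 \<Omega>. grad_norm \<Omega> u \<le> 1 \<longrightarrow> grad_norm \<Omega> v \<le> 1 \<longrightarrow> \<kappa> u = \<kappa> v \<longrightarrow> norm (u - v) \<le> \<epsilon>)"
proof -
 obtain Z \<eta> where Z: "finite Z" "\<eta> > 0"
  "\<And>w. w \<in> H10 \<Omega> \<Longrightarrow> grad_norm \<Omega> w \<le> 2 \<Longrightarrow> (\<And>z. z \<in> Z \<Longrightarrow> \<bar>z \<bullet> w\<bar> \<le> \<eta>) \<Longrightarrow> norm w \<le> \<epsilon>"
  using H10_finite_rank[OF assms] by metis
 obtain C where C: "C > 0" "\<And>u. u \<in> H10 \<Omega> \<Longrightarrow> norm u \<le> C * grad_norm \<Omega> u"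
  using H10_poincare[OF assms(1)] by blast
 define \<kappa> :: "'a L2 \<Rightarrow> 'a L2 \<Rightarrow> int" where "\<kappa> u = (\<lambda>z. if z \<in> Z then \<lfloor>z \<bullet> u / \<eta>\<rfloor> else 0)" for u
 obtain B where B: "\<And>z. z \<in> Z \<Longrightarrow> norm z \<le> B" using finite_imp_bounded[OF Z(1)] by (auto simp: bounded_iff)
 define k where "k = \<lceil>B * C / \<eta>\<rceil> + 1"
 have "\<kappa> u z \<in> {-k..k}" if "u \<in> H10 \<Omega>" "grad_norm \<Omega> u \<le> 1" "z \<in> Z" for u z
 proof -
  have "norm u \<le> C * 1" using C(2)[OF that(1)] mult_left_mono[OF that(2), of C] C(1) by linarith
  then have "norm z * norm u \<le> B * C" using B[OF that(3)] by (intro mult_mono) (auto intro: order_trans[OF norm_ge_zero])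
  then have "\<bar>z \<bullet> u\<bar> \<le> B * C" using Cauchy_Schwarz_ineq2[of z u] by linarith
  then have "\<bar>z \<bullet> u / \<eta>\<bar> \<le> B * C / \<eta>" using Z(2) by (simp add: abs_divide divide_right_mono)
  then have "- k \<le> \<lfloor>z \<bullet> u / \<eta>\<rfloor> \<and> \<lfloor>z \<bullet> u / \<eta>\<rfloor> \<le> k" unfolding k_def by linarith
  then show ?thesis using that(3) by (simp add: \<kappa>_def)
 qed
 then have "\<kappa> ` {u \<in> H10 \<Omega>. grad_norm \<Omega> u \<le> 1} \<subseteq> {f. \<forall>x. (x \<in> Z \<longrightarrow> f x \<in> {-k..k}) \<and> (x \<notin> Z \<longrightarrow> f x = 0)}"
  by (auto simp: \<kappa>_def)
 moreover have "finite {f. \<forall>x. (x \<in> Z \<longrightarrow> f x \<in> {-k..k}) \<and> (x \<notin> Z \<longrightarrow> f x = (0::int))}"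
  using Z(1) by (intro finite_set_of_finite_funs) auto
 ultimately have "finite (\<kappa> ` {u \<in> H10 \<Omega>. grad_norm \<Omega> u \<le> 1})" by (rule finite_subset)
 moreover have "norm (u - v) \<le> \<epsilon>"
  if uv: "u \<in> H10 \<Omega>" "v \<in> H10 \<Omega>" "grad_norm \<Omega> u \<le> 1" "grad_norm \<Omega> v \<le> 1" and eq: "\<kappa> u = \<kappa> v" for u v
 proof (rule Z(3))
  have mv: "(-1) *\<^sub>R v \<in> H10 \<Omega>" using uv subspace_H10[OF assms(2)] by (simp add: subspace_neg)
  show "u - v \<in> H10 \<Omega>" using uv subspace_H10[OF assms(2)] by (simp add: subspace_diff)
  show "grad_norm \<Omega> (u - v) \<le> 2"
   using grad_norm_triangle[OF assms(2) uv(1) mv] grad_norm_scaleR[OF assms(2) uv(2), of "-1"] uv by simp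
  show "\<bar>z \<bullet> (u - v)\<bar> \<le> \<eta>" if "z \<in> Z" for z
  proof -
   have "\<lfloor>z \<bullet> u / \<eta>\<rfloor> = \<lfloor>z \<bullet> v / \<eta>\<rfloor>" using fun_cong[OF eq, of z] that by (simp add: \<kappa>_def)
   then have "\<bar>z \<bullet> u / \<eta> - z \<bullet> v / \<eta>\<bar> \<le> 1" by linarith
   then have "\<bar>z \<bullet> (u - v) / \<eta>\<bar> \<le> 1" by (simp add: inner_diff_right diff_divide_distrib)
   then show ?thesis using Z(2) by (simp add: abs_divide)
  qed
 qed
 ultimately show ?thesis by blast
qed

subsection \<open>Weak time derivatives\<close>

lemmas hk_integral_add = Henstock_Kurzweil_Integration.integral_add
lemmas hk_integral_combine = Henstock_Kurzweil_Integration.integral_combine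
lemmas hk_integral_cong = Henstock_Kurzweil_Integration.integral_cong
lemmas hk_integral_diff = Henstock_Kurzweil_Integration.integral_diff
lemmas hk_integral_divide = Henstock_Kurzweil_Integration.integral_divide
lemmas hk_integral_mult_right = Henstock_Kurzweil_Integration.integral_mult_right
lemmas hk_integral_nonneg = Henstock_Kurzweil_Integration.integral_nonneg
lemmas hk_integral_reflect_real = Henstock_Kurzweil_Integration.integral_reflect_real
lemmas hk_integral_sum = Henstock_Kurzweil_Integration.integral_sum

text \<open>\<open>D k\<close> is a nonnegative kernel whose total mass \<eta> k c tends to 1. Its
  mass away from s tends to 0, because \<eta> k already tends to 1 at every point to the right of
  s.\<close>

lemma delta_sequence_left:
 fixes Z :: "real \<Rightarrow> real"
 assumes sc: "s < c" and Z: "continuous_on {s..c} Z"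
  and deriv: "\<And>k x. x \<in> {s..c} \<Longrightarrow> (\<eta> k has_real_derivative D k x) (at x)"
  and contD: "\<And>k. continuous_on {s..c} (D k)"
  and Dpos: "\<And>k x. x \<in> {s..c} \<Longrightarrow> 0 \<le> D k x"
  and \<eta>0: "\<And>k. \<eta> k s = 0" and \<eta>1: "\<And>x. x \<in> {s<..c} \<Longrightarrow> (\<lambda>k. \<eta> k x) \<longlonglongrightarrow> 1"
 shows "(\<lambda>k::nat. integral {s..c} (\<lambda>x. Z x * D k x)) \<longlonglongrightarrow> Z s"
proof -
 have FTC: "integral {a..b} (D k) = \<eta> k b - \<eta> k a" if "s \<le> a" "a \<le> b" "b \<le> c" for a b k
 proof -
  have "(D k has_integral \<eta> k b - \<eta> k a) {a..b}"
   using that deriv by (intro fundamental_theorem_of_calculus)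
    (auto simp: has_real_derivative_iff_has_vector_derivative[symmetric] intro: has_field_derivative_at_within)
  then show ?thesis by (rule integral_unique)
 qed
 have Dint: "D k integrable_on {a..b}" if "s \<le> a" "b \<le> c" for k a b
  using continuous_on_subset[OF contD] that by (intro integrable_continuous_real) auto
 have ZDint: "(\<lambda>x. (Z x - Z s) * D k x) integrable_on {a..b}" if "s \<le> a" "b \<le> c" for k a b
  using continuous_on_subset[OF contD] continuous_on_subset[OF Z] that
  by (intro integrable_continuous_real continuous_intros) auto
 obtain B where B: "\<And>x. x \<in> {s..c} \<Longrightarrow> \<bar>Z x - Z s\<bar> \<le> B" "B \<ge> 0"
 proof -
  have "bounded ((\<lambda>x. Z x - Z s) ` {s..c})"
   by (intro compact_imp_bounded compact_continuous_image continuous_intros Z) simp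
  then obtain B where B: "\<forall>x\<in>{s..c}. \<bar>Z x - Z s\<bar> \<le> B" by (auto simp: bounded_iff)
  show ?thesis by (rule that[of "max B 0"]) (use B in \<open>auto simp: le_max_iff_disj\<close>)
 qed
 have "(\<lambda>k. integral {s..c} (\<lambda>x. (Z x - Z s) * D k x)) \<longlonglongrightarrow> 0"
 proof (rule LIMSEQ_I)
  fix e :: real assume "e > 0"
  define \<epsilon> where "\<epsilon> = e / 4"
  have "\<epsilon> > 0" using \<open>e > 0\<close> by (simp add: \<epsilon>_def)
  then obtain \<delta> where \<delta>: "\<delta> > 0" "\<And>x. x \<in> {s..c} \<Longrightarrow> dist x s < \<delta> \<Longrightarrow> dist (Z x) (Z s) < \<epsilon>"
   using Z sc unfolding continuous_on_iff by (metis atLeastAtMost_iff less_imp_le order_refl)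
  \<comment> \<open>To the left of d the function varies by at most \<epsilon>; to the right of d
    the kernel has mass \<eta> k c - \<eta> k d, which tends to 0.\<close>
  define d where "d = min c (s + \<delta> / 2)"
  have d: "s < d" "d \<le> c" using sc \<delta> by (auto simp: d_def)
  have near: "\<bar>Z x - Z s\<bar> \<le> \<epsilon>" if "x \<in> {s..d}" for x
   using \<delta>(2)[of x] that \<delta>(1) by (force simp: d_def dist_real_def)
  have bound: "norm (integral {s..c} (\<lambda>x. (Z x - Z s) * D k x)) \<le> \<epsilon> * \<eta> k d + B * (\<eta> k c - \<eta> k d)" for k
  proof -
   have "norm (integral {s..d} (\<lambda>x. (Z x - Z s) * D k x)) \<le> integral {s..d} (\<lambda>x. \<epsilon> * D k x)"
    using d near Dpos Dint ZDint
    by (intro integral_norm_bound_integral integrable_on_mult_right) (auto simp: abs_mult intro!: mult_right_mono)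
   also have "... = \<epsilon> * \<eta> k d" using FTC[of s d k] d by (simp add: \<eta>0)
   finally have 1: "norm (integral {s..d} (\<lambda>x. (Z x - Z s) * D k x)) \<le> \<epsilon> * \<eta> k d" .
   have "norm (integral {d..c} (\<lambda>x. (Z x - Z s) * D k x)) \<le> integral {d..c} (\<lambda>x. B * D k x)"
    using d B Dpos Dint ZDint
    by (intro integral_norm_bound_integral integrable_on_mult_right) (auto simp: abs_mult intro!: mult_right_mono)
   also have "... = B * (\<eta> k c - \<eta> k d)" using FTC[of d c k] d by simp
   finally have 2: "norm (integral {d..c} (\<lambda>x. (Z x - Z s) * D k x)) \<le> B * (\<eta> k c - \<eta> k d)" .
   have "integral {s..c} (\<lambda>x. (Z x - Z s) * D k x) = integral {s..d} (\<lambda>x. (Z x - Z s) * D k x) + integral {d..c} (\<lambda>x. (Z x - Z s) * D k x)"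
    using d ZDint by (intro hk_integral_combine[symmetric]) auto
   then show ?thesis using norm_triangle_mono[OF 1 2] by simp
  qed
  have "(\<lambda>k. \<epsilon> * \<eta> k d + B * (\<eta> k c - \<eta> k d)) \<longlonglongrightarrow> \<epsilon> * 1 + B * (1 - 1)"
   using d sc by (intro tendsto_intros \<eta>1) auto
  then have "\<forall>\<^sub>F k in sequentially. \<epsilon> * \<eta> k d + B * (\<eta> k c - \<eta> k d) < e"
   by (rule order_tendstoD(2)) (use \<open>e > 0\<close> in \<open>simp add: \<epsilon>_def\<close>)
  then obtain N where N: "\<And>k. k \<ge> N \<Longrightarrow> \<epsilon> * \<eta> k d + B * (\<eta> k c - \<eta> k d) < e" by (auto simp: eventually_sequentially)
  show "\<exists>no. \<forall>n\<ge>no. norm (integral {s..c} (\<lambda>x. (Z x - Z s) * D n x) - 0) < e"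
  proof (intro exI[of _ N] allI impI)
   fix n assume "N \<le> n"
   then show "norm (integral {s..c} (\<lambda>x. (Z x - Z s) * D n x) - 0) < e"
    using le_less_trans[OF bound N] by simp
  qed
 qed
 moreover have "(\<lambda>k. Z s * \<eta> k c) \<longlonglongrightarrow> Z s * 1" using sc by (intro tendsto_intros \<eta>1) auto
 ultimately have "(\<lambda>k. integral {s..c} (\<lambda>x. (Z x - Z s) * D k x) + Z s * \<eta> k c) \<longlonglongrightarrow> 0 + Z s * 1"
  by (rule tendsto_add)
 moreover have "integral {s..c} (\<lambda>x. Z x * D k x) = integral {s..c} (\<lambda>x. (Z x - Z s) * D k x) + Z s * \<eta> k c" for k
 proof -
  have "integral {s..c} (\<lambda>x. Z x * D k x) = integral {s..c} (\<lambda>x. (Z x - Z s) * D k x + Z s * D k x)"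
   by (simp add: algebra_simps)
  also have "... = integral {s..c} (\<lambda>x. (Z x - Z s) * D k x) + integral {s..c} (\<lambda>x. Z s * D k x)"
   by (rule hk_integral_add) (use ZDint Dint in \<open>auto intro!: integrable_on_mult_right\<close>)
  finally show ?thesis using FTC[of s c k] sc by (simp add: \<eta>0)
 qed
 ultimately show ?thesis by simp
qed

text \<open>The mirror image of the previous kernel; the derivatives are now nonpositive, which
  accounts for the sign of the limit.\<close>

lemma delta_sequence_right:
 fixes Z :: "real \<Rightarrow> real"
 assumes sc: "c < t" and Z: "continuous_on {c..t} Z"
  and deriv: "\<And>k x. x \<in> {c..t} \<Longrightarrow> (\<eta> k has_real_derivative D k x) (at x)"
  and contD: "\<And>k. continuous_on {c..t} (D k)"
  and Dneg: "\<And>k x. x \<in> {c..t} \<Longrightarrow> D k x \<le> 0"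
  and \<eta>0: "\<And>k. \<eta> k t = 0" and \<eta>1: "\<And>x. x \<in> {c..<t} \<Longrightarrow> (\<lambda>k. \<eta> k x) \<longlonglongrightarrow> 1"
 shows "(\<lambda>k::nat. integral {c..t} (\<lambda>x. Z x * D k x)) \<longlonglongrightarrow> - Z t"
proof -
 have "(\<lambda>k. integral {-t..-c} (\<lambda>x. Z (- x) * (- D k (- x)))) \<longlonglongrightarrow> Z (- (- t))"
 proof (rule delta_sequence_left[where \<eta>="\<lambda>k x. \<eta> k (- x)"])
  show "continuous_on {-t..-c} (\<lambda>x. Z (- x))"
   by (rule continuous_on_compose2[OF Z]) (auto intro!: continuous_intros)
  show "continuous_on {-t..-c} (\<lambda>x. - D k (- x))" for k
   by (intro continuous_on_minus continuous_on_compose2[OF contD]) (auto intro!: continuous_intros)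
  show "((\<lambda>x. \<eta> k (- x)) has_real_derivative - D k (- x)) (at x)" if "x \<in> {- t..- c}" for k x
  proof -
   have "(\<eta> k has_real_derivative D k (- x)) (at (- x))" by (rule deriv) (use that in auto)
   then show ?thesis using DERIV_chain2[of "\<eta> k" "D k (- x)" "\<lambda>x. - x" x "-1"]
    by (simp add: DERIV_minus)
  qed
 qed (use sc Dneg \<eta>0 \<eta>1 in auto)
 moreover have "integral {-t..-c} (\<lambda>x. Z (- x) * (- D k (- x))) = - integral {c..t} (\<lambda>x. Z x * D k x)" for k
  using hk_integral_reflect_real[of t c "\<lambda>x. Z x * D k x"] by simp
 ultimately have "(\<lambda>k. - integral {c..t} (\<lambda>x. Z x * D k x)) \<longlonglongrightarrow> Z t" by simp
 from tendsto_minus[OF this] show ?thesis by simp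
qed

definition expinv_deriv :: "real \<Rightarrow> real" where
 "expinv_deriv = expinv (monom 1 2 * (1 - pderiv 1))"

lemma expinv_deriv_eq: "expinv_deriv u = (if u > 0 then (1 / u)^2 * expinv 1 u else 0)"
 by (simp add: expinv_deriv_def expinv_def poly_monom)

lemma expinv_1_deriv: "(expinv 1 has_real_derivative expinv_deriv u) (at u)"
 unfolding expinv_deriv_def by (rule expinv_has_derivative)

lemma continuous_expinv: "continuous_on S (expinv p)"
 using expinv_has_derivative by (intro continuous_at_imp_continuous_on) (meson DERIV_isCont)

lemma box_bump_real: "box_bump a b k x = expinv 1 (real (Suc k) * (x - a)) * expinv 1 (real (Suc k) * (b - x))"
 for a b x :: real
 by (simp add: box_bump_def)

definition box_bump_deriv :: "real \<Rightarrow> real \<Rightarrow> nat \<Rightarrow> real \<Rightarrow> real" where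
 "box_bump_deriv a b k x = real (Suc k) * (expinv_deriv (real (Suc k) * (x - a)) * expinv 1 (real (Suc k) * (b - x))
   - expinv 1 (real (Suc k) * (x - a)) * expinv_deriv (real (Suc k) * (b - x)))"

lemma box_bump_has_derivative:
 fixes a b :: real
 shows "(box_bump a b k has_real_derivative box_bump_deriv a b k x) (at x)"
proof -
 have 1: "((\<lambda>x. expinv 1 (real (Suc k) * (x - a))) has_real_derivative expinv_deriv (real (Suc k) * (x - a)) * real (Suc k)) (at x)"
  by (rule DERIV_chain2[OF expinv_1_deriv]) (auto intro!: derivative_eq_intros)
 have 2: "((\<lambda>x. expinv 1 (real (Suc k) * (b - x))) has_real_derivative expinv_deriv (real (Suc k) * (b - x)) * - real (Suc k)) (at x)"
  by (rule DERIV_chain2[OF expinv_1_deriv]) (auto intro!: derivative_eq_intros)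
 show ?thesis
  using DERIV_mult[OF 1 2] unfolding box_bump_real[abs_def] box_bump_deriv_def
  by (rule DERIV_cong) (simp add: algebra_simps)
qed

lemma continuous_box_bump_deriv: "continuous_on S (box_bump_deriv a b k)"
 unfolding box_bump_deriv_def[abs_def] expinv_deriv_def
 by (intro continuous_intros continuous_on_compose2[OF continuous_expinv[of UNIV]]) auto

text \<open>The logarithmic derivative of the bump is proportional to 1/u^2 - 1/v^2, with u and v
  the scaled distances to the two endpoints. The bump therefore rises up to the midpoint and falls
  after it, and each half is a kernel of the kind treated above.\<close>

lemma box_bump_deriv_sign:
 assumes "s < t"
 shows "x \<in> {s..(s + t) / 2} \<Longrightarrow> 0 \<le> box_bump_deriv s t k x"
  and "x \<in> {(s + t) / 2..t} \<Longrightarrow> box_bump_deriv s t k x \<le> 0"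
proof -
 let ?u = "real (Suc k) * (x - s)" and ?v = "real (Suc k) * (t - x)"
 have eq: "box_bump_deriv s t k x = real (Suc k) * (expinv 1 ?u * expinv 1 ?v * ((1 / ?u)^2 - (1 / ?v)^2))"
  if "s < x" "x < t"
  using that unfolding box_bump_deriv_def expinv_deriv_eq by (simp add: algebra_simps del: of_nat_Suc)
 have edge: "box_bump_deriv s t k x = 0" if "x = s \<or> x = t"
  using that unfolding box_bump_deriv_def expinv_deriv_eq by (auto simp: expinv_1_eq_0_iff)
 show "0 \<le> box_bump_deriv s t k x" if x: "x \<in> {s..(s + t) / 2}"
 proof (cases "x = s")
  case False
  then have "s < x" "x < t" "x - s \<le> t - x" using x assms by auto
  then have "1 / ?v \<le> 1 / ?u" "0 \<le> 1 / ?v" by (auto intro!: divide_left_mono mult_left_mono mult_pos_pos simp del: of_nat_Suc)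
  then have "(1 / ?v)^2 \<le> (1 / ?u)^2" by (rule power_mono)
  then show ?thesis unfolding eq[OF \<open>s < x\<close> \<open>x < t\<close>] by (intro mult_nonneg_nonneg expinv_1_bounds) auto
 qed (use edge in simp)
 show "box_bump_deriv s t k x \<le> 0" if x: "x \<in> {(s + t) / 2..t}"
 proof (cases "x = t")
  case False
  then have "s < x" "x < t" "t - x \<le> x - s" using x assms by auto
  then have "1 / ?u \<le> 1 / ?v" "0 \<le> 1 / ?u" by (auto intro!: divide_left_mono mult_left_mono mult_pos_pos simp del: of_nat_Suc)
  then have "(1 / ?u)^2 \<le> (1 / ?v)^2" by (rule power_mono)
  then have "0 \<le> real (Suc k) * (expinv 1 ?u * expinv 1 ?v * ((1 / ?v)^2 - (1 / ?u)^2))"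
   by (intro mult_nonneg_nonneg expinv_1_bounds) auto
  then show ?thesis unfolding eq[OF \<open>s < x\<close> \<open>x < t\<close>] by (simp add: algebra_simps del: of_nat_Suc)
 qed (use edge in simp)
qed

lemma abs_integrable_subinterval:
 fixes f :: "real \<Rightarrow> real"
 assumes "f absolutely_integrable_on {a..b}" "a \<le> c" "d \<le> b"
 shows "f absolutely_integrable_on {c..d}"
 using assms by (intro set_integrable_subset[OF assms(1)]) auto

text \<open>The weak equation is tested with the bumps of the interval (s,t): one side converges to
  Z s - Z t, the other to minus the integral of q. These bumps are admissible for 0 < s and t <
  \<tau>; s = 0 follows by continuity, and the right end of an interval is reached by applying the
  lemma on a longer one.\<close>

lemma weak_derivative_integral:
 fixes Z q :: "real \<Rightarrow> real"
 assumes weak: "has_weak_partial {0<..<\<tau>} 1 Z q" and Z: "continuous_on {0..\<tau>} Z"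
  and q: "q absolutely_integrable_on {0..\<tau>}" and st: "0 \<le> s" "s \<le> t" "t < \<tau>"
 shows "Z t - Z s = integral {s..t} q"
proof -
 have pos: "Z t - Z s = integral {s..t} q" if st: "0 < s" "s < t" "t < \<tau>" for s t
 proof -
  let ?\<eta> = "box_bump s t" and ?D = "box_bump_deriv s t"
  define c where "c = (s + t) / 2"
  have c: "s < c" "c < t" using st by (auto simp: c_def)
  have Zst: "continuous_on {a..b} Z" if "s \<le> a" "b \<le> t" for a b
   using that st by (intro continuous_on_subset[OF Z]) auto
  have "cbox s t \<subseteq> {0<..<\<tau>}" using st by auto
  then have tf: "?\<eta> k \<in> test_functions {0<..<\<tau>}" for k by (rule box_bump_test_function)
  have pd: "partial_deriv 1 (?\<eta> k) x = ?D k x" for k x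
   using partial_deriv_eq[OF box_bump_has_derivative[unfolded has_field_derivative_def]] by simp
  have outside: "?\<eta> k x = 0" "?D k x = 0" if "x \<notin> {s..t}" for k x
   using that by (auto simp: box_bump_eq_0_iff box_bump_deriv_def expinv_deriv_eq expinv_1_eq_0_iff mult_le_0_iff
     zero_less_mult_iff not_le simp del: of_nat_Suc)
  have lim1: "(\<lambda>k. ?\<eta> k x) \<longlonglongrightarrow> 1" if "s < x" "x < t" for x
   using box_bump_tendsto[of s t x] that by simp
  have L: "(LINT x:{0<..<\<tau>}|lebesgue. Z x * partial_deriv 1 (?\<eta> k) x) = integral {s..t} (\<lambda>x. Z x * ?D k x)" for k
  proof -
   have "(LINT x:{0<..<\<tau>}|lebesgue. Z x * partial_deriv 1 (?\<eta> k) x) = (LINT x:{s..t}|lebesgue. Z x * ?D k x)"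
    unfolding set_lebesgue_integral_def pd using st outside
    by (intro Bochner_Integration.integral_cong) (auto simp: indicator_def)
   also have "... = integral {s..t} (\<lambda>x. Z x * ?D k x)"
    by (intro set_lebesgue_integral_eq_integral absolutely_integrable_continuous_real continuous_intros Zst continuous_box_bump_deriv) auto
   finally show ?thesis .
  qed
  have "(\<lambda>k. integral {s..c} (\<lambda>x. Z x * ?D k x) + integral {c..t} (\<lambda>x. Z x * ?D k x)) \<longlonglongrightarrow> Z s + - Z t"
  proof (rule tendsto_add)
   show "(\<lambda>k. integral {s..c} (\<lambda>x. Z x * ?D k x)) \<longlonglongrightarrow> Z s"
    by (rule delta_sequence_left[where \<eta>="?\<eta>"])
     (use c lim1 box_bump_deriv_sign(1)[of s t] in \<open>auto simp: c_def box_bump_eq_0_iff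
      intro!: Zst box_bump_has_derivative continuous_box_bump_deriv\<close>)
   show "(\<lambda>k. integral {c..t} (\<lambda>x. Z x * ?D k x)) \<longlonglongrightarrow> - Z t"
    by (rule delta_sequence_right[where \<eta>="?\<eta>"])
     (use c lim1 box_bump_deriv_sign(2)[of s t] in \<open>auto simp: c_def box_bump_eq_0_iff
      intro!: Zst box_bump_has_derivative continuous_box_bump_deriv\<close>)
  qed
  moreover have "integral {s..c} (\<lambda>x. Z x * ?D k x) + integral {c..t} (\<lambda>x. Z x * ?D k x) = integral {s..t} (\<lambda>x. Z x * ?D k x)" for k
   by (rule hk_integral_combine) (use c in \<open>auto intro!: integrable_continuous_real continuous_intros Zst continuous_box_bump_deriv\<close>)
  ultimately have 1: "(\<lambda>k. integral {s..t} (\<lambda>x. Z x * ?D k x)) \<longlonglongrightarrow> Z s - Z t" by simp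
  have qst: "set_integrable lebesgue {s..t} q" using st by (intro abs_integrable_subinterval[OF q]) auto
  have "(\<lambda>k. LINT x:{0<..<\<tau>}|lebesgue. q x * ?\<eta> k x) \<longlonglongrightarrow> (LINT x:{s..t}|lebesgue. q x)"
   unfolding set_lebesgue_integral_def
  proof (rule integral_dominated_convergence[where w="\<lambda>x. norm (indicator {s..t} x *\<^sub>R q x)"])
   have eq: "indicator {0<..<\<tau>} x *\<^sub>R (q x * ?\<eta> k x) = (indicator {s..t} x *\<^sub>R q x) * ?\<eta> k x" for x k
    using st outside by (auto simp: indicator_def)
   have m: "?\<eta> k \<in> borel_measurable lebesgue" for k
    by (rule measurable_completion) (simp add: smooth_measurable[OF smooth_box_bump])
   show "(\<lambda>x. indicator {0<..<\<tau>} x *\<^sub>R (q x * ?\<eta> k x)) \<in> borel_measurable lebesgue" for k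
    unfolding eq using qst m[of k] by (intro borel_measurable_times) (auto simp: set_integrable_def)
   show "AE x in lebesgue. norm (indicator {0<..<\<tau>} x *\<^sub>R (q x * ?\<eta> k x)) \<le> norm (indicator {s..t} x *\<^sub>R q x)" for k
    unfolding eq using box_bump_bounds[of s t k] by (auto simp: abs_mult mult_left_le)
   show "integrable lebesgue (\<lambda>x. norm (indicator {s..t} x *\<^sub>R q x))"
    using qst by (intro integrable_norm) (simp add: set_integrable_def)
   have "AE x in lebesgue. x \<notin> {s, t}"
    by (intro AE_not_in) (auto simp: negligible_iff_null_sets[symmetric])
   then show "AE x in lebesgue. (\<lambda>k. indicator {0<..<\<tau>} x *\<^sub>R (q x * ?\<eta> k x)) \<longlonglongrightarrow> indicator {s..t} x *\<^sub>R q x"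
   proof eventually_elim
    case (elim x)
    have "(\<lambda>k. (indicator {s..t} x *\<^sub>R q x) * ?\<eta> k x) \<longlonglongrightarrow> (indicator {s..t} x *\<^sub>R q x) * indicator (box s t) x"
     by (intro tendsto_intros box_bump_tendsto)
    then show ?case unfolding eq using elim by (auto simp: indicator_def split: if_splits)
   qed
   show "(\<lambda>x. indicator {s..t} x *\<^sub>R q x) \<in> borel_measurable lebesgue"
    using qst by (auto simp: set_integrable_def)
  qed
  then have 2: "(\<lambda>k. - (LINT x:{0<..<\<tau>}|lebesgue. q x * ?\<eta> k x)) \<longlonglongrightarrow> - integral {s..t} q"
   unfolding set_lebesgue_integral_eq_integral(2)[OF qst] by (rule tendsto_minus)
  have "integral {s..t} (\<lambda>x. Z x * ?D k x) = - (LINT x:{0<..<\<tau>}|lebesgue. q x * ?\<eta> k x)" for k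
   using weak tf[of k] L[of k] by (simp add: has_weak_partial_def)
  then have "(\<lambda>k. integral {s..t} (\<lambda>x. Z x * ?D k x)) \<longlonglongrightarrow> - integral {s..t} q" using 2 by simp
  with 1 have "Z s - Z t = - integral {s..t} q" by (rule LIMSEQ_unique)
  then show ?thesis by simp
 qed
 have zero: "Z t - Z 0 = integral {0..t} q" if t: "0 < t" "t < \<tau>" for t
 proof -
  have qi: "q integrable_on {0..t}" using abs_integrable_subinterval[OF q] t
   by (intro set_lebesgue_integral_eq_integral(1)) auto
  \<comment> \<open>The double successor keeps the points strictly below t, as the case of positive
    times requires.\<close>
  have X: "(\<lambda>n. t * inverse (real (Suc (Suc n)))) \<longlonglongrightarrow> t * 0"
   by (intro tendsto_intros LIMSEQ_Suc[OF LIMSEQ_inverse_real_of_nat])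
  let ?X = "\<lambda>n. t * inverse (real (Suc (Suc n)))"
  have Xin: "?X n \<in> {0..t}" "0 < ?X n" "?X n < t" for n using t by (auto simp: field_simps add_pos_nonneg)
  have "continuous_on {0..t} (\<lambda>x. Z x + (integral {0..t} q - integral {0..x} q))"
   using t by (intro continuous_intros indefinite_integral_continuous_1[OF qi] continuous_on_subset[OF Z]) auto
  then have "(\<lambda>n. Z (?X n) + (integral {0..t} q - integral {0..?X n} q)) \<longlonglongrightarrow> Z 0 + (integral {0..t} q - integral {0..0} q)"
   by (rule continuous_on_tendsto_compose) (use X Xin t in \<open>auto intro!: always_eventually\<close>)
  moreover have "Z (?X n) + (integral {0..t} q - integral {0..?X n} q) = Z t" for n
   using pos[OF Xin(2,3) t(2), of n] hk_integral_combine[OF _ _ qi, of "?X n"] Xin[of n] by simp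
  ultimately have "Z t = Z 0 + integral {0..t} q" by (simp add: LIMSEQ_const_iff)
  then show ?thesis by simp
 qed
 show ?thesis
 proof (cases "s = t")
  case False
  then show ?thesis using pos[of s t] zero[of t] st by (cases "s = 0") auto
 qed simp
qed

subsection \<open>Steklov averages\<close>

lemma absolutely_integrable_iff_integrable_on:
 fixes f :: "real \<Rightarrow> real"
 shows "f absolutely_integrable_on {a..b} \<longleftrightarrow> integrable (lebesgue_on {a..b}) f"
 by (simp add: set_integrable_def integrable_restrict_space)

text \<open>A truncation at a high level is close to q in L^1 by dominated convergence. The
  truncated function is an almost everywhere limit of continuous functions; these may be truncated
  at the same level and are then dominated by a constant.\<close>

lemma L1_continuous_approximation:
 fixes q :: "real \<Rightarrow> real"
 assumes q: "q absolutely_integrable_on {a..b}" and "\<epsilon> > 0"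
 obtains g where "continuous_on UNIV g" "integral {a..b} (\<lambda>x. \<bar>q x - g x\<bar>) < \<epsilon>"
proof -
 define M where "M = lebesgue_on {a..b}"
 have qM: "integrable M q" using q by (simp add: M_def absolutely_integrable_iff_integrable_on)
 then have qm: "q \<in> borel_measurable (lebesgue_on {a..b})" by (auto simp: M_def)
 let ?c = "\<lambda>K x. max (- K) (min K x) :: real"
 have int: "integral {a..b} f = integral\<^sup>L M f" if "f \<in> borel_measurable M" "\<And>x. \<bar>f x\<bar> \<le> 2 * \<bar>q x\<bar> + K" for f K
 proof -
  have "finite_measure M" unfolding M_def by (rule finite_measure_lebesgue_on) auto
  then have "integrable M (\<lambda>x. 2 * \<bar>q x\<bar> + K)" using qM
   by (intro Bochner_Integration.integrable_add integrable_mult_right integrable_abs) (auto intro: finite_measure.integrable_const)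
  then have "integrable M f" by (rule Bochner_Integration.integrable_bound) (use that in \<open>auto intro: order_trans[OF _ abs_ge_self]\<close>)
  then have "set_integrable lebesgue {a..b} f" by (simp add: M_def absolutely_integrable_iff_integrable_on)
  then show ?thesis using set_lebesgue_integral_eq_integral(2)[of "{a..b}" f]
   by (simp add: M_def integral_restrict_space set_lebesgue_integral_def)
 qed
 have "(\<lambda>n. LINT x|M. \<bar>q x - ?c (real n) (q x)\<bar>) \<longlonglongrightarrow> (LINT x|M. 0)"
 proof (rule integral_dominated_convergence[where w="\<lambda>x. \<bar>q x\<bar>"])
  show "AE x in M. (\<lambda>n. \<bar>q x - ?c (real n) (q x)\<bar>) \<longlonglongrightarrow> 0"
  proof (rule AE_I2)
   fix x
   obtain N :: nat where "\<bar>q x\<bar> \<le> real N" using real_arch_simple by blast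
   then have "\<forall>n\<ge>N. \<bar>q x - ?c (real n) (q x)\<bar> = 0" by auto
   then show "(\<lambda>n. \<bar>q x - ?c (real n) (q x)\<bar>) \<longlonglongrightarrow> 0"
    by (intro tendsto_eventually) (auto simp: eventually_sequentially)
  qed
 qed (use qM in auto)
 then have "\<forall>\<^sub>F n in sequentially. (LINT x|M. \<bar>q x - ?c (real n) (q x)\<bar>) < \<epsilon> / 2"
  using assms(2) by (intro order_tendstoD) auto
 then obtain n where n: "(LINT x|M. \<bar>q x - ?c (real n) (q x)\<bar>) < \<epsilon> / 2" by (auto simp: eventually_sequentially)
 define K where "K = real n"
 have "(\<lambda>x. ?c K (q x)) \<in> borel_measurable (lebesgue_on {a..b})" using qm by measurable
 then have "(\<lambda>x. ?c K (q x)) measurable_on {a..b}" by (simp add: measurable_on_iff_borel_measurable)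
 then obtain N g where N: "negligible N" and g: "\<And>n. continuous_on UNIV (g n)"
  and gq: "\<And>x. x \<notin> N \<Longrightarrow> (\<lambda>n. g n x) \<longlonglongrightarrow> (if x \<in> {a..b} then ?c K (q x) else 0)"
  unfolding measurable_on_def by blast
 have gm: "(\<lambda>x. ?c K (g n x)) \<in> borel_measurable M" for n
 proof -
  have "(\<lambda>x. ?c K (g n x)) \<in> borel_measurable borel"
   using g by (intro borel_measurable_continuous_onI continuous_intros)
  then show ?thesis unfolding M_def by (intro measurable_restrict_space1 measurable_completion) simp
 qed
 have K0: "0 \<le> K" by (simp add: K_def)
 have fM: "finite_measure M" unfolding M_def by (rule finite_measure_lebesgue_on) auto
 have "(\<lambda>n. LINT x|M. \<bar>?c K (q x) - ?c K (g n x)\<bar>) \<longlonglongrightarrow> (LINT x|M. 0)"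
 proof (rule integral_dominated_convergence[where w="\<lambda>x. 2 * K"])
  have "AE x in lebesgue. x \<notin> N" using N by (intro AE_not_in) (simp add: negligible_iff_null_sets)
  then have "AE x in lebesgue. x \<in> {a..b} \<longrightarrow> (\<lambda>n. \<bar>?c K (q x) - ?c K (g n x)\<bar>) \<longlonglongrightarrow> 0"
  proof eventually_elim
   case (elim x)
   show ?case
   proof
    assume "x \<in> {a..b}"
    then have "(\<lambda>n. g n x) \<longlonglongrightarrow> ?c K (q x)" using gq[OF elim] by simp
    then have "(\<lambda>n. \<bar>?c K (q x) - ?c K (g n x)\<bar>) \<longlonglongrightarrow> \<bar>?c K (q x) - ?c K (?c K (q x))\<bar>"
     by (intro tendsto_intros)
    then show "(\<lambda>n. \<bar>?c K (q x) - ?c K (g n x)\<bar>) \<longlonglongrightarrow> 0" using K0 by (simp add: max_def min_def split: if_splits)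
   qed
  qed
  then show "AE x in M. (\<lambda>n. \<bar>?c K (q x) - ?c K (g n x)\<bar>) \<longlonglongrightarrow> 0"
   unfolding M_def by (subst AE_restrict_space_iff) auto
  show "integrable M (\<lambda>x. 2 * K)" using fM by (rule finite_measure.integrable_const)
  show "AE x in M. norm \<bar>?c K (q x) - ?c K (g n x)\<bar> \<le> 2 * K" for n using K0 by (intro AE_I2) (auto simp: max_def min_def)
 qed (use gm qM in auto)
 then have "\<forall>\<^sub>F n in sequentially. (LINT x|M. \<bar>?c K (q x) - ?c K (g n x)\<bar>) < \<epsilon> / 2"
  using assms(2) by (intro order_tendstoD) auto
 then obtain n' where n': "(LINT x|M. \<bar>?c K (q x) - ?c K (g n' x)\<bar>) < \<epsilon> / 2" by (auto simp: eventually_sequentially)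
 let ?g = "\<lambda>x. ?c K (g n' x)"
 have i1: "integrable M (\<lambda>x. \<bar>q x - ?c K (q x)\<bar>)"
  by (rule Bochner_Integration.integrable_bound[OF qM]) (use qM K0 in \<open>auto simp: max_def min_def\<close>)
 have i2: "integrable M (\<lambda>x. \<bar>?c K (q x) - ?g x\<bar>)"
  by (rule Bochner_Integration.integrable_bound[OF finite_measure.integrable_const[OF fM, of "2 * K"]])
   (use qM gm K0 in \<open>auto simp: max_def min_def\<close>)
 have i3: "integrable M (\<lambda>x. \<bar>q x - ?g x\<bar>)"
  by (intro integrable_abs Bochner_Integration.integrable_diff qM
    Bochner_Integration.integrable_bound[OF finite_measure.integrable_const[OF fM, of K]])
   (use gm K0 in \<open>auto simp: max_def min_def\<close>)
 have tri: "\<bar>x - z\<bar> \<le> \<bar>x - y\<bar> + \<bar>y - z\<bar>" for x y z :: real by simp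
 have "integral {a..b} (\<lambda>x. \<bar>q x - ?g x\<bar>) = (LINT x|M. \<bar>q x - ?g x\<bar>)"
  by (rule int[where K=K]) (use qM gm K0 in \<open>auto simp: max_def min_def abs_le_iff\<close>)
 also have "... \<le> (LINT x|M. \<bar>q x - ?c K (q x)\<bar> + \<bar>?c K (q x) - ?g x\<bar>)"
  by (intro Bochner_Integration.integral_mono Bochner_Integration.integrable_add i1 i2 i3 tri)
 also have "... < \<epsilon>" unfolding Bochner_Integration.integral_add[OF i1 i2] using n[folded K_def] n' by linarith
 finally have "integral {a..b} (\<lambda>x. \<bar>q x - ?g x\<bar>) < \<epsilon>" .
 moreover have "continuous_on UNIV ?g" by (intro continuous_intros g)
 ultimately show ?thesis using that by blast
qed

text \<open>The integrals of f and of its shift overlap, and only the windows of length h at the two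
  ends survive.\<close>

lemma shift_difference_integral:
 fixes f :: "real \<Rightarrow> real"
 assumes "f integrable_on {a..b + h}" "a \<le> b" "0 \<le> h"
 shows "(\<lambda>x. f (x - h)) integrable_on {a + h..b + h}"
  and "integral {a + h..b + h} (\<lambda>x. f x - f (x - h)) = integral {b..b + h} f - integral {a..a + h} f"
proof -
 have fi: "f integrable_on {c..d}" if "a \<le> c" "d \<le> b + h" for c d
  using that by (intro integrable_on_subinterval[OF assms(1)]) auto
 have eq: "(f \<circ> (+) (- h)) = (\<lambda>x. f (x - h))" by (auto simp: o_def)
 show sh: "(\<lambda>x. f (x - h)) integrable_on {a + h..b + h}"
  using integrable_on_shift_Icc_real[of f "-h" "a + h" "b + h"] fi[of a b] assms unfolding eq by simp
 have shi: "integral {a + h..b + h} (\<lambda>x. f (x - h)) = integral {a..b} f"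
  using integral_shift_Icc_real[of "a + h" "b + h" f "-h"] unfolding eq by simp
 have "integral {a + h..b + h} (\<lambda>x. f x - f (x - h)) = integral {a + h..b + h} f - integral {a..b} f"
  unfolding shi[symmetric] by (rule hk_integral_diff) (use fi sh assms in auto)
 moreover have "integral {a..a + h} f + integral {a + h..b + h} f = integral {a..b + h} f"
  by (rule hk_integral_combine) (use assms in auto)
 moreover have "integral {a..b} f + integral {b..b + h} f = integral {a..b + h} f"
  by (rule hk_integral_combine) (use assms in auto)
 ultimately show "integral {a + h..b + h} (\<lambda>x. f x - f (x - h)) = integral {b..b + h} f - integral {a..a + h} f"
  by linarith
qed

lemma integral_window:
 fixes w :: "real \<Rightarrow> real"
 assumes "w integrable_on {0..T}" "0 \<le> c" "c \<le> d" "d \<le> T"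
 shows "integral {c..d} w = integral {0..d} w - integral {0..c} w"
proof -
 have "w integrable_on {0..d}" using assms by (intro integrable_on_subinterval[OF assms(1)]) auto
 then show ?thesis using hk_integral_combine[of 0 c d w] assms by simp
qed

lemma steklov_continuous:
 fixes w :: "real \<Rightarrow> real"
 assumes "w integrable_on {0..T}" "0 \<le> a" "0 < h" "b + h \<le> T"
 shows "continuous_on {a + h..b + h} (\<lambda>x. integral {x - h..x} w / h)"
proof -
 have c: "continuous_on {0..T} (\<lambda>x. integral {0..x} w)" by (rule indefinite_integral_continuous_1[OF assms(1)])
 have "continuous_on {a + h..b + h} (\<lambda>x. (integral {0..x} w - integral {0..x - h} w) / h)"
  by (intro continuous_intros continuous_on_subset[OF c] continuous_on_compose2[OF c]) (use assms in auto)
 moreover have "(integral {0..x} w - integral {0..x - h} w) / h = integral {x - h..x} w / h" if "x \<in> {a + h..b + h}" for x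
  using integral_window[OF assms(1), of "x - h" x] that assms by simp
 ultimately show ?thesis by (rule continuous_on_eq)
qed

text \<open>In terms of the primitive R the average is (R x - R (x - h)) / h, whose integral
  telescopes to the mean of R over the last window minus that over the first. R is nonnegative and
  bounded by R T.\<close>

lemma steklov_contraction:
 fixes w :: "real \<Rightarrow> real"
 assumes w: "w integrable_on {0..T}" and pos: "\<And>x. x \<in> {0..T} \<Longrightarrow> 0 \<le> w x"
  and ab: "0 \<le> a" "a \<le> b" "0 < h" "b + h \<le> T"
 shows "integral {a + h..b + h} (\<lambda>x. integral {x - h..x} w / h) \<le> integral {0..T} w"
proof -
 let ?R = "\<lambda>x. integral {0..x} w"
 have wi: "w integrable_on {c..d}" if "0 \<le> c" "d \<le> T" for c d
  using that by (intro integrable_on_subinterval[OF w]) auto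
 have R0: "0 \<le> ?R x" if "x \<le> T" for x
  using that pos by (intro hk_integral_nonneg wi) auto
 have RT: "?R x \<le> ?R T" if "x \<le> T" for x
  using that pos by (intro integral_subset_le wi) auto
 have cont: "continuous_on {0..T} ?R" by (rule indefinite_integral_continuous_1[OF w])
 have Ri: "?R integrable_on {c..d}" if "0 \<le> c" "d \<le> T" for c d
  using that by (intro integrable_continuous_real continuous_on_subset[OF cont]) auto
 have "integral {a + h..b + h} (\<lambda>x. integral {x - h..x} w / h) = integral {a + h..b + h} (\<lambda>x. (?R x - ?R (x - h)) / h)"
 proof (rule hk_integral_cong)
  show "integral {x - h..x} w / h = (?R x - ?R (x - h)) / h" if "x \<in> {a + h..b + h}" for x
   using integral_window[OF w, of "x - h" x] that ab by simp
 qed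
 also have "... = (integral {b..b + h} ?R - integral {a..a + h} ?R) / h"
  using shift_difference_integral(2)[of ?R a b h] Ri[of a "b + h"] ab by simp
 also have "... \<le> (h * ?R T) / h"
 proof (rule divide_right_mono)
  have "integral {b..b + h} ?R \<le> integral {b..b + h} (\<lambda>x. ?R T)"
   using ab by (intro integral_le Ri RT) auto
  moreover have "0 \<le> integral {a..a + h} ?R"
   using ab by (intro hk_integral_nonneg Ri R0) auto
  ultimately show "integral {b..b + h} ?R - integral {a..a + h} ?R \<le> h * ?R T" using ab by simp
 qed (use ab in simp)
 finally show ?thesis using ab by simp
qed

text \<open>Averages of q are compared with those of a continuous approximation g, using contraction
  for |q - g| and uniform continuity of g. The weight f is merely measurable, since it will be the
  indicator of a level set. The window of integration is moved by h so that the averages never look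
  to the left of a.\<close>

lemma steklov_limit:
 fixes f q :: "real \<Rightarrow> real" and h :: "nat \<Rightarrow> real"
 assumes q: "q absolutely_integrable_on {0..T}" and f: "f \<in> borel_measurable lebesgue" "\<And>x. \<bar>f x\<bar> \<le> 1"
  and ab: "0 \<le> a" "a \<le> b" "b < T" and h: "\<And>n. 0 < h n" "\<And>n. b + h n \<le> T" "h \<longlonglongrightarrow> 0"
 shows "(\<lambda>n. integral {a + h n..b + h n} (\<lambda>x. f x * (integral {x - h n..x} q / h n))) \<longlonglongrightarrow> integral {a..b} (\<lambda>x. f x * q x)"
proof (rule LIMSEQ_I)
 fix e :: real assume "e > 0"
 \<comment> \<open>Three errors of size \<epsilon> and one of size \<epsilon> (b - a) have to add up
   to less than e.\<close>
 define \<epsilon> where "\<epsilon> = e / (4 + (b - a))"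
 have \<epsilon>: "\<epsilon> > 0" "\<epsilon> * (4 + (b - a)) = e" using \<open>e > 0\<close> ab by (auto simp: \<epsilon>_def)
 obtain g where g: "continuous_on UNIV g" "integral {0..T} (\<lambda>x. \<bar>q x - g x\<bar>) < \<epsilon>"
  using L1_continuous_approximation[OF q \<epsilon>(1)] by blast
 have f_on: "f \<in> borel_measurable (lebesgue_on S)" for S using f(1) by (rule measurable_restrict_space1)
 have fb: "bounded (f ` S)" for S using f(2) by (auto simp: bounded_iff)
 have ga: "g absolutely_integrable_on {c..d}" for c d
  by (rule absolutely_integrable_continuous_real) (rule continuous_on_subset[OF g(1)], simp)
 have fmul: "(\<lambda>x. f x * p x) absolutely_integrable_on {c..d}" if "p absolutely_integrable_on {c..d}" for p and c d :: real
  by (rule absolutely_integrable_bounded_measurable_product_real[OF f_on _ fb that]) simp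
 have aint: "p integrable_on S" if "p absolutely_integrable_on S" for p :: "real \<Rightarrow> real" and S :: "real set"
  using that by (rule set_lebesgue_integral_eq_integral(1))
 have qg: "(\<lambda>x. q x - g x) absolutely_integrable_on {0..T}" by (rule set_integral_diff(1)[OF q ga])
 let ?w = "\<lambda>x. \<bar>q x - g x\<bar>"
 have wa: "?w absolutely_integrable_on {0..T}" using qg by (rule set_integrable_abs)
 have qT: "q integrable_on {0..T}" and gT: "g integrable_on {0..T}" and wT: "?w integrable_on {0..T}" and qgT: "(\<lambda>x. q x - g x) integrable_on {0..T}"
  using q ga wa qg by (auto intro: aint)
 have sub: "p integrable_on {c..d}" if "p integrable_on {0..T}" "0 \<le> c" "d \<le> T" for p :: "real \<Rightarrow> real" and c d
  using that by (intro integrable_on_subinterval[OF that(1)]) auto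
 let ?S = "\<lambda>p n. \<lambda>x. integral {x - h n..x} p / h n"
 have Sa: "?S p n absolutely_integrable_on {a + h n..b + h n}" if "p integrable_on {0..T}" for p n
  by (rule absolutely_integrable_continuous_real[OF steklov_continuous[OF that ab(1) h(1,2)]])
 have 1: "\<bar>integral {a + h n..b + h n} (\<lambda>x. f x * ?S q n x) - integral {a + h n..b + h n} (\<lambda>x. f x * ?S g n x)\<bar> \<le> \<epsilon>" for n
 proof -
  have "integral {a + h n..b + h n} (\<lambda>x. f x * ?S q n x) - integral {a + h n..b + h n} (\<lambda>x. f x * ?S g n x)
   = integral {a + h n..b + h n} (\<lambda>x. f x * ?S q n x - f x * ?S g n x)"
   by (rule hk_integral_diff[symmetric]) (intro aint fmul Sa qT gT)+
  moreover have "norm (integral {a + h n..b + h n} (\<lambda>x. f x * ?S q n x - f x * ?S g n x)) \<le> integral {a + h n..b + h n} (?S ?w n)"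
  proof (rule integral_norm_bound_integral)
   show "(\<lambda>x. f x * ?S q n x - f x * ?S g n x) integrable_on {a + h n..b + h n}"
    by (intro integrable_diff aint fmul Sa qT gT)
   show "?S ?w n integrable_on {a + h n..b + h n}" by (intro aint Sa wT)
   fix x assume x: "x \<in> {a + h n..b + h n}"
   then have xs: "0 \<le> x - h n" "x \<le> T" using ab h(2)[of n] by auto
   have "norm (integral {x - h n..x} q - integral {x - h n..x} g) = norm (integral {x - h n..x} (\<lambda>x. q x - g x))"
    by (subst hk_integral_diff) (use xs sub qT gT in auto)
   also have "... \<le> integral {x - h n..x} ?w"
    by (rule integral_norm_bound_integral) (use xs sub qgT wT in auto)
   finally have *: "\<bar>integral {x - h n..x} q - integral {x - h n..x} g\<bar> \<le> integral {x - h n..x} ?w" by simp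
   have "norm (f x * ?S q n x - f x * ?S g n x) = \<bar>f x\<bar> * (\<bar>integral {x - h n..x} q - integral {x - h n..x} g\<bar> / h n)"
    using h(1)[of n] by (simp add: abs_mult[symmetric] abs_divide right_diff_distrib[symmetric] diff_divide_distrib[symmetric])
   also have "... \<le> 1 * (integral {x - h n..x} ?w / h n)"
    using h(1)[of n] f(2) * by (intro mult_mono divide_right_mono) auto
   finally show "norm (f x * ?S q n x - f x * ?S g n x) \<le> ?S ?w n x" by simp
  qed
  moreover have "integral {a + h n..b + h n} (?S ?w n) \<le> integral {0..T} ?w"
   by (rule steklov_contraction[OF wT _ ab(1,2) h(1,2)]) simp
  ultimately show ?thesis using g(2) by simp
 qed
 have "uniformly_continuous_on {0..T} g"
  by (rule compact_uniformly_continuous) (auto intro: continuous_on_subset[OF g(1)])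
 then obtain \<delta> where \<delta>: "\<delta> > 0" "\<And>x y. x \<in> {0..T} \<Longrightarrow> y \<in> {0..T} \<Longrightarrow> dist y x < \<delta> \<Longrightarrow> dist (g y) (g x) < \<epsilon>"
  unfolding uniformly_continuous_on_def using \<epsilon>(1) by metis
 have fg: "(\<lambda>x. f x * g x) integrable_on {c..d}" for c d by (intro aint fmul ga)
 have 2: "\<bar>integral {a + h n..b + h n} (\<lambda>x. f x * ?S g n x) - integral {a + h n..b + h n} (\<lambda>x. f x * g x)\<bar> \<le> \<epsilon> * (b - a)"
  if hn: "h n < \<delta>" for n
 proof -
  have "integral {a + h n..b + h n} (\<lambda>x. f x * ?S g n x) - integral {a + h n..b + h n} (\<lambda>x. f x * g x)
   = integral {a + h n..b + h n} (\<lambda>x. f x * ?S g n x - f x * g x)"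
   by (rule hk_integral_diff[symmetric]) (intro aint fmul Sa gT fg)+
  moreover have "norm (integral {a + h n..b + h n} (\<lambda>x. f x * ?S g n x - f x * g x)) \<le> integral {a + h n..b + h n} (\<lambda>x. \<epsilon>)"
  proof (rule integral_norm_bound_integral)
   show "(\<lambda>x. f x * ?S g n x - f x * g x) integrable_on {a + h n..b + h n}"
    by (intro integrable_diff aint fmul Sa gT fg)
   fix x assume x: "x \<in> {a + h n..b + h n}"
   then have xs: "0 \<le> x - h n" "x \<le> T" using ab h(2)[of n] by auto
   have "norm (integral {x - h n..x} g - integral {x - h n..x} (\<lambda>y. g x)) = norm (integral {x - h n..x} (\<lambda>y. g y - g x))"
    by (subst hk_integral_diff) (use xs sub gT in auto)
   also have "... \<le> integral {x - h n..x} (\<lambda>y. \<epsilon>)"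
   proof (rule integral_norm_bound_integral)
    show "(\<lambda>y. g y - g x) integrable_on {x - h n..x}" by (intro integrable_diff) (use xs sub gT in auto)
    fix y assume "y \<in> {x - h n..x}"
    then have "dist (g y) (g x) < \<epsilon>" using xs hn by (intro \<delta>(2)) (auto simp: dist_real_def)
    then show "norm (g y - g x) \<le> \<epsilon>" by (simp add: dist_norm)
   qed auto
   finally have "\<bar>integral {x - h n..x} g - h n * g x\<bar> \<le> h n * \<epsilon>" using h(1)[of n] by simp
   then have "\<bar>?S g n x - g x\<bar> \<le> \<epsilon>" using h(1)[of n] by (simp add: abs_le_iff field_simps)
   then have "\<bar>f x\<bar> * \<bar>?S g n x - g x\<bar> \<le> 1 * \<epsilon>" using f(2) by (intro mult_mono) auto
   then show "norm (f x * ?S g n x - f x * g x) \<le> \<epsilon>" by (simp add: abs_mult[symmetric] right_diff_distrib)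
  qed auto
  ultimately show ?thesis using ab by (simp add: mult.commute)
 qed
 let ?F = "\<lambda>x. integral {0..x} (\<lambda>x. f x * g x)"
 have contF: "continuous_on {0..T} ?F" by (rule indefinite_integral_continuous_1[OF fg])
 have "(\<lambda>n. ?F (b + h n) - ?F (a + h n)) \<longlonglongrightarrow> ?F (b + 0) - ?F (a + 0)"
  using ab h(1,2) less_imp_le[OF h(1)]
  by (intro tendsto_diff continuous_on_tendsto_compose[OF contF] tendsto_add tendsto_const h(3))
   (auto intro!: always_eventually intro: add_nonneg_nonneg order_trans[OF add_right_mono[OF ab(2)]])
 then have "(\<lambda>n. integral {a + h n..b + h n} (\<lambda>x. f x * g x)) \<longlonglongrightarrow> integral {a..b} (\<lambda>x. f x * g x)"
 proof -
  have "integral {a + h n..b + h n} (\<lambda>x. f x * g x) = ?F (b + h n) - ?F (a + h n)" for n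
   using ab h(1)[of n] h(2)[of n] by (intro integral_window[OF fg, of _ _ T]) auto
  moreover have "integral {a..b} (\<lambda>x. f x * g x) = ?F b - ?F a"
   using ab by (intro integral_window[OF fg, of _ _ T]) auto
  ultimately show ?thesis using \<open>(\<lambda>n. ?F (b + h n) - ?F (a + h n)) \<longlonglongrightarrow> ?F (b + 0) - ?F (a + 0)\<close> by simp
 qed
 then have "\<forall>\<^sub>F n in sequentially. dist (integral {a + h n..b + h n} (\<lambda>x. f x * g x)) (integral {a..b} (\<lambda>x. f x * g x)) < \<epsilon>"
  using \<epsilon>(1) by (rule tendstoD)
 moreover have "\<forall>\<^sub>F n in sequentially. h n < \<delta>" using h(3) \<delta>(1) by (rule order_tendstoD)
 ultimately have "\<forall>\<^sub>F n in sequentially. dist (integral {a + h n..b + h n} (\<lambda>x. f x * g x)) (integral {a..b} (\<lambda>x. f x * g x)) < \<epsilon> \<and> h n < \<delta>"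
  by eventually_elim simp
 then obtain N where N: "\<And>n. n \<ge> N \<Longrightarrow> dist (integral {a + h n..b + h n} (\<lambda>x. f x * g x)) (integral {a..b} (\<lambda>x. f x * g x)) < \<epsilon> \<and> h n < \<delta>"
  by (auto simp: eventually_sequentially)
 have 4: "\<bar>integral {a..b} (\<lambda>x. f x * g x) - integral {a..b} (\<lambda>x. f x * q x)\<bar> \<le> \<epsilon>"
 proof -
  have qab: "q absolutely_integrable_on {a..b}" using ab by (intro abs_integrable_subinterval[OF q]) auto
  have "integral {a..b} (\<lambda>x. f x * g x) - integral {a..b} (\<lambda>x. f x * q x) = integral {a..b} (\<lambda>x. f x * g x - f x * q x)"
   by (rule hk_integral_diff[symmetric]) (intro aint fmul ga qab)+
  moreover have "norm (integral {a..b} (\<lambda>x. f x * g x - f x * q x)) \<le> integral {a..b} ?w"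
  proof (rule integral_norm_bound_integral)
   show "(\<lambda>x. f x * g x - f x * q x) integrable_on {a..b}" by (intro integrable_diff aint fmul ga qab)
   show "?w integrable_on {a..b}" using ab by (intro sub[OF wT]) auto
   show "norm (f x * g x - f x * q x) \<le> ?w x" for x
    using f(2) mult_left_le_one_le[of "\<bar>q x - g x\<bar>" "\<bar>f x\<bar>"]
    by (simp add: abs_mult abs_minus_commute right_diff_distrib[symmetric])
  qed
  moreover have "integral {a..b} ?w \<le> integral {0..T} ?w"
   by (rule integral_subset_le) (use ab sub[OF wT] wT in auto)
  ultimately show ?thesis using g(2) by simp
 qed
 show "\<exists>no. \<forall>n\<ge>no. norm (integral {a + h n..b + h n} (\<lambda>x. f x * ?S q n x) - integral {a..b} (\<lambda>x. f x * q x)) < e"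
 proof (intro exI[of _ N] allI impI)
  fix n assume "N \<le> n"
  then have "dist (integral {a + h n..b + h n} (\<lambda>x. f x * g x)) (integral {a..b} (\<lambda>x. f x * g x)) < \<epsilon>" "h n < \<delta>" using N by auto
  then have "\<bar>integral {a + h n..b + h n} (\<lambda>x. f x * ?S q n x) - integral {a..b} (\<lambda>x. f x * q x)\<bar> < \<epsilon> + \<epsilon> * (b - a) + \<epsilon> + \<epsilon>"
   using 1[of n] 2[of n] 4 unfolding dist_real_def by linarith
  also have "... < e" using \<epsilon> by (simp add: algebra_simps)
  finally show "norm (integral {a + h n..b + h n} (\<lambda>x. f x * ?S q n x) - integral {a..b} (\<lambda>x. f x * q x)) < e" by simp
 qed
qed

text \<open>Cauchy-Schwarz in the form that the variance of m about its mean is nonnegative.\<close>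

lemma integral_power2_le:
 fixes m :: "real \<Rightarrow> real"
 assumes m: "m integrable_on {c..d}" "(\<lambda>x. (m x)^2) integrable_on {c..d}" and "c \<le> d"
 shows "(integral {c..d} m)^2 \<le> (d - c) * integral {c..d} (\<lambda>x. (m x)^2)"
proof (cases "c = d")
 case False
 define L where "L = d - c"
 have L: "L > 0" using False assms by (simp add: L_def)
 let ?A = "integral {c..d} m"
 have "0 \<le> integral {c..d} (\<lambda>x. (m x - ?A / L)^2)"
 proof (rule hk_integral_nonneg)
  show "(\<lambda>x. (m x - ?A / L)^2) integrable_on {c..d}"
  proof -
   have "(\<lambda>x. ((m x)^2 + (?A / L)^2) - (2 * (?A / L)) * m x) integrable_on {c..d}"
    by (intro integrable_diff integrable_add m integrable_const_ivl integrable_on_mult_right)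
   then show ?thesis by (simp add: power2_diff mult.commute mult.left_commute)
  qed
 qed simp
 also have "integral {c..d} (\<lambda>x. (m x - ?A / L)^2) = integral {c..d} (\<lambda>x. ((m x)^2 + (?A / L)^2) - (2 * (?A / L)) * m x)"
  by (simp add: power2_diff mult.commute mult.left_commute)
 also have "... = integral {c..d} (\<lambda>x. (m x)^2 + (?A / L)^2) - integral {c..d} (\<lambda>x. (2 * (?A / L)) * m x)"
  by (rule hk_integral_diff) (intro integrable_add m integrable_const_ivl integrable_on_mult_right)+
 also have "... = integral {c..d} (\<lambda>x. (m x)^2) + L * (?A / L)^2 - 2 * (?A / L) * ?A"
  by (subst hk_integral_add) (use m assms in \<open>auto simp: L_def\<close>)
 also have "... = integral {c..d} (\<lambda>x. (m x)^2) - ?A^2 / L" using L by (simp add: power2_eq_square field_simps)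
 finally show ?thesis using L by (simp add: L_def[symmetric] field_simps)
qed simp

subsection \<open>Energy inequality for weak evolution equations\<close>

text \<open>The route by which everything built from a strongly measurable path becomes measurable:
  the path is an almost everywhere limit of simple functions.\<close>

lemma lebesgue_on_measurable_AE_limit:
 fixes f :: "nat \<Rightarrow> real \<Rightarrow> real"
 assumes "\<And>n. f n \<in> borel_measurable (lebesgue_on S)" and S: "S \<in> sets lebesgue"
  and lim: "AE x in lebesgue_on S. (\<lambda>n. f n x) \<longlonglongrightarrow> g x"
 shows "g \<in> borel_measurable (lebesgue_on S)"
proof -
 define F where "F n x = indicator S x *\<^sub>R f n x" for n x
 have F: "F n \<in> borel_measurable lebesgue" for n
  using assms(1)[of n] S unfolding F_def[abs_def] by (simp add: borel_measurable_restrict_space_iff)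
 define L where "L x = lim (\<lambda>n. F n x)" for x
 have L: "L \<in> borel_measurable lebesgue" unfolding L_def using F by (rule borel_measurable_lim_metric)
 have "AE x in lebesgue. x \<in> S \<longrightarrow> (\<lambda>n. f n x) \<longlonglongrightarrow> g x"
  using lim S by (subst (asm) AE_restrict_space_iff) auto
 then have "AE x in lebesgue. L x = indicator S x *\<^sub>R g x"
 proof eventually_elim
  case (elim x)
  show ?case
  proof (cases "x \<in> S")
   case True
   then have "(\<lambda>n. F n x) \<longlonglongrightarrow> g x" using elim by (simp add: F_def)
   then show ?thesis using True by (simp add: L_def limI)
  qed (simp add: L_def F_def lim_const)
 qed
 with L have "(\<lambda>x. indicator S x *\<^sub>R g x) \<in> borel_measurable lebesgue" by (rule borel_measurable_AE)
 then show ?thesis using S by (simp add: borel_measurable_restrict_space_iff)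
qed

text \<open>F may depend on its second argument in any way, because a simple function splits the
  domain into finitely many measurable level sets.\<close>

lemma measurable_simple_composition:
 fixes F :: "'t \<Rightarrow> 'h \<Rightarrow> real"
 assumes y: "simple_function M y" and F: "\<And>v. v \<in> range y \<Longrightarrow> (\<lambda>t. F t v) \<in> borel_measurable M"
 shows "(\<lambda>t. F t (y t)) \<in> borel_measurable M"
proof -
 have fin: "finite (y ` space M)" using y by (rule simple_functionD)
 have "(\<lambda>t. \<Sum>v\<in>y ` space M. indicator (y -` {v} \<inter> space M) t * F t v) \<in> borel_measurable M"
  using F by (intro borel_measurable_sum borel_measurable_times borel_measurable_indicator simple_functionD(2)[OF y]) auto
 moreover have "(\<Sum>v\<in>y ` space M. indicator (y -` {v} \<inter> space M) t * F t v) = F t (y t)" if "t \<in> space M" for t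
 proof -
  have "(\<Sum>v\<in>y ` space M. indicator (y -` {v} \<inter> space M) t * F t v) = (\<Sum>v\<in>y ` space M. if v = y t then F t v else 0)"
   by (intro sum.cong) (auto simp: indicator_def that)
  also have "... = F t (y t)" using fin that by (simp add: sum.delta)
  finally show ?thesis .
 qed
 ultimately show ?thesis by (simp cong: measurable_cong)
qed

lemma absolutely_integrable_bound:
 fixes f g :: "real \<Rightarrow> real"
 assumes f: "f \<in> borel_measurable (lebesgue_on {a..b})" and g: "g absolutely_integrable_on {a..b}"
  and le: "AE x in lebesgue_on {a..b}. \<bar>f x\<bar> \<le> g x"
 shows "f absolutely_integrable_on {a..b}"
 unfolding absolutely_integrable_iff_integrable_on
 by (rule Bochner_Integration.integrable_bound[OF g[unfolded absolutely_integrable_iff_integrable_on] f])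
  (use le in \<open>eventually_elim, simp\<close>)

lemma absolutely_integrable_const: "(\<lambda>x. k :: real) absolutely_integrable_on {a..b :: real}"
 by (rule absolutely_integrable_continuous_real) simp

lemma AE_lebesgue_on_subset:
 assumes "AE x in lebesgue_on T. P x" "S \<subseteq> T" "S \<in> sets lebesgue" "T \<in> sets lebesgue"
 shows "AE x in lebesgue_on S. P x"
proof -
 have "AE x in lebesgue. x \<in> T \<longrightarrow> P x" using assms by (subst (asm) AE_restrict_space_iff) auto
 then have "AE x in lebesgue. x \<in> S \<longrightarrow> P x" by eventually_elim (use assms in auto)
 then show ?thesis using assms by (subst AE_restrict_space_iff) auto
qed

lemma integral_le_AE:
 fixes f g :: "real \<Rightarrow> real"
 assumes f: "f absolutely_integrable_on {a..b}" and g: "g absolutely_integrable_on {a..b}"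
  and le: "AE x in lebesgue_on {a..b}. f x \<le> g x"
 shows "integral {a..b} f \<le> integral {a..b} g"
proof -
 have "(LINT x:{a..b}|lebesgue. f x) \<le> (LINT x:{a..b}|lebesgue. g x)"
  using le by (intro set_integral_mono_AE f g) (subst (asm) AE_restrict_space_iff, auto)
 then show ?thesis using set_lebesgue_integral_eq_integral(2)[OF f] set_lebesgue_integral_eq_integral(2)[OF g] by simp
qed

lemmas abs_integrable_integrable = set_lebesgue_integral_eq_integral(1)

text \<open>An abstract version of the pair H, E, so that the same calculus serves solutions,
  differences of solutions and weighted solutions. Nonnegativity of \<open>nV\<close> is asked
  everywhere because a path lies in \<open>V\<close> only at almost every time.\<close>

locale energy_space =
 fixes Hs V :: "'h::real_inner set" and nV :: "'h \<Rightarrow> real" and CP :: real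
 assumes Hs: "subspace Hs" and V: "subspace V" and VH: "V \<subseteq> Hs"
  and nV_nonneg: "0 \<le> nV x"
  and nV_add: "x \<in> V \<Longrightarrow> y \<in> V \<Longrightarrow> nV (x + y) \<le> nV x + nV y"
  and nV_scale: "x \<in> V \<Longrightarrow> nV (c *\<^sub>R x) = \<bar>c\<bar> * nV x"
  and poincare: "x \<in> V \<Longrightarrow> norm x \<le> CP * nV x" and CP: "CP > 0"
begin

text \<open>A path \<open>z\<close> with values in \<open>Hs\<close>, square integrable in \<open>V\<close>, whose weak derivative is the functional \<open>G\<close>
 on \<open>V\<close>; \<open>m\<close> bounds the dual norm of \<open>G\<close>.\<close>

definition weak_path :: "real \<Rightarrow> (real \<Rightarrow> 'h) \<Rightarrow> (real \<Rightarrow> 'h \<Rightarrow> real) \<Rightarrow> (real \<Rightarrow> real) \<Rightarrow> bool" where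
 "weak_path T z G m \<longleftrightarrow>
  (\<forall>t\<in>{0..T}. z t \<in> Hs) \<and> (\<forall>h\<in>Hs. continuous_on {0..T} (\<lambda>t. z t \<bullet> h)) \<and>
  (AE t in lebesgue_on {0..T}. z t \<in> V) \<and>
  (\<exists>s. (\<forall>k::nat. simple_function (lebesgue_on {0..T}) (s k) \<and> range (s k) \<subseteq> V) \<and>
    (AE t in lebesgue_on {0..T}. (\<lambda>k. nV (s k t - z t)) \<longlonglongrightarrow> 0)) \<and>
  (\<lambda>t. (nV (z t))^2) absolutely_integrable_on {0..T} \<and>
  (\<forall>t. 0 \<le> m t) \<and> m \<in> borel_measurable (lebesgue_on {0..T}) \<and> (\<lambda>t. (m t)^2) absolutely_integrable_on {0..T} \<and>
  (AE t in lebesgue_on {0..T}. (\<forall>\<phi>\<in>V. \<forall>\<psi>\<in>V. G t (\<phi> + \<psi>) = G t \<phi> + G t \<psi>) \<and>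
    (\<forall>\<phi>\<in>V. \<forall>c. G t (c *\<^sub>R \<phi>) = c * G t \<phi>) \<and> (\<forall>\<phi>\<in>V. \<bar>G t \<phi>\<bar> \<le> m t * nV \<phi>)) \<and>
  (\<forall>\<phi>\<in>V. (\<lambda>t. G t \<phi>) \<in> borel_measurable (lebesgue_on {0..T})) \<and>
  (\<forall>\<phi>\<in>V. \<forall>a b. 0 \<le> a \<longrightarrow> a \<le> b \<longrightarrow> b \<le> T \<longrightarrow> z b \<bullet> \<phi> - z a \<bullet> \<phi> = integral {a..b} (\<lambda>t. G t \<phi>))"

lemma nV_diff: "x \<in> V \<Longrightarrow> y \<in> V \<Longrightarrow> nV (x - y) \<le> nV x + nV y"
 using nV_add[of x "- y"] nV_scale[of y "-1"] subspace_neg[OF V] by simp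

lemma nV_commute: "x \<in> V \<Longrightarrow> y \<in> V \<Longrightarrow> nV (x - y) = nV (y - x)"
 using nV_scale[of "x - y" "-1"] subspace_diff[OF V] by simp

lemma nV_triangle: "x \<in> V \<Longrightarrow> y \<in> V \<Longrightarrow> w \<in> V \<Longrightarrow> \<bar>nV (x - w) - nV (y - w)\<bar> \<le> nV (x - y)"
 using nV_add[of "x - y" "y - w"] nV_add[of "y - x" "x - w"] nV_commute[of x y] subspace_diff[OF V] by force

lemma nV_zero: "nV 0 = 0"
 using nV_scale[of 0 0] subspace_0[OF V] by simp

context
 fixes T z G m
 assumes path: "weak_path T z G m"
begin

lemma path_Hs: "t \<in> {0..T} \<Longrightarrow> z t \<in> Hs" using path unfolding weak_path_def by (elim conjE) blast
lemma path_cont: "h \<in> Hs \<Longrightarrow> continuous_on {0..T} (\<lambda>t. z t \<bullet> h)" using path unfolding weak_path_def by (elim conjE) blast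
lemma path_V: "AE t in lebesgue_on {0..T}. z t \<in> V" using path unfolding weak_path_def by (elim conjE)
lemma path_nV2: "(\<lambda>t. (nV (z t))^2) absolutely_integrable_on {0..T}" using path unfolding weak_path_def by (elim conjE)
lemma path_m: "0 \<le> m t" "m \<in> borel_measurable (lebesgue_on {0..T})" "(\<lambda>t. (m t)^2) absolutely_integrable_on {0..T}"
 using path unfolding weak_path_def by ((elim conjE), blast)+
lemma path_G_linear: "AE t in lebesgue_on {0..T}. (\<forall>\<phi>\<in>V. \<forall>\<psi>\<in>V. G t (\<phi> + \<psi>) = G t \<phi> + G t \<psi>) \<and>
    (\<forall>\<phi>\<in>V. \<forall>c. G t (c *\<^sub>R \<phi>) = c * G t \<phi>) \<and> (\<forall>\<phi>\<in>V. \<bar>G t \<phi>\<bar> \<le> m t * nV \<phi>)"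
 using path unfolding weak_path_def by (elim conjE)
lemma path_G_measurable: "\<phi> \<in> V \<Longrightarrow> (\<lambda>t. G t \<phi>) \<in> borel_measurable (lebesgue_on {0..T})"
 using path unfolding weak_path_def by (elim conjE) blast
lemma path_eq: "\<phi> \<in> V \<Longrightarrow> 0 \<le> a \<Longrightarrow> a \<le> b \<Longrightarrow> b \<le> T \<Longrightarrow> z b \<bullet> \<phi> - z a \<bullet> \<phi> = integral {a..b} (\<lambda>t. G t \<phi>)"
 using path unfolding weak_path_def by (elim conjE) blast

lemma path_simple: "\<exists>s. (\<forall>k::nat. simple_function (lebesgue_on {0..T}) (s k) \<and> range (s k) \<subseteq> V) \<and>
    (AE t in lebesgue_on {0..T}. (\<lambda>k. nV (s k t - z t)) \<longlonglongrightarrow> 0)"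
 using path unfolding weak_path_def by (elim conjE)

lemma path_m_integrable: "m absolutely_integrable_on {0..T}"
proof (rule absolutely_integrable_bound[OF path_m(2)])
 show "(\<lambda>t. 1 + (m t)^2) absolutely_integrable_on {0..T}"
  by (intro set_integral_add(1) absolutely_integrable_const path_m(3))
 have "\<bar>m t\<bar> \<le> 1 + (m t)^2" for t
  using zero_le_power2[of "m t - 1"] path_m(1)[of t] by (simp add: power2_diff)
 then show "AE x in lebesgue_on {0..T}. \<bar>m x\<bar> \<le> 1 + (m x)^2" by simp
qed

lemma path_G_integrable:
 assumes "\<phi> \<in> V" shows "(\<lambda>t. G t \<phi>) absolutely_integrable_on {0..T}"
proof (rule absolutely_integrable_bound[OF path_G_measurable[OF assms]])
 show "(\<lambda>t. nV \<phi> * m t) absolutely_integrable_on {0..T}"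
  using path_m_integrable by (rule set_integrable_mult_right)
 show "AE t in lebesgue_on {0..T}. \<bar>G t \<phi>\<bar> \<le> nV \<phi> * m t"
  using path_G_linear by eventually_elim (use assms in \<open>auto simp: mult.commute\<close>)
qed

text \<open>The weak equation with a fixed test vector: in the dual norm, an increment of z is at
  most the integral of m.\<close>

lemma path_increment_le:
 assumes "\<phi> \<in> V" "0 \<le> a" "a \<le> b" "b \<le> T"
 shows "\<bar>(z b - z a) \<bullet> \<phi>\<bar> \<le> nV \<phi> * integral {a..b} m"
proof -
 have sub: "{a..b} \<subseteq> {0..T}" using assms by auto
 have Gi: "(\<lambda>t. G t \<phi>) absolutely_integrable_on {a..b}"
  using assms by (intro abs_integrable_subinterval[OF path_G_integrable]) auto
 have mi: "m absolutely_integrable_on {a..b}"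
  using assms by (intro abs_integrable_subinterval[OF path_m_integrable]) auto
 have "\<bar>integral {a..b} (\<lambda>t. G t \<phi>)\<bar> \<le> integral {a..b} (\<lambda>t. \<bar>G t \<phi>\<bar>)"
  using abs_integrable_integrable[OF Gi] abs_integrable_integrable[OF set_integrable_abs[OF Gi]]
  integral_norm_bound_integral[of "\<lambda>t. G t \<phi>" "{a..b}" "\<lambda>t. \<bar>G t \<phi>\<bar>"] by simp
 also have "... \<le> integral {a..b} (\<lambda>t. nV \<phi> * m t)"
 proof (rule integral_le_AE[OF set_integrable_abs[OF Gi] set_integrable_mult_right[OF mi]])
  have "AE t in lebesgue_on {a..b}. (\<forall>\<phi>\<in>V. \<bar>G t \<phi>\<bar> \<le> m t * nV \<phi>)"
   using AE_lebesgue_on_subset[OF path_G_linear sub] by (auto elim: eventually_mono)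
  then show "AE t in lebesgue_on {a..b}. \<bar>G t \<phi>\<bar> \<le> nV \<phi> * m t"
   by eventually_elim (use assms in \<open>auto simp: mult.commute\<close>)
 qed
 finally show ?thesis using path_eq[OF assms] by (simp add: inner_diff_left)
qed

lemma path_nV_diff_measurable:
 assumes "v \<in> V" shows "(\<lambda>t. nV (z t - v)) \<in> borel_measurable (lebesgue_on {0..T})"
proof -
 obtain s where s: "\<And>k::nat. simple_function (lebesgue_on {0..T}) (s k)" "\<And>k. range (s k) \<subseteq> V"
  "AE t in lebesgue_on {0..T}. (\<lambda>k. nV (s k t - z t)) \<longlonglongrightarrow> 0" using path_simple by blast
 show ?thesis
 proof (rule lebesgue_on_measurable_AE_limit)
  show "(\<lambda>t. nV (s k t - v)) \<in> borel_measurable (lebesgue_on {0..T})" for k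
   by (rule measurable_simple_composition[OF s(1)]) simp
  show "AE t in lebesgue_on {0..T}. (\<lambda>k. nV (s k t - v)) \<longlonglongrightarrow> nV (z t - v)"
   using s(3) path_V
  proof eventually_elim
   case (elim t)
   have "\<bar>nV (s k t - v) - nV (z t - v)\<bar> \<le> nV (s k t - z t)" for k
    using s(2)[of k] elim assms by (intro nV_triangle) auto
   then have "(\<lambda>k. nV (s k t - v) - nV (z t - v)) \<longlonglongrightarrow> 0"
    by (intro Lim_null_comparison[OF _ elim(1)]) simp
   then show ?case by (rule LIM_zero_cancel)
  qed
 qed auto
qed

lemma path_nV_measurable: "(\<lambda>t. nV (z t)) \<in> borel_measurable (lebesgue_on {0..T})"
 using path_nV_diff_measurable[OF subspace_0[OF V]] by simp

text \<open>Replacing a simple approximation by 0 wherever its norm exceeds twice that of z makes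
  the error at most 3 \<open>nV (z t)\<close>, so dominated convergence applies. At a given time
  nothing is cut off eventually, except where \<open>nV (z t)\<close> is 0, and there cutting off
  only helps.\<close>

lemma path_simple_approximation:
 assumes "\<epsilon> > 0"
 obtains y where "simple_function (lebesgue_on {0..T}) y" "range y \<subseteq> V"
  "(\<lambda>t. (nV (z t - y t))^2) absolutely_integrable_on {0..T}" "integral {0..T} (\<lambda>t. (nV (z t - y t))^2) < \<epsilon>"
proof -
 define M where "M = lebesgue_on {0..T}"
 obtain s where s: "\<And>k::nat. simple_function M (s k)" "\<And>k. range (s k) \<subseteq> V"
  "AE t in M. (\<lambda>k. nV (s k t - z t)) \<longlonglongrightarrow> 0" using path_simple unfolding M_def by blast
 define y where "y k t = (if nV (s k t) \<le> 2 * nV (z t) then s k t else 0)" for k t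
 have [measurable]: "(\<lambda>t. nV (z t)) \<in> borel_measurable M" unfolding M_def by (rule path_nV_measurable)
 have [measurable]: "(\<lambda>t. nV (s k t)) \<in> borel_measurable M" for k
  by (rule measurable_simple_composition[OF s(1)]) simp
 have y: "simple_function M (y k)" for k
  unfolding y_def by (intro simple_function_If s simple_function_const) measurable
 have yV: "range (y k) \<subseteq> V" for k using s(2)[of k] subspace_0[OF V] by (auto simp: y_def)
 have ym: "(\<lambda>t. (nV (z t - y k t))^2) \<in> borel_measurable M" for k
  using yV[of k] by (intro borel_measurable_power measurable_simple_composition[OF y, where F="\<lambda>t v. nV (z t - v)"])
   (auto simp: M_def intro!: path_nV_diff_measurable)
 have dom: "AE t in M. norm ((nV (z t - y k t))^2) \<le> 9 * (nV (z t))^2" for k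
  using path_V unfolding M_def[symmetric]
 proof eventually_elim
  case (elim t)
  have "nV (z t - y k t) \<le> nV (z t) + nV (y k t)" using elim yV[of k] by (intro nV_diff) auto
  also have "... \<le> 3 * nV (z t)" using nV_zero nV_nonneg[of "z t"] by (auto simp: y_def)
  finally have "(nV (z t - y k t))^2 \<le> (3 * nV (z t))^2" by (intro power_mono nV_nonneg)
  then show ?case by (simp add: power_mult_distrib)
 qed
 have nzi: "integrable M (\<lambda>t. 9 * (nV (z t))^2)"
  using path_nV2 unfolding M_def absolutely_integrable_iff_integrable_on by (rule integrable_mult_right)
 have "(\<lambda>k. LINT t|M. (nV (z t - y k t))^2) \<longlonglongrightarrow> (LINT t|M. 0)"
 proof (rule integral_dominated_convergence[OF _ ym nzi _ dom])
  show "AE t in M. (\<lambda>k. (nV (z t - y k t))^2) \<longlonglongrightarrow> 0"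
   using s(3) path_V unfolding M_def[symmetric]
  proof eventually_elim
   case (elim t)
   have sV: "s k t \<in> V" for k using s(2)[of k] by auto
   have lim: "(\<lambda>k. nV (s k t)) \<longlonglongrightarrow> nV (z t)"
   proof -
    have "\<bar>nV (s k t) - nV (z t)\<bar> \<le> nV (s k t - z t)" for k
     using nV_triangle[OF sV elim(2) subspace_0[OF V]] by simp
    then have "(\<lambda>k. nV (s k t) - nV (z t)) \<longlonglongrightarrow> 0"
     by (intro Lim_null_comparison[OF _ elim(1)]) simp
    then show ?thesis by (rule LIM_zero_cancel)
   qed
   have "(\<lambda>k. nV (z t - y k t)) \<longlonglongrightarrow> 0"
   proof (cases "nV (z t) = 0")
    case True
    have "nV (z t - y k t) \<le> nV (s k t - z t)" for k
     using nV_commute[OF elim(2) sV, of k] True nV_nonneg[of "s k t - z t"] by (auto simp: y_def)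
    then show ?thesis by (intro Lim_null_comparison[OF _ elim(1)]) (simp add: nV_nonneg)
   next
    case False
    then have "nV (z t) < 2 * nV (z t)" using nV_nonneg[of "z t"] by linarith
    then have "\<forall>\<^sub>F k in sequentially. nV (s k t) < 2 * nV (z t)" by (rule order_tendstoD(2)[OF lim])
    then have "\<forall>\<^sub>F k in sequentially. nV (s k t - z t) = nV (z t - y k t)"
     by eventually_elim (use nV_commute[OF elim(2) sV] in \<open>simp add: y_def\<close>)
    with elim(1) show ?thesis by (rule Lim_transform_eventually)
   qed
   from tendsto_power[OF this, of 2] show ?case by simp
  qed
 qed simp
 then have "\<forall>\<^sub>F k in sequentially. (LINT t|M. (nV (z t - y k t))^2) < \<epsilon>" using assms by (intro order_tendstoD) auto
 then obtain k where k: "(LINT t|M. (nV (z t - y k t))^2) < \<epsilon>" by (auto simp: eventually_sequentially)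
 have "integrable M (\<lambda>t. (nV (z t - y k t))^2)"
  by (rule Bochner_Integration.integrable_bound[OF nzi ym]) (use dom[of k] in \<open>eventually_elim, simp\<close>)
 then have ai: "(\<lambda>t. (nV (z t - y k t))^2) absolutely_integrable_on {0..T}"
  by (simp add: M_def absolutely_integrable_iff_integrable_on)
 have "integral {0..T} (\<lambda>t. (nV (z t - y k t))^2) = (LINT t|M. (nV (z t - y k t))^2)"
  using set_lebesgue_integral_eq_integral(2)[OF ai] by (simp add: M_def integral_restrict_space set_lebesgue_integral_def)
 with k that[OF y[unfolded M_def] yV ai] show ?thesis by simp
qed

text \<open>The path is weakly continuous, so measurability of its norm is taken from the simple
  approximations, which converge in norm by the Poincare inequality; the same inequality supplies
  the dominating function.\<close>

lemma path_norm2_integrable: "(\<lambda>t. (norm (z t))^2) absolutely_integrable_on {0..T}"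
proof (rule absolutely_integrable_bound)
 obtain s where s: "\<And>k::nat. simple_function (lebesgue_on {0..T}) (s k)" "\<And>k. range (s k) \<subseteq> V"
  "AE t in lebesgue_on {0..T}. (\<lambda>k. nV (s k t - z t)) \<longlonglongrightarrow> 0" using path_simple by blast
 show "(\<lambda>t. (norm (z t))^2) \<in> borel_measurable (lebesgue_on {0..T})"
 proof (rule lebesgue_on_measurable_AE_limit)
  show "(\<lambda>t. (norm (s k t))^2) \<in> borel_measurable (lebesgue_on {0..T})" for k
   by (rule measurable_simple_composition[OF s(1)]) simp
  show "AE t in lebesgue_on {0..T}. (\<lambda>k. (norm (s k t))^2) \<longlonglongrightarrow> (norm (z t))^2"
   using s(3) path_V
  proof eventually_elim
   case (elim t)
   have "norm (s k t - z t) \<le> CP * nV (s k t - z t)" for k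
    using s(2)[of k] elim by (intro poincare subspace_diff[OF V]) auto
   then have "\<forall>\<^sub>F k in sequentially. norm (s k t - z t) \<le> CP * nV (s k t - z t)" by (rule always_eventually[OF allI])
   then have "(\<lambda>k. s k t - z t) \<longlonglongrightarrow> 0"
    by (rule Lim_null_comparison) (rule tendsto_mult_right_zero[OF elim(1)])
   then have "(\<lambda>k. s k t) \<longlonglongrightarrow> z t" by (rule LIM_zero_cancel)
   then show ?case by (intro tendsto_intros)
  qed
 qed auto
 show "(\<lambda>t. CP^2 * (nV (z t))^2) absolutely_integrable_on {0..T}"
  using path_nV2 by (rule set_integrable_mult_right)
 show "AE t in lebesgue_on {0..T}. \<bar>(norm (z t))^2\<bar> \<le> CP^2 * (nV (z t))^2"
  using path_V by eventually_elim (use power_mono[OF poincare norm_ge_zero, of _ 2] in \<open>simp add: power_mult_distrib\<close>)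
qed

text \<open>The functional acts on a vector that moves with time, so measurability comes from the
  simple approximations together with linearity and the dual bound.\<close>

lemma path_G_path_integrable: "(\<lambda>t. G t (z t)) absolutely_integrable_on {0..T}"
proof (rule absolutely_integrable_bound)
 obtain s where s: "\<And>k::nat. simple_function (lebesgue_on {0..T}) (s k)" "\<And>k. range (s k) \<subseteq> V"
  "AE t in lebesgue_on {0..T}. (\<lambda>k. nV (s k t - z t)) \<longlonglongrightarrow> 0" using path_simple by blast
 show "(\<lambda>t. G t (z t)) \<in> borel_measurable (lebesgue_on {0..T})"
 proof (rule lebesgue_on_measurable_AE_limit)
  show "(\<lambda>t. G t (s k t)) \<in> borel_measurable (lebesgue_on {0..T})" for k
   by (rule measurable_simple_composition[OF s(1), where F=G]) (use s(2)[of k] path_G_measurable in blast)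
  show "AE t in lebesgue_on {0..T}. (\<lambda>k. G t (s k t)) \<longlonglongrightarrow> G t (z t)"
   using s(3) path_V path_G_linear
  proof eventually_elim
   case (elim t)
   have sV: "s k t \<in> V" for k using s(2)[of k] by auto
   have "G t (s k t) - G t (z t) = G t (s k t - z t)" for k
   proof -
    have "G t (s k t + (-1) *\<^sub>R z t) = G t (s k t) + G t ((-1) *\<^sub>R z t)"
     using elim(3) sV[of k] subspace_scale[OF V elim(2), of "-1"] by blast
    moreover have "G t ((-1) *\<^sub>R z t) = (-1) * G t (z t)" using elim(3) elim(2) by blast
    ultimately show ?thesis by simp
   qed
   moreover have "\<bar>G t (s k t - z t)\<bar> \<le> m t * nV (s k t - z t)" for k
    using elim(3) subspace_diff[OF V sV elim(2)] by blast
   ultimately have "norm (G t (s k t) - G t (z t)) \<le> m t * nV (s k t - z t)" for k by simp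
   then have "\<forall>\<^sub>F k in sequentially. norm (G t (s k t) - G t (z t)) \<le> m t * nV (s k t - z t)" by (rule always_eventually[OF allI])
   then have "(\<lambda>k. G t (s k t) - G t (z t)) \<longlonglongrightarrow> 0"
    by (rule Lim_null_comparison) (rule tendsto_mult_right_zero[OF elim(1)])
   then show ?case by (rule LIM_zero_cancel)
  qed
 qed auto
 show "(\<lambda>t. (m t)^2 + (nV (z t))^2) absolutely_integrable_on {0..T}"
  by (intro set_integral_add(1) path_m(3) path_nV2)
 show "AE t in lebesgue_on {0..T}. \<bar>G t (z t)\<bar> \<le> (m t)^2 + (nV (z t))^2"
  using path_V path_G_linear
 proof eventually_elim
  case (elim t)
  then have "\<bar>G t (z t)\<bar> \<le> m t * nV (z t)" by blast
  also have "... \<le> (m t)^2 + (nV (z t))^2"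
   using sum_squares_bound[of "m t" "nV (z t)"] path_m(1)[of t] nV_nonneg[of "z t"]
    mult_nonneg_nonneg[OF path_m(1)[of t] nV_nonneg[of "z t"]] by linarith
  finally show ?case .
 qed
qed

lemma young: "0 < \<delta> \<Longrightarrow> 2 * (x * y) \<le> (x :: real)^2 / \<delta> + \<delta> * y^2"
proof -
 assume d: "0 < \<delta>"
 have "0 \<le> (x / sqrt \<delta> - sqrt \<delta> * y)^2" by simp
 also have "... = x^2 / \<delta> + \<delta> * y^2 - 2 * (x * y)" using d by (simp add: power2_diff power_divide power_mult_distrib)
 finally show ?thesis by simp
qed

text \<open>A substitute for right continuity in norm. Split |z t|^2 - |z a|^2 into (z t - z a)
  \<bullet> z t and (z t - z a) \<bullet> z a. The second is small by weak continuity. The first is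
  treated by the increment bound and Young's inequality with weight 1/h, which after averaging
  leaves the integrals of \<open>nV (z t)\<close>^2 and m^2 over a shrinking window.\<close>

lemma path_right_average:
 assumes a: "0 \<le> a" "a < T" and h: "\<And>n. 0 < h n" "\<And>n. a + h n \<le> T" "(h :: nat \<Rightarrow> real) \<longlonglongrightarrow> 0"
 shows "(\<lambda>n. integral {a..a + h n} (\<lambda>t. (norm (z t))^2) / h n) \<longlonglongrightarrow> (norm (z a))^2"
proof -
 let ?e = "\<lambda>t. (norm (z t))^2" and ?p = "\<lambda>t. (z t - z a) \<bullet> z a"
 have za: "z a \<in> Hs" using a by (intro path_Hs) auto
 have pc: "continuous_on {0..T} ?p"
  unfolding inner_diff_left by (intro continuous_intros path_cont za)
 have "(\<lambda>n. integral {0..a + h n} (\<lambda>t. (nV (z t))^2 + (m t)^2) - integral {0..a} (\<lambda>t. (nV (z t))^2 + (m t)^2)) \<longlonglongrightarrow>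
  integral {0..a + 0} (\<lambda>t. (nV (z t))^2 + (m t)^2) - integral {0..a} (\<lambda>t. (nV (z t))^2 + (m t)^2)"
 proof (intro tendsto_diff tendsto_const continuous_on_tendsto_compose[OF indefinite_integral_continuous_1])
  show "(\<lambda>t. (nV (z t))^2 + (m t)^2) integrable_on {0..T}"
   by (intro abs_integrable_integrable set_integral_add(1) path_m(3) path_nV2)
  show "(\<lambda>n. a + h n) \<longlonglongrightarrow> a + 0" by (intro tendsto_intros h)
  show "\<forall>\<^sub>F n in sequentially. a + h n \<in> {0..T}" using a h(1,2) less_imp_le[OF h(1)] by (auto intro: add_nonneg_nonneg)
 qed (use a in auto)
 moreover have ii: "(\<lambda>t. (nV (z t))^2 + (m t)^2) integrable_on {0..T}"
  by (intro abs_integrable_integrable set_integral_add(1) path_m(3) path_nV2)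
 ultimately have E0: "(\<lambda>n. integral {a..a + h n} (\<lambda>t. (nV (z t))^2 + (m t)^2)) \<longlonglongrightarrow> 0"
  using integral_window[OF ii a(1), of "a + h n" for n] h less_imp_le[OF h(1)] by simp
 have "(\<lambda>n. integral {a..a + h n} ?e / h n - (norm (z a))^2) \<longlonglongrightarrow> 0"
 proof (rule LIMSEQ_I)
  fix r :: real assume r: "r > 0"
  have "?p a = 0" by simp
  then obtain \<delta> where \<delta>: "\<delta> > 0" "\<And>t. t \<in> {0..T} \<Longrightarrow> dist t a < \<delta> \<Longrightarrow> \<bar>?p t\<bar> < r / 2"
   using pc[unfolded continuous_on_iff] a r
   by (metis (no_types, lifting) atLeastAtMost_iff dist_real_def diff_zero half_gt_zero less_imp_le)
  have "\<forall>\<^sub>F n in sequentially. integral {a..a + h n} (\<lambda>t. (nV (z t))^2 + (m t)^2) < r / 2 \<and> h n < \<delta>"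
   using order_tendstoD(2)[OF E0, of "r / 2"] order_tendstoD(2)[OF h(3) \<delta>(1)] r by (simp add: eventually_conj)
  then obtain N where N: "\<And>n. n \<ge> N \<Longrightarrow> integral {a..a + h n} (\<lambda>t. (nV (z t))^2 + (m t)^2) < r / 2" "\<And>n. n \<ge> N \<Longrightarrow> h n < \<delta>"
   by (auto simp: eventually_sequentially)
  show "\<exists>no. \<forall>n\<ge>no. norm (integral {a..a + h n} ?e / h n - (norm (z a))^2 - 0) < r"
  proof (intro exI[of _ N] allI impI)
   fix n assume n: "N \<le> n"
   let ?h = "h n" and ?I = "{a..a + h n}"
   note hn = h(1)[of n] h(2)[of n]
   have I: "?I \<subseteq> {0..T}" using a hn by auto
   have ei: "?e absolutely_integrable_on ?I"
    using a hn by (intro abs_integrable_subinterval[OF path_norm2_integrable]) auto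
   have ni: "(\<lambda>t. (nV (z t))^2) absolutely_integrable_on ?I"
    using a hn by (intro abs_integrable_subinterval[OF path_nV2]) auto
   have mi: "(\<lambda>t. (m t)^2) absolutely_integrable_on ?I" "m absolutely_integrable_on ?I"
    using a hn by (intro abs_integrable_subinterval[OF path_m(3)] abs_integrable_subinterval[OF path_m_integrable]; simp)+
   let ?N = "integral ?I (\<lambda>t. (m t)^2)" and ?D = "integral ?I m"
   have D: "?D^2 \<le> ?h * ?N"
    using integral_power2_le[OF abs_integrable_integrable[OF mi(2)] abs_integrable_integrable[OF mi(1)]] hn by simp
   have bnd: "AE t in lebesgue_on ?I. \<bar>?e t - (norm (z a))^2\<bar> \<le> ?h * (nV (z t))^2 + (?N + r / 2)"
   proof -
    have "AE t in lebesgue_on ?I. z t \<in> V" by (rule AE_lebesgue_on_subset[OF path_V I]) auto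
    moreover have "AE t in lebesgue_on ?I. t \<in> ?I" by (rule AE_I2) simp
    ultimately show ?thesis
   proof eventually_elim
    case (elim t)
    then have t: "z t \<in> V" "a \<le> t" "t \<le> a + ?h" by auto
    have "?e t - (norm (z a))^2 = (z t - z a) \<bullet> z t + ?p t"
     by (simp add: power2_norm_eq_inner inner_diff_left inner_diff_right inner_commute)
    moreover have "\<bar>(z t - z a) \<bullet> z t\<bar> \<le> ?h * (nV (z t))^2 + ?N"
    proof -
     have "\<bar>(z t - z a) \<bullet> z t\<bar> \<le> nV (z t) * integral {a..t} m"
      using a t hn by (intro path_increment_le) auto
     also have "... \<le> nV (z t) * ?D"
     proof (rule mult_left_mono[OF _ nV_nonneg])
      have mI: "m integrable_on ?I" by (rule abs_integrable_integrable[OF mi(2)])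
      have sub: "{a..t} \<subseteq> ?I" using t by auto
      then have "m integrable_on {a..t}" by (rule integrable_on_subinterval[OF mI])
      with mI sub show "integral {a..t} m \<le> ?D" using path_m(1) by (intro integral_subset_le) auto
     qed
     finally have 1: "\<bar>(z t - z a) \<bullet> z t\<bar> \<le> nV (z t) * ?D" .
     have "2 * (nV (z t) * ?D) \<le> (nV (z t))^2 / (1 / ?h) + (1 / ?h) * ?D^2" by (rule young) (use hn in simp)
     also have "... \<le> ?h * (nV (z t))^2 + ?N" using D hn by (simp add: field_simps)
     finally show ?thesis using 1 abs_ge_zero[of "(z t - z a) \<bullet> z t"] by linarith
    qed
    moreover have "\<bar>?p t\<bar> < r / 2" using t a hn N(2)[OF n] by (intro \<delta>(2)) (auto simp: dist_real_def)
    ultimately show ?case by linarith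
   qed
   qed
   have fi: "(\<lambda>t. ?e t - (norm (z a))^2) absolutely_integrable_on ?I"
    by (intro set_integral_diff(1) ei absolutely_integrable_const)
   have gi: "(\<lambda>t. ?h * (nV (z t))^2 + (?N + r / 2)) absolutely_integrable_on ?I"
    by (intro set_integral_add(1) set_integrable_mult_right absolutely_integrable_const ni)
   have "\<bar>integral ?I (\<lambda>t. ?e t - (norm (z a))^2)\<bar> \<le> integral ?I (\<lambda>t. \<bar>?e t - (norm (z a))^2\<bar>)"
    using integral_norm_bound_integral[OF abs_integrable_integrable[OF fi] abs_integrable_integrable[OF set_integrable_abs[OF fi]]] by simp
   also have "... \<le> integral ?I (\<lambda>t. ?h * (nV (z t))^2 + (?N + r / 2))"
    by (rule integral_le_AE[OF set_integrable_abs[OF fi] gi bnd])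
   also have "... = ?h * integral ?I (\<lambda>t. (nV (z t))^2) + ?h * (?N + r / 2)"
    using abs_integrable_integrable[OF ni] hn
    by (subst hk_integral_add) (auto intro!: integrable_on_mult_right)
   finally have "\<bar>integral ?I ?e - ?h * (norm (z a))^2\<bar> \<le> ?h * (integral ?I (\<lambda>t. (nV (z t))^2) + (?N + r / 2))"
    using abs_integrable_integrable[OF ei] hn
    by (subst (asm) hk_integral_diff) (auto simp: distrib_left)
   also have "integral ?I (\<lambda>t. (nV (z t))^2) + (?N + r / 2) = integral ?I (\<lambda>t. (nV (z t))^2 + (m t)^2) + r / 2"
    using abs_integrable_integrable[OF ni] abs_integrable_integrable[OF mi(1)]
    by (subst hk_integral_add) auto
   also have "?h * ... < ?h * r" using N(1)[OF n] hn by (intro mult_strict_left_mono) auto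
   finally show "norm (integral ?I ?e / ?h - (norm (z a))^2 - 0) < r"
    using hn by (simp add: abs_less_iff field_simps)
  qed
 qed
 then show ?thesis by (rule LIM_zero_cancel)
qed

end

end

lemma indicator_mult_absolutely_integrable:
 fixes p :: "real \<Rightarrow> real"
 assumes "A \<in> sets lebesgue" "p absolutely_integrable_on {c..d}"
 shows "(\<lambda>x. indicator A x * p x) absolutely_integrable_on {c..d}"
proof (rule absolutely_integrable_bounded_measurable_product_real[OF _ _ _ assms(2)])
 show "indicat_real A \<in> borel_measurable (lebesgue_on {c..d})"
  using assms(1) by (intro measurable_restrict_space1 borel_measurable_indicator)
qed (auto simp: bounded_iff indicator_def intro!: exI[of _ 1])

context energy_space
begin

text \<open>By |x|^2 - |y|^2 \<le> 2 (x - y) \<bullet> x, the difference quotient of |z|^2 is at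
  most twice that of z paired with z t. Replacing z t by a simple function y t turns this pairing
  into Steklov averages of G at finitely many fixed vectors, whose limit is known on each level set.
  The error of the replacement is controlled by the dual bound.\<close>

lemma energy_inequality:
 assumes path: "weak_path T z G m" and ab: "0 \<le> a" "a \<le> b" "b < T"
 shows "(norm (z b))^2 - (norm (z a))^2 \<le> 2 * integral {a..b} (\<lambda>t. G t (z t))"
proof -
 let ?e = "\<lambda>t. (norm (z t))^2"
 define N where "N = integral {0..T} (\<lambda>t. (m t)^2)"
 note ai = abs_integrable_integrable
 have N0: "0 \<le> N" unfolding N_def by (intro hk_integral_nonneg ai path_m[OF path]) auto
 \<comment> \<open>Shifts that fit into the gap between b and T, so that all windows
   [a + h n, b + h n] stay in [0,T].\<close>
 define h where "h n = (T - b) / real (Suc n)" for n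
 have h: "0 < h n" "b + h n \<le> T" for n
 proof -
  show "0 < h n" using ab by (simp add: h_def)
  have "(T - b) / real (Suc n) \<le> (T - b) / 1" using ab by (intro divide_left_mono) auto
  then show "b + h n \<le> T" by (simp add: h_def)
 qed
 have hlim: "h \<longlonglongrightarrow> 0"
 proof -
  have "(\<lambda>n. (T - b) * inverse (real (Suc n))) \<longlonglongrightarrow> (T - b) * 0" by (intro tendsto_intros LIMSEQ_inverse_real_of_nat)
  then show ?thesis by (simp add: h_def[abs_def] divide_inverse)
 qed
 have L: "(\<lambda>n. integral {a + h n..b + h n} (\<lambda>t. (?e t - ?e (t - h n)) / h n)) \<longlonglongrightarrow> ?e b - ?e a"
 proof -
  have "(\<lambda>n. integral {b..b + h n} ?e / h n - integral {a..a + h n} ?e / h n) \<longlonglongrightarrow> ?e b - ?e a"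
   using ab h hlim order_trans[OF add_right_mono[OF ab(2)] h(2)]
   by (intro tendsto_diff path_right_average[OF path]) auto
  moreover have "integral {a + h n..b + h n} (\<lambda>t. (?e t - ?e (t - h n)) / h n) = integral {b..b + h n} ?e / h n - integral {a..a + h n} ?e / h n" for n
  proof -
   have "?e integrable_on {a..b + h n}"
    using ab h(2)[of n] by (intro ai abs_integrable_subinterval[OF path_norm2_integrable[OF path]]) auto
   from shift_difference_integral(2)[OF this ab(2) less_imp_le[OF h(1)]] show ?thesis
    unfolding diff_divide_distrib[symmetric] hk_integral_divide by simp
  qed
  ultimately show ?thesis by simp
 qed
 \<comment> \<open>E is the squared distance from z to y, and N the integral of m^2. In the end
   \<delta> is fixed first to make \<delta> N small, and y is chosen afterwards so that E / \<delta>
   is small.\<close>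
 have main: "?e b - ?e a \<le> 2 * integral {a..b} (\<lambda>t. G t (z t)) + 2 * (E / \<delta> + \<delta> * N)"
  if \<delta>: "\<delta> > 0" and y: "simple_function (lebesgue_on {0..T}) y" "range y \<subseteq> V"
   "(\<lambda>t. (nV (z t - y t))^2) absolutely_integrable_on {0..T}" and E: "E = integral {0..T} (\<lambda>t. (nV (z t - y t))^2)" for \<delta> y E
 proof -
  define Y where "Y = y ` {0..T}"
  have finY: "finite Y" using simple_functionD(1)[OF y(1)] by (simp add: Y_def)
  have YV: "v \<in> V" if "v \<in> Y" for v using that y(2) by (auto simp: Y_def)
  define A where "A v = y -` {v} \<inter> {0..T}" for v
  have A: "A v \<in> sets lebesgue" for v
   using simple_functionD(2)[OF y(1), of "{v}"] by (simp add: A_def sets_restrict_space_iff)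
  have indY: "(\<Sum>v\<in>Y. indicator (A v) t * p v) = p (y t)" if "t \<in> {0..T}" for t and p :: "'h \<Rightarrow> real"
  proof -
   have "(\<Sum>v\<in>Y. indicator (A v) t * p v) = (\<Sum>v\<in>Y. if v = y t then p v else 0)"
    using that by (intro sum.cong) (auto simp: indicator_def A_def)
   also have "... = p (y t)" using finY that by (simp add: sum.delta Y_def)
   finally show ?thesis .
  qed
  let ?S = "\<lambda>w n t. integral {t - h n..t} w / h n"
  have Sa: "?S w n absolutely_integrable_on {a + h n..b + h n}" if "w integrable_on {0..T}" for w n
   by (rule absolutely_integrable_continuous_real[OF steklov_continuous[OF that ab(1) h]])
  have GvI: "(\<lambda>t. G t v) absolutely_integrable_on {0..T}" if "v \<in> Y" for v by (rule path_G_integrable[OF path YV[OF that]])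
  let ?R = "\<lambda>n t. (\<Sum>v\<in>Y. indicator (A v) t * ?S (\<lambda>t. G t v) n t)"
  let ?Q = "\<lambda>n t. (nV (z t - y t))^2 / \<delta> + \<delta> * ?S (\<lambda>t. (m t)^2) n t"
  have Ra: "(\<lambda>t. indicator (A v) t * ?S (\<lambda>t. G t v) n t) absolutely_integrable_on {a + h n..b + h n}" if "v \<in> Y" for v n
   by (intro indicator_mult_absolutely_integrable A Sa ai GvI that)
  have na: "(\<lambda>t. (nV (z t - y t))^2 / \<delta>) absolutely_integrable_on {a + h n..b + h n}" for n
   by (rule set_integrable_divide, rule abs_integrable_subinterval[OF y(3)]) (use ab h[of n] in auto)
  have ma: "(\<lambda>t. \<delta> * ?S (\<lambda>t. (m t)^2) n t) absolutely_integrable_on {a + h n..b + h n}" for n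
   by (intro set_integrable_mult_right Sa ai path_m[OF path])
  have step: "integral {a + h n..b + h n} (\<lambda>t. (?e t - ?e (t - h n)) / h n) \<le>
   2 * (\<Sum>v\<in>Y. integral {a + h n..b + h n} (\<lambda>t. indicator (A v) t * ?S (\<lambda>t. G t v) n t)) + (E / \<delta> + \<delta> * N)" for n
  proof -
   let ?h = "h n" and ?I = "{a + h n..b + h n}"
   note hn = h[of n]
   have I: "?I \<subseteq> {0..T}" using ab hn by auto
   have ei: "?e absolutely_integrable_on {c..d}" if "0 \<le> c" "d \<le> T" for c d
    using that by (intro abs_integrable_subinterval[OF path_norm2_integrable[OF path]])
   have esh: "(\<lambda>t. ?e (t - ?h)) absolutely_integrable_on ?I"
   proof -
    have "?e integrable_on {a..b + ?h}" by (rule ai[OF ei]) (use ab hn in auto)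
    from shift_difference_integral(1)[OF this ab(2) less_imp_le[OF hn(1)]]
    show ?thesis by (rule nonnegative_absolutely_integrable_1) simp
   qed
   have lhs: "(\<lambda>t. (?e t - ?e (t - ?h)) / ?h) absolutely_integrable_on ?I"
    by (intro set_integrable_divide set_integral_diff(1) esh ei) (use ab hn in auto)
   have rhs: "(\<lambda>t. 2 * ?R n t + ?Q n t) absolutely_integrable_on ?I"
    by (intro set_integral_add(1) set_integrable_mult_right absolutely_integrable_sum finY Ra na ma)
   have "AE t in lebesgue_on ?I. (?e t - ?e (t - ?h)) / ?h \<le> 2 * ?R n t + ?Q n t"
   proof -
    have "AE t in lebesgue_on ?I. z t \<in> V" by (rule AE_lebesgue_on_subset[OF path_V[OF path] I]) auto
    moreover have "AE t in lebesgue_on ?I. t \<in> ?I" by (rule AE_I2) simp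
    ultimately show ?thesis
    proof eventually_elim
     case (elim t)
     then have t: "0 \<le> t - ?h" "t - ?h \<le> t" "t \<le> T" "t \<in> {0..T}" using I ab hn by auto
     have yt: "y t \<in> V" using y(2) by auto
     let ?d = "z t - z (t - ?h)"
     have "?e t - ?e (t - ?h) \<le> 2 * (?d \<bullet> z t)"
      using zero_le_power2[of "norm ?d"] unfolding power2_norm_eq_inner
      by (simp add: inner_diff_left inner_diff_right inner_commute)
     also have "?d \<bullet> z t = ?d \<bullet> y t + ?d \<bullet> (z t - y t)" by (simp add: inner_diff_right)
     finally have 1: "(?e t - ?e (t - ?h)) / ?h \<le> 2 * ((?d \<bullet> y t) / ?h) + 2 * (?d \<bullet> (z t - y t)) / ?h"
      using hn by (simp add: add_divide_distrib[symmetric] divide_right_mono)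
     have "(?d \<bullet> y t) / ?h = ?S (\<lambda>s. G s (y t)) n t"
      using path_eq[OF path yt t(1-3)] by (simp add: inner_diff_left)
     also have "... = ?R n t" by (rule indY[OF t(4), symmetric])
     finally have 2: "(?d \<bullet> y t) / ?h = ?R n t" .
     let ?D = "integral {t - ?h..t} m" and ?x = "nV (z t - y t)"
     have "\<bar>?d \<bullet> (z t - y t)\<bar> \<le> ?x * ?D"
      using t elim yt by (intro path_increment_le[OF path] subspace_diff[OF V]) auto
     then have "2 * (?d \<bullet> (z t - y t)) / ?h \<le> 2 * (?x * (?D / ?h))" using hn by (simp add: divide_right_mono)
     also have "... \<le> ?x^2 / \<delta> + \<delta> * (?D / ?h)^2" by (rule young[OF path \<delta>])
     also have "... \<le> ?x^2 / \<delta> + \<delta> * ?S (\<lambda>t. (m t)^2) n t"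
     proof -
      have "?D^2 \<le> (t - (t - ?h)) * integral {t - ?h..t} (\<lambda>t. (m t)^2)"
       using t by (intro integral_power2_le ai abs_integrable_subinterval[OF path_m_integrable[OF path]]
        abs_integrable_subinterval[OF path_m(3)[OF path]]) auto
      then have "(?D / ?h)^2 \<le> ?S (\<lambda>t. (m t)^2) n t" using hn by (simp add: power2_eq_square field_simps)
      then show ?thesis using \<delta> by (intro add_left_mono mult_left_mono) auto
     qed
     finally show ?case using 1 unfolding 2 by linarith
    qed
   qed
   from integral_le_AE[OF lhs rhs this]
   have "integral ?I (\<lambda>t. (?e t - ?e (t - ?h)) / ?h) \<le> integral ?I (\<lambda>t. 2 * ?R n t + ?Q n t)" .
   also have "... = integral ?I (\<lambda>t. 2 * ?R n t) + integral ?I (?Q n)"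
   proof (rule hk_integral_add)
    show "(\<lambda>t. 2 * ?R n t) integrable_on ?I"
     by (intro ai set_integrable_mult_right absolutely_integrable_sum finY Ra)
    show "?Q n integrable_on ?I" by (rule ai[OF set_integral_add(1)[OF na ma]])
   qed
   also have "integral ?I (\<lambda>t. 2 * ?R n t) = 2 * (\<Sum>v\<in>Y. integral ?I (\<lambda>t. indicator (A v) t * ?S (\<lambda>t. G t v) n t))"
    by (simp add: hk_integral_sum[OF finY ai[OF Ra]] del: times_divide_eq_right)
   also have "integral ?I (?Q n) = integral ?I (\<lambda>t. (nV (z t - y t))^2 / \<delta>) + integral ?I (\<lambda>t. \<delta> * ?S (\<lambda>t. (m t)^2) n t)"
    by (rule hk_integral_add) (intro ai na ma)+
   also have "integral ?I (\<lambda>t. (nV (z t - y t))^2 / \<delta>) \<le> E / \<delta>"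
   proof -
    have "integral ?I (\<lambda>t. (nV (z t - y t))^2) \<le> E" unfolding E
     using I ab hn by (intro integral_subset_le ai y(3) abs_integrable_subinterval[OF y(3)]) auto
    then show ?thesis using \<delta> by (simp add: divide_right_mono)
   qed
   also have "integral ?I (\<lambda>t. \<delta> * ?S (\<lambda>t. (m t)^2) n t) \<le> \<delta> * N"
    unfolding hk_integral_mult_right N_def
    by (rule mult_left_mono[OF steklov_contraction[OF ai[OF path_m(3)[OF path]] _ ab(1,2) hn]]) (use \<delta> in auto)
   finally show ?thesis by simp
  qed
  have "(\<lambda>n. 2 * (\<Sum>v\<in>Y. integral {a + h n..b + h n} (\<lambda>t. indicator (A v) t * ?S (\<lambda>t. G t v) n t)) + (E / \<delta> + \<delta> * N))
   \<longlonglongrightarrow> 2 * (\<Sum>v\<in>Y. integral {a..b} (\<lambda>t. indicator (A v) t * G t v)) + (E / \<delta> + \<delta> * N)"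
  proof (intro tendsto_add tendsto_mult tendsto_const tendsto_sum)
   fix v assume v: "v \<in> Y"
   show "(\<lambda>n. integral {a + h n..b + h n} (\<lambda>t. indicator (A v) t * ?S (\<lambda>t. G t v) n t)) \<longlonglongrightarrow> integral {a..b} (\<lambda>t. indicator (A v) t * G t v)"
    by (rule steklov_limit[OF GvI[OF v] _ _ ab h hlim]) (use A in \<open>auto simp: indicator_def intro!: borel_measurable_indicator[unfolded indicator_def]\<close>)
  qed
  from LIMSEQ_le[OF L this] step
  have X: "?e b - ?e a \<le> 2 * (\<Sum>v\<in>Y. integral {a..b} (\<lambda>t. indicator (A v) t * G t v)) + (E / \<delta> + \<delta> * N)" by blast
  have AG: "(\<lambda>t. indicator (A v) t * G t v) absolutely_integrable_on {a..b}" if "v \<in> Y" for v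
   using ab by (intro indicator_mult_absolutely_integrable A abs_integrable_subinterval[OF GvI[OF that]]) auto
  have "(\<Sum>v\<in>Y. integral {a..b} (\<lambda>t. indicator (A v) t * G t v)) = integral {a..b} (\<lambda>t. \<Sum>v\<in>Y. indicator (A v) t * G t v)"
   by (rule hk_integral_sum[OF finY ai[OF AG], symmetric])
  \<comment> \<open>Going back from y to z by linearity and the dual bound costs a second error of
    the same size, whence the doubled error in the claim.\<close>
  also have "... \<le> integral {a..b} (\<lambda>t. G t (z t) + ((nV (z t - y t))^2 / \<delta> + \<delta> * (m t)^2) / 2)"
  proof (rule integral_le_AE)
   show "(\<lambda>t. \<Sum>v\<in>Y. indicator (A v) t * G t v) absolutely_integrable_on {a..b}"
    by (intro absolutely_integrable_sum finY AG)
   show "(\<lambda>t. G t (z t) + ((nV (z t - y t))^2 / \<delta> + \<delta> * (m t)^2) / 2) absolutely_integrable_on {a..b}"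
    using ab by (intro abs_integrable_subinterval[OF set_integral_add(1)[OF path_G_path_integrable[OF path]
     set_integrable_divide[OF set_integral_add(1)[OF set_integrable_divide[OF y(3)] set_integrable_mult_right[OF path_m(3)[OF path]]]]]]) auto
   have I: "{a..b} \<subseteq> {0..T}" using ab by auto
   have "AE t in lebesgue_on {a..b}. z t \<in> V" by (rule AE_lebesgue_on_subset[OF path_V[OF path] I]) auto
   moreover have "AE t in lebesgue_on {a..b}. t \<in> {a..b}" by (rule AE_I2) simp
   moreover have "AE t in lebesgue_on {a..b}. (\<forall>\<phi>\<in>V. \<forall>\<psi>\<in>V. G t (\<phi> + \<psi>) = G t \<phi> + G t \<psi>) \<and>
     (\<forall>\<phi>\<in>V. \<forall>c. G t (c *\<^sub>R \<phi>) = c * G t \<phi>) \<and> (\<forall>\<phi>\<in>V. \<bar>G t \<phi>\<bar> \<le> m t * nV \<phi>)"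
    by (rule AE_lebesgue_on_subset[OF path_G_linear[OF path] I]) auto
   ultimately show "AE t in lebesgue_on {a..b}. (\<Sum>v\<in>Y. indicator (A v) t * G t v) \<le> G t (z t) + ((nV (z t - y t))^2 / \<delta> + \<delta> * (m t)^2) / 2"
   proof eventually_elim
    case (elim t)
    have yt: "y t \<in> V" using y(2) by auto
    have d: "z t - y t \<in> V" "(-1) *\<^sub>R (z t - y t) \<in> V" using elim yt by (auto intro!: subspace_diff[OF V] subspace_scale[OF V])
    have "(\<Sum>v\<in>Y. indicator (A v) t * G t v) = G t (y t)" using elim ab by (intro indY) auto
    also have "... = G t (z t + (-1) *\<^sub>R (z t - y t))" by simp
    also have "... = G t (z t) + G t ((-1) *\<^sub>R (z t - y t))" using elim d by blast
    also have "G t ((-1) *\<^sub>R (z t - y t)) = (-1) * G t (z t - y t)" using elim(3) d(1) by blast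
    finally have "(\<Sum>v\<in>Y. indicator (A v) t * G t v) = G t (z t) - G t (z t - y t)" by simp
    moreover have "\<bar>G t (z t - y t)\<bar> \<le> m t * nV (z t - y t)" using elim(3) d(1) by blast
    moreover have "2 * (nV (z t - y t) * m t) \<le> (nV (z t - y t))^2 / \<delta> + \<delta> * (m t)^2" by (rule young[OF path \<delta>])
    ultimately show ?case by (simp add: mult.commute)
   qed
  qed
  also have "... = integral {a..b} (\<lambda>t. G t (z t)) + integral {a..b} (\<lambda>t. ((nV (z t - y t))^2 / \<delta> + \<delta> * (m t)^2) / 2)"
   using ab by (intro hk_integral_add ai abs_integrable_subinterval[OF path_G_path_integrable[OF path]]
    abs_integrable_subinterval[OF set_integrable_divide[OF set_integral_add(1)[OF set_integrable_divide[OF y(3)] set_integrable_mult_right[OF path_m(3)[OF path]]]]]) auto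
  also have "integral {a..b} (\<lambda>t. ((nV (z t - y t))^2 / \<delta> + \<delta> * (m t)^2) / 2) \<le> (E / \<delta> + \<delta> * N) / 2"
  proof -
   have "integral {a..b} (\<lambda>t. ((nV (z t - y t))^2 / \<delta> + \<delta> * (m t)^2) / 2) \<le> integral {0..T} (\<lambda>t. ((nV (z t - y t))^2 / \<delta> + \<delta> * (m t)^2) / 2)"
    using ab \<delta> by (intro integral_subset_le ai abs_integrable_subinterval[OF set_integrable_divide[OF set_integral_add(1)[OF set_integrable_divide[OF y(3)] set_integrable_mult_right[OF path_m(3)[OF path]]]]])
     (auto intro!: divide_nonneg_nonneg add_nonneg_nonneg mult_nonneg_nonneg)
   also have "... = (integral {0..T} (\<lambda>t. (nV (z t - y t))^2 / \<delta>) + integral {0..T} (\<lambda>t. \<delta> * (m t)^2)) / 2"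
    by (simp add: hk_integral_add[OF ai[OF set_integrable_divide[OF y(3)]] ai[OF set_integrable_mult_right[OF path_m(3)[OF path]]]])
   finally show ?thesis by (simp add: E N_def)
  qed
  finally have Y: "(\<Sum>v\<in>Y. integral {a..b} (\<lambda>t. indicator (A v) t * G t v)) \<le> integral {a..b} (\<lambda>t. G t (z t)) + (E / \<delta> + \<delta> * N) / 2"
   by simp
  have "l \<le> 2 * i + 2 * q" if "l \<le> 2 * s + q" "s \<le> i + q / 2" "0 \<le> q" for l s i q :: real
   using that by linarith
  moreover have "0 \<le> E / \<delta> + \<delta> * N"
   using \<delta> N0 unfolding E by (intro add_nonneg_nonneg divide_nonneg_nonneg mult_nonneg_nonneg hk_integral_nonneg ai y(3)) auto
  ultimately show ?thesis using X Y by blast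
 qed
 show ?thesis
 proof (rule field_le_epsilon)
  fix \<epsilon> :: real assume "\<epsilon> > 0"
  define \<delta> where "\<delta> = \<epsilon> / (4 * (N + 1))"
  have \<delta>: "\<delta> > 0" using \<open>\<epsilon> > 0\<close> N0 by (simp add: \<delta>_def)
  obtain y where y: "simple_function (lebesgue_on {0..T}) y" "range y \<subseteq> V"
   "(\<lambda>t. (nV (z t - y t))^2) absolutely_integrable_on {0..T}" "integral {0..T} (\<lambda>t. (nV (z t - y t))^2) < \<epsilon> * \<delta> / 4"
   using path_simple_approximation[OF path, of "\<epsilon> * \<delta> / 4"] \<delta> \<open>\<epsilon> > 0\<close> by auto
  have "integral {0..T} (\<lambda>t. (nV (z t - y t))^2) / \<delta> \<le> \<epsilon> / 4" using y(4) \<delta> by (simp add: field_simps)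
  moreover have "\<delta> * N \<le> \<epsilon> / 4" using \<open>\<epsilon> > 0\<close> N0 by (simp add: \<delta>_def field_simps)
  ultimately have "2 * (integral {0..T} (\<lambda>t. (nV (z t - y t))^2) / \<delta> + \<delta> * N) \<le> \<epsilon>" by argo
  then show "?e b - ?e a \<le> 2 * integral {a..b} (\<lambda>t. G t (z t)) + \<epsilon>"
   by (intro order_trans[OF main[OF \<delta> y(1-3) refl]] add_left_mono)
 qed
qed

text \<open>The dual bounds add up. Since \<open>G\<close> is an arbitrary family of functionals,
  this yields the equation for the difference of two solutions although the reaction is
  nonlinear.\<close>

lemma weak_path_diff:
 assumes p1: "weak_path T z1 G1 m1" and p2: "weak_path T z2 G2 m2"
 shows "weak_path T (\<lambda>t. z1 t - z2 t) (\<lambda>t \<phi>. G1 t \<phi> - G2 t \<phi>) (\<lambda>t. m1 t + m2 t)"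
proof -
 let ?M = "lebesgue_on {0..T}"
 obtain s1 where s1: "\<And>k::nat. simple_function ?M (s1 k)" "\<And>k. range (s1 k) \<subseteq> V"
  "AE t in ?M. (\<lambda>k. nV (s1 k t - z1 t)) \<longlonglongrightarrow> 0" using path_simple[OF p1] by blast
 obtain s2 where s2: "\<And>k::nat. simple_function ?M (s2 k)" "\<And>k. range (s2 k) \<subseteq> V"
  "AE t in ?M. (\<lambda>k. nV (s2 k t - z2 t)) \<longlonglongrightarrow> 0" using path_simple[OF p2] by blast
 define s where "s k t = s1 k t - s2 k t" for k t
 have s: "simple_function ?M (s k)" for k
  unfolding s_def[abs_def] by (rule simple_function_compose2[OF s1(1) s2(1)])
 have sV: "range (s k) \<subseteq> V" for k using s1(2)[of k] s2(2)[of k] by (auto simp: s_def intro!: subspace_diff[OF V])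
 have conv: "AE t in ?M. (\<lambda>k. nV (s k t - (z1 t - z2 t))) \<longlonglongrightarrow> 0"
  using s1(3) s2(3) path_V[OF p1] path_V[OF p2]
 proof eventually_elim
  case (elim t)
  have a: "nV (s k t - (z1 t - z2 t)) \<le> nV (s1 k t - z1 t) + nV (s2 k t - z2 t)" for k
  proof -
   have "s k t - (z1 t - z2 t) = (s1 k t - z1 t) - (s2 k t - z2 t)" by (simp add: s_def)
   moreover have "s1 k t - z1 t \<in> V" "s2 k t - z2 t \<in> V"
    using elim s1(2)[of k] s2(2)[of k] by (auto intro!: subspace_diff[OF V])
   ultimately show ?thesis using nV_diff by presburger
  qed
  then have "\<forall>\<^sub>F k in sequentially. norm (nV (s k t - (z1 t - z2 t))) \<le> nV (s1 k t - z1 t) + nV (s2 k t - z2 t)"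
   by (simp add: nV_nonneg)
  then show ?case by (rule Lim_null_comparison) (use tendsto_add[OF elim(1,2)] in simp)
 qed
 have zV: "AE t in ?M. z1 t - z2 t \<in> V"
  using path_V[OF p1] path_V[OF p2] by eventually_elim (auto intro!: subspace_diff[OF V])
 have nV2: "(\<lambda>t. (nV (z1 t - z2 t))^2) absolutely_integrable_on {0..T}"
 proof (rule absolutely_integrable_bound)
  show "(\<lambda>t. (nV (z1 t - z2 t))^2) \<in> borel_measurable ?M"
  proof (rule lebesgue_on_measurable_AE_limit)
   show "(\<lambda>t. (nV (s k t))^2) \<in> borel_measurable ?M" for k
    by (rule measurable_simple_composition[OF s, where F="\<lambda>t v. (nV v)^2"]) simp
   show "AE t in ?M. (\<lambda>k. (nV (s k t))^2) \<longlonglongrightarrow> (nV (z1 t - z2 t))^2"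
    using conv zV
   proof eventually_elim
    case (elim t)
    have "\<bar>nV (s k t) - nV (z1 t - z2 t)\<bar> \<le> nV (s k t - (z1 t - z2 t))" for k
     using nV_triangle[of "s k t" "z1 t - z2 t" 0] elim sV[of k] subspace_0[OF V] by auto
    then have "\<forall>\<^sub>F k in sequentially. norm (nV (s k t) - nV (z1 t - z2 t)) \<le> nV (s k t - (z1 t - z2 t))" by simp
    then have "(\<lambda>k. nV (s k t) - nV (z1 t - z2 t)) \<longlonglongrightarrow> 0" by (rule Lim_null_comparison[OF _ elim(1)])
    then have "(\<lambda>k. nV (s k t)) \<longlonglongrightarrow> nV (z1 t - z2 t)" by (rule LIM_zero_cancel)
    then show ?case by (rule tendsto_power)
   qed
  qed auto
  show "(\<lambda>t. 2 * (nV (z1 t))^2 + 2 * (nV (z2 t))^2) absolutely_integrable_on {0..T}"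
   by (intro set_integral_add(1) set_integrable_mult_right path_nV2[OF p1] path_nV2[OF p2])
  show "AE t in ?M. \<bar>(nV (z1 t - z2 t))^2\<bar> \<le> 2 * (nV (z1 t))^2 + 2 * (nV (z2 t))^2"
   using path_V[OF p1] path_V[OF p2]
  proof eventually_elim
   case (elim t)
   have "(nV (z1 t - z2 t))^2 \<le> (nV (z1 t) + nV (z2 t))^2" by (intro power_mono nV_diff elim nV_nonneg)
   also have "... \<le> 2 * (nV (z1 t))^2 + 2 * (nV (z2 t))^2"
    using zero_le_power2[of "nV (z1 t) - nV (z2 t)"] by (simp add: power2_sum power2_diff)
   finally show ?case by simp
  qed
 qed
 have m2: "(\<lambda>t. (m1 t + m2 t)^2) absolutely_integrable_on {0..T}"
 proof (rule absolutely_integrable_bound)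
  show "(\<lambda>t. (m1 t + m2 t)^2) \<in> borel_measurable ?M"
   by (intro borel_measurable_power borel_measurable_add path_m[OF p1] path_m[OF p2])
  show "(\<lambda>t. 2 * (m1 t)^2 + 2 * (m2 t)^2) absolutely_integrable_on {0..T}"
   by (intro set_integral_add(1) set_integrable_mult_right path_m[OF p1] path_m[OF p2])
  have "(m1 t + m2 t)^2 \<le> 2 * (m1 t)^2 + 2 * (m2 t)^2" for t
   using zero_le_power2[of "m1 t - m2 t"] by (simp add: power2_sum power2_diff)
  then show "AE t in ?M. \<bar>(m1 t + m2 t)^2\<bar> \<le> 2 * (m1 t)^2 + 2 * (m2 t)^2" by simp
 qed
 have lin: "AE t in ?M. (\<forall>\<phi>\<in>V. \<forall>\<psi>\<in>V. G1 t (\<phi> + \<psi>) - G2 t (\<phi> + \<psi>) = (G1 t \<phi> - G2 t \<phi>) + (G1 t \<psi> - G2 t \<psi>)) \<and>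
    (\<forall>\<phi>\<in>V. \<forall>c. G1 t (c *\<^sub>R \<phi>) - G2 t (c *\<^sub>R \<phi>) = c * (G1 t \<phi> - G2 t \<phi>)) \<and> (\<forall>\<phi>\<in>V. \<bar>G1 t \<phi> - G2 t \<phi>\<bar> \<le> (m1 t + m2 t) * nV \<phi>)"
  using path_G_linear[OF p1] path_G_linear[OF p2]
 proof eventually_elim
  case (elim t)
  have "\<bar>G1 t \<phi> - G2 t \<phi>\<bar> \<le> (m1 t + m2 t) * nV \<phi>" if "\<phi> \<in> V" for \<phi>
  proof -
   have "\<bar>G1 t \<phi>\<bar> \<le> m1 t * nV \<phi>" "\<bar>G2 t \<phi>\<bar> \<le> m2 t * nV \<phi>" using elim that by blast+
   then show ?thesis unfolding distrib_right by linarith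
  qed
  then show ?case using elim by (simp add: right_diff_distrib)
 qed
 have eq: "(z1 b - z2 b) \<bullet> \<phi> - (z1 a - z2 a) \<bullet> \<phi> = integral {a..b} (\<lambda>t. G1 t \<phi> - G2 t \<phi>)"
  if "\<phi> \<in> V" "0 \<le> a" "a \<le> b" "b \<le> T" for \<phi> a b
 proof -
  have "integral {a..b} (\<lambda>t. G1 t \<phi> - G2 t \<phi>) = integral {a..b} (\<lambda>t. G1 t \<phi>) - integral {a..b} (\<lambda>t. G2 t \<phi>)"
   using that by (intro hk_integral_diff abs_integrable_integrable
    abs_integrable_subinterval[OF path_G_integrable[OF p1]] abs_integrable_subinterval[OF path_G_integrable[OF p2]]) auto
  then show ?thesis using path_eq[OF p1 that] path_eq[OF p2 that] by (simp add: inner_diff_left)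
 qed
 show ?thesis
  unfolding weak_path_def
 proof (intro conjI)
  show "\<forall>t\<in>{0..T}. z1 t - z2 t \<in> Hs" using path_Hs[OF p1] path_Hs[OF p2] by (auto intro!: subspace_diff[OF Hs])
  show "\<forall>h\<in>Hs. continuous_on {0..T} (\<lambda>t. (z1 t - z2 t) \<bullet> h)"
   unfolding inner_diff_left by (intro ballI continuous_intros path_cont[OF p1] path_cont[OF p2])
  show "\<exists>s. (\<forall>k::nat. simple_function ?M (s k) \<and> range (s k) \<subseteq> V) \<and> (AE t in ?M. (\<lambda>k. nV (s k t - (z1 t - z2 t))) \<longlonglongrightarrow> 0)"
   using s sV conv by blast
  show "\<forall>t. 0 \<le> m1 t + m2 t" using path_m(1)[OF p1] path_m(1)[OF p2] by simp
  show "(\<lambda>t. m1 t + m2 t) \<in> borel_measurable ?M" by (intro borel_measurable_add path_m[OF p1] path_m[OF p2])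
  show "\<forall>\<phi>\<in>V. (\<lambda>t. G1 t \<phi> - G2 t \<phi>) \<in> borel_measurable ?M"
   by (intro ballI borel_measurable_diff path_G_measurable[OF p1] path_G_measurable[OF p2])
  show "\<forall>\<phi>\<in>V. \<forall>a b. 0 \<le> a \<longrightarrow> a \<le> b \<longrightarrow> b \<le> T \<longrightarrow> (z1 b - z2 b) \<bullet> \<phi> - (z1 a - z2 a) \<bullet> \<phi> = integral {a..b} (\<lambda>t. G1 t \<phi> - G2 t \<phi>)"
   using eq by blast
 qed (fact zV nV2 m2 lin)+
qed

text \<open>Used to pass to weighted norms in the energy inequality.\<close>

lemma weak_path_transform:
 assumes p: "weak_path T z G m" and W: "linear W" "\<And>x. x \<in> V \<Longrightarrow> W x \<in> V" "\<And>x. x \<in> Hs \<Longrightarrow> W x \<in> Hs"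
  "\<And>x y. W x \<bullet> y = x \<bullet> W y" "\<And>x. x \<in> V \<Longrightarrow> nV (W x) \<le> C * nV x" "C \<ge> 0"
 shows "weak_path T (\<lambda>t. W (z t)) (\<lambda>t \<phi>. G t (W \<phi>)) (\<lambda>t. C * m t)"
proof -
 let ?M = "lebesgue_on {0..T}"
 interpret W: linear W by fact
 obtain s where s: "\<And>k::nat. simple_function ?M (s k)" "\<And>k. range (s k) \<subseteq> V"
  "AE t in ?M. (\<lambda>k. nV (s k t - z t)) \<longlonglongrightarrow> 0" using path_simple[OF p] by blast
 have conv: "AE t in ?M. (\<lambda>k. nV (W (s k t) - W (z t))) \<longlonglongrightarrow> 0"
  using s(3) path_V[OF p]
 proof eventually_elim
  case (elim t)
  have "nV (W (s k t) - W (z t)) \<le> C * nV (s k t - z t)" for k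
   using W(5)[of "s k t - z t"] s(2)[of k] elim by (auto simp: W.diff intro!: subspace_diff[OF V])
  then have "\<forall>\<^sub>F k in sequentially. norm (nV (W (s k t) - W (z t))) \<le> C * nV (s k t - z t)" by (simp add: nV_nonneg)
  then show ?case by (rule Lim_null_comparison) (rule tendsto_mult_right_zero[OF elim(1)])
 qed
 have Wk: "simple_function ?M (\<lambda>t. W (s k t))" "range (\<lambda>t. W (s k t)) \<subseteq> V" for k
  using simple_function_compose1[OF s(1)[of k], of W] s(2)[of k] W(2) by auto
 have meas: "(\<lambda>t. nV (W (z t))) \<in> borel_measurable ?M"
 proof (rule lebesgue_on_measurable_AE_limit)
  show "(\<lambda>t. nV (W (s k t))) \<in> borel_measurable ?M" for k
   by (rule measurable_simple_composition[OF s(1), where F="\<lambda>t v. nV (W v)"]) simp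
  show "AE t in ?M. (\<lambda>k. nV (W (s k t))) \<longlonglongrightarrow> nV (W (z t))"
   using conv path_V[OF p]
  proof eventually_elim
   case (elim t)
   have "\<bar>nV (W (s k t)) - nV (W (z t))\<bar> \<le> nV (W (s k t) - W (z t))" for k
    using nV_triangle[of "W (s k t)" "W (z t)" 0] W(2) elim s(2)[of k] subspace_0[OF V] by auto
   then have "\<forall>\<^sub>F k in sequentially. norm (nV (W (s k t)) - nV (W (z t))) \<le> nV (W (s k t) - W (z t))" by simp
   then have "(\<lambda>k. nV (W (s k t)) - nV (W (z t))) \<longlonglongrightarrow> 0" by (rule Lim_null_comparison[OF _ elim(1)])
   then show ?case by (rule LIM_zero_cancel)
  qed
 qed auto
 have nV2: "(\<lambda>t. (nV (W (z t)))^2) absolutely_integrable_on {0..T}"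
 proof (rule absolutely_integrable_bound[OF borel_measurable_power[OF meas]])
  show "(\<lambda>t. C^2 * (nV (z t))^2) absolutely_integrable_on {0..T}" by (intro set_integrable_mult_right path_nV2[OF p])
  show "AE t in ?M. \<bar>(nV (W (z t)))^2\<bar> \<le> C^2 * (nV (z t))^2"
   using path_V[OF p] by eventually_elim (use power_mono[OF W(5) nV_nonneg, of _ 2] in \<open>simp add: power_mult_distrib\<close>)
 qed
 have lin: "AE t in ?M. (\<forall>\<phi>\<in>V. \<forall>\<psi>\<in>V. G t (W (\<phi> + \<psi>)) = G t (W \<phi>) + G t (W \<psi>)) \<and>
    (\<forall>\<phi>\<in>V. \<forall>c. G t (W (c *\<^sub>R \<phi>)) = c * G t (W \<phi>)) \<and> (\<forall>\<phi>\<in>V. \<bar>G t (W \<phi>)\<bar> \<le> C * m t * nV \<phi>)"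
  using path_G_linear[OF p]
 proof eventually_elim
  case (elim t)
  have "\<bar>G t (W \<phi>)\<bar> \<le> C * m t * nV \<phi>" if "\<phi> \<in> V" for \<phi>
  proof -
   have "\<bar>G t (W \<phi>)\<bar> \<le> m t * nV (W \<phi>)" using elim W(2)[OF that] by blast
   also have "... \<le> m t * (C * nV \<phi>)" using W(5)[OF that] path_m(1)[OF p] by (rule mult_left_mono)
   finally show ?thesis by (simp add: mult.assoc mult.left_commute)
  qed
  then show ?case using elim W(2) by (simp add: W.add W.scale)
 qed
 show ?thesis
  unfolding weak_path_def
 proof (intro conjI)
  show "\<forall>t\<in>{0..T}. W (z t) \<in> Hs" using path_Hs[OF p] W(3) by blast
  show "\<forall>h\<in>Hs. continuous_on {0..T} (\<lambda>t. W (z t) \<bullet> h)"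
   unfolding W(4) using path_cont[OF p] W(3) by blast
  show "AE t in ?M. W (z t) \<in> V" using path_V[OF p] by eventually_elim (rule W(2))
  show "\<exists>s. (\<forall>k::nat. simple_function ?M (s k) \<and> range (s k) \<subseteq> V) \<and> (AE t in ?M. (\<lambda>k. nV (s k t - W (z t))) \<longlonglongrightarrow> 0)"
   using Wk conv by (intro exI[of _ "\<lambda>k t. W (s k t)"]) blast
  show "\<forall>t. 0 \<le> C * m t" using path_m(1)[OF p] W(6) by simp
  show "(\<lambda>t. C * m t) \<in> borel_measurable ?M" by (intro borel_measurable_times borel_measurable_const path_m[OF p])
  show "(\<lambda>t. (C * m t)^2) absolutely_integrable_on {0..T}"
   unfolding power_mult_distrib by (intro set_integrable_mult_right path_m[OF p])
  show "\<forall>\<phi>\<in>V. (\<lambda>t. G t (W \<phi>)) \<in> borel_measurable ?M"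
   using path_G_measurable[OF p] W(2) by blast
  show "\<forall>\<phi>\<in>V. \<forall>a b. 0 \<le> a \<longrightarrow> a \<le> b \<longrightarrow> b \<le> T \<longrightarrow> W (z b) \<bullet> \<phi> - W (z a) \<bullet> \<phi> = integral {a..b} (\<lambda>t. G t (W \<phi>))"
   unfolding W(4) using path_eq[OF p] W(2) by blast
 qed (fact nV2 lin)+
qed

text \<open>Averaging over [0,1] finds a time at which the path lies in \<open>V\<close> both there
  and \<tau> later, with controlled norms. Testing the increment with itself, and Cauchy-Schwarz for
  the integral of m, give the factor sqrt \<tau> in the squared norm.\<close>

lemma path_time_holder:
 assumes p: "weak_path T z G m" and \<tau>: "0 \<le> \<tau>" "1 + \<tau> \<le> T"
 shows "\<exists>t\<in>{0..1}. (norm (z (t + \<tau>) - z t))^2 \<le>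
  sqrt \<tau> * (sqrt (integral {0..T} (\<lambda>t. (m t)^2)) * (2 * integral {0..T} (\<lambda>t. (nV (z t))^2) + 3))"
proof -
 note ai = abs_integrable_integrable
 let ?f = "\<lambda>t. (nV (z t))^2" and ?M = "lebesgue_on {0..1::real}"
 define E where "E = integral {0..T} ?f"
 have f: "?f absolutely_integrable_on {c..d}" if "0 \<le> c" "d \<le> T" for c d
  using that by (intro abs_integrable_subinterval[OF path_nV2[OF p]])
 have fs: "(\<lambda>t. ?f (t + \<tau>)) absolutely_integrable_on {0..1}" "integral {0..1} (\<lambda>t. ?f (t + \<tau>)) = integral {\<tau>..1 + \<tau>} ?f"
 proof -
  have eq: "(?f \<circ> (+) \<tau>) = (\<lambda>t. ?f (t + \<tau>))" by (auto simp: o_def add.commute)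
  have "?f integrable_on {0 + \<tau>..1 + \<tau>}" using \<tau> by (intro ai f) auto
  then have "(\<lambda>t. ?f (t + \<tau>)) integrable_on {0..1}"
   using integrable_on_shift_Icc_real[of ?f \<tau> 0 1] by (simp add: eq)
  then show "(\<lambda>t. ?f (t + \<tau>)) absolutely_integrable_on {0..1}" by (rule nonnegative_absolutely_integrable_1) simp
  show "integral {0..1} (\<lambda>t. ?f (t + \<tau>)) = integral {\<tau>..1 + \<tau>} ?f"
   using integral_shift_Icc_real[of 0 1 ?f \<tau>] by (simp add: eq)
 qed
 have le: "integral {c..d} ?f \<le> E" if "0 \<le> c" "d \<le> T" for c d
  unfolding E_def using that by (intro integral_subset_le ai f) auto
 have V1: "AE t in ?M. z t \<in> V" by (rule AE_lebesgue_on_subset[OF path_V[OF p]]) (use \<tau> in auto)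
 \<comment> \<open>The exceptional null set is translated by \<tau>, so almost every t is good at
   both instants.\<close>
 have V2: "AE t in ?M. z (t + \<tau>) \<in> V"
 proof -
  have "AE t in lebesgue. t \<in> {0..T} \<longrightarrow> z t \<in> V"
   using path_V[OF p] by (subst (asm) AE_restrict_space_iff) auto
  then have "AE t in lborel. t \<in> {0..T} \<longrightarrow> z t \<in> V" by (simp only: AE_completion_iff)
  then have "AE t in distr lborel borel ((+) \<tau>). t \<in> {0..T} \<longrightarrow> z t \<in> V" by (simp only: lborel_distr_plus)
  then have "AE t in lborel. \<tau> + t \<in> {0..T} \<longrightarrow> z (\<tau> + t) \<in> V" by (rule AE_distrD[rotated]) simp
  then have "AE t in lebesgue. \<tau> + t \<in> {0..T} \<longrightarrow> z (\<tau> + t) \<in> V" by (rule AE_completion)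
  then have "AE t in lebesgue. t \<in> {0..1} \<longrightarrow> z (t + \<tau>) \<in> V"
   by eventually_elim (use \<tau> in \<open>auto simp: add.commute\<close>)
  then show ?thesis by (subst AE_restrict_space_iff) auto
 qed
 \<comment> \<open>If all times were bad, the integral over [0,1] would be at least 2 E + 1, while
   each of the two summands contributes at most E.\<close>
 have "\<exists>t\<in>{0..1}. z t \<in> V \<and> z (t + \<tau>) \<in> V \<and> ?f t + ?f (t + \<tau>) \<le> 2 * E + 1"
 proof (rule ccontr)
  assume neg: "\<not> ?thesis"
  have sp: "AE t in ?M. t \<in> {0..1}" by (rule AE_I2) simp
  have "AE t in ?M. 2 * E + 1 \<le> ?f t + ?f (t + \<tau>)"
   using V1 V2 sp by eventually_elim (use neg in force)
  then have "integral {0..1::real} (\<lambda>t. 2 * E + 1) \<le> integral {0..1} (\<lambda>t. ?f t + ?f (t + \<tau>))"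
   by (intro integral_le_AE absolutely_integrable_const set_integral_add(1) f fs(1)) (use \<tau> in auto)
  also have "... = integral {0..1} ?f + integral {\<tau>..1 + \<tau>} ?f"
   using \<tau> by (subst hk_integral_add) (auto intro!: ai f fs(1) simp: fs(2))
  also have "... \<le> E + E" using \<tau> by (intro add_mono le) auto
  finally show False by simp
 qed
 then obtain t where t: "t \<in> {0..1}" "z t \<in> V" "z (t + \<tau>) \<in> V" "?f t + ?f (t + \<tau>) \<le> 2 * E + 1" by blast
 let ?D = "integral {t..t + \<tau>} m" and ?N = "integral {0..T} (\<lambda>t. (m t)^2)"
 have mi: "m absolutely_integrable_on {t..t + \<tau>}" "(\<lambda>t. (m t)^2) absolutely_integrable_on {t..t + \<tau>}"
  using t \<tau> by (intro abs_integrable_subinterval[OF path_m_integrable[OF p]] abs_integrable_subinterval[OF path_m(3)[OF p]]; simp)+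
 have "?D^2 \<le> (t + \<tau> - t) * integral {t..t + \<tau>} (\<lambda>t. (m t)^2)"
  using \<tau> by (intro integral_power2_le ai mi) auto
 also have "... \<le> \<tau> * ?N"
  using t \<tau> by (auto intro!: mult_left_mono integral_subset_le ai mi path_m(3)[OF p])
 finally have "sqrt (?D^2) \<le> sqrt (\<tau> * ?N)" by (rule real_sqrt_le_mono)
 then have D: "?D \<le> sqrt \<tau> * sqrt ?N" by (simp add: real_sqrt_mult)
 have D0: "0 \<le> ?D" using path_m(1)[OF p] by (intro hk_integral_nonneg ai mi) auto
 have n1: "nV x \<le> 1 + (nV x)^2" for x using zero_le_power2[of "nV x - 1"] nV_nonneg[of x] by (simp add: power2_diff)
 have "(norm (z (t + \<tau>) - z t))^2 \<le> \<bar>(z (t + \<tau>) - z t) \<bullet> (z (t + \<tau>) - z t)\<bar>" by (simp add: power2_norm_eq_inner)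
 also have "... \<le> nV (z (t + \<tau>) - z t) * ?D"
  using t \<tau> by (intro path_increment_le[OF p] subspace_diff[OF V]) auto
 also have "... \<le> (2 * E + 3) * (sqrt \<tau> * sqrt ?N)"
 proof (rule mult_mono[OF _ D _ D0])
  have "nV (z (t + \<tau>) - z t) \<le> nV (z (t + \<tau>)) + nV (z t)" using t by (intro nV_diff)
  also have "... \<le> 2 * E + 3" using n1[of "z t"] n1[of "z (t + \<tau>)"] t(4) by linarith
  finally show "nV (z (t + \<tau>) - z t) \<le> 2 * E + 3" .
  then show "0 \<le> 2 * E + 3" using nV_nonneg order_trans by blast
 qed
 finally show ?thesis using t(1) unfolding E_def by (intro bexI[of _ t]) (simp_all add: mult.assoc mult.left_commute mult.commute)
qed

end

subsection \<open>Uniform boundedness\<close>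

text \<open>A gliding hump. From vectors of norm at least 4^n a series with steps of length 3^(-n-1)
  along these vectors is built, the sign of each step chosen so that the pairing with the current
  vector is large. The later steps sum to at most half of the current one, so the limit has
  unbounded pairings with \<open>A\<close>.\<close>

lemma uniform_boundedness:
 fixes Hs :: "'h::real_inner set" and A :: "'h set"
 assumes sub: "subspace Hs" and comp: "complete Hs" and A: "A \<subseteq> Hs"
  and bdd: "\<And>h. h \<in> Hs \<Longrightarrow> bounded ((\<lambda>a. a \<bullet> h) ` A)"
 shows "bounded A"
proof (rule ccontr)
 assume nb: "\<not> bounded A"
 have "\<exists>a\<in>A. norm a \<ge> c \<and> a \<noteq> 0" for c
 proof -
  obtain a where "a \<in> A" "norm a > max c 0" using nb unfolding bounded_iff by (metis not_le)
  then show ?thesis by (intro bexI[of _ a]) auto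
 qed
 then have "\<forall>n::nat. \<exists>a. a \<in> A \<and> norm a \<ge> 4 ^ n \<and> a \<noteq> 0" by blast
 from choice[OF this] obtain a :: "nat \<Rightarrow> 'h"
  where a: "\<And>n. a n \<in> A" "\<And>n. norm (a n) \<ge> 4 ^ n" "\<And>n. a n \<noteq> 0" by blast
 define d where "d n = (1/3) ^ Suc n *\<^sub>R (a n /\<^sub>R norm (a n))" for n
 define x where "x = rec_nat 0 (\<lambda>n x. if \<bar>a n \<bullet> (x + d n)\<bar> \<ge> (1/3) ^ Suc n * norm (a n) then x + d n else x - d n)"
 have x0: "x 0 = 0" by (simp add: x_def)
 have xS: "x (Suc n) = (if \<bar>a n \<bullet> (x n + d n)\<bar> \<ge> (1/3) ^ Suc n * norm (a n) then x n + d n else x n - d n)" for n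
  by (simp add: x_def)
 have dH: "d n \<in> Hs" for n unfolding d_def using a(1) A by (intro subspace_scale[OF sub]) auto
 have xH: "x n \<in> Hs" for n
  by (induction n) (auto simp: x0 xS subspace_0[OF sub] intro!: subspace_add[OF sub] subspace_diff[OF sub] dH)
 have nd: "norm (d n) = (1/3) ^ Suc n" for n using a(3)[of n] by (simp add: d_def)
 have ad: "a n \<bullet> d n = (1/3) ^ Suc n * norm (a n)" for n
  using a(3)[of n] by (simp add: d_def power2_norm_eq_inner[symmetric] power2_eq_square)
 \<comment> \<open>As a n \<bullet> d n equals the required size, x n + d n and x n - d n cannot
   both fail.\<close>
 have big: "\<bar>a n \<bullet> x (Suc n)\<bar> \<ge> (1/3) ^ Suc n * norm (a n)" for n
 proof -
  have "t \<le> \<bar>s - t\<bar>" if "\<not> t \<le> \<bar>s + t\<bar>" "0 \<le> t" for s t :: real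
   using that by (auto simp: abs_if split: if_splits)
  from this[of "a n \<bullet> d n" "a n \<bullet> x n"] show ?thesis
   unfolding xS ad[of n, symmetric] by (auto simp: inner_add_right inner_diff_right ad)
 qed
 have step: "norm (x (Suc n) - x n) \<le> (1/3) ^ Suc n" for n using nd[of n] by (simp add: xS)
 have tail: "norm (x (k + j) - x k) \<le> 1/2 * (1/3) ^ k - 1/2 * (1/3) ^ (k + j)" for k j
 proof (induction j)
  case (Suc j)
  have "x (k + Suc j) - x k = (x (Suc (k + j)) - x (k + j)) + (x (k + j) - x k)" by simp
  then have "norm (x (k + Suc j) - x k) \<le> norm (x (Suc (k + j)) - x (k + j)) + norm (x (k + j) - x k)"
   by (metis norm_triangle_ineq)
  then show ?case using Suc step[of "k + j"] by simp
 qed simp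
 have tail': "norm (x m - x k) \<le> 1/2 * (1/3) ^ k" if "k \<le> m" for m k
 proof -
  have "0 \<le> (1/3::real) ^ m" by simp
  moreover have "norm (x m - x k) \<le> 1/2 * (1/3) ^ k - 1/2 * (1/3) ^ m" using tail[of k "m - k"] that by (simp only: le_add_diff_inverse)
  ultimately show ?thesis by linarith
 qed
 have "Cauchy x"
 proof (rule CauchyI')
  fix e :: real assume "e > 0"
  then obtain k where k: "(1/3::real) ^ k < e" using real_arch_pow_inv[of e "1/3"] by auto
  have "norm (x m - x n) < e" if "k \<le> m" "m < n" for m n
  proof -
   have "norm (x m - x n) \<le> 1/2 * (1/3) ^ m" using tail'[of m n] that by (simp add: norm_minus_commute)
   also have "... \<le> 1/2 * (1/3) ^ k" using that by (intro mult_left_mono power_decreasing) auto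
   also have "... < e" using k zero_less_power[of "1/3::real" k] by linarith
   finally show ?thesis .
  qed
  then show "\<exists>M. \<forall>m\<ge>M. \<forall>n>m. dist (x m) (x n) < e" by (auto simp: dist_norm)
 qed
 then obtain l where l: "l \<in> Hs" "x \<longlonglongrightarrow> l" using comp xH unfolding complete_def by blast
 have lx: "norm (l - x k) \<le> 1/2 * (1/3) ^ k" for k
 proof (rule LIMSEQ_le_const2)
  show "(\<lambda>m. norm (x m - x k)) \<longlonglongrightarrow> norm (l - x k)" by (intro tendsto_intros l)
  show "\<exists>N. \<forall>m\<ge>N. norm (x m - x k) \<le> 1/2 * (1/3) ^ k" using tail' by blast
 qed
 obtain B where B: "\<And>v. v \<in> A \<Longrightarrow> \<bar>v \<bullet> l\<bar> \<le> B" using bdd[OF l(1)] by (auto simp: bounded_iff)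
 have "1/2 * (4/3) ^ n \<le> 3 * B" for n
 proof -
  have "\<bar>a n \<bullet> (l - x (Suc n))\<bar> \<le> norm (a n) * (1/2 * (1/3) ^ Suc n)"
   using Cauchy_Schwarz_ineq2[of "a n" "l - x (Suc n)"] mult_left_mono[OF lx[of "Suc n"] norm_ge_zero[of "a n"]] by linarith
  moreover have "a n \<bullet> l = a n \<bullet> x (Suc n) + a n \<bullet> (l - x (Suc n))" by (simp add: inner_diff_right)
  moreover have "1/2 * r * N \<le> \<bar>z\<bar>" if "r * N \<le> \<bar>s\<bar>" "\<bar>t\<bar> \<le> N * (1/2 * r)" "z = s + t" for r N s t z :: real
  proof -
   have "N * (1/2 * r) = 1/2 * (r * N)" "1/2 * r * N = 1/2 * (r * N)" by simp_all
   then show ?thesis using that by linarith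
  qed
  ultimately have "1/2 * (1/3) ^ Suc n * norm (a n) \<le> \<bar>a n \<bullet> l\<bar>" using big[of n] by blast
  also have "... \<le> B" by (rule B[OF a(1)])
  finally have "(1/3) ^ n * norm (a n) \<le> 6 * B" by simp
  moreover have "(1/3) ^ n * 4 ^ n \<le> (1/3) ^ n * norm (a n)" by (intro mult_left_mono a) simp
  moreover have "(1/3::real) ^ n * 4 ^ n = (4/3) ^ n" by (simp add: power_mult_distrib[symmetric])
  ultimately show ?thesis by simp
 qed
 then have "(4/3) ^ n \<le> 6 * B" for n by (simp add: field_simps)
 moreover obtain n where "6 * B < (4/3::real) ^ n" using real_arch_pow[of "4/3" "6 * B"] by auto
 ultimately show False using leD by blast
qed

lemma closed_L2_on: "closed (L2_on \<Omega>)"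
 unfolding closed_sequential_limits
proof (intro allI impI)
 fix X u assume "(\<forall>n. X n \<in> L2_on \<Omega>) \<and> X \<longlonglongrightarrow> u"
 then have X: "\<And>n. X n \<in> L2_on \<Omega>" and lim: "X \<longlonglongrightarrow> u" by auto
 obtain r :: "nat \<Rightarrow> nat" where r: "AE x in lebesgue. (\<lambda>k. rep_L2 (X (r k)) x) \<longlonglongrightarrow> rep_L2 u x"
  using L2_tendsto_AE_subseq[OF lim] by blast
 have 1: "AE x in lebesgue. \<forall>k. x \<notin> \<Omega> \<longrightarrow> rep_L2 (X (r k)) x = 0"
  using X by (subst AE_all_countable) (auto simp: L2_on_def)
 have "AE x in lebesgue. x \<notin> \<Omega> \<longrightarrow> rep_L2 u x = 0" using 1 r
  by eventually_elim (auto simp: LIMSEQ_const_iff)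
 then show "u \<in> L2_on \<Omega>" by (simp add: L2_on_def)
qed

lemma subspace_H_space: "subspace (H_space \<Omega>)"
 unfolding H_space_def by (intro subspace_Times L2_on_subspace)

lemma complete_H_space: "complete (H_space \<Omega>)"
 unfolding H_space_def by (intro complete_eq_closed[THEN iffD2] closed_Times closed_L2_on)

text \<open>Each scalar function is bounded on the compact interval, and uniform boundedness carries
  this over to the norms. The quadratic terms along a solution are thereby under control before any
  energy estimate is known.\<close>

lemma weakly_continuous_bounded:
 assumes "weakly_continuous_H \<Omega> T g" shows "bounded (g ` {0..T})"
proof (rule uniform_boundedness[OF subspace_H_space complete_H_space])
 show "g ` {0..T} \<subseteq> H_space \<Omega>" using assms by (auto simp: weakly_continuous_H_def)
 show "bounded ((\<lambda>a. a \<bullet> h) ` g ` {0..T})" if "h \<in> H_space \<Omega>" for h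
 proof -
  have "continuous_on {0..T} (\<lambda>t. g t \<bullet> h)" using assms that by (simp add: weakly_continuous_H_def)
  then have "bounded ((\<lambda>t. g t \<bullet> h) ` {0..T})" by (intro compact_imp_bounded compact_continuous_image) auto
  then show ?thesis by (simp add: image_image)
 qed
qed

subsection \<open>Products and the spaces \<open>E\<close> and \<open>H\<close>\<close>

context
 fixes \<Omega> :: "'a::euclidean_space set"
 assumes dim: "DIM('a) \<le> 3" and open_domain: "open \<Omega>" and bounded_domain: "bounded \<Omega>"
begin

lemma H10_power4_integrable:
 assumes "u \<in> H10 \<Omega>" shows "integrable lebesgue (\<lambda>x. (rep_L2 u x) ^ 4)"
proof (rule integrableI_bounded)
 obtain C where "(\<integral>\<^sup>+x. ennreal ((rep_L2 u x) ^ 4) \<partial>lebesgue) \<le> ennreal (1 * (grad_norm \<Omega> u) ^ 4 + C * (norm u) ^ 4)"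
  using H10_L4[OF dim, of 1 \<Omega>] assms by auto
 then show "(\<integral>\<^sup>+x. ennreal (norm ((rep_L2 u x) ^ 4)) \<partial>lebesgue) < \<infinity>"
  using le_less_trans[OF _ ennreal_less_top] by simp
qed measurable

text \<open>By the L^4 bound, the default value 0 in \<open>L2_of\<close> is never taken for a
  product of factors in \<open>H10\<close>.\<close>

lemma H10_mult_square_integrable:
 assumes "u \<in> H10 \<Omega>" "v \<in> H10 \<Omega>" shows "square_integrable (\<lambda>x. rep_L2 u x * rep_L2 v x)"
 unfolding square_integrable_def
proof
 show "integrable lebesgue (\<lambda>x. (rep_L2 u x * rep_L2 v x)^2)"
 proof (rule Bochner_Integration.integrable_bound)
  show "integrable lebesgue (\<lambda>x. (rep_L2 u x) ^ 4 + (rep_L2 v x) ^ 4)"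
   by (intro Bochner_Integration.integrable_add H10_power4_integrable assms)
  have "(a * b)^2 \<le> a ^ 4 + b ^ 4" for a b :: real
  proof -
   have "2 * (a^2 * b^2) \<le> a ^ 4 + b ^ 4"
    using sum_squares_bound[of "a^2" "b^2"] by (simp add: power_mult[symmetric] mult.assoc)
   moreover have "0 \<le> a^2 * b^2" by simp
   ultimately show ?thesis unfolding power_mult_distrib by linarith
  qed
  then show "AE x in lebesgue. norm ((rep_L2 u x * rep_L2 v x)^2) \<le> norm ((rep_L2 u x) ^ 4 + (rep_L2 v x) ^ 4)"
   by (intro AE_I2) (auto intro: order_trans[OF _ abs_ge_self])
 qed measurable
qed measurable

lemma rep_L2_mult:
 assumes "u \<in> H10 \<Omega>" "v \<in> H10 \<Omega>" shows "AE x in lebesgue. rep_L2 (u \<odot> v) x = rep_L2 u x * rep_L2 v x"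
 unfolding L2_mult_def by (rule rep_L2_of[OF H10_mult_square_integrable[OF assms]])

lemma inner_mult_swap:
 assumes "u \<in> H10 \<Omega>" "v \<in> H10 \<Omega>" "p \<in> H10 \<Omega>" shows "(u \<odot> v) \<bullet> p = u \<bullet> (v \<odot> p)"
 unfolding inner_L2_eq
proof (rule integral_cong_AE)
 show "AE x in lebesgue. rep_L2 (u \<odot> v) x * rep_L2 p x = rep_L2 u x * rep_L2 (v \<odot> p) x"
  using rep_L2_mult[OF assms(1,2)] rep_L2_mult[OF assms(2,3)] by eventually_elim simp
qed measurable

text \<open>The integral of v^2 p^2 is read once as |v p|^2 and once as the pairing of v^2 with
  p^2.\<close>

lemma norm_mult_le:
 assumes "v \<in> H10 \<Omega>" "p \<in> H10 \<Omega>" shows "(norm (v \<odot> p))^2 \<le> norm (v \<odot> v) * norm (p \<odot> p)"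
proof -
 have "(norm (v \<odot> p))^2 = (v \<odot> v) \<bullet> (p \<odot> p)"
  unfolding power2_norm_eq_inner inner_L2_eq
 proof (rule integral_cong_AE)
  show "AE x in lebesgue. rep_L2 (v \<odot> p) x * rep_L2 (v \<odot> p) x = rep_L2 (v \<odot> v) x * rep_L2 (p \<odot> p) x"
   using rep_L2_mult[OF assms] rep_L2_mult[OF assms(1,1)] rep_L2_mult[OF assms(2,2)] by eventually_elim simp
 qed measurable
 then show ?thesis using Cauchy_Schwarz_ineq2[of "v \<odot> v" "p \<odot> p"] by linarith
qed

text \<open>The norm of the square is the square of the L^4 norm, so this is the L^4 inequality for
  \<epsilon>^2 after a square root. The small factor in front of the gradient is what lets diffusion
  absorb the quadratic terms.\<close>

lemma square_norm_le:
 assumes "\<epsilon> > 0"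
 shows "\<exists>C\<ge>0. \<forall>v\<in>H10 \<Omega>. norm (v \<odot> v) \<le> \<epsilon> * (grad_norm \<Omega> v)^2 + C * (norm v)^2"
proof -
 obtain C where C: "C \<ge> 0" "\<And>v. v \<in> H10 \<Omega> \<Longrightarrow> (\<integral>\<^sup>+x. ennreal ((rep_L2 v x) ^ 4) \<partial>lebesgue) \<le> ennreal (\<epsilon>^2 * (grad_norm \<Omega> v) ^ 4 + C * (norm v) ^ 4)"
  using H10_L4[OF dim, of "\<epsilon>^2" \<Omega>] assms by auto
 have "norm (v \<odot> v) \<le> \<epsilon> * (grad_norm \<Omega> v)^2 + sqrt C * (norm v)^2" if v: "v \<in> H10 \<Omega>" for v
 proof -
  have "ennreal ((norm (v \<odot> v))^2) = (\<integral>\<^sup>+x. ennreal ((rep_L2 (v \<odot> v) x)^2) \<partial>lebesgue)"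
   by (rule nn_integral_rep_power2[symmetric])
  also have "... = (\<integral>\<^sup>+x. ennreal ((rep_L2 v x) ^ 4) \<partial>lebesgue)"
   by (rule nn_integral_cong_AE) (use rep_L2_mult[OF v v] in \<open>eventually_elim, simp add: power2_eq_square power4_eq_xxxx mult.assoc\<close>)
  also note C(2)[OF v]
  finally have "(norm (v \<odot> v))^2 \<le> \<epsilon>^2 * (grad_norm \<Omega> v) ^ 4 + C * (norm v) ^ 4"
   using C(1) by (subst (asm) ennreal_le_iff) auto
  also have "... \<le> (\<epsilon> * (grad_norm \<Omega> v)^2 + sqrt C * (norm v)^2)^2"
   using C(1) assms by (simp add: power2_sum power_mult_distrib power_mult[symmetric] real_sqrt_pow2)
  finally show ?thesis by (rule power2_le_imp_le) (use C(1) assms in auto)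
 qed
 then show ?thesis using C(1) by (intro exI[of _ "sqrt C"]) auto
qed

text \<open>The case \<epsilon> = 1, with the L^2 norm absorbed by the Poincare inequality.\<close>

lemma square_norm_le_grad:
 shows "\<exists>K\<ge>0. \<forall>v\<in>H10 \<Omega>. norm (v \<odot> v) \<le> (K * grad_norm \<Omega> v)^2"
proof -
 obtain C where C: "C \<ge> 0" "\<And>v. v \<in> H10 \<Omega> \<Longrightarrow> norm (v \<odot> v) \<le> 1 * (grad_norm \<Omega> v)^2 + C * (norm v)^2"
  using square_norm_le[of 1] by auto
 obtain P where P: "P > 0" "\<And>u. u \<in> H10 \<Omega> \<Longrightarrow> norm u \<le> P * grad_norm \<Omega> u" using H10_poincare[OF bounded_domain] by blast
 have "norm (v \<odot> v) \<le> (sqrt (1 + C * P^2) * grad_norm \<Omega> v)^2" if v: "v \<in> H10 \<Omega>" for v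
 proof -
  have "(norm v)^2 \<le> (P * grad_norm \<Omega> v)^2" by (intro power_mono P v) simp
  then have "C * (norm v)^2 \<le> C * (P * grad_norm \<Omega> v)^2" using C(1) by (rule mult_left_mono)
  then show ?thesis using C P(1) C(2)[OF v] by (simp add: power_mult_distrib real_sqrt_pow2 algebra_simps)
 qed
 then show ?thesis using C P by (intro exI[of _ "sqrt (1 + C * P^2)"]) auto
qed

lemma E_norm_eq: "E_norm \<Omega> (u, v, w) = norm (grad_norm \<Omega> u, grad_norm \<Omega> v, grad_norm \<Omega> w)"
proof -
 have "norm (a, b, c) = sqrt (a^2 + b^2 + c^2)" for a b c :: real by (simp add: norm_Pair)
 then show ?thesis by (simp add: grad_norm_power2)
qed

lemma E_norm_power2: "(E_norm \<Omega> (u, v, w))^2 = (grad_norm \<Omega> u)^2 + (grad_norm \<Omega> v)^2 + (grad_norm \<Omega> w)^2"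
 by (simp add: grad_norm_power2[symmetric])

lemma triple_norm_power2: "(norm (u, v, w))^2 = (norm u)^2 + (norm v)^2 + (norm w)^2"
 by (simp add: norm_Pair)

lemma norm_triple_mono:
 fixes a b c a' b' c' :: real
 assumes "0 \<le> a" "a \<le> a'" "0 \<le> b" "b \<le> b'" "0 \<le> c" "c \<le> c'"
 shows "norm (a, b, c) \<le> norm (a', b', c')"
 using assms by (simp add: norm_Pair add_mono power_mono)

lemma E_energy_space: "\<exists>CP. energy_space (H_space \<Omega>) (E_space \<Omega>) (E_norm \<Omega>) CP"
proof -
 obtain P where P: "P > 0" "\<And>u. u \<in> H10 \<Omega> \<Longrightarrow> norm u \<le> P * grad_norm \<Omega> u" using H10_poincare[OF bounded_domain] by blast
 have "energy_space (H_space \<Omega>) (E_space \<Omega>) (E_norm \<Omega>) P"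
 proof
  show "subspace (H_space \<Omega>)" by (rule subspace_H_space)
  show "subspace (E_space \<Omega>)" unfolding E_space_def by (intro subspace_Times subspace_H10 open_domain)
  show "E_space \<Omega> \<subseteq> H_space \<Omega>" by (auto simp: E_space_def H_space_def H10_L2_on)
  show "0 \<le> E_norm \<Omega> x" for x by (cases x) (simp only: E_norm_eq norm_ge_zero)
  show "P > 0" by (rule P)
  fix x assume x: "x \<in> E_space \<Omega>"
  obtain u v w where xe: "x = (u, v, w)" by (cases x)
  have uvw: "u \<in> H10 \<Omega>" "v \<in> H10 \<Omega>" "w \<in> H10 \<Omega>" using x by (auto simp: xe E_space_def)
  show "E_norm \<Omega> (c *\<^sub>R x) = \<bar>c\<bar> * E_norm \<Omega> x" for c
  proof -
   have "E_norm \<Omega> (c *\<^sub>R x) = norm (\<bar>c\<bar> *\<^sub>R (grad_norm \<Omega> u, grad_norm \<Omega> v, grad_norm \<Omega> w))"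
    using uvw open_domain by (simp only: xe scaleR_Pair E_norm_eq grad_norm_scaleR real_scaleR_def)
   then show ?thesis by (simp only: norm_scaleR xe E_norm_eq abs_idempotent)
  qed
  show "norm x \<le> P * E_norm \<Omega> x"
  proof (rule power2_le_imp_le)
   have "(norm u)^2 \<le> (P * grad_norm \<Omega> u)^2" "(norm v)^2 \<le> (P * grad_norm \<Omega> v)^2" "(norm w)^2 \<le> (P * grad_norm \<Omega> w)^2"
    by (intro power_mono P uvw; simp)+
   then show "(norm x)^2 \<le> (P * E_norm \<Omega> x)^2"
    unfolding xe triple_norm_power2 power_mult_distrib E_norm_power2 by (simp add: distrib_left)
   show "0 \<le> P * E_norm \<Omega> x" using P(1) by (simp add: xe grad_norm_power2[symmetric])
  qed
  fix y assume y: "y \<in> E_space \<Omega>"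
  obtain p q r where ye: "y = (p, q, r)" by (cases y)
  have pqr: "p \<in> H10 \<Omega>" "q \<in> H10 \<Omega>" "r \<in> H10 \<Omega>" using y by (auto simp: ye E_space_def)
  have "E_norm \<Omega> (x + y) = norm (grad_norm \<Omega> (u + p), grad_norm \<Omega> (v + q), grad_norm \<Omega> (w + r))"
   by (simp only: xe ye add_Pair E_norm_eq)
  also have "... \<le> norm (grad_norm \<Omega> u + grad_norm \<Omega> p, grad_norm \<Omega> v + grad_norm \<Omega> q, grad_norm \<Omega> w + grad_norm \<Omega> r)"
   by (intro norm_triple_mono grad_norm_nonneg grad_norm_triangle open_domain uvw pqr)
  also have "... = norm ((grad_norm \<Omega> u, grad_norm \<Omega> v, grad_norm \<Omega> w) + (grad_norm \<Omega> p, grad_norm \<Omega> q, grad_norm \<Omega> r))"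
   by simp
  also have "... \<le> E_norm \<Omega> x + E_norm \<Omega> y" unfolding xe ye E_norm_eq by (rule norm_triangle_ineq)
  finally show "E_norm \<Omega> (x + y) \<le> E_norm \<Omega> x + E_norm \<Omega> y" .
 qed
 then show ?thesis by blast
qed

text \<open>The labels of the components form a label of the triple. Componentwise distance
  \<epsilon>/2 gives at most sqrt(3) \<epsilon>/2 in the product norm, so separated points carry
  different labels.\<close>

lemma E_totally_bounded:
 assumes "\<epsilon> > 0"
 shows "\<exists>N. \<forall>X. X \<subseteq> E_space \<Omega> \<longrightarrow> (\<forall>x\<in>X. E_norm \<Omega> x \<le> 1) \<longrightarrow> finite X \<longrightarrow>
  (\<forall>x\<in>X. \<forall>y\<in>X. x \<noteq> y \<longrightarrow> norm (x - y) > \<epsilon>) \<longrightarrow> card X \<le> N"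
proof -
 obtain \<kappa> :: "'a L2 \<Rightarrow> 'a L2 \<Rightarrow> int" where fin: "finite (\<kappa> ` {u \<in> H10 \<Omega>. grad_norm \<Omega> u \<le> 1})"
  and \<kappa>: "\<And>u v. u \<in> H10 \<Omega> \<Longrightarrow> v \<in> H10 \<Omega> \<Longrightarrow> grad_norm \<Omega> u \<le> 1 \<Longrightarrow> grad_norm \<Omega> v \<le> 1 \<Longrightarrow> \<kappa> u = \<kappa> v \<Longrightarrow> norm (u - v) \<le> \<epsilon> / 2"
  using H10_totally_bounded[OF bounded_domain open_domain, of "\<epsilon> / 2"] assms by auto
 let ?K = "\<kappa> ` {u \<in> H10 \<Omega>. grad_norm \<Omega> u \<le> 1}"
 define k where "k x = (case x of (u, v, w) \<Rightarrow> (\<kappa> u, \<kappa> v, \<kappa> w))" for x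
 have comp: "u \<in> H10 \<Omega> \<and> v \<in> H10 \<Omega> \<and> w \<in> H10 \<Omega> \<and> grad_norm \<Omega> u \<le> 1 \<and> grad_norm \<Omega> v \<le> 1 \<and> grad_norm \<Omega> w \<le> 1"
  if "(u, v, w) \<in> E_space \<Omega>" "E_norm \<Omega> (u, v, w) \<le> 1" for u v w
 proof -
  have "(E_norm \<Omega> (u, v, w))^2 \<le> 1^2" by (rule power_mono[OF that(2)]) (simp add: E_norm_eq del: E_norm.simps)
  then have "(grad_norm \<Omega> u)^2 \<le> 1^2" "(grad_norm \<Omega> v)^2 \<le> 1^2" "(grad_norm \<Omega> w)^2 \<le> 1^2"
   unfolding E_norm_power2 using zero_le_power2[of "grad_norm \<Omega> u"] zero_le_power2[of "grad_norm \<Omega> v"] zero_le_power2[of "grad_norm \<Omega> w"]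
   by linarith+
  then show ?thesis using that(1) by (auto simp: E_space_def intro: power2_le_imp_le)
 qed
 have "card X \<le> card (?K \<times> ?K \<times> ?K)"
  if X: "X \<subseteq> E_space \<Omega>" "\<forall>x\<in>X. E_norm \<Omega> x \<le> 1" "finite X" "\<forall>x\<in>X. \<forall>y\<in>X. x \<noteq> y \<longrightarrow> norm (x - y) > \<epsilon>" for X
 proof (rule card_inj_on_le)
  show "inj_on k X"
  proof (rule inj_onI, rule ccontr)
   fix x y assume xy: "x \<in> X" "y \<in> X" "k x = k y" "x \<noteq> y"
   obtain u v w p q r where e: "x = (u, v, w)" "y = (p, q, r)" by (cases x, cases y)
   have eq: "\<kappa> u = \<kappa> p" "\<kappa> v = \<kappa> q" "\<kappa> w = \<kappa> r" using xy(3) by (auto simp: k_def e)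
   have mem: "(u, v, w) \<in> E_space \<Omega>" "(p, q, r) \<in> E_space \<Omega>" "E_norm \<Omega> (u, v, w) \<le> 1" "E_norm \<Omega> (p, q, r) \<le> 1"
    using X xy e by auto
   note c1 = comp[OF mem(1,3)] and c2 = comp[OF mem(2,4)]
   have "norm (u - p) \<le> \<epsilon> / 2" "norm (v - q) \<le> \<epsilon> / 2" "norm (w - r) \<le> \<epsilon> / 2"
    using \<kappa>[of u p] \<kappa>[of v q] \<kappa>[of w r] c1 c2 eq by blast+
   then have "(norm (u - p))^2 \<le> (\<epsilon> / 2)^2" "(norm (v - q))^2 \<le> (\<epsilon> / 2)^2" "(norm (w - r))^2 \<le> (\<epsilon> / 2)^2"
    by (auto intro: power_mono)
   then have "(norm (x - y))^2 \<le> 3 * (\<epsilon> / 2)^2" by (simp only: e diff_Pair triple_norm_power2)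
   also have "... \<le> \<epsilon>^2" by (simp add: power2_eq_square)
   finally have "norm (x - y) \<le> \<epsilon>" by (rule power2_le_imp_le) (use assms in simp)
   moreover have "norm (x - y) > \<epsilon>" using X(4) xy(1,2,4) by blast
   ultimately show False by simp
  qed
  show "k ` X \<subseteq> ?K \<times> ?K \<times> ?K"
  proof
   fix y assume "y \<in> k ` X"
   then obtain u v w where "(u, v, w) \<in> X" "y = (\<kappa> u, \<kappa> v, \<kappa> w)" by (auto simp: k_def)
   then show "y \<in> ?K \<times> ?K \<times> ?K" using comp X(1,2) by blast
  qed
  show "finite (?K \<times> ?K \<times> ?K)" using fin by blast
 qed
 then show ?thesis by blast
qed

end

subsection \<open>Solutions as weak paths\<close>

lemma AE_lebesgue_shift:
 assumes "AE t in lebesgue. P t" shows "AE t in lebesgue. P (s + t :: real)"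
proof -
 have "AE t in lborel. P t" using assms by (simp only: AE_completion_iff)
 then have "AE t in distr lborel borel ((+) s). P t" by (simp only: lborel_distr_plus)
 then have "AE t in lborel. P (s + t)" by (rule AE_distrD[rotated]) simp
 then show ?thesis by (rule AE_completion)
qed

lemma AE_lebesgue_on_shift:
 assumes "AE t in lebesgue_on {0..s + \<tau>}. P t" "0 \<le> s" shows "AE t in lebesgue_on {0..\<tau>}. P (s + t :: real)"
proof -
 have "AE t in lebesgue. t \<in> {0..s + \<tau>} \<longrightarrow> P t" using assms by (subst (asm) AE_restrict_space_iff) auto
 from AE_lebesgue_shift[OF this, of s] have "AE t in lebesgue. t \<in> {0..\<tau>} \<longrightarrow> P (s + t)"
  by eventually_elim (use assms in auto)
 then show ?thesis by (subst AE_restrict_space_iff) auto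
qed

text \<open>Local integrability on the open interval gives no integrability up to 0, but
  measurability survives the exhaustion by the compact intervals [1/(n+1), T]. The open interval
  extends to T + 1 so that T lies in its interior.\<close>

lemma locally_integrable_measurable:
 fixes q :: "real \<Rightarrow> real"
 assumes "locally_integrable {0<..<T + 1} q"
 shows "q \<in> borel_measurable (lebesgue_on {0..T})"
proof (rule lebesgue_on_measurable_AE_limit)
 let ?I = "\<lambda>n. {1 / real (Suc n)..T}"
 show "(\<lambda>t. indicator (?I n) t *\<^sub>R q t) \<in> borel_measurable (lebesgue_on {0..T})" for n
 proof (rule measurable_restrict_space1)
  have "?I n \<subseteq> {0<..<T + 1}"
  proof
   fix t assume "t \<in> ?I n"
   then have "1 / real (Suc n) \<le> t" "t \<le> T" by (simp_all only: atLeastAtMost_iff)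
   moreover have "0 < 1 / real (Suc n)" by simp
   ultimately have "0 < t" "t < T + 1" by linarith+
   then show "t \<in> {0<..<T + 1}" by simp
  qed
  moreover have "compact (?I n)" by simp
  ultimately have "set_integrable lebesgue (?I n) q" using assms by (auto simp: locally_integrable_def)
  then show "(\<lambda>t. indicator (?I n) t *\<^sub>R q t) \<in> borel_measurable lebesgue" by (auto simp: set_integrable_def)
 qed
 have "AE t in lebesgue. t \<notin> {0::real}" by (intro AE_not_in) (auto simp: negligible_iff_null_sets[symmetric])
 then have "AE t in lebesgue. t \<in> {0..T} \<longrightarrow> (\<lambda>n. indicator (?I n) t *\<^sub>R q t) \<longlonglongrightarrow> q t"
 proof eventually_elim
  case (elim t)
  show ?case
  proof
   assume t: "t \<in> {0..T}"
   then have "t > 0" using elim by auto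
   then obtain N where N: "inverse (real (Suc N)) < t" using reals_Archimedean by blast
   have "indicator (?I n) t *\<^sub>R q t = q t" if "n \<ge> N" for n
   proof -
    have "1 / real (Suc n) \<le> 1 / real (Suc N)" using that by (intro divide_left_mono) auto
    moreover have "1 / real (Suc N) < t" using N by (simp add: divide_inverse)
    ultimately have "t \<in> ?I n" using t by simp
    then show ?thesis by simp
   qed
   then show "(\<lambda>n. indicator (?I n) t *\<^sub>R q t) \<longlonglongrightarrow> q t"
    by (intro tendsto_eventually) (auto simp: eventually_sequentially)
  qed
 qed
 then show "AE t in lebesgue_on {0..T}. (\<lambda>n. indicator (?I n) t *\<^sub>R q t) \<longlonglongrightarrow> q t"
  by (subst AE_restrict_space_iff) auto
qed auto

lemma locally_integrable_shift:
 fixes q :: "real \<Rightarrow> real"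
 assumes "locally_integrable {0<..<s + \<tau>} q" "0 \<le> s"
 shows "locally_integrable {0<..<\<tau>} (\<lambda>t. q (s + t))"
 unfolding locally_integrable_def set_integrable_def
proof (intro allI impI)
 fix K :: "real set" assume K: "compact K \<and> K \<subseteq> {0<..<\<tau>}"
 have "compact ((+) s ` K)" "(+) s ` K \<subseteq> {0<..<s + \<tau>}"
  using K assms(2) by (auto intro: compact_translation)
 then have "integrable lebesgue (\<lambda>x. indicator ((+) s ` K) x *\<^sub>R q x)"
  using assms(1) by (auto simp: locally_integrable_def set_integrable_def)
 from lebesgue_integrable_real_affine[OF this, of 1 s]
 show "integrable lebesgue (\<lambda>t. indicator K t *\<^sub>R q (s + t))" by (simp add: indicator_def image_iff)
qed

text \<open>Test functions are moved to the right by s and remain supported in the longer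
  interval.\<close>

lemma has_weak_partial_shift:
 fixes Z q :: "real \<Rightarrow> real"
 assumes "has_weak_partial {0<..<s + \<tau>} 1 Z q" "0 \<le> s"
 shows "has_weak_partial {0<..<\<tau>} 1 (\<lambda>t. Z (s + t)) (\<lambda>t. q (s + t))"
 unfolding has_weak_partial_def
proof (intro conjI ballI)
 show "locally_integrable {0<..<\<tau>} (\<lambda>t. Z (s + t))" "locally_integrable {0<..<\<tau>} (\<lambda>t. q (s + t))"
  using assms by (auto simp: has_weak_partial_def intro: locally_integrable_shift)
 fix \<phi> assume \<phi>: "\<phi> \<in> test_functions {0<..<\<tau>}"
 let ?\<psi> = "\<lambda>x. \<phi> (x + - s)"
 have \<psi>: "?\<psi> \<in> test_functions {0<..<s + \<tau>}"
 proof -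
  have "{x. ?\<psi> x \<noteq> 0} = (+) s ` {x. \<phi> x \<noteq> 0}" by (force simp: image_iff)
  then have "closure {x. ?\<psi> x \<noteq> 0} = (+) s ` closure {x. \<phi> x \<noteq> 0}" by (simp add: closure_translation)
  moreover have "smooth ?\<psi>" using \<phi> smooth_translate(1)[of \<phi> "- s"] by (simp add: test_functions_def)
  moreover have "compact ((+) s ` closure {x. \<phi> x \<noteq> 0})" using \<phi> by (intro compact_translation) (simp only: test_functions_def mem_Collect_eq)
  moreover have "(+) s ` closure {x. \<phi> x \<noteq> 0} \<subseteq> {0<..<s + \<tau>}" using \<phi> assms(2) by (fastforce simp: test_functions_def)
  ultimately show ?thesis unfolding test_functions_def mem_Collect_eq by simp
 qed
 have shift: "(LINT x|lebesgue. f x) = (LINT x|lebesgue. f (s + x))" for f :: "real \<Rightarrow> real"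
  using lebesgue_integral_real_affine[of 1 f s] by simp
 have "(LINT t:{0<..<\<tau>}|lebesgue. Z (s + t) * partial_deriv 1 \<phi> t) = (LINT t|lebesgue. Z (s + t) * partial_deriv 1 \<phi> t)"
  by (rule set_integral_test_function(2)[OF \<phi>])
 also have "... = (LINT x|lebesgue. Z x * partial_deriv 1 ?\<psi> x)"
  by (subst shift[of "\<lambda>x. Z x * partial_deriv 1 ?\<psi> x"]) (simp only: smooth_translate(2)[OF test_function_smooth[OF \<phi>]], simp)
 also have "... = (LINT x:{0<..<s + \<tau>}|lebesgue. Z x * partial_deriv 1 ?\<psi> x)"
  by (rule set_integral_test_function(2)[OF \<psi>, symmetric])
 also have "... = - (LINT x:{0<..<s + \<tau>}|lebesgue. q x * ?\<psi> x)"
  using assms(1) \<psi> unfolding has_weak_partial_def by blast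
 also have "(LINT x:{0<..<s + \<tau>}|lebesgue. q x * ?\<psi> x) = (LINT x|lebesgue. q x * ?\<psi> x)"
  by (rule set_integral_test_function(1)[OF \<psi>])
 also have "... = (LINT t|lebesgue. q (s + t) * \<phi> t)"
  by (subst shift[of "\<lambda>x. q x * ?\<psi> x"]) simp
 also have "... = (LINT t:{0<..<\<tau>}|lebesgue. q (s + t) * \<phi> t)"
  by (rule set_integral_test_function(1)[OF \<phi>, symmetric])
 finally show "(LINT t:{0<..<\<tau>}|lebesgue. Z (s + t) * partial_deriv 1 \<phi> t) = - (LINT t:{0<..<\<tau>}|lebesgue. q (s + t) * \<phi> t)" .
qed

lemma bochner_L2_E_shift:
 assumes B: "bochner_L2_E \<Omega> (s + \<tau>) g" and s: "0 \<le> s"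
 shows "bochner_L2_E \<Omega> \<tau> (\<lambda>t. g (s + t))"
proof -
 obtain k where k: "\<And>n::nat. simple_function (lebesgue_on {0..s + \<tau>}) (k n)" "\<And>n. range (k n) \<subseteq> E_space \<Omega>"
  "AE t in lebesgue_on {0..s + \<tau>}. (\<lambda>n. E_norm \<Omega> (k n t - g t)) \<longlonglongrightarrow> 0" using B by (auto simp: bochner_L2_E_def)
 have "simple_function (lebesgue_on {0..\<tau>}) (\<lambda>t. k n (s + t))" for n
  unfolding simple_function_def
 proof (intro conjI ballI)
  have "(\<lambda>t. k n (s + t)) ` space (lebesgue_on {0..\<tau>}) \<subseteq> k n ` space (lebesgue_on {0..s + \<tau>})" using s by auto
  then show "finite ((\<lambda>t. k n (s + t)) ` space (lebesgue_on {0..\<tau>}))"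
   using simple_functionD(1)[OF k(1)] by (rule finite_subset)
  fix x
  let ?B = "k n -` {x} \<inter> {0..s + \<tau>}"
  have "?B \<in> sets lebesgue" using simple_functionD(2)[OF k(1), of n "{x}"] by (simp add: sets_restrict_space_iff)
  then have "(+) (- s) ` ?B \<in> sets lebesgue" by (rule lebesgue_sets_translation)
  then have "(+) (- s) ` ?B \<inter> {0..\<tau>} \<in> sets lebesgue" by auto
  moreover have "(+) (- s) ` ?B \<inter> {0..\<tau>} = (\<lambda>t. k n (s + t)) -` {x} \<inter> {0..\<tau>}"
   using s by (force simp: image_iff)
  ultimately show "(\<lambda>t. k n (s + t)) -` {x} \<inter> space (lebesgue_on {0..\<tau>}) \<in> sets (lebesgue_on {0..\<tau>})"
   by (simp add: sets_restrict_space_iff)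
 qed
 moreover have "range (\<lambda>t. k n (s + t)) \<subseteq> E_space \<Omega>" for n using k(2)[of n] by auto
 moreover have "AE t in lebesgue_on {0..\<tau>}. (\<lambda>n. E_norm \<Omega> (k n (s + t) - g (s + t))) \<longlonglongrightarrow> 0"
  by (rule AE_lebesgue_on_shift[OF k(3) s])
 moreover have "AE t in lebesgue_on {0..\<tau>}. g (s + t) \<in> E_space \<Omega>"
  by (rule AE_lebesgue_on_shift[OF _ s]) (use B in \<open>simp add: bochner_L2_E_def\<close>)
 moreover have "integrable (lebesgue_on {0..\<tau>}) (\<lambda>t. (E_norm \<Omega> (g (s + t)))^2)"
 proof -
  let ?f = "\<lambda>t. (E_norm \<Omega> (g t))^2"
  have "?f absolutely_integrable_on {0..s + \<tau>}"
   using B by (simp add: bochner_L2_E_def absolutely_integrable_iff_integrable_on)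
  then have "?f absolutely_integrable_on {0 + s..\<tau> + s}" by (rule abs_integrable_subinterval) (use s in auto)
  then have "?f integrable_on {0 + s..\<tau> + s}" by (rule abs_integrable_integrable)
  then have "(?f \<circ> (+) s) integrable_on {0..\<tau>}" by (simp only: integrable_on_shift_Icc_real)
  then have "(?f \<circ> (+) s) absolutely_integrable_on {0..\<tau>}" by (rule nonnegative_absolutely_integrable_1) simp
  then show ?thesis by (simp add: absolutely_integrable_iff_integrable_on o_def)
 qed
 ultimately show ?thesis unfolding bochner_L2_E_def by (intro conjI exI[of _ "\<lambda>n t. k n (s + t)"] allI)
qed

text \<open>The equation is autonomous. Combined with uniqueness this yields the semigroup law,
  which is not among the clauses of \<open>weak_solution_semiflow\<close>.\<close>

lemma global_weak_solution_shift:
 assumes g: "global_weak_solution \<Omega> A f g0 g" and s: "0 \<le> s"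
 shows "global_weak_solution \<Omega> A f (g s) (\<lambda>t. g (s + t))"
 unfolding global_weak_solution_def
proof (intro allI impI)
 fix \<tau> :: real assume \<tau>: "\<tau> > 0"
 then have w: "weak_solution \<Omega> A f g0 (s + \<tau>) g" using g s by (simp add: global_weak_solution_def)
 show "weak_solution \<Omega> A f (g s) \<tau> (\<lambda>t. g (s + t))"
  unfolding weak_solution_def
 proof (intro conjI ballI)
  show "bochner_L2_E \<Omega> \<tau> (\<lambda>t. g (s + t))"
   using w s by (intro bochner_L2_E_shift) (auto simp: weak_solution_def)
  have wc: "weakly_continuous_H \<Omega> (s + \<tau>) g" using w by (simp add: weak_solution_def)
  show "weakly_continuous_H \<Omega> \<tau> (\<lambda>t. g (s + t))"
   unfolding weakly_continuous_H_def
  proof (intro conjI ballI)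
   show "g (s + t) \<in> H_space \<Omega>" if "t \<in> {0..\<tau>}" for t using wc that s by (auto simp: weakly_continuous_H_def)
   fix h assume "h \<in> H_space \<Omega>"
   then have "continuous_on {0..s + \<tau>} (\<lambda>t. g t \<bullet> h)" using wc by (simp add: weakly_continuous_H_def)
   then show "continuous_on {0..\<tau>} (\<lambda>t. g (s + t) \<bullet> h)"
    by (rule continuous_on_compose2) (use s in \<open>auto intro!: continuous_intros\<close>)
  qed
  fix \<phi> assume "\<phi> \<in> E_space \<Omega>"
  then show "has_weak_partial {0<..<\<tau>} 1 (\<lambda>t. g (s + t) \<bullet> \<phi>) (\<lambda>t. A (g (s + t)) \<phi> + f (g (s + t)) \<bullet> \<phi>)"
   using w s has_weak_partial_shift[of s \<tau> "\<lambda>t. g t \<bullet> \<phi>" "\<lambda>t. A (g t) \<phi> + f (g t) \<bullet> \<phi>"] by (simp add: weak_solution_def)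
 qed simp
qed

section \<open>Dual bounds for the right-hand side; solutions as weak paths\<close>

locale oregonator =
 fixes \<Omega> :: "'a::euclidean_space set" and d1 d2 d3 a1 a3 b1 b2 c2 c3 F G1 G2 :: real
  and S :: "real \<Rightarrow> 'a L2_triple \<Rightarrow> 'a L2_triple"
 assumes dim: "DIM('a) \<le> 3" and open_domain: "open \<Omega>" and bounded_domain: "bounded \<Omega>"
  and pos: "d1 > 0" "d2 > 0" "d3 > 0" "a1 > 0" "a3 > 0" "b1 > 0" "b2 > 0" "c2 > 0" "c3 > 0" "F > 0" "G1 > 0" "G2 > 0"
  and semiflow: "weak_solution_semiflow \<Omega> (dirichlet_diffusion \<Omega> d1 d2 d3)
      (oregonator_reaction a1 a3 b1 b2 c2 c3 F G1 G2) S"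
begin

abbreviation "A \<equiv> dirichlet_diffusion \<Omega> d1 d2 d3"
abbreviation "f \<equiv> oregonator_reaction a1 a3 b1 b2 c2 c3 F G1 G2 :: 'a L2_triple \<Rightarrow> 'a L2_triple"
abbreviation "rhs g t \<phi> \<equiv> A (g t) \<phi> + f (g t) \<bullet> \<phi>"

text \<open>Chosen once, so that the Poincare constant can be a parameter of the sublocale.\<close>

definition "poincare_const = (SOME CP. energy_space (H_space \<Omega>) (E_space \<Omega>) (E_norm \<Omega>) CP)"

sublocale energy_space "H_space \<Omega>" "E_space \<Omega>" "E_norm \<Omega>" poincare_const
 unfolding poincare_const_def by (rule someI_ex[OF E_energy_space[OF dim open_domain bounded_domain]])

lemma mem_E: "(u, v, w) \<in> E_space \<Omega> \<longleftrightarrow> u \<in> H10 \<Omega> \<and> v \<in> H10 \<Omega> \<and> w \<in> H10 \<Omega>"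
 by (simp add: E_space_def)

lemma solution: "g0 \<in> H_plus \<Omega> \<Longrightarrow> global_weak_solution \<Omega> A f g0 (\<lambda>t. S t g0)"
 and solution_unique: "g0 \<in> H_plus \<Omega> \<Longrightarrow> global_weak_solution \<Omega> A f g0 g \<Longrightarrow> t \<ge> 0 \<Longrightarrow> g t = S t g0"
 and solution_H_plus: "g0 \<in> H_plus \<Omega> \<Longrightarrow> t \<ge> 0 \<Longrightarrow> S t g0 \<in> H_plus \<Omega>"
 using semiflow unfolding weak_solution_semiflow_def by blast+

lemma semigroup_zero: "g0 \<in> H_plus \<Omega> \<Longrightarrow> S 0 g0 = g0"
 using solution[of g0] unfolding global_weak_solution_def weak_solution_def by (metis zero_less_one)

lemma semigroup_add:
 assumes "g0 \<in> H_plus \<Omega>" "0 \<le> s" "0 \<le> t" shows "S (s + t) g0 = S t (S s g0)"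
 using solution_unique[OF solution_H_plus[OF assms(1,2)] global_weak_solution_shift[OF solution[OF assms(1)] assms(2)] assms(3)] .

lemma grad_norm_le_E_norm:
 "grad_norm \<Omega> u \<le> E_norm \<Omega> (u, v, w)" "grad_norm \<Omega> v \<le> E_norm \<Omega> (u, v, w)" "grad_norm \<Omega> w \<le> E_norm \<Omega> (u, v, w)"
proof -
 have *: "0 \<le> E_norm \<Omega> (u, v, w)" by (rule nV_nonneg)
 have "(grad_norm \<Omega> u)^2 \<le> (E_norm \<Omega> (u, v, w))^2" "(grad_norm \<Omega> v)^2 \<le> (E_norm \<Omega> (u, v, w))^2" "(grad_norm \<Omega> w)^2 \<le> (E_norm \<Omega> (u, v, w))^2"
  unfolding E_norm_power2[OF dim open_domain bounded_domain] by simp_all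
 then show "grad_norm \<Omega> u \<le> E_norm \<Omega> (u, v, w)" "grad_norm \<Omega> v \<le> E_norm \<Omega> (u, v, w)" "grad_norm \<Omega> w \<le> E_norm \<Omega> (u, v, w)"
  using * by (simp_all only: power2_le_imp_le)
qed

lemma norm_component_le:
 "norm u \<le> norm (u, v, w)" "norm v \<le> norm (u, v, w)" "norm w \<le> norm (u, v, w)" for u v w :: "'a L2"
proof -
 have "(norm u)^2 \<le> (norm (u, v, w))^2" "(norm v)^2 \<le> (norm (u, v, w))^2" "(norm w)^2 \<le> (norm (u, v, w))^2"
  unfolding triple_norm_power2[OF dim open_domain bounded_domain] by simp_all
 then show "norm u \<le> norm (u, v, w)" "norm v \<le> norm (u, v, w)" "norm w \<le> norm (u, v, w)"
  by (auto intro: power2_le_imp_le)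
qed

lemma diffusion_le:
 assumes "g \<in> E_space \<Omega>" "\<phi> \<in> E_space \<Omega>"
 shows "\<bar>A g \<phi>\<bar> \<le> (d1 + d2 + d3) * (E_norm \<Omega> g * E_norm \<Omega> \<phi>)"
proof -
 obtain u v w p q r where e: "g = (u, v, w)" "\<phi> = (p, q, r)" by (cases g, cases \<phi>)
 let ?X = "E_norm \<Omega> g * E_norm \<Omega> \<phi>"
 have "\<bar>grad_inner \<Omega> u p\<bar> \<le> ?X" "\<bar>grad_inner \<Omega> v q\<bar> \<le> ?X" "\<bar>grad_inner \<Omega> w r\<bar> \<le> ?X"
  unfolding e by (rule order_trans[OF grad_inner_le mult_mono[OF grad_norm_le_E_norm(1) grad_norm_le_E_norm(1) nV_nonneg grad_norm_nonneg]]
   order_trans[OF grad_inner_le mult_mono[OF grad_norm_le_E_norm(2) grad_norm_le_E_norm(2) nV_nonneg grad_norm_nonneg]]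
   order_trans[OF grad_inner_le mult_mono[OF grad_norm_le_E_norm(3) grad_norm_le_E_norm(3) nV_nonneg grad_norm_nonneg]])+
 then have "\<bar>d1 * grad_inner \<Omega> u p\<bar> \<le> d1 * ?X" "\<bar>d2 * grad_inner \<Omega> v q\<bar> \<le> d2 * ?X" "\<bar>d3 * grad_inner \<Omega> w r\<bar> \<le> d3 * ?X"
  using pos by (auto simp: abs_mult intro!: mult_left_mono)
 then have "\<bar>A g \<phi>\<bar> \<le> d1 * ?X + d2 * ?X + d3 * ?X" by (simp add: e)
 then show ?thesis by (simp only: distrib_right)
qed

text \<open>Only the first factor is measured in H, the other two in the gradient norm. This
  distribution matters because along a solution the H-norm is locally bounded in time, whereas the
  gradient norm is only square integrable.\<close>

lemma trilinear_le:
 "\<exists>K\<ge>0. \<forall>u\<in>H10 \<Omega>. \<forall>v\<in>H10 \<Omega>. \<forall>p\<in>H10 \<Omega>. \<bar>(u \<odot> v) \<bullet> p\<bar> \<le> K * (norm u * (grad_norm \<Omega> v * grad_norm \<Omega> p))"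
proof -
 obtain K where K: "K \<ge> 0" "\<And>v. v \<in> H10 \<Omega> \<Longrightarrow> norm (v \<odot> v) \<le> (K * grad_norm \<Omega> v)^2"
  using square_norm_le_grad[OF dim open_domain bounded_domain] by blast
 have "\<bar>(u \<odot> v) \<bullet> p\<bar> \<le> K^2 * (norm u * (grad_norm \<Omega> v * grad_norm \<Omega> p))"
  if "u \<in> H10 \<Omega>" "v \<in> H10 \<Omega>" "p \<in> H10 \<Omega>" for u v p
 proof -
  have "(norm (v \<odot> p))^2 \<le> norm (v \<odot> v) * norm (p \<odot> p)"
   using that by (intro norm_mult_le[OF dim open_domain bounded_domain])
  also have "... \<le> (K * grad_norm \<Omega> v)^2 * (K * grad_norm \<Omega> p)^2"
   using that by (intro mult_mono K) auto
  also have "... = (K^2 * (grad_norm \<Omega> v * grad_norm \<Omega> p))^2" by (simp add: power_mult_distrib power2_eq_square)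
  finally have vp: "norm (v \<odot> p) \<le> K^2 * (grad_norm \<Omega> v * grad_norm \<Omega> p)"
   by (rule power2_le_imp_le) (simp add: grad_norm_nonneg)
  have "\<bar>(u \<odot> v) \<bullet> p\<bar> \<le> norm u * norm (v \<odot> p)"
   unfolding inner_mult_swap[OF dim open_domain bounded_domain that] by (rule Cauchy_Schwarz_ineq2)
  also have "... \<le> norm u * (K^2 * (grad_norm \<Omega> v * grad_norm \<Omega> p))" using vp by (rule mult_left_mono) simp
  finally show ?thesis by (simp add: mult.left_commute)
 qed
 then show ?thesis by (intro exI[of _ "K^2"]) auto
qed

lemma reaction_inner:
 "f (u, v, w) \<bullet> (p, q, r) = (a1 * (u \<bullet> p) + b1 * (v \<bullet> p) - F * ((u \<odot> u) \<bullet> p) - G1 * ((u \<odot> v) \<bullet> p))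
  + (- b2 * (v \<bullet> q) + c2 * (w \<bullet> q) - G2 * ((u \<odot> v) \<bullet> q)) + (a3 * (u \<bullet> r) - c3 * (w \<bullet> r))"
 by (simp add: inner_add_left inner_diff_left)

text \<open>In the dual of E the reaction is bounded by the E-norm of g to the first power, with a
  factor depending on its H-norm. Along a solution it is therefore square integrable in time with
  values in the dual. In the proof \<open>L\<close> bounds all linear pairings and \<open>Q\<close>
  all quadratic ones.\<close>

lemma reaction_le: "\<exists>M\<ge>0. \<forall>g\<in>E_space \<Omega>. \<forall>\<phi>\<in>E_space \<Omega>. \<bar>f g \<bullet> \<phi>\<bar> \<le> M * (1 + norm g) * (E_norm \<Omega> g * E_norm \<Omega> \<phi>)"
proof -
 obtain K where K: "K \<ge> 0" "\<And>u v p. u \<in> H10 \<Omega> \<Longrightarrow> v \<in> H10 \<Omega> \<Longrightarrow> p \<in> H10 \<Omega> \<Longrightarrow>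
   \<bar>(u \<odot> v) \<bullet> p\<bar> \<le> K * (norm u * (grad_norm \<Omega> v * grad_norm \<Omega> p))" using trilinear_le by blast
 define M where "M = (a1 + b1 + b2 + c2 + a3 + c3) * poincare_const^2 + (F + G1 + G2) * K"
 have M: "M \<ge> 0" using pos K(1) by (simp add: M_def)
 have "\<bar>f g \<bullet> \<phi>\<bar> \<le> M * (1 + norm g) * (E_norm \<Omega> g * E_norm \<Omega> \<phi>)" if "g \<in> E_space \<Omega>" "\<phi> \<in> E_space \<Omega>" for g \<phi>
 proof -
  obtain u v w p q r where e: "g = (u, v, w)" "\<phi> = (p, q, r)" by (cases g, cases \<phi>)
  have H: "u \<in> H10 \<Omega>" "v \<in> H10 \<Omega>" "w \<in> H10 \<Omega>" "p \<in> H10 \<Omega>" "q \<in> H10 \<Omega>" "r \<in> H10 \<Omega>"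
   using that by (auto simp: e mem_E)
  define X where "X = E_norm \<Omega> g * E_norm \<Omega> \<phi>"
  define L where "L = poincare_const^2 * X"
  define Q where "Q = K * (norm g * X)"
  have X: "X \<ge> 0" unfolding X_def by (intro mult_nonneg_nonneg nV_nonneg)
  have lin: "\<bar>x \<bullet> y\<bar> \<le> L" if "norm x \<le> norm g" "norm y \<le> norm \<phi>" for x y :: "'a L2"
  proof -
   have "\<bar>x \<bullet> y\<bar> \<le> norm x * norm y" by (rule Cauchy_Schwarz_ineq2)
   also have "... \<le> norm g * norm \<phi>" using that by (intro mult_mono) auto
   also have "... \<le> (poincare_const * E_norm \<Omega> g) * (poincare_const * E_norm \<Omega> \<phi>)"
    using \<open>g \<in> E_space \<Omega>\<close> \<open>\<phi> \<in> E_space \<Omega>\<close> CP nV_nonneg by (intro mult_mono poincare) auto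
   finally show ?thesis by (simp add: L_def X_def power2_eq_square mult.assoc mult.left_commute)
  qed
  have quad: "\<bar>(u \<odot> y) \<bullet> z\<bar> \<le> Q"
   if "y \<in> H10 \<Omega>" "z \<in> H10 \<Omega>" "grad_norm \<Omega> y \<le> E_norm \<Omega> g" "grad_norm \<Omega> z \<le> E_norm \<Omega> \<phi>" for y z
  proof -
   have "norm u * (grad_norm \<Omega> y * grad_norm \<Omega> z) \<le> norm g * X"
    unfolding X_def using that norm_component_le(1)[of u v w] by (intro mult_mono) (auto simp: e grad_norm_nonneg nV_nonneg simp del: E_norm.simps)
   then show ?thesis using K(2)[OF H(1) that(1,2)] mult_left_mono[OF _ K(1)] unfolding Q_def by fastforce
  qed
  have sc: "\<bar>c * x\<bar> \<le> c * B" if "\<bar>x\<bar> \<le> B" "c > 0" for c x B :: real using that by (simp add: abs_mult)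
  note comp = norm_component_le[where u = u and v = v and w = w, folded e] norm_component_le[where u = p and v = q and w = r, folded e]
  note gcomp = grad_norm_le_E_norm[where u = u and v = v and w = w, folded e] grad_norm_le_E_norm[where u = p and v = q and w = r, folded e]
  have bounds: "\<bar>a1 * (u \<bullet> p)\<bar> \<le> a1 * L" "\<bar>b1 * (v \<bullet> p)\<bar> \<le> b1 * L" "\<bar>b2 * (v \<bullet> q)\<bar> \<le> b2 * L" "\<bar>c2 * (w \<bullet> q)\<bar> \<le> c2 * L"
   "\<bar>a3 * (u \<bullet> r)\<bar> \<le> a3 * L" "\<bar>c3 * (w \<bullet> r)\<bar> \<le> c3 * L" "\<bar>F * ((u \<odot> u) \<bullet> p)\<bar> \<le> F * Q" "\<bar>G1 * ((u \<odot> v) \<bullet> p)\<bar> \<le> G1 * Q" "\<bar>G2 * ((u \<odot> v) \<bullet> q)\<bar> \<le> G2 * Q"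
   using sc[OF lin[OF comp(1,4)] pos(4)] sc[OF lin[OF comp(2,4)] pos(6)] sc[OF lin[OF comp(2,5)] pos(7)] sc[OF lin[OF comp(3,5)] pos(8)]
    sc[OF lin[OF comp(1,6)] pos(5)] sc[OF lin[OF comp(3,6)] pos(9)] sc[OF quad[OF H(1,4) gcomp(1,4)] pos(10)]
    sc[OF quad[OF H(2,4) gcomp(2,4)] pos(11)] sc[OF quad[OF H(2,5) gcomp(2,5)] pos(12)] by blast+
  have "\<bar>f g \<bullet> \<phi>\<bar> \<le> (a1 * L + b1 * L + b2 * L + c2 * L + a3 * L + c3 * L) + (F * Q + G1 * Q + G2 * Q)"
   unfolding e reaction_inner mult_minus_left using bounds[unfolded abs_le_iff] by (intro abs_leI; linarith)
  also have "... = ((a1 + b1 + b2 + c2 + a3 + c3) * poincare_const^2) * X + ((F + G1 + G2) * K) * (norm g * X)"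
   unfolding L_def Q_def by (simp add: algebra_simps)
  also have "... \<le> M * X + M * (norm g * X)"
   using X K(1) pos by (intro add_mono mult_right_mono) (auto simp: M_def)
  also have "... = M * (1 + norm g) * X" by (simp add: algebra_simps)
  finally show ?thesis by (simp add: X_def)
 qed
 then show ?thesis using M by blast
qed

lemma rhs_linear:
 assumes "g t \<in> E_space \<Omega>" "\<phi> \<in> E_space \<Omega>"
 shows "\<psi> \<in> E_space \<Omega> \<Longrightarrow> rhs g t (\<phi> + \<psi>) = rhs g t \<phi> + rhs g t \<psi>" "rhs g t (c *\<^sub>R \<phi>) = c * rhs g t \<phi>"
proof -
 obtain u v w p q r where e: "g t = (u, v, w)" "\<phi> = (p, q, r)" by (cases "g t", cases \<phi>)
 have H: "p \<in> H10 \<Omega>" "q \<in> H10 \<Omega>" "r \<in> H10 \<Omega>" using assms by (auto simp: e mem_E)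
 show "rhs g t (\<phi> + \<psi>) = rhs g t \<phi> + rhs g t \<psi>" if "\<psi> \<in> E_space \<Omega>"
 proof -
  obtain p' q' r' where e': "\<psi> = (p', q', r')" by (cases \<psi>)
  have "p' \<in> H10 \<Omega>" "q' \<in> H10 \<Omega>" "r' \<in> H10 \<Omega>" using that by (auto simp: e' mem_E)
  then have "A (g t) (\<phi> + \<psi>) = A (g t) \<phi> + A (g t) \<psi>"
   using H by (simp add: e e' grad_inner_add[OF open_domain] algebra_simps)
  then show ?thesis by (simp add: inner_add_right)
 qed
 have "A (g t) (c *\<^sub>R \<phi>) = c * A (g t) \<phi>"
  using H by (simp add: e grad_inner_scaleR[OF open_domain] algebra_simps)
 then show "rhs g t (c *\<^sub>R \<phi>) = c * rhs g t \<phi>" by (simp add: distrib_left)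
qed

text \<open>Quantified over paths and times, rather than over states, to match the shape of
  \<open>rhs g t\<close>.\<close>

lemma rhs_bound: "\<exists>M>0. \<forall>R g (t::real). g t \<in> E_space \<Omega> \<longrightarrow> norm (g t) \<le> R \<longrightarrow>
  (\<forall>\<phi>\<in>E_space \<Omega>. \<bar>rhs g t \<phi>\<bar> \<le> M * (1 + R) * E_norm \<Omega> (g t) * E_norm \<Omega> \<phi>)"
proof -
 obtain M where M: "M \<ge> 0" "\<And>g \<phi>. g \<in> E_space \<Omega> \<Longrightarrow> \<phi> \<in> E_space \<Omega> \<Longrightarrow> \<bar>f g \<bullet> \<phi>\<bar> \<le> M * (1 + norm g) * (E_norm \<Omega> g * E_norm \<Omega> \<phi>)"
  using reaction_le by blast
 let ?M = "d1 + d2 + d3 + M"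
 have "\<bar>rhs g t \<phi>\<bar> \<le> ?M * (1 + R) * E_norm \<Omega> (g t) * E_norm \<Omega> \<phi>"
  if "g t \<in> E_space \<Omega>" "norm (g t) \<le> R" "\<phi> \<in> E_space \<Omega>" for R g t \<phi>
 proof -
  let ?X = "E_norm \<Omega> (g t) * E_norm \<Omega> \<phi>"
  have X: "?X \<ge> 0" by (intro mult_nonneg_nonneg nV_nonneg)
  have R: "R \<ge> 0" using that(2) norm_ge_zero order_trans by blast
  have "M * (1 + norm (g t)) * ?X \<le> M * (1 + R) * ?X" using that(2) M(1) X by (intro mult_right_mono mult_left_mono) auto
  moreover have "(d1 + d2 + d3) * 1 * ?X \<le> (d1 + d2 + d3) * (1 + R) * ?X" using R pos X by (intro mult_right_mono mult_left_mono) auto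
  ultimately have "\<bar>rhs g t \<phi>\<bar> \<le> (d1 + d2 + d3) * (1 + R) * ?X + M * (1 + R) * ?X"
   using M(2)[OF that(1,3)] diffusion_le[OF that(1,3)] by simp
  then show ?thesis by (simp add: algebra_simps)
 qed
 moreover have "?M > 0" using pos M(1) by simp
 ultimately show ?thesis by (intro exI[of _ ?M] conjI allI impI ballI)
qed

definition "rhs_const = (SOME M. M > 0 \<and> (\<forall>R g (t::real). g t \<in> E_space \<Omega> \<longrightarrow> norm (g t) \<le> R \<longrightarrow>
  (\<forall>\<phi>\<in>E_space \<Omega>. \<bar>rhs g t \<phi>\<bar> \<le> M * (1 + R) * E_norm \<Omega> (g t) * E_norm \<Omega> \<phi>)))"

lemma rhs_const: "rhs_const > 0"
 "g t \<in> E_space \<Omega> \<Longrightarrow> norm (g t) \<le> R \<Longrightarrow> \<phi> \<in> E_space \<Omega> \<Longrightarrow> \<bar>rhs g t \<phi>\<bar> \<le> rhs_const * (1 + R) * E_norm \<Omega> (g t) * E_norm \<Omega> \<phi>"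
 using someI_ex[OF rhs_bound] unfolding rhs_const_def by blast+

text \<open>The dual bound is a constant multiple of the E-norm of the solution, so its square is
  integrable. Boundedness of the path in H makes the right-hand side integrable up to time 0, where
  the weak formulation itself provides only local integrability.\<close>

lemma solution_path:
 assumes sol: "global_weak_solution \<Omega> A f g0 g" and T: "T > 0" and R: "\<And>t. t \<in> {0..T} \<Longrightarrow> norm (g t) \<le> R"
 shows "weak_path T g (rhs g) (\<lambda>t. rhs_const * (1 + R) * E_norm \<Omega> (g t))"
proof -
 have w: "weak_solution \<Omega> A f g0 \<tau> g" if "\<tau> > 0" for \<tau> using sol that by (simp add: global_weak_solution_def)
 have B: "bochner_L2_E \<Omega> \<tau> g" if "\<tau> > 0" for \<tau> using w[OF that] by (simp add: weak_solution_def)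
 have C: "weakly_continuous_H \<Omega> \<tau> g" if "\<tau> > 0" for \<tau> using w[OF that] by (simp add: weak_solution_def)
 have nV2: "(\<lambda>t. (E_norm \<Omega> (g t))^2) absolutely_integrable_on {0..\<tau>}" if "\<tau> > 0" for \<tau>
  using B[OF that] by (simp add: bochner_L2_E_def absolutely_integrable_iff_integrable_on)
 have V: "AE t in lebesgue_on {0..\<tau>}. g t \<in> E_space \<Omega>" if "\<tau> > 0" for \<tau>
  using B[OF that] by (simp add: bochner_L2_E_def)
 have weak: "has_weak_partial {0<..<\<tau>} 1 (\<lambda>t. g t \<bullet> \<phi>) (\<lambda>t. rhs g t \<phi>)" if "\<tau> > 0" "\<phi> \<in> E_space \<Omega>" for \<tau> \<phi>
  using w[OF that(1)] that(2) by (simp add: weak_solution_def)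
 have m: "(\<lambda>t. rhs g t \<phi>) \<in> borel_measurable (lebesgue_on {0..\<tau>})" if "\<tau> > 0" "\<phi> \<in> E_space \<Omega>" for \<tau> \<phi>
  using weak[of "\<tau> + 1" \<phi>] that by (intro locally_integrable_measurable) (auto simp: has_weak_partial_def)
 have int: "(\<lambda>t. rhs g t \<phi>) absolutely_integrable_on {0..\<tau>}" if "\<tau> > 0" "\<phi> \<in> E_space \<Omega>" for \<tau> \<phi>
 proof -
  obtain R' where R': "\<And>t. t \<in> {0..\<tau>} \<Longrightarrow> norm (g t) \<le> R'"
   using weakly_continuous_bounded[OF C[OF \<open>\<tau> > 0\<close>]] unfolding bounded_iff by blast
  show ?thesis
  proof (rule absolutely_integrable_bound[OF m[OF that]])
   show "(\<lambda>t. rhs_const * (1 + R') * E_norm \<Omega> \<phi> * (1 + (E_norm \<Omega> (g t))^2)) absolutely_integrable_on {0..\<tau>}"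
    by (intro set_integrable_mult_right set_integral_add(1) absolutely_integrable_const nV2 that)
   have "AE t in lebesgue_on {0..\<tau>}. t \<in> {0..\<tau>}" by (rule AE_I2) simp
   with V[OF that(1)] show "AE t in lebesgue_on {0..\<tau>}. \<bar>rhs g t \<phi>\<bar> \<le> rhs_const * (1 + R') * E_norm \<Omega> \<phi> * (1 + (E_norm \<Omega> (g t))^2)"
   proof eventually_elim
    case (elim t)
    have R0: "0 \<le> R'" using R'[OF elim(2)] norm_ge_zero order_trans by blast
    have n1: "E_norm \<Omega> (g t) \<le> 1 + (E_norm \<Omega> (g t))^2"
     using zero_le_power2[of "E_norm \<Omega> (g t) - 1"] nV_nonneg[of "g t"] by (simp add: power2_diff)
    have "\<bar>rhs g t \<phi>\<bar> \<le> rhs_const * (1 + R') * E_norm \<Omega> (g t) * E_norm \<Omega> \<phi>"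
     by (rule rhs_const(2)[where g = g and t = t, OF elim(1) R'[OF elim(2)] that(2)])
    also have "... = rhs_const * (1 + R') * E_norm \<Omega> \<phi> * E_norm \<Omega> (g t)" by simp
    also have "... \<le> rhs_const * (1 + R') * E_norm \<Omega> \<phi> * (1 + (E_norm \<Omega> (g t))^2)"
     using n1 R0 rhs_const(1) nV_nonneg by (intro mult_left_mono mult_nonneg_nonneg) auto
    finally show ?case .
   qed
  qed
 qed
 have R0: "0 \<le> R" by (rule order_trans[OF norm_ge_zero R[of 0]]) (use T in simp)
 have mm: "(\<lambda>t. E_norm \<Omega> (g t)) \<in> borel_measurable (lebesgue_on {0..T})"
 proof -
  have "(\<lambda>t. (E_norm \<Omega> (g t))^2) \<in> borel_measurable (lebesgue_on {0..T})"
   using nV2[OF T] by (simp only: absolutely_integrable_iff_integrable_on) (rule borel_measurable_integrable)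
  then have "(\<lambda>t. sqrt ((E_norm \<Omega> (g t))^2)) \<in> borel_measurable (lebesgue_on {0..T})" by measurable
  then show ?thesis by (simp only: real_sqrt_abs abs_of_nonneg[OF nV_nonneg])
 qed
 show ?thesis
  unfolding weak_path_def
 proof (intro conjI)
  show "\<forall>t\<in>{0..T}. g t \<in> H_space \<Omega>" "\<forall>h\<in>H_space \<Omega>. continuous_on {0..T} (\<lambda>t. g t \<bullet> h)"
   using C[OF T] unfolding weakly_continuous_H_def by blast+
  show "\<exists>s. (\<forall>k::nat. simple_function (lebesgue_on {0..T}) (s k) \<and> range (s k) \<subseteq> E_space \<Omega>) \<and>
    (AE t in lebesgue_on {0..T}. (\<lambda>k. E_norm \<Omega> (s k t - g t)) \<longlonglongrightarrow> 0)"
   using B[OF T] by (simp only: bochner_L2_E_def)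
  show "\<forall>t. 0 \<le> rhs_const * (1 + R) * E_norm \<Omega> (g t)"
   using R0 rhs_const(1) nV_nonneg by (intro allI mult_nonneg_nonneg) auto
  show "(\<lambda>t. rhs_const * (1 + R) * E_norm \<Omega> (g t)) \<in> borel_measurable (lebesgue_on {0..T})"
   by (intro borel_measurable_times borel_measurable_const mm)
  show "(\<lambda>t. (rhs_const * (1 + R) * E_norm \<Omega> (g t))^2) absolutely_integrable_on {0..T}"
   unfolding power_mult_distrib by (intro set_integrable_mult_right nV2 T)
  have "AE t in lebesgue_on {0..T}. t \<in> {0..T}" by (rule AE_I2) simp
  with V[OF T] show "AE t in lebesgue_on {0..T}. (\<forall>\<phi>\<in>E_space \<Omega>. \<forall>\<psi>\<in>E_space \<Omega>. rhs g t (\<phi> + \<psi>) = rhs g t \<phi> + rhs g t \<psi>) \<and>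
    (\<forall>\<phi>\<in>E_space \<Omega>. \<forall>c. rhs g t (c *\<^sub>R \<phi>) = c * rhs g t \<phi>) \<and>
    (\<forall>\<phi>\<in>E_space \<Omega>. \<bar>rhs g t \<phi>\<bar> \<le> rhs_const * (1 + R) * E_norm \<Omega> (g t) * E_norm \<Omega> \<phi>)"
   by eventually_elim (intro conjI ballI allI rhs_linear[where g = g] rhs_const(2)[where g = g] R)
  show "\<forall>\<phi>\<in>E_space \<Omega>. (\<lambda>t. rhs g t \<phi>) \<in> borel_measurable (lebesgue_on {0..T})" using m[OF T] by blast
  show "\<forall>\<phi>\<in>E_space \<Omega>. \<forall>a b. 0 \<le> a \<longrightarrow> a \<le> b \<longrightarrow> b \<le> T \<longrightarrow> g b \<bullet> \<phi> - g a \<bullet> \<phi> = integral {a..b} (\<lambda>t. rhs g t \<phi>)"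
  proof (intro ballI allI impI)
   fix \<phi> a b assume \<phi>: "\<phi> \<in> E_space \<Omega>" and ab: "0 \<le> a" "a \<le> b" "b \<le> T"
   \<comment> \<open>Working on [0, T + 1] makes the integrated equation available up to and
     including b = T.\<close>
   have T1: "T + 1 > 0" using T by simp
   have "\<phi> \<in> H_space \<Omega>" using \<phi> VH by blast
   then have "continuous_on {0..T + 1} (\<lambda>t. g t \<bullet> \<phi>)" using C[OF T1] by (simp add: weakly_continuous_H_def)
   from weak_derivative_integral[OF weak[OF T1 \<phi>] this int[OF T1 \<phi>] ab(1,2)] ab(3)
   show "g b \<bullet> \<phi> - g a \<bullet> \<phi> = integral {a..b} (\<lambda>t. rhs g t \<phi>)" by simp
  qed
 qed (fact V[OF T] nV2[OF T])+
qed

end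

section \<open>Pointwise dissipativity of the reaction\<close>

lemma young_quarter: "0 < k \<Longrightarrow> p * q \<le> k / 4 * p^2 + q^2 / k" for k p q :: real
 using zero_le_power2[of "k * p - 2 * q"] by (simp add: field_simps power2_eq_square)

text \<open>If F x \<ge> M the cubic term wins; otherwise x \<le> M / F bounds the quadratic
  one.\<close>

lemma quadratic_minus_cubic_le:
 fixes x M F :: real
 assumes "0 \<le> x" "0 < F" "0 < M" shows "M * x^2 - F * x ^ 3 \<le> M ^ 3 / F^2"
proof (cases "M \<le> F * x")
 case True
 have "M * x^2 \<le> (F * x) * x^2" by (rule mult_right_mono[OF True]) simp
 then have "M * x^2 - F * x ^ 3 \<le> 0" by (simp add: power2_eq_square power3_eq_cube algebra_simps)
 also have "0 \<le> M ^ 3 / F^2" using assms by simp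
 finally show ?thesis .
next
 case False
 then have "x \<le> M / F" using assms by (simp add: field_simps)
 then have "x^2 \<le> (M / F)^2" using assms by (intro power_mono) auto
 then have "M * x^2 \<le> M * (M / F)^2" using assms by (intro mult_left_mono) auto
 moreover have "0 \<le> F * x ^ 3" using assms by simp
 moreover have "M * (M / F)^2 = M ^ 3 / F^2" by (simp add: power2_eq_square power3_eq_cube)
 ultimately show ?thesis by linarith
qed

text \<open>The weight \<beta> is such that the coupling c2 z y costs a quarter of each of the
  damping terms b2 y^2 and \<beta> c3 z^2. The coupling through a3 costs another quarter of the
  z-damping and a multiple of x^2, which the cubic term absorbs. The production b1 x y is balanced
  by the sink G1 x^2 y up to a term linear in y, at the cost of a quarter of the y-damping. Half of
  the y-damping and of the z-damping remains.\<close>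

lemma reaction_dissipative:
 fixes x y z a1 a3 b1 b2 c2 c3 F G1 G2 :: real
 assumes xyz: "0 \<le> x" "0 \<le> y" "0 \<le> z" and pos: "0 < a1" "0 < b2" "0 < c3" "0 < F" "0 < G1" "0 < G2" "0 < \<beta>" "0 < l"
  and l: "l \<le> b2" "l \<le> c3" and \<beta>: "\<beta> * b2 * c3 = 4 * c2^2" and M: "M = a1 + \<beta> * a3^2 / c3 + l / 2"
 shows "(a1 * (x * x) + b1 * (y * x) - F * ((x * x) * x) - G1 * ((x * y) * x))
   + (- b2 * (y * y) + c2 * (z * y) - G2 * ((x * y) * y)) + \<beta> * (a3 * (x * z) - c3 * (z * z))
  \<le> M ^ 3 / F^2 + (b1^2 / (4 * G1))^2 / b2 - l / 2 * (x * x + y * y + \<beta> * (z * z))"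
proof -
 define N where "N = b1^2 / (4 * G1)"
 have A: "c2 * (z * y) \<le> b2 / 4 * y^2 + \<beta> * c3 / 4 * z^2"
 proof -
  have "y * (c2 * z) \<le> b2 / 4 * y^2 + (c2 * z)^2 / b2" by (rule young_quarter[OF pos(2)])
  moreover have "(c2 * z)^2 / b2 = \<beta> * c3 / 4 * z^2"
  proof -
   have "4 * (c2 * z)^2 = (\<beta> * b2 * c3) * z^2" unfolding \<beta> by (simp add: power_mult_distrib)
   then show ?thesis using pos by (simp add: field_simps)
  qed
  ultimately show ?thesis by (simp add: mult.left_commute mult.commute)
 qed
 have "z * (a3 * x) \<le> c3 / 4 * z^2 + (a3 * x)^2 / c3" by (rule young_quarter[OF pos(3)])
 then have "\<beta> * (z * (a3 * x)) \<le> \<beta> * (c3 / 4 * z^2 + (a3 * x)^2 / c3)" using pos by (intro mult_left_mono) auto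
 then have B: "\<beta> * (a3 * (x * z)) \<le> \<beta> * c3 / 4 * z^2 + \<beta> * a3^2 / c3 * x^2"
  by (simp add: algebra_simps power_mult_distrib)
 have "x * b1 \<le> 4 * G1 / 4 * x^2 + b1^2 / (4 * G1)" using pos by (intro young_quarter) simp
 then have "y * (x * b1) \<le> y * (G1 * x^2 + N)" using xyz unfolding N_def by (intro mult_left_mono) auto
 then have C: "b1 * (y * x) \<le> G1 * ((x * y) * x) + y * N" by (simp add: algebra_simps power2_eq_square)
 have D: "y * N \<le> b2 / 4 * y^2 + N^2 / b2" by (rule young_quarter[OF pos(2)])
 have E: "0 \<le> G2 * ((x * y) * y)" using xyz pos by simp
 have Q: "M * x^2 - F * x ^ 3 \<le> M ^ 3 / F^2"
 proof -
  have "0 < M" unfolding M using pos by (intro add_pos_pos add_pos_nonneg divide_nonneg_pos mult_nonneg_nonneg) auto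
  then show ?thesis using quadratic_minus_cubic_le xyz pos by blast
 qed
 have G: "l / 2 * y^2 \<le> b2 / 2 * y^2" using l by (intro mult_right_mono) auto
 have H: "(\<beta> * z^2) * l \<le> (\<beta> * z^2) * c3" using l pos by (intro mult_left_mono) auto
 have cubes: "F * ((x * x) * x) = F * x ^ 3" "M * x^2 = a1 * x^2 + \<beta> * a3^2 / c3 * x^2 + l / 2 * x^2"
  "\<beta> * (a3 * (x * z) - c3 * (z * z)) = \<beta> * (a3 * (x * z)) - (\<beta> * z^2) * c3"
  "l / 2 * (x * x + y * y + \<beta> * (z * z)) = l / 2 * x^2 + l / 2 * y^2 + (\<beta> * z^2) * l / 2"
  "\<beta> * c3 / 4 * z^2 = (\<beta> * z^2) * c3 / 4" "- b2 * (y * y) = - (b2 * y^2)" "b2 / 4 * y^2 = b2 * y^2 / 4" "b2 / 2 * y^2 = b2 * y^2 / 2" "x * x = x^2"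
  unfolding M by (simp_all add: power2_eq_square power3_eq_cube algebra_simps)
 show ?thesis
  using A B C D E Q G H unfolding cubes(1-8) N_def[symmetric] unfolding power2_eq_square[symmetric] by linarith
qed

section \<open>Weighted energy, and the difference of two reaction terms\<close>

context oregonator
begin

text \<open>The solution \<beta> of \<beta> b2 c3 = 4 c2^2, for which damping absorbs the coupling
  of w into the second equation.\<close>

definition w_weight :: real where "w_weight = 4 * c2^2 / (b2 * c3)"

definition decay :: real where "decay = min b2 c3"

text \<open>With the square root on the third component, the operator is symmetric and the weighted
  energy is the ordinary squared norm of a transformed path. The energy inequality then tests the
  original equation with \<open>weight (weight g)\<close>.\<close>

definition weight :: "'a L2_triple \<Rightarrow> 'a L2_triple" where
 "weight g = (fst g, fst (snd g), sqrt w_weight *\<^sub>R snd (snd g))"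

lemma w_weight_pos: "0 < w_weight" and decay_pos: "0 < decay"
 using pos by (auto simp: w_weight_def decay_def)

lemma weight_weight: "weight (weight (u, v, w)) = (u, v, w_weight *\<^sub>R w)"
 using w_weight_pos by (simp add: weight_def)

lemma norm_weight: "(norm (weight (u, v, w)))^2 = u \<bullet> u + v \<bullet> v + w_weight * (w \<bullet> w)"
 using w_weight_pos by (simp add: weight_def power2_norm_eq_inner)

lemma weight_linear: "linear weight"
 by (rule linearI) (auto simp: weight_def scaleR_add_right mult.commute)

lemma weight_symmetric: "weight x \<bullet> y = x \<bullet> weight y"
 by (simp add: weight_def inner_prod_def)

lemma weight_E: "x \<in> E_space \<Omega> \<Longrightarrow> weight x \<in> E_space \<Omega>"
 by (auto simp: E_space_def weight_def intro: subspace_scale[OF subspace_H10[OF open_domain]])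

lemma weight_H: "x \<in> H_space \<Omega> \<Longrightarrow> weight x \<in> H_space \<Omega>"
 by (auto simp: H_space_def weight_def intro: subspace_scale[OF L2_on_subspace])

lemma weight_E_norm:
 assumes "x \<in> E_space \<Omega>" shows "E_norm \<Omega> (weight x) \<le> max 1 (sqrt w_weight) * E_norm \<Omega> x"
proof -
 obtain u v w where x: "x = (u, v, w)" by (cases x)
 let ?k = "max 1 (sqrt w_weight)"
 have w: "w \<in> H10 \<Omega>" using assms by (simp add: x mem_E)
 have k: "1 \<le> ?k^2" "(sqrt w_weight)^2 \<le> ?k^2" by (rule one_le_power, simp, rule power_mono) (use w_weight_pos in auto)
 have "(E_norm \<Omega> (weight x))^2 = 1 * (grad_norm \<Omega> u)^2 + 1 * (grad_norm \<Omega> v)^2 + (sqrt w_weight)^2 * (grad_norm \<Omega> w)^2"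
  using grad_norm_scaleR[OF open_domain w, of "sqrt w_weight"] w_weight_pos
  by (simp add: x weight_def E_norm_power2[OF dim open_domain bounded_domain] power_mult_distrib del: E_norm.simps)
 also have "... \<le> ?k^2 * (grad_norm \<Omega> u)^2 + ?k^2 * (grad_norm \<Omega> v)^2 + ?k^2 * (grad_norm \<Omega> w)^2"
  by (intro add_mono mult_right_mono k) auto
 also have "... = (?k * E_norm \<Omega> x)^2"
  by (simp only: x power_mult_distrib E_norm_power2[OF dim open_domain bounded_domain] distrib_left)
 finally show ?thesis by (rule power2_le_imp_le) (auto intro!: mult_nonneg_nonneg nV_nonneg)
qed

lemma H_plus_AE:
 assumes "u \<in> L2_nonneg \<Omega>" shows "AE x in lebesgue. 0 \<le> rep_L2 u x \<and> (x \<notin> \<Omega> \<longrightarrow> rep_L2 u x = 0)"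
proof -
 have "AE x in lebesgue. x \<notin> \<Omega> \<longrightarrow> rep_L2 u x = 0" "AE x in lebesgue. x \<in> \<Omega> \<longrightarrow> rep_L2 u x \<ge> 0"
  using assms by (auto simp: L2_nonneg_def L2_on_def)
 then show ?thesis by eventually_elim force
qed

text \<open>The pointwise inequality is integrated. Its constant enters only on \<Omega>, which has
  finite measure, and outside both sides vanish; the summand 1 makes the final constant
  positive.\<close>

lemma reaction_energy: "\<exists>C>0. \<forall>g\<in>E_space \<Omega> \<inter> H_plus \<Omega>. 2 * (f g \<bullet> weight (weight g)) \<le> C - decay * (norm (weight g))^2"
proof -
 define M where "M = a1 + w_weight * a3^2 / c3 + decay / 2"
 define K where "K = M ^ 3 / F^2 + (b1^2 / (4 * G1))^2 / b2"
 have M: "M > 0" unfolding M_def using pos w_weight_pos decay_pos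
  by (intro add_pos_pos add_pos_nonneg divide_nonneg_pos mult_nonneg_nonneg) auto
 have K: "K > 0" unfolding K_def using pos M by (intro add_pos_nonneg) auto
 have \<Omega>: "\<Omega> \<in> lmeasurable" by (rule lmeasurable_open[OF bounded_domain open_domain])
 then have ind: "integrable lebesgue (indicator \<Omega> :: 'a \<Rightarrow> real)" by (intro integrable_real_indicator) (auto simp: fmeasurable_def)
 have "f g \<bullet> weight (weight g) \<le> K * measure lebesgue \<Omega> - decay / 2 * (norm (weight g))^2" if g: "g \<in> E_space \<Omega>" "g \<in> H_plus \<Omega>" for g
 proof -
  obtain u v w where e: "g = (u, v, w)" by (cases g)
  have E: "u \<in> H10 \<Omega>" "v \<in> H10 \<Omega>" "w \<in> H10 \<Omega>" using g by (auto simp: e mem_E)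
  have P: "u \<in> L2_nonneg \<Omega>" "v \<in> L2_nonneg \<Omega>" "w \<in> L2_nonneg \<Omega>" using g by (auto simp: e H_plus_def)
  define U V W UU UV where "U = rep_L2 u" and "V = rep_L2 v" and "W = rep_L2 w" and "UU = rep_L2 (u \<odot> u)" and "UV = rep_L2 (u \<odot> v)"
  note defs = U_def V_def W_def UU_def UV_def
  let ?h = "\<lambda>x. (a1 * (U x * U x) + b1 * (V x * U x) - F * (UU x * U x) - G1 * (UV x * U x))
   + (- b2 * (V x * V x) + c2 * (W x * V x) - G2 * (UV x * V x)) + w_weight * (a3 * (U x * W x) - c3 * (W x * W x))"
  let ?k = "\<lambda>x. K * indicator \<Omega> x - decay / 2 * (U x * U x + V x * V x + w_weight * (W x * W x))"
  have int: "integrable lebesgue ?h" "integrable lebesgue ?k"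
   unfolding defs by (simp_all add: integrable_rep_mult ind)
  have "f g \<bullet> weight (weight g) = integral\<^sup>L lebesgue ?h"
  proof -
   have "integral\<^sup>L lebesgue ?h = (a1 * (u \<bullet> u) + b1 * (v \<bullet> u) - F * ((u \<odot> u) \<bullet> u) - G1 * ((u \<odot> v) \<bullet> u))
    + (- b2 * (v \<bullet> v) + c2 * (w \<bullet> v) - G2 * ((u \<odot> v) \<bullet> v)) + w_weight * (a3 * (u \<bullet> w) - c3 * (w \<bullet> w))"
    unfolding defs inner_L2_eq by (simp add: integrable_rep_mult)
   then show ?thesis unfolding e weight_weight reaction_inner by (simp add: algebra_simps)
  qed
  also have "... \<le> integral\<^sup>L lebesgue ?k"
  proof (rule integral_mono_AE[OF int])
   show "AE x in lebesgue. ?h x \<le> ?k x"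
    using H_plus_AE[OF P(1)] H_plus_AE[OF P(2)] H_plus_AE[OF P(3)] rep_L2_mult[OF dim open_domain bounded_domain E(1) E(1)]
     rep_L2_mult[OF dim open_domain bounded_domain E(1) E(2)] unfolding defs[symmetric]
   proof eventually_elim
    case (elim x)
    have s: "UU x = U x * U x" "UV x = U x * V x" using elim by auto
    show ?case
    proof (cases "x \<in> \<Omega>")
     case True
     show ?thesis
      unfolding s K_def indicator_def using True
      by (simp only: if_True mult_1_right of_bool_eq) (rule reaction_dissipative; use elim pos w_weight_pos decay_pos in \<open>simp add: M_def decay_def w_weight_def\<close>)
    next
     case False
     then show ?thesis using elim by simp
    qed
   qed
  qed
  also have "... = K * measure lebesgue \<Omega> - decay / 2 * (u \<bullet> u + v \<bullet> v + w_weight * (w \<bullet> w))"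
   unfolding defs inner_L2_eq using ind by (simp add: integrable_rep_mult)
  finally show ?thesis by (simp only: e norm_weight)
 qed
 then have *: "2 * (f g \<bullet> weight (weight g)) \<le> (2 * (K * measure lebesgue \<Omega>) + 1) - decay * (norm (weight g))^2"
  if "g \<in> E_space \<Omega> \<inter> H_plus \<Omega>" for g using that by fastforce
 have "0 < 2 * (K * measure lebesgue \<Omega>) + 1" using K by (intro add_nonneg_pos mult_nonneg_nonneg) auto
 then show ?thesis using * by (intro exI[of _ "2 * (K * measure lebesgue \<Omega>) + 1"]) blast
qed

lemma grad_inner_diff:
 assumes "u \<in> H10 \<Omega>" "v \<in> H10 \<Omega>" shows "grad_inner \<Omega> (u - v) w = grad_inner \<Omega> u w - grad_inner \<Omega> v w"
proof -
 have "(-1) *\<^sub>R v \<in> H10 \<Omega>" using assms by (intro subspace_scale[OF subspace_H10[OF open_domain]])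
 from grad_inner_add(2)[OF open_domain assms(1) this] grad_inner_scaleR(2)[OF open_domain assms(2), of "-1"]
 show ?thesis by simp
qed

lemma min_mult_le: "min x (min y z) * (p + q + r) \<le> x * p + y * q + z * r" if "0 \<le> p" "0 \<le> q" "0 \<le> r" for x y z p q r :: real
 unfolding distrib_left using that by (intro add_mono mult_right_mono) auto

lemma diffusion_self:
 assumes "g \<in> E_space \<Omega>" shows "A g g \<le> - (min d1 (min d2 d3)) * (E_norm \<Omega> g)^2"
proof (cases g)
 case (fields u v w)
 show ?thesis
  using min_mult_le[of "(grad_norm \<Omega> u)^2" "(grad_norm \<Omega> v)^2" "(grad_norm \<Omega> w)^2" d1 d2 d3]
  unfolding fields E_norm_power2[OF dim open_domain bounded_domain] by (simp add: grad_norm_power2[symmetric])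
qed

lemma diffusion_weight:
 assumes "g \<in> E_space \<Omega>"
 shows "A g (weight (weight g)) \<le> - (min d1 (min d2 (d3 * w_weight))) * (E_norm \<Omega> g)^2"
proof (cases g)
 case (fields u v w)
 have "w \<in> H10 \<Omega>" using assms by (simp add: fields mem_E)
 then show ?thesis
  using min_mult_le[of "(grad_norm \<Omega> u)^2" "(grad_norm \<Omega> v)^2" "(grad_norm \<Omega> w)^2" d1 d2 "d3 * w_weight"]
  unfolding fields E_norm_power2[OF dim open_domain bounded_domain] weight_weight
  by (simp add: grad_norm_power2[symmetric] grad_inner_scaleR[OF open_domain] mult.assoc)
qed

lemma diffusion_diff:
 assumes "g1 \<in> E_space \<Omega>" "g2 \<in> E_space \<Omega>" shows "A (g1 - g2) \<phi> = A g1 \<phi> - A g2 \<phi>"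
 using assms by (cases g1; cases g2; cases \<phi>) (simp add: mem_E grad_inner_diff algebra_simps)

text \<open>The difference u1 v1 - u2 v2 is written as v1 p + u2 q in the G1 term and as u1 q + v2 p
  in the G2 term. The contributions (u1 + u2) p^2, v1 p^2 and u1 q^2 have the good sign; the mixed
  ones u2 p q and v2 p q are bounded by half sums of squares.\<close>

lemma nonlinear_difference_le:
 fixes u1 u2 v1 v2 p q :: real
 assumes "0 \<le> u1" "0 \<le> u2" "0 \<le> v1" "0 \<le> v2" "p = u1 - u2" "q = v1 - v2"
 shows "- F * (u1 * u1 * p - u2 * u2 * p) - G1 * (u1 * v1 * p - u2 * v2 * p) - G2 * (u1 * v1 * q - u2 * v2 * q)
  \<le> G1 / 2 * (u2 * (p * p)) + G1 / 2 * (u2 * (q * q)) + G2 / 2 * (v2 * (p * p)) + G2 / 2 * (v2 * (q * q))"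
proof -
 have "0 \<le> F * ((u1 + u2) * p^2) + G1 * (v1 * p^2) + G2 * (u1 * q^2) + G1 / 2 * (u2 * (p + q)^2) + G2 / 2 * (v2 * (p + q)^2)"
  using assms(1-4) pos by (intro add_nonneg_nonneg mult_nonneg_nonneg zero_le_power2) auto
 also have "... = (G1 / 2 * (u2 * (p * p)) + G1 / 2 * (u2 * (q * q)) + G2 / 2 * (v2 * (p * p)) + G2 / 2 * (v2 * (q * q)))
   - (- F * (u1 * u1 * p - u2 * u2 * p) - G1 * (u1 * v1 * p - u2 * v2 * p) - G2 * (u1 * v1 * q - u2 * v2 * q))"
  unfolding assms(5,6) by (simp add: field_simps power2_eq_square)
 finally show ?thesis by simp
qed

lemma nonlinear_difference:
 assumes g: "(u1, v1, w1) \<in> E_space \<Omega> \<inter> H_plus \<Omega>" "(u2, v2, w2) \<in> E_space \<Omega> \<inter> H_plus \<Omega>"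
  and p: "p = u1 - u2" and q: "q = v1 - v2"
 shows "- F * ((u1 \<odot> u1) \<bullet> p - (u2 \<odot> u2) \<bullet> p) - G1 * ((u1 \<odot> v1) \<bullet> p - (u2 \<odot> v2) \<bullet> p) - G2 * ((u1 \<odot> v1) \<bullet> q - (u2 \<odot> v2) \<bullet> q)
  \<le> G1 / 2 * (u2 \<bullet> (p \<odot> p)) + G1 / 2 * (u2 \<bullet> (q \<odot> q)) + G2 / 2 * (v2 \<bullet> (p \<odot> p)) + G2 / 2 * (v2 \<bullet> (q \<odot> q))" (is "?N \<le> ?B")
proof -
 have E: "u1 \<in> H10 \<Omega>" "v1 \<in> H10 \<Omega>" "u2 \<in> H10 \<Omega>" "v2 \<in> H10 \<Omega>" using g by (auto simp: mem_E)
 then have pq: "p \<in> H10 \<Omega>" "q \<in> H10 \<Omega>" unfolding p q by (auto intro: subspace_diff[OF subspace_H10[OF open_domain]])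
 have P: "u1 \<in> L2_nonneg \<Omega>" "v1 \<in> L2_nonneg \<Omega>" "u2 \<in> L2_nonneg \<Omega>" "v2 \<in> L2_nonneg \<Omega>" using g by (auto simp: H_plus_def)
 let ?r = rep_L2
 let ?h = "\<lambda>x. - F * (?r (u1 \<odot> u1) x * ?r p x - ?r (u2 \<odot> u2) x * ?r p x) - G1 * (?r (u1 \<odot> v1) x * ?r p x - ?r (u2 \<odot> v2) x * ?r p x)
  - G2 * (?r (u1 \<odot> v1) x * ?r q x - ?r (u2 \<odot> v2) x * ?r q x)"
 let ?k = "\<lambda>x. G1 / 2 * (?r u2 x * ?r (p \<odot> p) x) + G1 / 2 * (?r u2 x * ?r (q \<odot> q) x) + G2 / 2 * (?r v2 x * ?r (p \<odot> p) x) + G2 / 2 * (?r v2 x * ?r (q \<odot> q) x)"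
 have int: "integrable lebesgue ?h" "integrable lebesgue ?k"
  by (intro Bochner_Integration.integrable_add Bochner_Integration.integrable_diff integrable_rep_mult Bochner_Integration.integrable_mult_right)+
 have eq: "?N = integral\<^sup>L lebesgue ?h" "?B = integral\<^sup>L lebesgue ?k"
  unfolding inner_L2_eq by (simp_all add: integrable_rep_mult)
 note mult = rep_L2_mult[OF dim open_domain bounded_domain]
 have "AE x in lebesgue. ?h x \<le> ?k x"
  using H_plus_AE[OF P(1)] H_plus_AE[OF P(2)] H_plus_AE[OF P(3)] H_plus_AE[OF P(4)]
   mult[OF E(1,1)] mult[OF E(3,3)] mult[OF E(1,2)] mult[OF E(3,4)] mult[OF pq(1,1)] mult[OF pq(2,2)]
   rep_L2_diff[of u1 u2, folded p] rep_L2_diff[of v1 v2, folded q]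
 proof eventually_elim
  case (elim x)
  show ?case unfolding elim(5-10) by (rule nonlinear_difference_le) (use elim in auto)
 qed
 then show ?thesis unfolding eq by (rule integral_mono_AE[OF int])
qed

text \<open>The remaining indefinite terms pair components of h, bounded in H by R, with squares of
  the difference, whose norms are at most a small multiple of the squared gradient norm plus a
  multiple of the squared H-norm. The linear couplings go into K.\<close>

lemma reaction_difference:
 assumes \<epsilon>: "\<epsilon> > 0" and R: "R \<ge> 0"
 shows "\<exists>K>0. \<forall>g\<in>E_space \<Omega> \<inter> H_plus \<Omega>. \<forall>h\<in>E_space \<Omega> \<inter> H_plus \<Omega>. norm g \<le> R \<longrightarrow> norm h \<le> R \<longrightarrow>
  2 * (f g \<bullet> (g - h) - f h \<bullet> (g - h)) \<le> \<epsilon> * (E_norm \<Omega> (g - h))^2 + K * (norm (g - h))^2"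
proof -
 \<comment> \<open>The summand 1 keeps m positive when R = 0, since \<epsilon> / m is used
   below.\<close>
 define m where "m = (G1 + G2) * R + 1"
 have m: "m > 0" "(G1 + G2) * R \<le> m" unfolding m_def using pos R by (auto intro: add_nonneg_pos)
 obtain C where C: "C \<ge> 0" "\<And>v. v \<in> H10 \<Omega> \<Longrightarrow> norm (v \<odot> v) \<le> \<epsilon> / m * (grad_norm \<Omega> v)^2 + C * (norm v)^2"
  using square_norm_le[OF dim open_domain bounded_domain, of "\<epsilon> / m"] \<epsilon> m by auto
 define K where "K = 2 * (a1 + b1 + c2 + a3) + m * C"
 have "2 * (f g \<bullet> (g - h) - f h \<bullet> (g - h)) \<le> \<epsilon> * (E_norm \<Omega> (g - h))^2 + K * (norm (g - h))^2"
  if gh: "g \<in> E_space \<Omega> \<inter> H_plus \<Omega>" "h \<in> E_space \<Omega> \<inter> H_plus \<Omega>" "norm g \<le> R" "norm h \<le> R" for g h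
 proof -
  obtain u1 v1 w1 u2 v2 w2 where e: "g = (u1, v1, w1)" "h = (u2, v2, w2)" by (cases g, cases h)
  define p q r where "p = u1 - u2" and "q = v1 - v2" and "r = w1 - w2"
  note pqr = p_def q_def r_def
  have z: "g - h = (p, q, r)" by (simp add: e pqr)
  have pq: "p \<in> H10 \<Omega>" "q \<in> H10 \<Omega>"
   using gh unfolding pqr e by (auto simp: mem_E intro: subspace_diff[OF subspace_H10[OF open_domain]])
  define Z X where "Z = (norm (g - h))^2" and "X = norm (p \<odot> p) + norm (q \<odot> q)"
  define N where "N = - F * ((u1 \<odot> u1) \<bullet> p - (u2 \<odot> u2) \<bullet> p) - G1 * ((u1 \<odot> v1) \<bullet> p - (u2 \<odot> v2) \<bullet> p) - G2 * ((u1 \<odot> v1) \<bullet> q - (u2 \<odot> v2) \<bullet> q)"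
  have l: "p \<bullet> y = u1 \<bullet> y - u2 \<bullet> y" "q \<bullet> y = v1 \<bullet> y - v2 \<bullet> y" "r \<bullet> y = w1 \<bullet> y - w2 \<bullet> y" for y
   by (simp_all add: pqr inner_diff_left)
  have split: "f g \<bullet> (g - h) - f h \<bullet> (g - h) = a1 * (p \<bullet> p) + b1 * (q \<bullet> p) - b2 * (q \<bullet> q) + c2 * (r \<bullet> q) + a3 * (p \<bullet> r) - c3 * (r \<bullet> r) + N"
   unfolding z unfolding e reaction_inner l N_def by (simp add: algebra_simps)
  have lin: "x \<bullet> y \<le> Z" if "norm x \<le> norm (g - h)" "norm y \<le> norm (g - h)" for x y :: "'a L2"
  proof -
   have "x \<bullet> y \<le> norm x * norm y" by (rule norm_cauchy_schwarz)
   also have "... \<le> norm (g - h) * norm (g - h)" using that by (intro mult_mono) auto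
   finally show ?thesis by (simp add: Z_def power2_eq_square)
  qed
  have n: "norm p \<le> norm (g - h)" "norm q \<le> norm (g - h)" "norm r \<le> norm (g - h)" unfolding z by (rule norm_component_le)+
  have L: "a1 * (p \<bullet> p) \<le> a1 * Z" "b1 * (q \<bullet> p) \<le> b1 * Z" "c2 * (r \<bullet> q) \<le> c2 * Z" "a3 * (p \<bullet> r) \<le> a3 * Z" "0 \<le> b2 * (q \<bullet> q)" "0 \<le> c3 * (r \<bullet> r)"
   using pos n by (auto intro!: mult_left_mono lin)
  have quad: "y \<bullet> x \<le> R * norm x" if "norm y \<le> R" for x y :: "'a L2"
   using norm_cauchy_schwarz[of y x] mult_right_mono[OF that, of "norm x"] by simp
  have n2: "norm u2 \<le> R" "norm v2 \<le> R" using norm_component_le[of u2 v2 w2] norm_component_le(2)[of v2 u2 w2] gh(4) unfolding e by auto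
  have Q: "G1 / 2 * (u2 \<bullet> (p \<odot> p)) \<le> G1 / 2 * (R * norm (p \<odot> p))" "G1 / 2 * (u2 \<bullet> (q \<odot> q)) \<le> G1 / 2 * (R * norm (q \<odot> q))"
   "G2 / 2 * (v2 \<bullet> (p \<odot> p)) \<le> G2 / 2 * (R * norm (p \<odot> p))" "G2 / 2 * (v2 \<bullet> (q \<odot> q)) \<le> G2 / 2 * (R * norm (q \<odot> q))"
   using pos n2 by (auto intro!: mult_left_mono quad)
  have "N \<le> G1 / 2 * (u2 \<bullet> (p \<odot> p)) + G1 / 2 * (u2 \<bullet> (q \<odot> q)) + G2 / 2 * (v2 \<bullet> (p \<odot> p)) + G2 / 2 * (v2 \<bullet> (q \<odot> q))"
   unfolding N_def by (rule nonlinear_difference[OF gh(1,2)[unfolded e] p_def q_def])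
  also have "... \<le> G1 / 2 * (R * norm (p \<odot> p)) + G1 / 2 * (R * norm (q \<odot> q)) + G2 / 2 * (R * norm (p \<odot> p)) + G2 / 2 * (R * norm (q \<odot> q))"
   by (intro add_mono Q)
  also have "... = ((G1 + G2) * R) * X / 2" unfolding X_def by algebra
  also have "... \<le> m * X / 2" using m(2) by (intro divide_right_mono mult_right_mono) (auto simp: X_def)
  finally have N: "2 * N \<le> m * X" by simp
  have "X \<le> \<epsilon> / m * ((grad_norm \<Omega> p)^2 + (grad_norm \<Omega> q)^2) + C * ((norm p)^2 + (norm q)^2)"
   unfolding X_def distrib_left using add_mono[OF C(2)[OF pq(1)] C(2)[OF pq(2)]] by linarith
  also have "... \<le> \<epsilon> / m * (E_norm \<Omega> (g - h))^2 + C * Z"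
   unfolding Z_def z E_norm_power2[OF dim open_domain bounded_domain] triple_norm_power2[OF dim open_domain bounded_domain]
   using \<epsilon> m C(1) by (rule_tac add_mono; rule_tac mult_left_mono) auto
  finally have "m * X \<le> m * (\<epsilon> / m * (E_norm \<Omega> (g - h))^2 + C * Z)" using m(1) by (intro mult_left_mono) auto
  also have "... = \<epsilon> * (E_norm \<Omega> (g - h))^2 + m * C * Z" using m(1) by (simp add: algebra_simps)
  finally have X: "m * X \<le> \<epsilon> * (E_norm \<Omega> (g - h))^2 + m * C * Z" .
  have sum: "2 * (a + b - y + c + e - w + n) \<le> U + (2 * (a' + b' + c' + e') + V)"
   if "a \<le> a'" "b \<le> b'" "c \<le> c'" "e \<le> e'" "0 \<le> y" "0 \<le> w" "2 * n \<le> k" "k \<le> U + V" for a b c e y w n k U V a' b' c' e' :: real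
   using that by argo
  have "2 * (f g \<bullet> (g - h) - f h \<bullet> (g - h)) \<le> \<epsilon> * (E_norm \<Omega> (g - h))^2 + (2 * (a1 * Z + b1 * Z + c2 * Z + a3 * Z) + m * C * Z)"
   unfolding split by (rule sum[OF L N X])
  also have "2 * (a1 * Z + b1 * Z + c2 * Z + a3 * Z) + m * C * Z = K * Z" unfolding K_def by algebra
  finally show ?thesis by (simp only: Z_def)
 qed
 moreover have "K > 0" unfolding K_def using pos m C(1) by (intro add_pos_nonneg mult_nonneg_nonneg) auto
 ultimately show ?thesis by (intro exI[of _ K] conjI ballI impI)
qed

end

section \<open>Scalar integral inequalities of Gronwall type\<close>

lemma affine_integral:
 fixes e E :: "real \<Rightarrow> real"
 assumes "e integrable_on {a..b}" "E integrable_on {a..b}" "a \<le> b"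
 shows "integral {a..b} (\<lambda>t. C + p * e t + q * E t) = C * (b - a) + p * integral {a..b} e + q * integral {a..b} E"
proof (rule integral_unique)
 have "((\<lambda>t. C) has_integral C * (b - a)) {a..b}"
  using has_integral_const_real[of C a b] assms(3) by (simp add: mult.commute)
 then show "((\<lambda>t. C + p * e t + q * E t) has_integral C * (b - a) + p * integral {a..b} e + q * integral {a..b} E) {a..b}"
  using assms(1,2) by (intro has_integral_add has_integral_mult_right integrable_integral)
qed

lemma integral_ge_const:
 fixes e :: "real \<Rightarrow> real"
 assumes "e integrable_on {a..b}" "a \<le> b" "\<And>t. t \<in> {a..b} \<Longrightarrow> r \<le> e t" shows "r * (b - a) \<le> integral {a..b} e"
proof -
 have "integral {a..b} (\<lambda>t. r) \<le> integral {a..b} e" using assms by (intro integral_le) auto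
 then show ?thesis using assms(2) by (simp add: mult.commute)
qed

lemma integral_le_const:
 fixes e :: "real \<Rightarrow> real"
 assumes "e integrable_on {a..b}" "a \<le> b" "\<And>t. t \<in> {a..b} \<Longrightarrow> e t \<le> r" shows "integral {a..b} e \<le> r * (b - a)"
proof -
 have "integral {a..b} e \<le> integral {a..b} (\<lambda>t. r)" using assms by (intro integral_le) auto
 then show ?thesis using assms(2) by (simp add: mult.commute)
qed

context
 fixes e :: "real \<Rightarrow> real" and C l :: real
 assumes int: "\<And>a b. 0 \<le> a \<Longrightarrow> a \<le> b \<Longrightarrow> e integrable_on {a..b}"
  and ineq: "\<And>a b. 0 \<le> a \<Longrightarrow> a \<le> b \<Longrightarrow> e b - e a \<le> C * (b - a) - l * integral {a..b} e"
  and nonneg: "\<And>t. 0 \<le> t \<Longrightarrow> 0 \<le> e t" and C: "0 < C" and l: "0 < l"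
begin

text \<open>Above the level r the inequality forces a decrease. As e is not assumed continuous, the
  supremum of the times with e \<le> r need not be attained; a time slightly before it is used, and
  the growth in between is at most C times the gap.\<close>

lemma dissipation_stays:
 assumes r: "C \<le> l * r" and s: "0 \<le> s" "s \<le> t" "e s \<le> r" shows "e t \<le> r"
proof (rule ccontr)
 assume "\<not> e t \<le> r"
 define X where "X = {\<tau> \<in> {s..t}. e \<tau> \<le> r}"
 define s0 where "s0 = Sup X"
 \<comment> \<open>Over a time shorter than 2 \<epsilon> the forcing can raise e by less than e t -
   r.\<close>
 define \<epsilon> where "\<epsilon> = (e t - r) / (2 * C)"
 have \<epsilon>: "\<epsilon> > 0" unfolding \<epsilon>_def using \<open>\<not> e t \<le> r\<close> C by simp
 have X: "s \<in> X" "bdd_above X" using s by (auto simp: X_def intro!: bdd_aboveI[of _ t])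
 then have ne: "X \<noteq> {}" by auto
 have s0: "\<tau> \<le> s0" if "\<tau> \<in> X" for \<tau> unfolding s0_def using that X(2) by (rule cSup_upper)
 have "s0 \<le> t" unfolding s0_def using ne by (rule cSup_least) (simp add: X_def)
 obtain \<tau> where \<tau>: "\<tau> \<in> X" "s0 - \<epsilon> < \<tau>"
  using less_cSupD[OF ne, of "s0 - \<epsilon>"] \<epsilon> unfolding s0_def[symmetric] by auto
 define s1 where "s1 = min t (s0 + \<epsilon>)"
 have \<tau>': "0 \<le> \<tau>" "\<tau> \<le> s1" "s1 \<le> t" "\<tau> \<le> t" "e \<tau> \<le> r" using \<tau> s s0[OF \<tau>(1)] \<epsilon> by (auto simp: s1_def X_def)
 have big: "r \<le> e x" if "x \<in> {s1..t}" for x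
 proof (cases "x \<in> X")
  case True
  then have "x = t" using s0[OF True] that \<epsilon> by (auto simp: s1_def min_def split: if_splits)
  then show ?thesis using \<open>\<not> e t \<le> r\<close> by simp
 next
  case False
  then show ?thesis using that \<tau>' \<tau>(1) by (auto simp: X_def)
 qed
 have "r * (t - s1) \<le> integral {s1..t} e" using \<tau>' by (intro integral_ge_const int big) auto
 also have "... \<le> integral {\<tau>..s1} e + integral {s1..t} e"
  using \<tau>' by (simp) (intro hk_integral_nonneg int nonneg; force)
 also have "... = integral {\<tau>..t} e" using \<tau>' by (intro hk_integral_combine int) auto
 finally have "l * (r * (t - s1)) \<le> l * integral {\<tau>..t} e" using l by (intro mult_left_mono) auto
 moreover have "C * (t - s1) \<le> (l * r) * (t - s1)" using r \<tau>' by (intro mult_right_mono) auto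
 moreover have "e t - e \<tau> \<le> C * (t - \<tau>) - l * integral {\<tau>..t} e" using \<tau>' by (intro ineq) auto
 ultimately have "e t - r \<le> C * (t - \<tau>) - C * (t - s1)" using \<tau>'(5) by (simp only: mult.assoc)
 also have "... = C * (s1 - \<tau>)" by algebra
 also have "... < C * (2 * \<epsilon>)" using \<tau>(2) C by (intro mult_strict_left_mono) (auto simp: s1_def)
 also have "... = e t - r" using C by (simp add: \<epsilon>_def)
 finally show False by simp
qed

text \<open>If e were still above C/l + 1 at time t, it would have been at least that on all of
  [0,t], since the level cannot be crossed upwards. Then e would have lost at least l t \<ge> e 0
  and could not be positive.\<close>

lemma dissipation_absorb:
 assumes t: "e 0 / l \<le> t" shows "e t \<le> C / l + 1"
proof (rule ccontr)
 assume n: "\<not> e t \<le> C / l + 1"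
 have t0: "0 \<le> t" using t nonneg[of 0] l divide_nonneg_pos[of "e 0" l] by linarith
 have r: "l * (C / l + 1) = C + l" using l by (simp add: field_simps)
 have "C / l + 1 \<le> e s" if "s \<in> {0..t}" for s
 proof (rule ccontr)
  assume "\<not> C / l + 1 \<le> e s"
  moreover have "C \<le> l * (C / l + 1)" unfolding r using l by simp
  ultimately have "e t \<le> C / l + 1" using that by (intro dissipation_stays[of "C / l + 1" s t]) simp_all
  then show False using n by simp
 qed
 then have "(C / l + 1) * (t - 0) \<le> integral {0..t} e" using t0 by (intro integral_ge_const int) auto
 then have "l * ((C / l + 1) * (t - 0)) \<le> l * integral {0..t} e" using l by (intro mult_left_mono) auto
 then have "(C + l) * t \<le> l * integral {0..t} e" unfolding r[symmetric] by (simp add: mult.assoc)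
 moreover have "e t - e 0 \<le> C * (t - 0) - l * integral {0..t} e" by (rule ineq) (use t0 in auto)
 moreover have "e 0 \<le> l * t" using t l by (simp add: field_simps)
 ultimately have "e t \<le> 0" by (simp add: distrib_right)
 moreover have "0 < C / l + 1" using C l by (simp add: add_pos_pos)
 ultimately show False using n by linarith
qed

end

lemma gronwall_doubling:
 fixes e :: "real \<Rightarrow> real"
 assumes int: "\<And>a b. 0 \<le> a \<Longrightarrow> a \<le> b \<Longrightarrow> e integrable_on {a..b}"
  and ineq: "\<And>a b. 0 \<le> a \<Longrightarrow> a \<le> b \<Longrightarrow> e b \<le> e a + K * integral {a..b} e"
  and bound: "\<And>t. 0 \<le> t \<Longrightarrow> 0 \<le> e t \<and> e t \<le> M" and K: "0 < K"
 shows "0 \<le> a \<Longrightarrow> a \<le> b \<Longrightarrow> b \<le> a + real n / (2 * K) \<Longrightarrow> e b \<le> 2 ^ n * e a"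
proof (induction n arbitrary: b)
 case 0
 then have "b = a" by simp
 then show ?case by simp
next
 case (Suc n)
 define c where "c = max a (b - 1 / (2 * K))"
 have K2: "real (Suc n) / (2 * K) = real n / (2 * K) + 1 / (2 * K)" "0 < 1 / (2 * K)" using K by (simp_all add: add_divide_distrib)
 have n0: "0 \<le> real n / (2 * K)" using K by simp
 have c: "a \<le> c" "c \<le> b" "c \<le> a + real n / (2 * K)" "b - c \<le> 1 / (2 * K)"
  using Suc.prems K2 n0 unfolding c_def by linarith+
 have ec: "e c \<le> 2 ^ n * e a" by (rule Suc.IH) (use Suc.prems c in auto)
 define m where "m = (SUP t\<in>{c..b}. e t)"
 have bdd: "bdd_above (e ` {c..b})" using bound Suc.prems c by (intro bdd_aboveI2[of _ _ M]) auto
 have le_m: "e t \<le> m" if "t \<in> {c..b}" for t unfolding m_def by (rule cSUP_upper[OF that bdd])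
 have m0: "0 \<le> m" using le_m[of c] bound[of c] Suc.prems c by auto
 have "m \<le> e c + m / 2"
  unfolding m_def
 proof (rule cSUP_least)
  show "{c..b} \<noteq> {}" using c by simp
  fix t assume t: "t \<in> {c..b}"
  have "K * integral {c..t} e \<le> K * (m * (t - c))"
   using K t Suc.prems c by (intro mult_left_mono integral_le_const int le_m) auto
  also have "... = (K * m) * (t - c)" by simp
  also have "... \<le> (K * m) * (1 / (2 * K))" using t c K m0 by (intro mult_left_mono) auto
  also have "... = m / 2" using K by simp
  finally have "K * integral {c..t} e \<le> m / 2" .
  moreover have "e t \<le> e c + K * integral {c..t} e" using t Suc.prems c by (intro ineq) auto
  ultimately show "e t \<le> e c + (SUP t\<in>{c..b}. e t) / 2" unfolding m_def[symmetric] by linarith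
 qed
 then have "e b \<le> 2 * e c" using le_m[of b] c by simp
 then show ?case using ec by simp
qed

section \<open>Energy estimate along solutions\<close>

context oregonator
begin

lemma AE_times: "T > 0 \<Longrightarrow> weak_path T z G m \<Longrightarrow> 0 \<le> a \<Longrightarrow> b \<le> T \<Longrightarrow> AE t in lebesgue_on {a..b}. z t \<in> E_space \<Omega> \<and> 0 \<le> t"
proof -
 assume T: "T > 0" "weak_path T z G m" "0 \<le> a" "b \<le> T"
 have "AE t in lebesgue_on {0..T}. t \<in> {0..T}" by (rule AE_I2) simp
 with path_V[OF T(2)] have "AE t in lebesgue_on {0..T}. z t \<in> E_space \<Omega> \<and> 0 \<le> t" by eventually_elim simp
 then show ?thesis by (rule AE_lebesgue_on_subset) (use T in auto)
qed

lemma solution_bound: "x \<in> H_plus \<Omega> \<Longrightarrow> 0 < T \<Longrightarrow> \<exists>R. \<forall>t\<in>{0..T}. norm (S t x) \<le> R"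
 using weakly_continuous_bounded[of \<Omega> T "\<lambda>t. S t x"] solution[of x]
 unfolding global_weak_solution_def weak_solution_def bounded_iff by blast

text \<open>The energy inequality for the weighted path: diffusion yields the gradient term on the
  left, and dissipativity of the reaction yields the decay.\<close>

lemma solution_energy:
 "\<exists>C>0. \<exists>d>0. \<forall>x\<in>H_plus \<Omega>. \<forall>a b. 0 \<le> a \<longrightarrow> a \<le> b \<longrightarrow>
  (\<lambda>t. (norm (weight (S t x)))^2) integrable_on {a..b} \<and> (\<lambda>t. (E_norm \<Omega> (S t x))^2) integrable_on {a..b} \<and>
  (norm (weight (S b x)))^2 - (norm (weight (S a x)))^2 + d * integral {a..b} (\<lambda>t. (E_norm \<Omega> (S t x))^2)
   \<le> C * (b - a) - decay * integral {a..b} (\<lambda>t. (norm (weight (S t x)))^2)"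
proof -
 obtain C where C: "C > 0" "\<And>g. g \<in> E_space \<Omega> \<inter> H_plus \<Omega> \<Longrightarrow> 2 * (f g \<bullet> weight (weight g)) \<le> C - decay * (norm (weight g))^2"
  using reaction_energy by blast
 define d where "d = 2 * min d1 (min d2 (d3 * w_weight))"
 have d: "d > 0" unfolding d_def using pos w_weight_pos by simp
 have "(\<lambda>t. (norm (weight (S t x)))^2) integrable_on {a..b} \<and> (\<lambda>t. (E_norm \<Omega> (S t x))^2) integrable_on {a..b} \<and>
  (norm (weight (S b x)))^2 - (norm (weight (S a x)))^2 + d * integral {a..b} (\<lambda>t. (E_norm \<Omega> (S t x))^2)
   \<le> C * (b - a) - decay * integral {a..b} (\<lambda>t. (norm (weight (S t x)))^2)"
  if x: "x \<in> H_plus \<Omega>" and ab: "0 \<le> a" "a \<le> b" for x a b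
 proof -
  let ?e = "\<lambda>t. (norm (weight (S t x)))^2" and ?E = "\<lambda>t. (E_norm \<Omega> (S t x))^2"
  \<comment> \<open>The energy inequality needs room to the right of b for its shifted
    windows.\<close>
  define T where "T = b + 1"
  have T: "T > 0" "b \<le> T" "b < T" using ab by (auto simp: T_def)
  obtain R where R: "\<And>t. t \<in> {0..T} \<Longrightarrow> norm (S t x) \<le> R" using solution_bound[OF x T(1)] by blast
  have path: "weak_path T (\<lambda>t. S t x) (rhs (\<lambda>t. S t x)) (\<lambda>t. rhs_const * (1 + R) * E_norm \<Omega> (S t x))"
   by (rule solution_path[OF solution[OF x] T(1) R])
  have k: "0 \<le> max 1 (sqrt w_weight)" by simp
  note wp = weak_path_transform[OF path weight_linear weight_E weight_H weight_symmetric weight_E_norm k]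
  have ai: "?e absolutely_integrable_on {a..b}" "?E absolutely_integrable_on {a..b}"
   using abs_integrable_subinterval[OF path_norm2_integrable[OF wp] ab(1) T(2)]
    abs_integrable_subinterval[OF path_nV2[OF path] ab(1) T(2)] by auto
  note i = abs_integrable_integrable[OF ai(1)] abs_integrable_integrable[OF ai(2)]
  let ?G = "\<lambda>t. rhs (\<lambda>t. S t x) t (weight (weight (S t x)))"
  let ?k = "\<lambda>t. C / 2 + (- decay / 2) * ?e t + (- d / 2) * ?E t"
  have "integral {a..b} ?G \<le> integral {a..b} ?k"
  proof (rule integral_le_AE)
   show "?G absolutely_integrable_on {a..b}"
    by (rule abs_integrable_subinterval[OF path_G_path_integrable[OF wp] ab(1) T(2)])
   show "?k absolutely_integrable_on {a..b}"
    by (intro set_integral_add(1) set_integrable_mult_right absolutely_integrable_const ai)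
   show "AE t in lebesgue_on {a..b}. ?G t \<le> ?k t"
    using AE_times[OF T(1) path ab(1) T(2)]
   proof eventually_elim
    case (elim t)
    then have m: "S t x \<in> E_space \<Omega> \<inter> H_plus \<Omega>" using solution_H_plus[OF x] by simp
    have "p + q \<le> C / 2 + (- decay / 2) * r + (- (2 * k) / 2) * s" if "p \<le> - k * s" "2 * q \<le> C - decay * r" for p q r s k
     using that by (simp add: field_simps)
    then show ?case unfolding d_def by this (use C(2)[OF m] diffusion_weight[of "S t x"] elim in blast)+
   qed
  qed
  also have "... = C / 2 * (b - a) + (- decay / 2) * integral {a..b} ?e + (- d / 2) * integral {a..b} ?E"
   by (rule affine_integral[OF i ab(2)])
  finally have "2 * integral {a..b} ?G \<le> C * (b - a) - decay * integral {a..b} ?e - d * integral {a..b} ?E" by simp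
  then show ?thesis using energy_inequality[OF wp ab T(3)] i by simp
 qed
 then show ?thesis using C(1) d by blast
qed

end

section \<open>The absorbing set\<close>

context oregonator
begin

lemma weight_norm_equiv:
 "\<exists>k>0. \<forall>x. (norm x)^2 \<le> k * (norm (weight x))^2 \<and> (norm (weight x))^2 \<le> k * (norm x)^2"
proof -
 define k where "k = max 1 (max w_weight (1 / w_weight))"
 have k: "1 \<le> k" "w_weight \<le> k" "1 / w_weight \<le> k" by (auto simp: k_def)
 have "(norm x)^2 \<le> k * (norm (weight x))^2 \<and> (norm (weight x))^2 \<le> k * (norm x)^2" for x
 proof (cases x)
  case (fields u v w)
  have c: "(norm (u, v, w))^2 = u \<bullet> u + v \<bullet> v + w \<bullet> w" by (simp add: power2_norm_eq_inner)
  have "1 * (w \<bullet> w) \<le> (k * w_weight) * (w \<bullet> w)"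
   using k(3) w_weight_pos by (intro mult_right_mono) (auto simp: field_simps)
  moreover have "w_weight * (w \<bullet> w) \<le> k * (w \<bullet> w)" "1 * (u \<bullet> u) \<le> k * (u \<bullet> u)" "1 * (v \<bullet> v) \<le> k * (v \<bullet> v)"
   by (rule mult_right_mono; use k in simp)+
  ultimately show ?thesis unfolding fields norm_weight c by (simp add: distrib_left mult.assoc)
 qed
 then show ?thesis using k(1) by (intro exI[of _ k]) auto
qed

lemma closed_weight_ball: "closed {x \<in> H_plus \<Omega>. (norm (weight x))^2 \<le> \<rho>}"
proof -
 have "closed (H_plus \<Omega> \<inter> {x. (norm (weight x))^2 \<le> \<rho>})"
  unfolding weight_def by (intro closed_Int closed_H_plus closed_Collect_le continuous_intros)
 then show ?thesis by (simp add: Collect_conj_eq)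
qed

text \<open>\<open>B\<close> is the sublevel set of the weighted energy at C / decay + 1. Sublevel
  sets from C / decay on are invariant, and the extra 1 gives absorption after a time proportional
  to the initial energy. The bound by r before T serves the attraction estimate, which starts at t =
  0; the interval [0,2] in the last clause is what Hoelder continuity for shifts up to 1
  requires.\<close>

lemma absorbing_set:
 "\<exists>B. B \<subseteq> H_plus \<Omega> \<and> B \<noteq> {} \<and> closed B \<and> bounded B \<and> (\<forall>t\<ge>0. \<forall>x\<in>B. S t x \<in> B) \<and>
  (\<forall>D\<subseteq>H_plus \<Omega>. bounded D \<longrightarrow> (\<exists>T\<ge>0. \<exists>r. \<forall>x\<in>D. (\<forall>t\<ge>T. S t x \<in> B) \<and> (\<forall>t\<in>{0..T}. norm (S t x) \<le> r))) \<and>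
  (\<exists>Q\<ge>0. \<forall>x\<in>B. integral {0..2} (\<lambda>t. (E_norm \<Omega> (S t x))^2) \<le> Q)"
proof -
 obtain C d where C: "C > 0" and d: "d > 0"
  and en: "\<And>x a b. x \<in> H_plus \<Omega> \<Longrightarrow> 0 \<le> a \<Longrightarrow> a \<le> b \<Longrightarrow>
   (\<lambda>t. (norm (weight (S t x)))^2) integrable_on {a..b} \<and> (\<lambda>t. (E_norm \<Omega> (S t x))^2) integrable_on {a..b} \<and>
   (norm (weight (S b x)))^2 - (norm (weight (S a x)))^2 + d * integral {a..b} (\<lambda>t. (E_norm \<Omega> (S t x))^2)
    \<le> C * (b - a) - decay * integral {a..b} (\<lambda>t. (norm (weight (S t x)))^2)"
  using solution_energy by blast
 define \<rho> where "\<rho> = C / decay + 1"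
 define B where "B = {x \<in> H_plus \<Omega>. (norm (weight x))^2 \<le> \<rho>}"
 let ?e = "\<lambda>x t. (norm (weight (S t x)))^2" and ?E = "\<lambda>x t. (E_norm \<Omega> (S t x))^2"
 note l = decay_pos
 have int: "?e x integrable_on {a..b}" if "x \<in> H_plus \<Omega>" "0 \<le> a" "a \<le> b" for x a b using en[OF that] by simp
 have E0: "0 \<le> integral {a..b} (?E x)" if "x \<in> H_plus \<Omega>" "0 \<le> a" "a \<le> b" for x a b
  using en[OF that] by (intro hk_integral_nonneg) auto
 have e0: "0 \<le> integral {a..b} (?e x)" if "x \<in> H_plus \<Omega>" "0 \<le> a" "a \<le> b" for x a b
  using en[OF that] by (intro hk_integral_nonneg) auto
 have ineq: "?e x b - ?e x a \<le> C * (b - a) - decay * integral {a..b} (?e x)" if "x \<in> H_plus \<Omega>" "0 \<le> a" "a \<le> b" for x a b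
  using en[OF that] mult_nonneg_nonneg[OF less_imp_le[OF d] E0[OF that]] by linarith
 have z: "0 \<le> ?e x t" for x t by simp
 have \<rho>: "C \<le> decay * r" if "\<rho> \<le> r" for r
 proof -
  have "decay * \<rho> = C + decay" unfolding \<rho>_def using l by (simp add: field_simps)
  moreover have "decay * \<rho> \<le> decay * r" using that l by (intro mult_left_mono) auto
  ultimately show ?thesis using l by linarith
 qed
 have \<rho>0: "0 < \<rho>" unfolding \<rho>_def using C l by (simp add: add_pos_pos)
 obtain k where k: "k > 0" "\<And>x. (norm x)^2 \<le> k * (norm (weight x))^2" "\<And>x. (norm (weight x))^2 \<le> k * (norm x)^2"
  using weight_norm_equiv by blast
 have stays: "?e x t \<le> r" if "x \<in> H_plus \<Omega>" "\<rho> \<le> r" "(norm (weight x))^2 \<le> r" "0 \<le> t" for x r t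
  by (rule dissipation_stays[where e = "?e x" and C = C and l = decay and s = 0, OF int[OF that(1)] ineq[OF that(1)] z C l \<rho>[OF that(2)]])
   (use that semigroup_zero[OF that(1)] in auto)
 have norm_le: "norm x \<le> sqrt (k * r)" if "(norm (weight x))^2 \<le> r" for x r
 proof (rule real_le_rsqrt)
  show "(norm x)^2 \<le> k * r" using k(2)[of x] mult_left_mono[OF that less_imp_le[OF k(1)]] by linarith
 qed
 have inv: "S t x \<in> B" if "0 \<le> t" "x \<in> B" for t x
  using stays[of x \<rho> t] that solution_H_plus[of x t] by (simp add: B_def)
 have zero: "0 \<in> B"
 proof -
  have "AE x in lebesgue. rep_L2 (0 :: 'a L2) x = 0" by (rule rep_L2_zero)
  then have "(0 :: 'a L2) \<in> L2_nonneg \<Omega>" by (auto simp: L2_nonneg_def L2_on_def elim!: eventually_mono)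
  then show ?thesis using \<rho>0 by (simp add: B_def H_plus_def zero_prod_def weight_def)
 qed
 have bounded: "bounded B"
  using norm_le by (intro boundedI[of _ "sqrt (k * \<rho>)"]) (simp add: B_def)
 have absorb: "\<exists>T\<ge>0. \<exists>r. \<forall>x\<in>D. (\<forall>t\<ge>T. S t x \<in> B) \<and> (\<forall>t\<in>{0..T}. norm (S t x) \<le> r)"
  if D: "D \<subseteq> H_plus \<Omega>" "bounded D" for D
 proof -
  obtain M where M: "M > 0" "\<And>x. x \<in> D \<Longrightarrow> norm x \<le> M" using D(2) by (auto simp: bounded_pos)
  define m where "m = k * M^2"
  have m: "(norm (weight x))^2 \<le> m" if "x \<in> D" for x
  proof -
   have "k * (norm x)^2 \<le> k * M^2" using k(1) M(2)[OF that] by (intro mult_left_mono power_mono) auto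
   then show ?thesis unfolding m_def using k(3)[of x] by linarith
  qed
  have m0: "0 \<le> m" unfolding m_def using k(1) by simp
  have "S t x \<in> B" if "x \<in> D" "m / decay \<le> t" for x t
  proof -
   have x: "x \<in> H_plus \<Omega>" using that D by blast
   have t: "?e x 0 / decay \<le> t"
    using divide_right_mono[OF m[OF that(1)] less_imp_le[OF l]] that(2) semigroup_zero[OF x] by simp
   have "?e x t \<le> \<rho>" unfolding \<rho>_def
    by (rule dissipation_absorb[where e = "?e x", OF int[OF x] ineq[OF x] z C l]) (use t in simp_all)
   moreover have "0 \<le> t" using that(2) m0 l divide_nonneg_pos[OF m0 l] by linarith
   ultimately show ?thesis using solution_H_plus[OF x] by (simp add: B_def)
  qed
  moreover have "norm (S t x) \<le> sqrt (k * max m \<rho>)" if "x \<in> D" "0 \<le> t" for x t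
   using that D m[OF that(1)] by (intro norm_le stays) auto
  ultimately have "\<forall>x\<in>D. (\<forall>t\<ge>m / decay. S t x \<in> B) \<and> (\<forall>t\<in>{0..m / decay}. norm (S t x) \<le> sqrt (k * max m \<rho>))" by simp
  moreover have "0 \<le> m / decay" using m0 l by simp
  ultimately show ?thesis by blast
 qed
 have "integral {0..2} (?E x) \<le> (\<rho> + 2 * C) / d" if "x \<in> B" for x
 proof -
  have x: "x \<in> H_plus \<Omega>" "?e x 0 \<le> \<rho>" using that semigroup_zero[of x] by (auto simp: B_def)
  have "?e x 2 - ?e x 0 + d * integral {0..2} (?E x) \<le> C * (2 - 0) - decay * integral {0..2} (?e x)"
   using en[OF x(1), of 0 2] by simp
  moreover have "0 \<le> decay * integral {0..2} (?e x)" using e0[OF x(1), of 0 2] l by simp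
  ultimately have "d * integral {0..2} (?E x) \<le> \<rho> + 2 * C" using x(2) z[of 2 x] by argo
  then show ?thesis using d by (simp add: field_simps)
 qed
 moreover have "0 \<le> (\<rho> + 2 * C) / d" using \<rho>0 C d by simp
 moreover have "closed B" unfolding B_def by (rule closed_weight_ball)
 moreover have "B \<subseteq> H_plus \<Omega>" by (auto simp: B_def)
 ultimately show ?thesis
  using zero bounded inv absorb by (intro exI[of _ B]) blast
qed

section \<open>Lipschitz dependence, time regularity and squeezing on a bounded invariant
  set\<close>

context
 fixes B R
 assumes B: "B \<subseteq> H_plus \<Omega>" and invariant: "\<forall>t\<ge>0. \<forall>x\<in>B. S t x \<in> B" and bound: "\<forall>x\<in>B. norm x \<le> R" and R0: "0 \<le> R"
begin

lemma inv: "0 \<le> t \<Longrightarrow> x \<in> B \<Longrightarrow> S t x \<in> B" and R: "x \<in> B \<Longrightarrow> norm x \<le> R"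
 using invariant bound by blast+

lemma path: "0 < T \<Longrightarrow> x \<in> B \<Longrightarrow> weak_path T (\<lambda>t. S t x) (rhs (\<lambda>t. S t x)) (\<lambda>t. rhs_const * (1 + R) * E_norm \<Omega> (S t x))"
 using B inv R by (intro solution_path[OF solution]) auto

text \<open>The difference is tested with itself. Diffusion provides 2 d times the squared E-norm,
  and the reaction estimate is used with \<epsilon> = d, so half of it is left over.\<close>

lemma pair_energy:
 "\<exists>K>0. \<exists>d>0. \<forall>x\<in>B. \<forall>y\<in>B. \<forall>a b. 0 \<le> a \<longrightarrow> a \<le> b \<longrightarrow>
  (\<lambda>t. (norm (S t x - S t y))^2) integrable_on {a..b} \<and> (\<lambda>t. (E_norm \<Omega> (S t x - S t y))^2) absolutely_integrable_on {a..b} \<and>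
  (norm (S b x - S b y))^2 - (norm (S a x - S a y))^2 + d * integral {a..b} (\<lambda>t. (E_norm \<Omega> (S t x - S t y))^2)
   \<le> K * integral {a..b} (\<lambda>t. (norm (S t x - S t y))^2)"
proof -
 define d where "d = min d1 (min d2 d3)"
 have d: "d > 0" unfolding d_def using pos by simp
 obtain K where K: "K > 0" "\<And>g h. g \<in> E_space \<Omega> \<inter> H_plus \<Omega> \<Longrightarrow> h \<in> E_space \<Omega> \<inter> H_plus \<Omega> \<Longrightarrow> norm g \<le> R \<Longrightarrow> norm h \<le> R \<Longrightarrow>
   2 * (f g \<bullet> (g - h) - f h \<bullet> (g - h)) \<le> d * (E_norm \<Omega> (g - h))^2 + K * (norm (g - h))^2"
  using reaction_difference[OF d R0] by blast
 have "(\<lambda>t. (norm (S t x - S t y))^2) integrable_on {a..b} \<and> (\<lambda>t. (E_norm \<Omega> (S t x - S t y))^2) absolutely_integrable_on {a..b} \<and>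
  (norm (S b x - S b y))^2 - (norm (S a x - S a y))^2 + d * integral {a..b} (\<lambda>t. (E_norm \<Omega> (S t x - S t y))^2)
   \<le> K * integral {a..b} (\<lambda>t. (norm (S t x - S t y))^2)"
  if xy: "x \<in> B" "y \<in> B" and ab: "0 \<le> a" "a \<le> b" for x y a b
 proof -
  let ?z = "\<lambda>t. S t x - S t y"
  let ?e = "\<lambda>t. (norm (?z t))^2" and ?E = "\<lambda>t. (E_norm \<Omega> (?z t))^2"
  define T where "T = b + 1"
  have T: "T > 0" "b \<le> T" "b < T" using ab by (auto simp: T_def)
  note px = path[OF T(1) xy(1)] and py = path[OF T(1) xy(2)]
  note wp = weak_path_diff[OF px py]
  have ai: "?e absolutely_integrable_on {a..b}" "?E absolutely_integrable_on {a..b}"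
   using abs_integrable_subinterval[OF path_norm2_integrable[OF wp] ab(1) T(2)]
    abs_integrable_subinterval[OF path_nV2[OF wp] ab(1) T(2)] by auto
  note i = abs_integrable_integrable[OF ai(1)] abs_integrable_integrable[OF ai(2)]
  let ?G = "\<lambda>t. rhs (\<lambda>t. S t x) t (?z t) - rhs (\<lambda>t. S t y) t (?z t)"
  let ?k = "\<lambda>t. 0 + K / 2 * ?e t + (- d / 2) * ?E t"
  have "integral {a..b} ?G \<le> integral {a..b} ?k"
  proof (rule integral_le_AE)
   show "?G absolutely_integrable_on {a..b}"
    by (rule abs_integrable_subinterval[OF path_G_path_integrable[OF wp] ab(1) T(2)])
   show "?k absolutely_integrable_on {a..b}"
    by (intro set_integral_add(1) set_integrable_mult_right absolutely_integrable_const ai)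
   show "AE t in lebesgue_on {a..b}. ?G t \<le> ?k t"
    using AE_times[OF T(1) px ab(1) T(2)] AE_times[OF T(1) py ab(1) T(2)]
   proof eventually_elim
    case (elim t)
    have mx: "S t x \<in> B" and my: "S t y \<in> B" using inv elim xy by auto
    then have m: "S t x \<in> E_space \<Omega> \<inter> H_plus \<Omega>" "S t y \<in> E_space \<Omega> \<inter> H_plus \<Omega>" using B elim by auto
    then have z: "?z t \<in> E_space \<Omega>" using subspace_diff[OF V] by blast
    have "?G t = A (?z t) (?z t) + (f (S t x) \<bullet> ?z t - f (S t y) \<bullet> ?z t)"
     using diffusion_diff[of "S t x" "S t y" "?z t"] elim by simp
    moreover have "p + q \<le> 0 + K / 2 * r + (- k / 2) * s" if "p \<le> - k * s" "2 * q \<le> k * s + K * r" for p q r s k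
     using that by (simp add: field_simps)
    from this[OF diffusion_self[OF z, folded d_def] K(2)[OF m R[OF mx] R[OF my]]]
    have "A (?z t) (?z t) + (f (S t x) \<bullet> ?z t - f (S t y) \<bullet> ?z t) \<le> ?k t" .
    ultimately show ?case by (simp only:)
   qed
  qed
  also have "... = 0 * (b - a) + K / 2 * integral {a..b} ?e + (- d / 2) * integral {a..b} ?E"
   by (rule affine_integral[OF i ab(2)])
  finally have "2 * integral {a..b} ?G \<le> K * integral {a..b} ?e - d * integral {a..b} ?E" by simp
  then show ?thesis using energy_inequality[OF wp ab T(3)] i ai(2) by simp
 qed
 then show ?thesis using K(1) d by blast
qed

text \<open>Iterating the doubling estimate over one unit of time gives L = 2^n with n \<ge> 2 K for
  the squared norm, and L \<le> L^2 lets the same L serve the norm. The dependence is stated from s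
  to t, not only from 0, because later it starts at an unknown time in [0,1].\<close>

lemma pair_bounds:
 "\<exists>L\<ge>1. \<exists>K>0. \<forall>x\<in>B. \<forall>y\<in>B.
  (\<forall>s t. 0 \<le> s \<longrightarrow> s \<le> t \<longrightarrow> t \<le> s + 1 \<longrightarrow> norm (S t x - S t y) \<le> L * norm (S s x - S s y)) \<and>
  (\<lambda>t. (E_norm \<Omega> (S t x - S t y))^2) absolutely_integrable_on {0..1} \<and>
  integral {0..1} (\<lambda>t. (E_norm \<Omega> (S t x - S t y))^2) \<le> K * (norm (x - y))^2"
proof -
 obtain K d where K: "K > 0" and d: "d > 0" and en: "\<And>x y a b. x \<in> B \<Longrightarrow> y \<in> B \<Longrightarrow> 0 \<le> a \<Longrightarrow> a \<le> b \<Longrightarrow>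
  (\<lambda>t. (norm (S t x - S t y))^2) integrable_on {a..b} \<and> (\<lambda>t. (E_norm \<Omega> (S t x - S t y))^2) absolutely_integrable_on {a..b} \<and>
  (norm (S b x - S b y))^2 - (norm (S a x - S a y))^2 + d * integral {a..b} (\<lambda>t. (E_norm \<Omega> (S t x - S t y))^2)
   \<le> K * integral {a..b} (\<lambda>t. (norm (S t x - S t y))^2)" using pair_energy by blast
 obtain n where n: "2 * K \<le> real n" using real_arch_simple by blast
 define L where "L = (2::real) ^ n"
 have L: "1 \<le> L" by (simp add: L_def)
 have "(\<forall>s t. 0 \<le> s \<longrightarrow> s \<le> t \<longrightarrow> t \<le> s + 1 \<longrightarrow> norm (S t x - S t y) \<le> L * norm (S s x - S s y)) \<and>
  (\<lambda>t. (E_norm \<Omega> (S t x - S t y))^2) absolutely_integrable_on {0..1} \<and>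
  integral {0..1} (\<lambda>t. (E_norm \<Omega> (S t x - S t y))^2) \<le> ((1 + K * L) / d) * (norm (x - y))^2"
  if xy: "x \<in> B" "y \<in> B" for x y
 proof -
  let ?e = "\<lambda>t. (norm (S t x - S t y))^2" and ?E = "\<lambda>t. (E_norm \<Omega> (S t x - S t y))^2"
  note en' = en[OF xy]
  have E0: "0 \<le> integral {a..b} ?E" if "0 \<le> a" "a \<le> b" for a b
   using en'[OF that] by (intro hk_integral_nonneg abs_integrable_integrable) auto
  have int: "?e integrable_on {a..b}" if "0 \<le> a" "a \<le> b" for a b using en'[OF that] by simp
  have ineq: "?e b \<le> ?e a + K * integral {a..b} ?e" if "0 \<le> a" "a \<le> b" for a b
   using en'[OF that] mult_nonneg_nonneg[OF less_imp_le[OF d] E0[OF that]] by linarith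
  have bnd: "0 \<le> ?e t \<and> ?e t \<le> (2 * R)^2" if "0 \<le> t" for t
  proof -
   have "norm (S t x - S t y) \<le> 2 * R"
    using norm_triangle_ineq4[of "S t x" "S t y"] R[OF inv[OF that xy(1)]] R[OF inv[OF that xy(2)]] by linarith
   from power_mono[OF this norm_ge_zero, of 2] show ?thesis by simp
  qed
  have double: "?e t \<le> L * ?e s" if "0 \<le> s" "s \<le> t" "t \<le> s + 1" for s t
   unfolding L_def
  proof (rule gronwall_doubling[OF int ineq bnd K that(1,2)])
   have "1 \<le> real n / (2 * K)" using n K by (simp add: field_simps)
   then show "t \<le> s + real n / (2 * K)" using that by linarith
  qed
  have "norm (S t x - S t y) \<le> L * norm (S s x - S s y)" if "0 \<le> s" "s \<le> t" "t \<le> s + 1" for s t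
  proof (rule power2_le_imp_le)
   have "?e t \<le> L * ?e s" by (rule double[OF that])
   also have "... \<le> (L * L) * ?e s" using L by (intro mult_right_mono) auto
   finally show "?e t \<le> (L * norm (S s x - S s y))^2" by (simp add: power2_eq_square mult.assoc mult.left_commute)
  qed (use L in simp)
  moreover have "integral {0..1} ?E \<le> ((1 + K * L) / d) * (norm (x - y))^2"
  proof -
   have "S 0 x = x" "S 0 y = y" using xy B by (auto intro!: semigroup_zero)
   then have z: "?e 0 = (norm (x - y))^2" by simp
   have "integral {0..1} ?e \<le> (L * ?e 0) * (1 - 0)"
    by (rule integral_le_const) (use int double[of 0] in auto)
   then have "K * integral {0..1} ?e \<le> K * L * (norm (x - y))^2" using K unfolding z by (simp add: mult.assoc)
   moreover have "?e 1 - ?e 0 + d * integral {0..1} ?E \<le> K * integral {0..1} ?e" using en'[of 0 1] by simp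
   ultimately have "d * integral {0..1} ?E \<le> (1 + K * L) * (norm (x - y))^2"
    using zero_le_power2[of "norm (S 1 x - S 1 y)"] unfolding z distrib_right by argo
   then show ?thesis using d by (simp add: field_simps)
  qed
  moreover have "?E absolutely_integrable_on {0..1}" using en'[of 0 1] by simp
  ultimately show ?thesis by blast
 qed
 moreover have "0 < (1 + K * L) / d" using K L d by (simp add: add_pos_nonneg)
 ultimately show ?thesis using L by blast
qed

text \<open>The good time t found by averaging depends on x and \<tau>; Lipschitz dependence carries
  the increment from t to 1. This is why the estimate is stated for the orbit after time 1. The
  nested square root is the exponent 1/4.\<close>

lemma time_holder:
 assumes Q': "0 \<le> Q" "\<forall>x\<in>B. integral {0..2} (\<lambda>t. (E_norm \<Omega> (S t x))^2) \<le> Q"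
 shows "\<exists>H>0. \<forall>x\<in>B. \<forall>\<tau>\<in>{0..1}. norm (S (1 + \<tau>) x - S 1 x) \<le> H * sqrt (sqrt \<tau>)"
proof -
 note Q = Q'(1) bspec[OF Q'(2)]
 obtain L where L: "1 \<le> L" "\<And>x y s t. x \<in> B \<Longrightarrow> y \<in> B \<Longrightarrow> 0 \<le> s \<Longrightarrow> s \<le> t \<Longrightarrow> t \<le> s + 1 \<Longrightarrow> norm (S t x - S t y) \<le> L * norm (S s x - S s y)"
  using pair_bounds by blast
 define k where "k = rhs_const * (1 + R)"
 define C where "C = sqrt (k^2 * Q) * (2 * Q + 3)"
 have C: "0 \<le> C" unfolding C_def using Q by simp
 have "norm (S (1 + \<tau>) x - S 1 x) \<le> (L * sqrt C + 1) * sqrt (sqrt \<tau>)" if x: "x \<in> B" and \<tau>: "\<tau> \<in> {0..1}" for x \<tau>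
 proof -
  let ?E = "\<lambda>t. (E_norm \<Omega> (S t x))^2"
  have \<tau>': "0 \<le> \<tau>" "1 + \<tau> \<le> 2" using \<tau> by auto
  have p: "weak_path 2 (\<lambda>t. S t x) (rhs (\<lambda>t. S t x)) (\<lambda>t. k * E_norm \<Omega> (S t x))" unfolding k_def using x by (intro path) simp
  obtain t where t: "t \<in> {0..1}" "(norm (S (t + \<tau>) x - S t x))^2 \<le>
    sqrt \<tau> * (sqrt (integral {0..2} (\<lambda>t. (k * E_norm \<Omega> (S t x))^2)) * (2 * integral {0..2} ?E + 3))"
   using path_time_holder[OF p \<tau>'] by blast
  have E0: "0 \<le> integral {0..2} ?E"
   by (intro hk_integral_nonneg abs_integrable_integrable path_nV2[OF p]) auto
  have "integral {0..2} (\<lambda>t. (k * E_norm \<Omega> (S t x))^2) = k^2 * integral {0..2} ?E" by (simp only: power_mult_distrib integral_mult_right)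
  also have "... \<le> k^2 * Q" by (intro mult_left_mono Q x) simp
  finally have "(norm (S (t + \<tau>) x - S t x))^2 \<le> sqrt \<tau> * C"
   unfolding C_def using Q(2)[OF x] Q(1) \<tau>' E0
   by (intro order_trans[OF t(2)] mult_left_mono mult_mono real_sqrt_le_mono) auto
  then have "norm (S (t + \<tau>) x - S t x) \<le> sqrt (sqrt \<tau> * C)" by (rule real_le_rsqrt)
  then have *: "norm (S (t + \<tau>) x - S t x) \<le> sqrt C * sqrt (sqrt \<tau>)" by (simp add: real_sqrt_mult mult.commute)
  have H: "x \<in> H_plus \<Omega>" using x B by blast
  \<comment> \<open>Both points are pushed forward by the same map S (1 - t), whose Lipschitz
    constant is at most L.\<close>
  have "S (1 + \<tau>) x = S (1 - t) (S (t + \<tau>) x)" "S 1 x = S (1 - t) (S t x)"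
   using semigroup_add[OF H, of "t + \<tau>" "1 - t"] semigroup_add[OF H, of t "1 - t"] t(1) \<tau> by (auto simp: algebra_simps)
  moreover have m: "S (t + \<tau>) x \<in> B" "S t x \<in> B" using t(1) \<tau> x by (auto intro: inv)
  moreover have "norm (S (1 - t) (S (t + \<tau>) x) - S (1 - t) (S t x)) \<le> L * norm (S 0 (S (t + \<tau>) x) - S 0 (S t x))"
   using t(1) by (intro L m) auto
  moreover have "S 0 (S (t + \<tau>) x) = S (t + \<tau>) x" "S 0 (S t x) = S t x" using m B by (auto intro!: semigroup_zero)
  ultimately have "norm (S (1 + \<tau>) x - S 1 x) \<le> L * norm (S (t + \<tau>) x - S t x)" by (simp only:)
  also have "... \<le> L * (sqrt C * sqrt (sqrt \<tau>))" using L(1) * by (intro mult_left_mono) auto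
  also have "... \<le> (L * sqrt C + 1) * sqrt (sqrt \<tau>)" using \<tau> by (simp add: distrib_right mult.assoc)
  finally show ?thesis .
 qed
 moreover have "0 < L * sqrt C + 1" using L(1) C by (intro add_nonneg_pos mult_nonneg_nonneg) auto
 ultimately show ?thesis by blast
qed

text \<open>The E-norm of S t x - S t x0 is controlled only after integration over t. Averaging the
  sum over the finite set X gives one time that is good for the sum, and by Markov's inequality for
  at least half of the points. Rescaled, these lie in the unit ball of E, and they are still
  separated, because Lipschitz dependence from t to 1 turns separation at time 1 into separation at
  time t. All bounds scale with r, so the count does not depend on r.\<close>

lemma separated_card_bound:
 "\<exists>N. \<forall>x0\<in>B. \<forall>r>0. \<forall>X. X \<subseteq> B \<longrightarrow> X \<subseteq> cball x0 r \<longrightarrow> finite X \<longrightarrow>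
  (\<forall>x\<in>X. \<forall>y\<in>X. x \<noteq> y \<longrightarrow> norm (S 1 x - S 1 y) > r / 2) \<longrightarrow> card X \<le> N"
proof -
 obtain L K where L: "1 \<le> L" and K: "0 < K"
  and lip: "\<And>x y s t. x \<in> B \<Longrightarrow> y \<in> B \<Longrightarrow> 0 \<le> s \<Longrightarrow> s \<le> t \<Longrightarrow> t \<le> s + 1 \<Longrightarrow> norm (S t x - S t y) \<le> L * norm (S s x - S s y)"
  and ai: "\<And>x y. x \<in> B \<Longrightarrow> y \<in> B \<Longrightarrow> (\<lambda>t. (E_norm \<Omega> (S t x - S t y))^2) absolutely_integrable_on {0..1}"
  and E: "\<And>x y. x \<in> B \<Longrightarrow> y \<in> B \<Longrightarrow> integral {0..1} (\<lambda>t. (E_norm \<Omega> (S t x - S t y))^2) \<le> K * (norm (x - y))^2"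
  using pair_bounds by blast
 \<comment> \<open>With c^2 = 4 K, a point violates the bound c r only by taking more than 4 K r^2
   out of a sum that is at most 2 K r^2 times the number of points.\<close>
 define c where "c = 2 * sqrt K"
 have c: "0 < c" "c^2 = 4 * K" unfolding c_def using K by (auto simp: power_mult_distrib)
 \<comment> \<open>The separation r/2 at time 1, divided by the Lipschitz constant and by the scale
   c r.\<close>
 define \<epsilon> where "\<epsilon> = 1 / (2 * L * c)"
 have \<epsilon>: "\<epsilon> > 0" unfolding \<epsilon>_def using L c by simp
 obtain N where N': "\<forall>X. X \<subseteq> E_space \<Omega> \<longrightarrow> (\<forall>x\<in>X. E_norm \<Omega> x \<le> 1) \<longrightarrow> finite X \<longrightarrow>
   (\<forall>x\<in>X. \<forall>y\<in>X. x \<noteq> y \<longrightarrow> norm (x - y) > \<epsilon>) \<longrightarrow> card X \<le> N"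
  using E_totally_bounded[OF dim open_domain bounded_domain \<epsilon>] by (rule exE)
 have N: "card X \<le> N" if "X \<subseteq> E_space \<Omega>" "\<And>x. x \<in> X \<Longrightarrow> E_norm \<Omega> x \<le> 1" "finite X"
   "\<And>x y. x \<in> X \<Longrightarrow> y \<in> X \<Longrightarrow> x \<noteq> y \<Longrightarrow> norm (x - y) > \<epsilon>" for X
  by (rule N'[rule_format]; fact that)
 have main: "card X \<le> 2 * N"
  if x0: "x0 \<in> B" and r: "r > 0" and X: "X \<subseteq> B" "X \<subseteq> cball x0 r" "finite X"
   and sep: "\<And>x y. x \<in> X \<Longrightarrow> y \<in> X \<Longrightarrow> x \<noteq> y \<Longrightarrow> norm (S 1 x - S 1 y) > r / 2" for x0 r X
 proof (cases "X = {}")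
  case False
  let ?E = "\<lambda>x t. (E_norm \<Omega> (S t x - S t x0))^2"
  let ?F = "\<lambda>t. \<Sum>x\<in>X. ?E x t"
  define m where "m = real (card X)"
  define k where "k = m * (K * r^2)"
  have m: "m > 0" unfolding m_def using False X(3) by (simp add: card_gt_0_iff)
  have k: "k > 0" unfolding k_def using m K r by simp
  have F: "?F absolutely_integrable_on {0..1}" using X x0 by (intro absolutely_integrable_sum ai) auto
  have "integral {0..1} ?F = (\<Sum>x\<in>X. integral {0..1} (?E x))"
   using X x0 by (intro hk_integral_sum abs_integrable_integrable ai) auto
  also have "... \<le> (\<Sum>x\<in>X. K * r^2)"
  proof (rule sum_mono)
   fix x assume x: "x \<in> X"
   then have "norm (x - x0) \<le> r" using X(2) by (auto simp: dist_norm norm_minus_commute)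
   then have "K * (norm (x - x0))^2 \<le> K * r^2" using K by (intro mult_left_mono power_mono) auto
   then show "integral {0..1} (?E x) \<le> K * r^2" using E[of x x0] x X(1) x0 by force
  qed
  also have "... = k" by (simp add: k_def m_def)
  finally have Fk: "integral {0..1} ?F \<le> k" .
  \<comment> \<open>Finiteness of X keeps the union of the exceptional sets null.\<close>
  have all: "AE t in lebesgue_on {0..1}. \<forall>x\<in>insert x0 X. S t x \<in> E_space \<Omega> \<and> 0 \<le> t"
   using X x0 by (intro AE_finite_allI AE_times[OF _ path[of 1]]) auto
  have "\<exists>t\<in>{0..1}. (\<forall>x\<in>insert x0 X. S t x \<in> E_space \<Omega>) \<and> ?F t \<le> 2 * k"
  proof (rule ccontr)
   assume "\<not> ?thesis"
   then have no: "2 * k \<le> ?F t" if "t \<in> {0..1}" "\<forall>x\<in>insert x0 X. S t x \<in> E_space \<Omega>" for t using that by fastforce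
   have "AE t in lebesgue_on {0..1}. t \<in> {0..1::real}" by (rule AE_I2) simp
   with all have "AE t in lebesgue_on {0..1}. 2 * k \<le> ?F t"
   proof eventually_elim
    case (elim t)
    show ?case by (rule no) (use elim in simp_all)
   qed
   then have "integral {0..1} (\<lambda>t::real. 2 * k) \<le> integral {0..1} ?F" by (intro integral_le_AE absolutely_integrable_const F)
   then show False using Fk k by simp
  qed
  then obtain t where t: "t \<in> {0..1}" "\<And>x. x \<in> insert x0 X \<Longrightarrow> S t x \<in> E_space \<Omega>" "?F t \<le> 2 * k" by blast
  \<comment> \<open>The points whose squared E-distance to the orbit of x0 at time t is at most
    twice the available mean.\<close>
  define Y where "Y = {x \<in> X. ?E x t \<le> (c * r)^2}"
  have Y: "Y \<subseteq> X" "finite Y" using X(3) by (auto simp: Y_def)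
  have "real (card (X - Y)) * (c * r)^2 = (\<Sum>x\<in>X - Y. (c * r)^2)" by simp
  also have "... \<le> (\<Sum>x\<in>X - Y. ?E x t)" by (rule sum_mono) (auto simp: Y_def)
  also have "... \<le> ?F t" using X(3) by (intro sum_mono2) auto
  also have "... \<le> 2 * k" by (rule t)
  finally have "real (card (X - Y)) * (4 * (K * r^2)) \<le> (m / 2) * (4 * (K * r^2))"
   unfolding k_def power_mult_distrib c(2) by (simp add: mult.assoc)
  then have "real (card (X - Y)) \<le> m / 2" using K r by (subst (asm) mult_le_cancel_right_pos) auto
  moreover have "card X = card (X - Y) + card Y" using card_Diff_subset[OF Y(2,1)] card_mono[OF X(3) Y(1)] by simp
  ultimately have cardY: "card X \<le> 2 * card Y" unfolding m_def by linarith
  define \<phi> where "\<phi> x = (1 / (c * r)) *\<^sub>R (S t x - S t x0)" for x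
  have cr: "0 < c * r" using c r by simp
  have separated: "norm (\<phi> x - \<phi> y) > \<epsilon>" if xy: "x \<in> Y" "y \<in> Y" "x \<noteq> y" for x y
  proof -
   have "r / 2 < norm (S 1 x - S 1 y)" using xy Y by (intro sep) auto
   also have "... \<le> L * norm (S t x - S t y)" using xy Y X t(1) by (intro lip) auto
   finally have "\<epsilon> < norm (S t x - S t y) / (c * r)" using L c r unfolding \<epsilon>_def by (simp add: field_simps)
   moreover have "\<phi> x - \<phi> y = (1 / (c * r)) *\<^sub>R (S t x - S t y)" by (simp add: \<phi>_def scaleR_diff_right[symmetric])
   ultimately show ?thesis using cr by simp
  qed
  have "inj_on \<phi> Y" using separated \<epsilon> by (intro inj_onI) force
  then have "card Y = card (\<phi> ` Y)" by (simp add: card_image)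
  also have "... \<le> N"
  proof (rule N)
   have z: "S t x - S t x0 \<in> E_space \<Omega>" if "x \<in> Y" for x
    using t(2)[of x] t(2)[of x0] that Y(1) by (intro subspace_diff[OF V]; blast)
   then show "\<phi> ` Y \<subseteq> E_space \<Omega>" unfolding \<phi>_def by (auto intro!: subspace_scale[OF V])
   fix x assume "x \<in> \<phi> ` Y"
   then obtain y where y: "y \<in> Y" "x = \<phi> y" by blast
   have "E_norm \<Omega> (S t y - S t x0) \<le> c * r" by (rule power2_le_imp_le) (use y cr in \<open>auto simp: Y_def\<close>)
   then show "E_norm \<Omega> x \<le> 1" unfolding y(2) \<phi>_def nV_scale[OF z[OF y(1)]] using cr by (simp add: field_simps)
  next
   show "finite (\<phi> ` Y)" using Y(2) by simp
   show "norm (x - y) > \<epsilon>" if "x \<in> \<phi> ` Y" "y \<in> \<phi> ` Y" "x \<noteq> y" for x y using that separated by blast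
  qed
  finally show ?thesis using cardY by linarith
 qed simp
 show ?thesis
 proof (intro exI[of _ "2 * N"] ballI allI impI)
  fix x0 r X assume "x0 \<in> B" "0 < r" "X \<subseteq> B" "X \<subseteq> cball x0 r" "finite X" "\<forall>x\<in>X. \<forall>y\<in>X. x \<noteq> y \<longrightarrow> norm (S 1 x - S 1 y) > r / 2"
  then show "card X \<le> 2 * N" by (intro main[of x0 r X]) auto
 qed
qed

text \<open>A separated subset of maximal cardinality has images covering the image of D, since a
  point farther than r/2 from all of them could be added. The centres are images of points of D
  itself, so the cover can be iterated.\<close>

lemma squeezing_cover:
 "\<exists>N. \<forall>x0\<in>B. \<forall>r>0. \<forall>D. D \<subseteq> B \<longrightarrow> D \<subseteq> cball x0 r \<longrightarrow>
  (\<exists>C\<subseteq>D. finite C \<and> card C \<le> N \<and> S 1 ` D \<subseteq> (\<Union>c\<in>C. cball (S 1 c) (r / 2)))"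
proof -
 obtain N where N: "\<forall>x0\<in>B. \<forall>r>0. \<forall>X. X \<subseteq> B \<longrightarrow> X \<subseteq> cball x0 r \<longrightarrow> finite X \<longrightarrow>
  (\<forall>x\<in>X. \<forall>y\<in>X. x \<noteq> y \<longrightarrow> norm (S 1 x - S 1 y) > r / 2) \<longrightarrow> card X \<le> N"
  using separated_card_bound by (rule exE)
 have main: "\<exists>C\<subseteq>D. finite C \<and> card C \<le> N \<and> S 1 ` D \<subseteq> (\<Union>c\<in>C. cball (S 1 c) (r / 2))"
  if D: "x0 \<in> B" "r > 0" "D \<subseteq> B" "D \<subseteq> cball x0 r" for x0 r D
 proof -
  let ?P = "\<lambda>X. X \<subseteq> D \<and> finite X \<and> (\<forall>x\<in>X. \<forall>y\<in>X. x \<noteq> y \<longrightarrow> norm (S 1 x - S 1 y) > r / 2)"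
  have le: "card X \<le> N" if "?P X" for X
   by (rule N[rule_format, of x0 r X]) (use that D in auto)
  have "\<exists>X. ?P X \<and> (\<forall>Y. ?P Y \<longrightarrow> card Y \<le> card X)"
   by (rule ex_has_greatest_nat[of ?P "{}" card "Suc N"]) (use le in \<open>auto simp: less_Suc_eq_le\<close>)
  then obtain X where X: "?P X" and max: "\<And>Y. ?P Y \<Longrightarrow> card Y \<le> card X" by blast
  have "S 1 d \<in> (\<Union>c\<in>X. cball (S 1 c) (r / 2))" if d: "d \<in> D" for d
  proof (rule ccontr)
   assume "S 1 d \<notin> (\<Union>c\<in>X. cball (S 1 c) (r / 2))"
   then have far: "norm (S 1 c - S 1 d) > r / 2" "norm (S 1 d - S 1 c) > r / 2" if "c \<in> X" for c
    using that by (auto simp: dist_norm not_le norm_minus_commute)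
   then have "d \<notin> X" using D(2) by fastforce
   moreover have "?P (insert d X)" using X far d by auto
   ultimately show False using max[of "insert d X"] X by simp
  qed
  then show ?thesis using X le[OF X] by (intro exI[of _ X]) auto
 qed
 show ?thesis by (intro exI[of _ N] ballI allI impI; rule main)
qed

end

end

section \<open>Exponential attractors for squeezing semigroups that are Hoelder continuous in
  time\<close>

locale squeezing_semigroup =
 fixes X B :: "'a::real_normed_vector set" and S :: "real \<Rightarrow> 'a \<Rightarrow> 'a" and L H :: real and N :: nat
 assumes X: "complete X" and BX: "B \<subseteq> X" and B_ne: "B \<noteq> {}" and B_closed: "closed B" and B_bounded: "bounded B"
  and S_zero: "x \<in> X \<Longrightarrow> S 0 x = x"
  and S_add: "x \<in> X \<Longrightarrow> 0 \<le> s \<Longrightarrow> 0 \<le> t \<Longrightarrow> S (s + t) x = S t (S s x)"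
  and B_inv: "0 \<le> t \<Longrightarrow> x \<in> B \<Longrightarrow> S t x \<in> B"
  and absorbing: "D \<subseteq> X \<Longrightarrow> bounded D \<Longrightarrow> \<exists>T\<ge>0. \<exists>r. \<forall>x\<in>D. (\<forall>t\<ge>T. S t x \<in> B) \<and> (\<forall>t\<in>{0..T}. norm (S t x) \<le> r)"
  and lipschitz: "x \<in> B \<Longrightarrow> y \<in> B \<Longrightarrow> 0 \<le> t \<Longrightarrow> t \<le> 1 \<Longrightarrow> norm (S t x - S t y) \<le> L * norm (x - y)"
  and cover: "x0 \<in> B \<Longrightarrow> r > 0 \<Longrightarrow> D \<subseteq> B \<Longrightarrow> D \<subseteq> cball x0 r \<Longrightarrow>
   \<exists>C\<subseteq>D. finite C \<and> card C \<le> N \<and> S 1 ` D \<subseteq> (\<Union>c\<in>C. cball (S 1 c) (r / 2))"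
  and holder: "x \<in> B \<Longrightarrow> 0 \<le> \<tau> \<Longrightarrow> \<tau> \<le> 1 \<Longrightarrow> norm (S (1 + \<tau>) x - S 1 x) \<le> H * sqrt (sqrt \<tau>)"
begin

lemma S_add_B: "x \<in> B \<Longrightarrow> 0 \<le> s \<Longrightarrow> 0 \<le> t \<Longrightarrow> S (s + t) x = S t (S s x)"
 using S_add BX by blast

text \<open>Lipschitz dependence is given for times up to 1; longer times are composed of steps of
  length at most 1.\<close>

lemma S_continuous: "0 \<le> t \<Longrightarrow> t \<le> real n \<Longrightarrow> continuous_on B (S t)"
proof (induction n arbitrary: t)
 case 0
 then have "continuous_on B (S t) \<longleftrightarrow> continuous_on B (\<lambda>x. x)" using S_zero BX by (intro continuous_on_cong) auto
 then show ?case by simp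
next
 case (Suc n)
 have one: "continuous_on B (S s)" if "0 \<le> s" "s \<le> 1" for s
 proof (rule Lipschitz.lipschitz_on_continuous_on)
  show "\<bar>L\<bar>-lipschitz_on B (S s)"
  proof (rule lipschitz_onI)
   fix x y assume "x \<in> B" "y \<in> B"
   then have "norm (S s x - S s y) \<le> L * norm (x - y)" using that by (intro lipschitz) auto
   also have "... \<le> \<bar>L\<bar> * norm (x - y)" by (intro mult_right_mono) auto
   finally show "dist (S s x) (S s y) \<le> \<bar>L\<bar> * dist x y" by (simp add: dist_norm)
  qed simp
 qed
 define s where "s = min t 1"
 have s: "0 \<le> s" "s \<le> 1" "0 \<le> t - s" "t - s \<le> real n" using Suc.prems by (auto simp: s_def)
 have "continuous_on B (S (t - s) \<circ> S s)"
  using one[OF s(1,2)] Suc.IH[OF s(3,4)] B_inv[OF s(1)]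
  by (intro continuous_on_compose) (auto intro: continuous_on_subset)
 moreover have "continuous_on B (S t) \<longleftrightarrow> continuous_on B (S (t - s) \<circ> S s)"
  using S_add_B[OF _ s(1,3)] by (intro continuous_on_cong) auto
 ultimately show ?case by simp
qed

text \<open>Each ball of radius r0 / 2^n is intersected with the current image of B before the
  squeezing cover is applied. The new centres are then images of points reached at time n, so that
  every net consists of points of the corresponding image of B.\<close>

lemma nested_cover:
 assumes b: "b \<in> B" and r0: "0 < r0" "B \<subseteq> cball b r0"
 shows "\<exists>V. V \<subseteq> S (real n) ` B \<and> finite V \<and> card V \<le> N ^ n \<and> S (real n) ` B \<subseteq> (\<Union>c\<in>V. cball c (r0 / 2 ^ n))"
proof (induction n)
 case 0
 have "S 0 ` B = B" using S_zero BX by force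
 then show ?case using b r0 by (intro exI[of _ "{b}"]) auto
next
 case (Suc n)
 then obtain V where V: "V \<subseteq> S (real n) ` B" "finite V" "card V \<le> N ^ n" "S (real n) ` B \<subseteq> (\<Union>c\<in>V. cball c (r0 / 2 ^ n))" by blast
 let ?K = "S (real n) ` B"
 have KB: "?K \<subseteq> B" using B_inv by auto
 have step: "S (real (Suc n)) ` B = S 1 ` ?K" using S_add_B[of _ "real n" 1] by (force simp: image_image add.commute intro!: image_cong)
 have "\<forall>v\<in>V. \<exists>C. C \<subseteq> ?K \<inter> cball v (r0 / 2 ^ n) \<and> finite C \<and> card C \<le> N \<and>
   S 1 ` (?K \<inter> cball v (r0 / 2 ^ n)) \<subseteq> (\<Union>c\<in>C. cball (S 1 c) (r0 / 2 ^ n / 2))"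
 proof
  fix v assume "v \<in> V"
  then have "v \<in> B" using V(1) KB by blast
  moreover have "0 < r0 / 2 ^ n" using r0 by simp
  moreover have "?K \<inter> cball v (r0 / 2 ^ n) \<subseteq> B" using KB by blast
  ultimately show "\<exists>C. C \<subseteq> ?K \<inter> cball v (r0 / 2 ^ n) \<and> finite C \<and> card C \<le> N \<and>
   S 1 ` (?K \<inter> cball v (r0 / 2 ^ n)) \<subseteq> (\<Union>c\<in>C. cball (S 1 c) (r0 / 2 ^ n / 2))"
   by (rule cover) (rule Int_lower2)
 qed
 from bchoice[OF this] obtain C where C': "\<forall>v\<in>V. C v \<subseteq> ?K \<inter> cball v (r0 / 2 ^ n) \<and> finite (C v) \<and> card (C v) \<le> N \<and>
   S 1 ` (?K \<inter> cball v (r0 / 2 ^ n)) \<subseteq> (\<Union>c\<in>C v. cball (S 1 c) (r0 / 2 ^ n / 2))"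
  by (rule exE)
 note C = bspec[OF C']
 let ?W = "\<Union>v\<in>V. S 1 ` C v"
 have "?W \<subseteq> S (real (Suc n)) ` B" unfolding step using C by blast
 moreover have "finite ?W" using V(2) C by auto
 moreover have "card ?W \<le> N ^ Suc n"
 proof -
  have "card ?W \<le> (\<Sum>v\<in>V. card (S 1 ` C v))" by (rule card_UN_le[OF V(2)])
  also have "... \<le> (\<Sum>v\<in>V. N)" by (intro sum_mono order_trans[OF card_image_le]) (use C in blast)+
  also have "... \<le> N ^ Suc n" using mult_right_mono[OF V(3), of N] by (simp add: mult.commute)
  finally show ?thesis .
 qed
 moreover have "S (real (Suc n)) ` B \<subseteq> (\<Union>c\<in>?W. cball c (r0 / 2 ^ Suc n))"
 proof
  fix y assume "y \<in> S (real (Suc n)) ` B"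
  then obtain x where x: "x \<in> ?K" "y = S 1 x" unfolding step by blast
  then obtain v where v: "v \<in> V" "x \<in> cball v (r0 / 2 ^ n)" using V(4) by blast
  then have "y \<in> S 1 ` (?K \<inter> cball v (r0 / 2 ^ n))" using x by blast
  then obtain c where c: "c \<in> C v" "y \<in> cball (S 1 c) (r0 / 2 ^ n / 2)" using C[OF v(1)] by blast
  then show "y \<in> (\<Union>c\<in>?W. cball c (r0 / 2 ^ Suc n))" using v(1) by (auto simp: field_simps)
 qed
 ultimately show ?case by blast
qed

definition r0 :: real where "r0 = (SOME r. 0 < r \<and> (\<forall>x\<in>B. \<forall>y\<in>B. dist x y \<le> r))"

lemma r0: "0 < r0" "x \<in> B \<Longrightarrow> y \<in> B \<Longrightarrow> dist x y \<le> r0"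
proof -
 obtain M where M: "M > 0" "\<And>x. x \<in> B \<Longrightarrow> norm x \<le> M" using B_bounded by (auto simp: bounded_pos)
 have "dist x y \<le> 2 * M" if "x \<in> B" "y \<in> B" for x y
  using norm_triangle_ineq4[of x y] M(2)[OF that(1)] M(2)[OF that(2)] by (simp add: dist_norm)
 then have "\<exists>r. 0 < r \<and> (\<forall>x\<in>B. \<forall>y\<in>B. dist x y \<le> r)" using M(1) by (intro exI[of _ "2 * M"]) auto
 from someI_ex[OF this] show "0 < r0" "x \<in> B \<Longrightarrow> y \<in> B \<Longrightarrow> dist x y \<le> r0" unfolding r0_def by blast+
qed

lemma nets: "\<exists>V. V \<subseteq> S (real n) ` B \<and> finite V \<and> card V \<le> N ^ n \<and> S (real n) ` B \<subseteq> (\<Union>c\<in>V. cball c (r0 / 2 ^ n))"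
proof -
 obtain b where b: "b \<in> B" using B_ne by blast
 have "B \<subseteq> cball b r0" using r0(2)[OF b] by auto
 then show ?thesis by (rule nested_cover[OF b r0(1)])
qed

definition net :: "nat \<Rightarrow> 'a set" where
 "net n = (SOME V. V \<subseteq> S (real n) ` B \<and> finite V \<and> card V \<le> N ^ n \<and> S (real n) ` B \<subseteq> (\<Union>c\<in>V. cball c (r0 / 2 ^ n)))"

lemma net: "net n \<subseteq> S (real n) ` B" "finite (net n)" "card (net n) \<le> N ^ n" "S (real n) ` B \<subseteq> (\<Union>c\<in>net n. cball c (r0 / 2 ^ n))"
 using someI_ex[OF nets[of n]] unfolding net_def by blast+

text \<open>Only levels n \<ge> 1 are used: their points are images under S 1 of points of B, where
  Hoelder continuity in time is available. The orbits run over all real times, which makes positive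
  invariance immediate.\<close>

definition orbit_nets :: "'a set" where "orbit_nets = (\<Union>n\<in>{1..}. \<Union>t\<in>{0..}. S t ` net n)"

lemma net_B: "net n \<subseteq> B" using net(1)[of n] B_inv by force

lemma orbit_nets_B: "orbit_nets \<subseteq> B"
 unfolding orbit_nets_def using net_B B_inv by fastforce

lemma net_orbit: "n \<ge> 1 \<Longrightarrow> net n \<subseteq> orbit_nets"
proof
 fix x assume x: "n \<ge> 1" "x \<in> net n"
 then have "S 0 x = x" using net_B BX S_zero by blast
 then have "x \<in> S 0 ` net n" using x(2) by (metis imageI)
 then show "x \<in> orbit_nets" unfolding orbit_nets_def using x(1) by force
qed

lemma net_ne: "net n \<noteq> {}" using net(4)[of n] B_ne by auto

lemma N_pos: "N \<ge> 1"
proof -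
 have "card (net 1) > 0" using net_ne[of 1] net(2)[of 1] by (simp add: card_gt_0_iff)
 then show ?thesis using net(3)[of 1] by simp
qed

text \<open>A point reached after time n is also reached at exactly time n from a later point of the
  same orbit. Hence the single net at level n serves all late parts of orbits.\<close>

lemma late_image:
 assumes "x \<in> B" "real n \<le> t" shows "S t x \<in> S (real n) ` B"
proof -
 have "S ((t - real n) + real n) x = S (real n) (S (t - real n) x)" by (rule S_add_B) (use assms in auto)
 moreover have "S (t - real n) x \<in> B" by (rule B_inv) (use assms in auto)
 ultimately show ?thesis by (simp only: diff_add_cancel) (rule imageI)
qed

text \<open>The number of time steps per unit at scale r0. The fourth power undoes the Hoelder
  exponent 1/4, so that a step of length 1 / mesh moves a point by at most r0; the summand 1 keeps
  the number positive.\<close>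

definition mesh :: nat where "mesh = nat \<lceil>(H / r0) ^ 4\<rceil> + 1"

lemma mesh: "mesh \<ge> 1" "H \<le> r0 * sqrt (sqrt (real mesh))"
proof -
 show "mesh \<ge> 1" by (simp add: mesh_def)
 have "(H / r0) ^ 4 \<le> real mesh" unfolding mesh_def by linarith
 then have "((H / r0)^2)^2 \<le> real mesh" by (simp add: power_mult[symmetric])
 then have "(H / r0)^2 \<le> sqrt (real mesh)" by (rule real_le_rsqrt)
 then have "H / r0 \<le> sqrt (sqrt (real mesh))" by (rule real_le_rsqrt)
 then show "H \<le> r0 * sqrt (sqrt (real mesh))" using r0(1) by (simp add: field_simps)
qed

text \<open>Refining the time step by 16^n improves the distance by 2^n, again because of the
  exponent 1/4. Both times act on S 1 x, so the increment has the form S (1 + \<tau>) y - S 1 y with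
  y in B.\<close>

lemma orbit_step:
 assumes x: "x \<in> B" and t: "0 \<le> t" "real j \<le> t * real (mesh * 16 ^ n)" "t * real (mesh * 16 ^ n) \<le> real j + 1"
 shows "dist (S (real j / real (mesh * 16 ^ n)) (S 1 x)) (S t (S 1 x)) \<le> r0 / 2 ^ n"
proof -
 define q where "q = real (mesh * 16 ^ n)"
 have "1 \<le> mesh * 16 ^ n" using mesh(1) by simp
 from of_nat_mono[OF this, where ?'a = real] have q: "q \<ge> 1" unfolding q_def by (simp only: of_nat_1)
 define s \<tau> where "s = real j / q" and "\<tau> = t - s"
 have \<tau>: "0 \<le> \<tau>" "\<tau> \<le> 1 / q" "0 \<le> s"
 proof -
  have e: "\<tau> = (t * q - real j) / q" using q by (simp add: \<tau>_def s_def field_simps)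
  show "0 \<le> \<tau>" unfolding e using t q by (intro divide_nonneg_nonneg) (auto simp: q_def)
  show "\<tau> \<le> 1 / q" unfolding e using t q by (intro divide_right_mono) (auto simp: q_def)
  show "0 \<le> s" using q by (simp add: s_def)
 qed
 have q1: "1 / q \<le> 1" using q by simp
 let ?y = "S s x"
 have y: "?y \<in> B" using x \<tau> by (intro B_inv)
 have 1: "S s (S 1 x) = S 1 ?y" using S_add_B[OF x, of 1 s] S_add_B[OF x, of s 1] \<tau> by (simp add: add.commute)
 have 2: "S t (S 1 x) = S (1 + \<tau>) ?y"
  using S_add_B[OF x, of 1 t] S_add_B[OF x, of s "1 + \<tau>"] \<tau> t by (simp add: \<tau>_def algebra_simps)
 have "norm (S (1 + \<tau>) ?y - S 1 ?y) \<le> H * sqrt (sqrt \<tau>)" using y \<tau> q1 by (intro holder) auto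
 also have "... \<le> (r0 * sqrt (sqrt (real mesh))) * sqrt (sqrt \<tau>)" using mesh(2) \<tau> by (intro mult_right_mono) auto
 also have "... \<le> (r0 * sqrt (sqrt (real mesh))) * sqrt (sqrt (1 / q))" using \<tau> r0(1) by (intro mult_left_mono) auto
 also have "... = r0 / 2 ^ n"
 proof -
  have "2 ^ (4 * n) = (2::real) ^ (n * 2 * 2)" by (simp add: mult.commute)
  then have "(2 ^ 4) ^ n = (((2::real) ^ n)^2)^2" by (simp only: power_mult)
  then have "(16::real) ^ n = ((2 ^ n)^2)^2" by simp
  then have "sqrt (sqrt ((16::real) ^ n)) = 2 ^ n" by (simp only: real_sqrt_abs) simp
  moreover have "sqrt (sqrt (real mesh)) \<noteq> 0" using mesh(1) by simp
  ultimately show ?thesis unfolding q_def by (simp add: real_sqrt_divide real_sqrt_mult)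
 qed
 finally show ?thesis unfolding q_def[symmetric] s_def[symmetric] 1 2 by (simp add: dist_norm norm_minus_commute)
qed

text \<open>A point S t v with v in \<open>net k\<close> has been evolved from B for the time k + t.
  If k + t \<ge> n, then \<open>net n\<close> covers it; all other points have k < n and t < n and
  are covered by orbit points at grid times.\<close>

definition centres :: "nat \<Rightarrow> 'a set" where
 "centres n = net n \<union> (\<Union>k\<in>{1..<n}. \<Union>j\<in>{..<n * (mesh * 16 ^ n)}. S (real j / real (mesh * 16 ^ n)) ` net k)"

lemma centres_finite: "finite (centres n)" unfolding centres_def using net(2) by auto

text \<open>The polynomial factor n^2, from n levels and n units of time, is absorbed by 4^n; with
  the 16^n of the time grid this gives the base 64 N.\<close>

lemma centres_card: "card (centres n) \<le> 2 * mesh * (64 * N) ^ n"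
proof -
 let ?q = "mesh * 16 ^ n"
 let ?f = "\<lambda>j k. S (real j / real ?q) ` net k"
 have "card (centres n) \<le> card (net n) + card (\<Union>k\<in>{1..<n}. \<Union>j\<in>{..<n * ?q}. ?f j k)"
  unfolding centres_def by (rule card_Un_le)
 also have "... \<le> N ^ n + n * (n * ?q * N ^ n)"
 proof (rule add_mono[OF net(3)])
  have *: "card (?f j k) \<le> N ^ n" if "k \<in> {1..<n}" for j k
   using card_image_le[OF net(2), of "S (real j / real ?q)" k] net(3)[of k] power_increasing[of k n N] N_pos that by auto
  have "card (\<Union>k\<in>{1..<n}. \<Union>j\<in>{..<n * ?q}. ?f j k) \<le> (\<Sum>k\<in>{1..<n}. card (\<Union>j\<in>{..<n * ?q}. ?f j k))" by (rule card_UN_le) simp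
  also have "... \<le> (\<Sum>k\<in>{1..<n}. n * ?q * N ^ n)"
  proof (rule sum_mono)
   fix k assume k: "k \<in> {1..<n}"
   have "card (\<Union>j\<in>{..<n * ?q}. ?f j k) \<le> (\<Sum>j\<in>{..<n * ?q}. card (?f j k))" by (rule card_UN_le) simp
   also have "... \<le> (\<Sum>j\<in>{..<n * ?q}. N ^ n)" by (rule sum_mono) (rule *[OF k])
   finally show "card (\<Union>j\<in>{..<n * ?q}. ?f j k) \<le> n * ?q * N ^ n" by simp
  qed
  also have "... \<le> n * (n * ?q * N ^ n)" by (simp add: mult_right_mono)
  finally show "card (\<Union>k\<in>{1..<n}. \<Union>j\<in>{..<n * ?q}. ?f j k) \<le> n * (n * ?q * N ^ n)" .
 qed
 also have "... = N ^ n + (n * n) * (mesh * (16 * N) ^ n)" by (simp add: power_mult_distrib algebra_simps)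
 also have "... \<le> mesh * (64 * N) ^ n + (2 ^ n * 2 ^ n) * (mesh * (16 * N) ^ n)"
 proof (rule add_mono)
  have "1 * N ^ n \<le> mesh * (64 * N) ^ n" by (intro mult_mono mesh power_mono) auto
  then show "N ^ n \<le> mesh * (64 * N) ^ n" by simp
  show "n * n * (mesh * (16 * N) ^ n) \<le> 2 ^ n * 2 ^ n * (mesh * (16 * N) ^ n)"
   by (intro mult_right_mono mult_mono less_imp_le[OF less_exp]) auto
 qed
 also have "(2 ^ n * 2 ^ n) * (mesh * (16 * N) ^ n) = mesh * (64 * N) ^ n"
 proof -
  have "(2 * 2 * (16 * N)) ^ n = 2 ^ n * 2 ^ n * (16 * N) ^ n" by (simp only: power_mult_distrib)
  moreover have "2 * 2 * (16 * N) = 64 * N" by simp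
  ultimately have "2 ^ n * 2 ^ n * (16 * N) ^ n = (64 * N) ^ n" by (simp only:)
  then show ?thesis by (metis mult.left_commute)
 qed
 finally show ?thesis by simp
qed

lemma centres_cover: "orbit_nets \<subseteq> (\<Union>c\<in>centres n. cball c (r0 / 2 ^ n))"
proof
 fix y assume "y \<in> orbit_nets"
 then obtain k t v where k: "k \<ge> 1" "0 \<le> t" "v \<in> net k" "y = S t v" unfolding orbit_nets_def by auto
 obtain x where x: "x \<in> B" "v = S (real k) x" using net(1) k(3) by blast
 show "y \<in> (\<Union>c\<in>centres n. cball c (r0 / 2 ^ n))"
 proof (cases "k < n \<and> t < real n")
  case True
  define q where "q = mesh * 16 ^ n"
  have q: "q > 0" unfolding q_def using mesh(1) by simp
  define j where "j = nat \<lfloor>t * real q\<rfloor>"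
  have tq: "0 \<le> t * real q" using k by simp
  have j: "real j \<le> t * real q" "t * real q \<le> real j + 1" unfolding j_def using tq by (auto simp: nat_floor_neg)
  have "t * real q < real n * real q" using True q by (intro mult_strict_right_mono) auto
  then have "real j < real (n * q)" using j(1) by simp
  then have jn: "j < n * q" by linarith
  \<comment> \<open>Since k \<ge> 1, the net point is itself the image under S 1 of a point of B, as
    the grid estimate demands.\<close>
  have "v = S 1 (S (real k - 1) x)" using S_add_B[OF x(1), of "real k - 1" 1] k x by simp
  moreover have "S (real k - 1) x \<in> B" using x k by (intro B_inv) auto
  ultimately have "dist (S (real j / real q) v) y \<le> r0 / 2 ^ n"
   using orbit_step[of "S (real k - 1) x" t j n] k j unfolding q_def by simp
  moreover have "S (real j / real q) v \<in> centres n" unfolding centres_def q_def[symmetric]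
   using True k jn by (intro UnI2 UN_I[of k] UN_I[of j] imageI) auto
  ultimately show ?thesis by auto
 next
  case False
  then have "real n \<le> real k + t" using k by auto
  moreover have "y = S (real k + t) x" using S_add_B[OF x(1), of "real k" t] k x by simp
  ultimately have "y \<in> S (real n) ` B" using late_image[OF x(1)] by simp
  then show ?thesis using net(4)[of n] unfolding centres_def by blast
 qed
qed

abbreviation "attractor \<equiv> closure orbit_nets"

lemma attractor_B: "attractor \<subseteq> B" by (rule closure_minimal[OF orbit_nets_B B_closed])

lemma attractor_cover: "attractor \<subseteq> (\<Union>c\<in>centres n. cball c (r0 / 2 ^ n))"
 by (rule closure_minimal[OF centres_cover]) (intro closed_UN centres_finite ballI closed_cball)

lemma small_radius: "0 < e \<Longrightarrow> \<exists>n. r0 / 2 ^ n < e"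
proof -
 assume "0 < e"
 then obtain n where "r0 / e < 2 ^ n" using real_arch_pow[of 2 "r0 / e"] by auto
 then show ?thesis using \<open>0 < e\<close> by (intro exI[of _ n]) (simp add: field_simps)
qed

lemma attractor_compact: "compact attractor"
 unfolding compact_eq_totally_bounded
proof (intro conjI allI impI)
 show "complete attractor"
  using complete_Int_closed[OF X closed_closure] attractor_B BX by (metis Int_absorb1 order_trans)
 fix e :: real assume "e > 0"
 then obtain n where n: "r0 / 2 ^ n < e" using small_radius by blast
 have "attractor \<subseteq> (\<Union>c\<in>centres n. ball c e)" using n by (intro order_trans[OF attractor_cover[of n]] UN_mono) auto
 then show "\<exists>k. finite k \<and> attractor \<subseteq> (\<Union>x\<in>k. ball x e)" using centres_finite by blast
qed

lemma attractor_invariant: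
 assumes s: "0 \<le> s" shows "S s ` attractor \<subseteq> attractor"
proof (rule image_closure_subset)
 obtain n where "s \<le> real n" using real_arch_simple by blast
 then show "continuous_on attractor (S s)" using S_continuous[OF s] attractor_B continuous_on_subset by blast
 have "S s ` orbit_nets \<subseteq> orbit_nets"
 proof
  fix y assume "y \<in> S s ` orbit_nets"
  then obtain k t v where k: "k \<ge> 1" "0 \<le> t" "v \<in> net k" "y = S s (S t v)" unfolding orbit_nets_def by auto
  have "v \<in> B" using net_B k by blast
  then have y: "y = S (t + s) v" using S_add_B[of v t s] k s by simp
  have "y \<in> S (t + s) ` net k" unfolding y using k(3) by (rule imageI)
  then have "y \<in> (\<Union>t\<in>{0..}. S t ` net k)" using k(2) s by (intro UN_I[of "t + s"]) auto
  then show "y \<in> orbit_nets" unfolding orbit_nets_def using k(1) by (intro UN_I[of k]) auto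
 qed
 then show "S s ` orbit_nets \<subseteq> attractor" using closure_subset by blast
qed simp

text \<open>The least n with r0 / 2^n \<le> \<epsilon> satisfies 2^n \<le> 2 r0 / \<epsilon>, so the
  number of centres is bounded by a constant times a power of 1/\<epsilon>. The additive constants
  are absorbed into the multiple of ln (1/\<epsilon>).\<close>

lemma attractor_dimension: "upper_box_dimension attractor < \<infinity>"
proof -
 define c1 where "c1 = ln (real (2 * mesh))"
 define c2 where "c2 = ln (real (64 * N)) / ln 2"
 define c where "c = c1 + c2 * \<bar>ln (2 * r0)\<bar> + c2"
 have m: "1 \<le> real (2 * mesh)" "1 \<le> real (64 * N)" using mesh(1) N_pos by auto
 have c12: "0 \<le> c1" "0 \<le> c2" unfolding c1_def c2_def using m by (auto intro!: divide_nonneg_pos ln_ge_zero)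
 \<comment> \<open>The bound \<epsilon> < r0 forces n \<noteq> 0, so that the predecessor of n is
   available; \<epsilon> < exp (-1) makes ln (1/\<epsilon>) at least 1.\<close>
 have "ln (real (covering_number attractor \<epsilon>)) / ln (1 / \<epsilon>) \<le> c" if \<epsilon>: "0 < \<epsilon>" "\<epsilon> < min r0 (exp (-1))" for \<epsilon>
 proof -
  have l1: "1 \<le> ln (1 / \<epsilon>)"
  proof -
   have "ln \<epsilon> \<le> ln (exp (-1))" using \<epsilon> by (subst ln_le_cancel_iff) auto
   then show ?thesis using \<epsilon> by (simp add: ln_div)
  qed
  define n where "n = (LEAST n. r0 / 2 ^ n \<le> \<epsilon>)"
  have ex: "\<exists>n. r0 / 2 ^ n \<le> \<epsilon>" using small_radius[OF \<epsilon>(1)] less_imp_le by blast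
  have n: "r0 / 2 ^ n \<le> \<epsilon>" unfolding n_def by (rule LeastI_ex[OF ex])
  have "n \<noteq> 0" using n \<epsilon> by (intro notI) simp
  then obtain k where k: "n = Suc k" by (cases n) auto
  have "\<not> r0 / 2 ^ k \<le> \<epsilon>" using not_less_Least[of k "\<lambda>n. r0 / 2 ^ n \<le> \<epsilon>"] k unfolding n_def by simp
  then have "2 ^ n \<le> 2 * r0 / \<epsilon>" using \<epsilon> unfolding k by (simp add: field_simps)
  then have "ln (2 ^ n) \<le> ln (2 * r0 / \<epsilon>)" using \<epsilon> r0 by (subst ln_le_cancel_iff) auto
  also have "... = ln (2 * r0) + ln (1 / \<epsilon>)" using \<epsilon> r0 by (simp add: ln_div)
  finally have "real n * ln 2 \<le> ln (2 * r0) + ln (1 / \<epsilon>)" by (simp add: ln_realpow)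
  then have nl: "real n \<le> (ln (2 * r0) + ln (1 / \<epsilon>)) / ln 2" by (simp add: field_simps)
  have "covering_number attractor \<epsilon> \<le> card (centres n)"
   unfolding covering_number_def
  proof (rule Least_le)
   have "attractor \<subseteq> (\<Union>c\<in>centres n. cball c \<epsilon>)" using n by (intro order_trans[OF attractor_cover[of n]] UN_mono) auto
   then show "\<exists>C. finite C \<and> card C = card (centres n) \<and> attractor \<subseteq> (\<Union>c\<in>C. cball c \<epsilon>)" using centres_finite by blast
  qed
  then have "real (covering_number attractor \<epsilon>) \<le> real (2 * mesh * (64 * N) ^ n)" using centres_card[of n] by (simp only: of_nat_le_iff)
  moreover have "1 \<le> real (2 * mesh * (64 * N) ^ n)"
  proof -
   have "1 * 1 \<le> real (2 * mesh) * real (64 * N) ^ n" by (intro mult_mono one_le_power m) auto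
   then show ?thesis by (simp only: of_nat_mult of_nat_power mult_1)
  qed
  \<comment> \<open>Monotonicity including p = 0, so that no separate argument for a positive
    covering number is called for.\<close>
  moreover have "ln p \<le> ln q" if "0 \<le> p" "p \<le> q" "1 \<le> q" for p q :: real
   using that by (cases "p = 0") (simp_all add: ln_ge_zero)
  ultimately have "ln (real (covering_number attractor \<epsilon>)) \<le> ln (real (2 * mesh * (64 * N) ^ n))"
   using of_nat_0_le_iff by blast
  also have "... = c1 + real n * ln (real (64 * N))"
  proof -
   have p: "0 < real (2 * mesh)" "0 < real (64 * N)" using m by simp_all
   have "real (2 * mesh * (64 * N) ^ n) = real (2 * mesh) * real (64 * N) ^ n" by (simp only: of_nat_mult of_nat_power)
   then show ?thesis
    unfolding c1_def using ln_mult_pos[OF p(1) zero_less_power[OF p(2)], of n] ln_realpow[of "real (64 * N)" n] by (simp only:)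
  qed
  also have "... \<le> c1 + (ln (2 * r0) + ln (1 / \<epsilon>)) / ln 2 * ln (real (64 * N))"
   using nl m by (intro add_left_mono mult_right_mono) (auto intro: ln_ge_zero)
  also have "... = c1 + c2 * ln (2 * r0) + c2 * ln (1 / \<epsilon>)" unfolding c2_def by (simp add: field_simps)
  also have "... \<le> c1 * ln (1 / \<epsilon>) + (c2 * \<bar>ln (2 * r0)\<bar>) * ln (1 / \<epsilon>) + c2 * ln (1 / \<epsilon>)"
  proof (intro add_mono order_refl)
   show "c1 \<le> c1 * ln (1 / \<epsilon>)" using mult_left_mono[OF l1 c12(1)] by simp
   have "c2 * ln (2 * r0) \<le> c2 * \<bar>ln (2 * r0)\<bar>" using c12 by (intro mult_left_mono) auto
   also have "... \<le> (c2 * \<bar>ln (2 * r0)\<bar>) * ln (1 / \<epsilon>)" using mult_left_mono[OF l1, of "c2 * \<bar>ln (2 * r0)\<bar>"] c12 by simp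
   finally show "c2 * ln (2 * r0) \<le> (c2 * \<bar>ln (2 * r0)\<bar>) * ln (1 / \<epsilon>)" .
  qed
  also have "... = c * ln (1 / \<epsilon>)" unfolding c_def by (simp only: distrib_right)
  finally show ?thesis using l1 by (simp add: pos_divide_le_eq)
 qed
 then have "\<forall>\<^sub>F \<epsilon> in at_right 0. ereal (ln (real (covering_number attractor \<epsilon>)) / ln (1 / \<epsilon>)) \<le> ereal c"
  using r0(1) by (intro eventually_at_rightI[of 0 "min r0 (exp (-1))"]) auto
 then have "upper_box_dimension attractor \<le> ereal c" unfolding upper_box_dimension_def by (rule Limsup_bounded)
 also have "... < \<infinity>" by simp
 finally show ?thesis .
qed

text \<open>With n the integer part of t - T, the point at time t is the image under S n of a point
  of B, hence within r0 / 2^n of \<open>net n\<close>; this gives the rate ln 2. Up to time T + 1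
  the distance to a fixed point w of the attractor is bounded. The factor 2^(T+1) pays both for the
  initial period and for the rounding in n.\<close>

lemma attraction:
 assumes D: "bounded D" "D \<subseteq> X"
 shows "\<exists>C>0. \<forall>t\<ge>0. \<forall>x\<in>D. infdist (S t x) attractor \<le> C * exp (- ln 2 * t)"
proof -
 obtain T r where "T \<ge> 0" "\<forall>x\<in>D. (\<forall>t\<ge>T. S t x \<in> B) \<and> (\<forall>t\<in>{0..T}. norm (S t x) \<le> r)"
  using absorbing[OF D(2,1)] by blast
 then have T: "T \<ge> 0" "\<And>x t. x \<in> D \<Longrightarrow> T \<le> t \<Longrightarrow> S t x \<in> B" "\<And>x t. x \<in> D \<Longrightarrow> 0 \<le> t \<Longrightarrow> t \<le> T \<Longrightarrow> norm (S t x) \<le> r"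
  by simp_all
 obtain w where w: "w \<in> net 1" using net_ne by blast
 have wA: "w \<in> attractor" using w net_orbit[of 1] closure_subset by blast
 have wB: "w \<in> B" using w net_B by blast
 define C where "C = (\<bar>r\<bar> + norm w + 2 * r0) * 2 powr (T + 1)"
 have C: "C > 0" unfolding C_def using r0(1) by (intro mult_pos_pos) (auto intro: add_nonneg_pos)
 have "infdist (S t x) attractor \<le> C * 2 powr (- t)" if t: "0 \<le> t" and x: "x \<in> D" for t x
 proof (cases "t \<le> T + 1")
  case True
  have "dist (S t x) w \<le> \<bar>r\<bar> + norm w + 2 * r0"
  proof (cases "t \<le> T")
   case True
   have "dist (S t x) w \<le> norm (S t x) + norm w" by (simp add: dist_norm norm_triangle_ineq4)
   then show ?thesis using T(3)[OF x t True] r0(1) by linarith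
  next
   case False
   then have "dist (S t x) w \<le> r0" using T(2)[OF x, of t] wB by (intro r0) auto
   then show ?thesis using r0(1) norm_ge_zero[of w] abs_ge_zero[of r] by linarith
  qed
  then have "infdist (S t x) attractor \<le> \<bar>r\<bar> + norm w + 2 * r0" using infdist_le[OF wA, of "S t x"] by linarith
  also have "... = (\<bar>r\<bar> + norm w + 2 * r0) * 1" by simp
  also have "... \<le> (\<bar>r\<bar> + norm w + 2 * r0) * 2 powr (T + 1 - t)"
   using True r0(1) by (intro mult_left_mono ge_one_powr_ge_zero) auto
  also have "... = C * 2 powr (- t)" unfolding C_def by (simp add: powr_diff powr_minus divide_inverse)
  finally show ?thesis .
 next
  case False
  define n where "n = nat \<lfloor>t - T\<rfloor>"
  have n: "real n \<le> t - T" "t - T < real n + 1" "n \<ge> 1" unfolding n_def using False by linarith+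
  have "S (t - real n) x \<in> B" using T(2)[OF x, of "t - real n"] n by simp
  moreover have "S t x = S (real n) (S (t - real n) x)" using S_add[of x "t - real n" "real n"] D(2) x n T(1) by auto
  ultimately have "S t x \<in> S (real n) ` B" by blast
  then obtain c where c: "c \<in> net n" "S t x \<in> cball c (r0 / 2 ^ n)" using net(4)[of n] by blast
  have "c \<in> attractor" using net_orbit[OF n(3)] c(1) closure_subset by blast
  then have "infdist (S t x) attractor \<le> dist (S t x) c" by (rule infdist_le)
  also have "... \<le> r0 / 2 ^ n" using c(2) by (simp add: dist_commute)
  also have "... = r0 * 2 powr (- real n)" by (simp add: powr_minus powr_realpow divide_inverse)
  also have "... \<le> r0 * 2 powr (T + 1 - t)" using n r0(1) by (intro mult_left_mono powr_mono) auto
  also have "... \<le> (\<bar>r\<bar> + norm w + 2 * r0) * 2 powr (T + 1 - t)" using r0(1) by (intro mult_right_mono) auto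
  also have "... = C * 2 powr (- t)" unfolding C_def by (simp add: powr_diff powr_minus divide_inverse)
  finally show ?thesis .
 qed
 moreover have "2 powr (- t) = exp (- ln 2 * t)" for t :: real by (simp add: powr_def mult.commute)
 ultimately show ?thesis using C by (intro exI[of _ C]) simp
qed

theorem exponential_attractor_exists: "exponential_attractor X S attractor"
 unfolding exponential_attractor_def
proof (intro conjI)
 show "attractor \<subseteq> X" using attractor_B BX by blast
 show "attractor \<noteq> {}" using net_orbit[of 1] net_ne[of 1] by auto
 show "\<forall>t\<ge>0. S t ` attractor \<subseteq> attractor" using attractor_invariant by blast
 show "\<exists>\<mu>>0. \<forall>D. bounded D \<and> D \<subseteq> X \<longrightarrow> (\<exists>C>0. \<forall>t\<ge>0. \<forall>x\<in>D. infdist (S t x) attractor \<le> C * exp (- \<mu> * t))"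
  using attraction by (intro exI[of _ "ln 2"]) auto
qed (fact attractor_compact attractor_dimension)+

end

section \<open>The Oregonator semiflow as an instance of the abstract construction\<close>

theorem theorem5:
  fixes \<Omega> :: "(real ^ 'n) set"
    and d1 d2 d3 a1 a3 b1 b2 c2 c3 F G1 G2 :: real
    and S :: "real \<Rightarrow> (real ^ 'n) L2_triple \<Rightarrow> (real ^ 'n) L2_triple"
  assumes "CARD('n) \<le> 3"
    and "bounded_lipschitz_domain \<Omega>"
    and "d1 > 0" "d2 > 0" "d3 > 0" "a1 > 0" "a3 > 0" "b1 > 0" "b2 > 0" "c2 > 0" "c3 > 0"
    and "F > 0" "G1 > 0" "G2 > 0"
    and "weak_solution_semiflow \<Omega> (dirichlet_diffusion \<Omega> d1 d2 d3)
           (oregonator_reaction a1 a3 b1 b2 c2 c3 F G1 G2) S"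
  shows "\<exists>M. exponential_attractor (H_plus \<Omega>) S M"
proof -
  have "DIM(real ^ 'n) \<le> 3" using assms(1) by simp
  moreover have "open \<Omega>" "bounded \<Omega>" using assms(2) by (auto simp: bounded_lipschitz_domain_def)
  ultimately interpret oregonator \<Omega> d1 d2 d3 a1 a3 b1 b2 c2 c3 F G1 G2 S
    by (rule oregonator.intro) (fact assms(3-15))+
  obtain B where B: "B \<subseteq> H_plus \<Omega>" "B \<noteq> {}" "closed B" "bounded B" "\<forall>t\<ge>0. \<forall>x\<in>B. S t x \<in> B"
    "\<forall>D\<subseteq>H_plus \<Omega>. bounded D \<longrightarrow> (\<exists>T\<ge>0. \<exists>r. \<forall>x\<in>D. (\<forall>t\<ge>T. S t x \<in> B) \<and> (\<forall>t\<in>{0..T}. norm (S t x) \<le> r))"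
    "\<exists>Q\<ge>0. \<forall>x\<in>B. integral {0..2} (\<lambda>t. (E_norm \<Omega> (S t x))\<^sup>2) \<le> Q"
    by (rule exE[OF absorbing_set], (erule conjE)+, rule that; assumption)
  obtain R where R: "0 < R" "\<forall>x\<in>B. norm x \<le> R" using B(4) by (auto simp: bounded_pos)
  note ctx = B(1,5) R(2) less_imp_le[OF R(1)]
  obtain L where L: "\<And>x y s t. x \<in> B \<Longrightarrow> y \<in> B \<Longrightarrow> 0 \<le> s \<Longrightarrow> s \<le> t \<Longrightarrow> t \<le> s + 1 \<Longrightarrow> norm (S t x - S t y) \<le> L * norm (S s x - S s y)"
    using pair_bounds[OF ctx] by blast
  obtain Q where Q: "0 \<le> Q" "\<forall>x\<in>B. integral {0..2} (\<lambda>t. (E_norm \<Omega> (S t x))\<^sup>2) \<le> Q" using B(7) by blast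
  obtain H where H: "\<And>x \<tau>. x \<in> B \<Longrightarrow> \<tau> \<in> {0..1} \<Longrightarrow> norm (S (1 + \<tau>) x - S 1 x) \<le> H * sqrt (sqrt \<tau>)"
    using time_holder[OF ctx Q] by blast
  obtain N where N: "\<forall>x0\<in>B. \<forall>r>0. \<forall>D. D \<subseteq> B \<longrightarrow> D \<subseteq> cball x0 r \<longrightarrow>
    (\<exists>C\<subseteq>D. finite C \<and> card C \<le> N \<and> S 1 ` D \<subseteq> (\<Union>c\<in>C. cball (S 1 c) (r / 2)))"
    using squeezing_cover[OF ctx] by (rule exE)
  interpret squeezing_semigroup "H_plus \<Omega>" B S L H N
  proof
    show "complete (H_plus \<Omega>)" by (simp add: complete_eq_closed closed_H_plus)
    show "S 0 x = x" if "x \<in> H_plus \<Omega>" for x by (rule semigroup_zero[OF that])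
    show "S (s + t) x = S t (S s x)" if "x \<in> H_plus \<Omega>" "0 \<le> s" "0 \<le> t" for x s t by (rule semigroup_add[OF that])
    show "\<exists>T\<ge>0. \<exists>r. \<forall>x\<in>D. (\<forall>t\<ge>T. S t x \<in> B) \<and> (\<forall>t\<in>{0..T}. norm (S t x) \<le> r)" if "D \<subseteq> H_plus \<Omega>" "bounded D" for D
      by (rule B(6)[rule_format, OF that])
    show "norm (S t x - S t y) \<le> L * norm (x - y)" if "x \<in> B" "y \<in> B" "0 \<le> t" "t \<le> 1" for x y t
    proof -
      have "S 0 x = x" "S 0 y = y" using that B(1) by (auto intro!: semigroup_zero)
      then show ?thesis using L[of x y 0 t] that by simp
    qed
    show "\<exists>C\<subseteq>D. finite C \<and> card C \<le> N \<and> S 1 ` D \<subseteq> (\<Union>c\<in>C. cball (S 1 c) (r / 2))"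
      if "x0 \<in> B" "r > 0" "D \<subseteq> B" "D \<subseteq> cball x0 r" for x0 r D by (rule N[rule_format, OF that])
    show "norm (S (1 + \<tau>) x - S 1 x) \<le> H * sqrt (sqrt \<tau>)" if "x \<in> B" "0 \<le> \<tau>" "\<tau> \<le> 1" for x \<tau>
      using H[of x \<tau>] that by simp
    show "S t x \<in> B" if "0 \<le> t" "x \<in> B" for t x by (rule B(5)[rule_format, OF that])
  qed (fact B(1-4))+
  show ?thesis using exponential_attractor_exists by (rule exI)
qed

end
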